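(* Let $\mathcal X$ be a smooth projective geometrically irreducible curve of genus $g_{\mathcal X}$ over $\mathbb F_q$, let $D=P_1+\cdots+P_N$ be a sum of distinct $\mathbb F_q$-rational points, and let $G$ be a divisor with $\operatorname{Supp}G\cap\operatorname{Supp}D=\emptyset$. Let $\eta$ be a differential of $\mathcal X$ over $\mathbb F_q$ with $v_P(\eta)=-1$ and $\operatorname{Res}_P(\eta)=1$ for every $P\in\operatorname{Supp}D$, put $K=\operatorname{div}(\eta)$, $A=D-G+K$ and $t(G)=\deg(G\vee A-D)=2g_{\mathcal X}-2-\deg(G\wedge A)$. Then the following hold. (1) $\dim\operatorname{Hull}(C_L(D,G))\le\ell(G\wedge A)+\ell(K-G\wedge A)$. (2) If $0\le\deg(G\wedge A)\le 2g_{\mathcal X}-2$, equivalently $0\le t(G)\le 2g_{\mathcal X}-2$, then $$\dim\operatorname{Hull}(C_L(D,G))\le g_{\mathcal X}+1.$$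
   Context: For a divisor $G$, $L(G)=\{h\in\mathbb F_q(\mathcal X)^*:\operatorname{div}(h)+G\ge 0\}\cup\{0\}$ and $\ell(G)=\dim_{\mathbb F_q}L(G)$. If $\operatorname{Supp} G\cap \operatorname{Supp} D=\emptyset$, then $C_L(D,G)\subseteq\mathbb F_q^N$ is the image of $L(G)\to\mathbb F_q^N$, $h\mapsto(h(P_1),\dots,h(P_N))$. The dual $C^\perp$ is taken with respect to the standard bilinear form on $\mathbb F_q^N$ and $\operatorname{Hull}(C)=C\cap C^\perp$. The meet $G_1\wedge G_2$ and join $G_1\vee G_2$ of two divisors are their coefficientwise minimum and maximum. *)

theory Defs
  imports
    "HOL-Analysis.Cartesian_Space"
    "HOL-Algebra.Algebraic_Closure_Type"
    "HOL-Library.Function_Algebras"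
begin

text \<open>
  A smooth projective curve over a field \<open>k\<close> is represented by its function field \<open>F\<close> together
  with the set of all its places over \<open>k\<close>, i.e. as the complete abstract nonsingular curve in the
  sense of Hartshorne, Section I.6. The constant field is a type \<open>'k\<close>, the function field a type
  \<open>'f\<close>, and \<open>\<iota> :: 'k \<Rightarrow> 'f\<close> is the inclusion of the constants.
\<close>


section \<open>Function fields of curves\<close>

definition field_embedding :: "('k::field \<Rightarrow> 'f::field) \<Rightarrow> bool" where
  "field_embedding \<iota> \<longleftrightarrow>
     \<iota> 1 = 1 \<and> (\<forall>a b. \<iota> (a + b) = \<iota> a + \<iota> b) \<and> (\<forall>a b. \<iota> (a * b) = \<iota> a * \<iota> b)"

definition const_scale :: "('k::field \<Rightarrow> 'f::field) \<Rightarrow> 'k \<Rightarrow> 'f \<Rightarrow> 'f" where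
  "const_scale \<iota> c h = \<iota> c * h"

definition algebraic_over :: "('k::field \<Rightarrow> 'f::field) \<Rightarrow> 'f \<Rightarrow> bool" where
  "algebraic_over \<iota> x \<longleftrightarrow> (\<exists>p. p \<noteq> 0 \<and> poly (map_poly \<iota> p) x = 0)"

definition simple_extension :: "('k::field \<Rightarrow> 'f::field) \<Rightarrow> 'f \<Rightarrow> 'f set" where
  "simple_extension \<iota> x =
     {poly (map_poly \<iota> p) x / poly (map_poly \<iota> q) x | p q. poly (map_poly \<iota> q) x \<noteq> 0}"

definition function_field_one_var :: "('k::field \<Rightarrow> 'f::field) \<Rightarrow> bool" where
  "function_field_one_var \<iota> \<longleftrightarrow>
     (\<exists>x. \<not> algebraic_over \<iota> x \<and>
        (\<exists>B. finite B \<and>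
           (\<forall>y. \<exists>c. (\<forall>b\<in>B. c b \<in> simple_extension \<iota> x) \<and> y = (\<Sum>b\<in>B. c b * b))))"

text \<open>
  \<open>F\<close> and the algebraic closure of \<open>k\<close> are linearly disjoint over \<open>k\<close> inside an algebraic closure
  of \<open>F\<close>. Equivalently, the tensor product of \<open>F\<close> with the algebraic closure of \<open>k\<close> is an integral
  domain. Over a perfect field \<open>k\<close>, such as a finite one, this is the condition that the curve is
  irreducible over the algebraic closure of \<open>k\<close>.
\<close>
definition geom_irreducible :: "('k::field \<Rightarrow> 'f::field) \<Rightarrow> bool" where
  "geom_irreducible \<iota> \<longleftrightarrow>
     (\<forall>B c. finite B \<and> \<not> module.dependent (const_scale \<iota>) B \<and>
        (\<forall>b\<in>B. algebraic_over (\<lambda>a. to_ac (\<iota> a)) (c b)) \<and>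
        (\<Sum>b\<in>B. c b * to_ac b) = (0 :: 'f alg_closure) \<longrightarrow> (\<forall>b\<in>B. c b = 0))"

definition curve :: "('k::field \<Rightarrow> 'f::field) \<Rightarrow> bool" where
  "curve \<iota> \<longleftrightarrow> field_embedding \<iota> \<and> function_field_one_var \<iota> \<and> geom_irreducible \<iota>"


section \<open>Places\<close>

text \<open>
  A closed point of the curve is identified with its normalised discrete valuation. The value at
  \<open>0\<close>, which should be infinite, is set to \<open>0\<close> so that a place is a unique function; every use
  below treats \<open>0\<close> separately.
\<close>
type_synonym 'f place = "'f \<Rightarrow> int"

definition places :: "('k::field \<Rightarrow> 'f::field) \<Rightarrow> 'f place set" where
  "places \<iota> =
     {v. v 0 = 0 \<and> (\<exists>t. v t = 1) \<and>
         (\<forall>a. a \<noteq> 0 \<longrightarrow> v (\<iota> a) = 0) \<and>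
         (\<forall>x y. x \<noteq> 0 \<longrightarrow> y \<noteq> 0 \<longrightarrow> v (x * y) = v x + v y) \<and>
         (\<forall>x y. x \<noteq> 0 \<longrightarrow> y \<noteq> 0 \<longrightarrow> x + y \<noteq> 0 \<longrightarrow> min (v x) (v y) \<le> v (x + y))}"

definition local_ring :: "('f::field) place \<Rightarrow> 'f set" where
  "local_ring P = {x. x = 0 \<or> 0 \<le> P x}"

definition max_ideal :: "('f::field) place \<Rightarrow> 'f set" where
  "max_ideal P = {x. x = 0 \<or> 0 < P x}"

text \<open>
  \<open>B\<close> is a set of representatives of a \<open>k\<close>-basis of the residue field
  \<open>local_ring P / max_ideal P\<close>.
\<close>
definition residue_basis :: "('k::field \<Rightarrow> 'f::field) \<Rightarrow> 'f place \<Rightarrow> 'f set \<Rightarrow> bool" where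
  "residue_basis \<iota> P B \<longleftrightarrow> finite B \<and> B \<subseteq> local_ring P \<and>
     (\<forall>x\<in>local_ring P. \<exists>!c. (\<forall>b. b \<notin> B \<longrightarrow> c b = 0) \<and> x - (\<Sum>b\<in>B. \<iota> (c b) * b) \<in> max_ideal P)"

definition place_degree :: "('k::field \<Rightarrow> 'f::field) \<Rightarrow> 'f place \<Rightarrow> nat" where
  "place_degree \<iota> P = card (SOME B. residue_basis \<iota> P B)"

definition rational_place :: "('k::field \<Rightarrow> 'f::field) \<Rightarrow> 'f place \<Rightarrow> bool" where
  "rational_place \<iota> P \<longleftrightarrow> P \<in> places \<iota> \<and> place_degree \<iota> P = 1"

text \<open>The value \<open>h(P)\<close>, for a rational place \<open>P\<close> and \<open>h\<close> in the local ring of \<open>P\<close>.\<close>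
definition eval_at :: "('k::field \<Rightarrow> 'f::field) \<Rightarrow> 'f place \<Rightarrow> 'f \<Rightarrow> 'k" where
  "eval_at \<iota> P h = (THE a. h - \<iota> a \<in> max_ideal P)"


section \<open>Divisors\<close>

text \<open>Divisors are added and subtracted pointwise, by the instances of \<open>Function_Algebras\<close>.\<close>
type_synonym 'f divisor = "'f place \<Rightarrow> int"

definition supp :: "'f divisor \<Rightarrow> 'f place set" where
  "supp G = {P. G P \<noteq> 0}"

definition divisors :: "('k::field \<Rightarrow> 'f::field) \<Rightarrow> 'f divisor set" where
  "divisors \<iota> = {G. finite (supp G) \<and> supp G \<subseteq> places \<iota>}"

definition prime_divisor :: "'f place \<Rightarrow> 'f divisor" where
  "prime_divisor P = (\<lambda>Q. if Q = P then 1 else 0)"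

definition div_degree :: "('k::field \<Rightarrow> 'f::field) \<Rightarrow> 'f divisor \<Rightarrow> int" where
  "div_degree \<iota> G = (\<Sum>P\<in>supp G. G P * int (place_degree \<iota> P))"

definition div_meet :: "'f divisor \<Rightarrow> 'f divisor \<Rightarrow> 'f divisor" where
  "div_meet G H = (\<lambda>P. min (G P) (H P))"

definition div_join :: "'f divisor \<Rightarrow> 'f divisor \<Rightarrow> 'f divisor" where
  "div_join G H = (\<lambda>P. max (G P) (H P))"

definition fun_div :: "('k::field \<Rightarrow> 'f::field) \<Rightarrow> 'f \<Rightarrow> 'f divisor" where
  "fun_div \<iota> h = (\<lambda>P. if P \<in> places \<iota> then P h else 0)"

definition rr_space :: "('k::field \<Rightarrow> 'f::field) \<Rightarrow> 'f divisor \<Rightarrow> 'f set" where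
  "rr_space \<iota> G = {h. h \<noteq> 0 \<and> (\<forall>P. 0 \<le> (fun_div \<iota> h + G) P)} \<union> {0}"

definition rr_dim :: "('k::field \<Rightarrow> 'f::field) \<Rightarrow> 'f divisor \<Rightarrow> nat" where
  "rr_dim \<iota> G = vector_space.dim (const_scale \<iota>) (rr_space \<iota> G)"


section \<open>Differentials\<close>

definition derivations :: "('k::field \<Rightarrow> 'f::field) \<Rightarrow> ('f \<Rightarrow> 'f) set" where
  "derivations \<iota> =
     {\<delta>. (\<forall>x y. \<delta> (x + y) = \<delta> x + \<delta> y) \<and> (\<forall>x y. \<delta> (x * y) = x * \<delta> y + y * \<delta> x) \<and> (\<forall>a. \<delta> (\<iota> a) = 0)}"

text \<open>
  The Kaehler differentials of \<open>F\<close> over \<open>k\<close> form a finite-dimensional \<open>F\<close>-vector space whose dual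
  is the space of \<open>k\<close>-derivations of \<open>F\<close>. A differential is therefore represented by the linear
  form it induces on derivations, with \<open>dx\<close> given by \<open>\<delta> \<mapsto> \<delta> x\<close>; outside the set of derivations
  the function is \<open>0\<close>.
\<close>
type_synonym 'f differential = "('f \<Rightarrow> 'f) \<Rightarrow> 'f"

definition kaehler_d :: "('k::field \<Rightarrow> 'f::field) \<Rightarrow> 'f \<Rightarrow> 'f differential" where
  "kaehler_d \<iota> x = (\<lambda>\<delta>. if \<delta> \<in> derivations \<iota> then \<delta> x else 0)"

definition diff_scale :: "'f::field \<Rightarrow> 'f differential \<Rightarrow> 'f differential" where
  "diff_scale f \<omega> = (\<lambda>\<delta>. f * \<omega> \<delta>)"

definition differentials :: "('k::field \<Rightarrow> 'f::field) \<Rightarrow> 'f differential set" where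
  "differentials \<iota> = module.span diff_scale (range (kaehler_d \<iota>))"

definition local_param :: "('f::field) place \<Rightarrow> 'f" where
  "local_param P = (SOME t. P t = 1)"

text \<open>The function \<open>f\<close> with \<open>\<omega> = f dt\<close>, where \<open>t\<close> is the chosen local parameter at \<open>P\<close>.\<close>
definition local_coeff :: "('k::field \<Rightarrow> 'f::field) \<Rightarrow> 'f place \<Rightarrow> 'f differential \<Rightarrow> 'f" where
  "local_coeff \<iota> P \<omega> = (THE f. \<omega> = diff_scale f (kaehler_d \<iota> (local_param P)))"

definition diff_val :: "('k::field \<Rightarrow> 'f::field) \<Rightarrow> 'f place \<Rightarrow> 'f differential \<Rightarrow> int" where
  "diff_val \<iota> P \<omega> = P (local_coeff \<iota> P \<omega>)"

definition diff_div :: "('k::field \<Rightarrow> 'f::field) \<Rightarrow> 'f differential \<Rightarrow> 'f divisor" where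
  "diff_div \<iota> \<omega> = (\<lambda>P. if P \<in> places \<iota> then diff_val \<iota> P \<omega> else 0)"

text \<open>
  The residue at a rational place \<open>P\<close>: the coefficient of \<open>1/t\<close> in the Laurent expansion of \<open>f\<close>
  in \<open>t\<close>, where \<open>\<omega> = f dt\<close>. The finite sum below is the principal part of that expansion, with
  \<open>a i\<close> the coefficient of \<open>1/t ^ (i + 1)\<close>.
\<close>
definition residue :: "('k::field \<Rightarrow> 'f::field) \<Rightarrow> 'f place \<Rightarrow> 'f differential \<Rightarrow> 'k" where
  "residue \<iota> P \<omega> =
     (THE r. \<exists>n a. r = a 0 \<and>
        local_coeff \<iota> P \<omega> - (\<Sum>i\<le>(n::nat). \<iota> (a i) / local_param P ^ Suc i) \<in> local_ring P)"

definition regular_differentials :: "('k::field \<Rightarrow> 'f::field) \<Rightarrow> 'f differential set" where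
  "regular_differentials \<iota> =
     {\<omega> \<in> differentials \<iota>. \<omega> \<noteq> 0 \<longrightarrow> (\<forall>P\<in>places \<iota>. 0 \<le> diff_val \<iota> P \<omega>)}"

definition genus :: "('k::field \<Rightarrow> 'f::field) \<Rightarrow> nat" where
  "genus \<iota> = vector_space.dim (\<lambda>a. diff_scale (\<iota> a)) (regular_differentials \<iota>)"


section \<open>Codes\<close>

text \<open>
  The code \<open>C_L(D,G)\<close> with \<open>D\<close> the sum of the places \<open>P i\<close>; the family \<open>P\<close> fixes the order of the
  coordinates.
\<close>
definition ag_code :: "('k::field \<Rightarrow> 'f::field) \<Rightarrow> ('n::finite \<Rightarrow> 'f place) \<Rightarrow> 'f divisor \<Rightarrow> ('k^'n) set" where
  "ag_code \<iota> P G = (\<lambda>h. \<chi> i. eval_at \<iota> (P i) h) ` rr_space \<iota> G"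

definition dual_code :: "(('k::field)^('n::finite)) set \<Rightarrow> ('k^'n) set" where
  "dual_code C = {x. \<forall>y\<in>C. (\<Sum>i\<in>UNIV. x $ i * y $ i) = 0}"

definition code_hull :: "(('k::field)^('n::finite)) set \<Rightarrow> ('k^'n) set" where
  "code_hull C = C \<inter> dual_code C"

end

theory Submission
  imports Defs
begin

text \<open>
  The hull of a code \<open>C\<close> is \<open>C \<inter> C\<^sup>\<bottom>\<close>, and the dual of \<open>C\<^sub>L(D,G)\<close> is the code \<open>C\<^sub>L(D,A)\<close> of the same
  kind. Orthogonality of the two codes is the residue theorem: for \<open>f \<in> L(G)\<close> and \<open>h \<in> L(A)\<close> the
  differential \<open>f h \<eta>\<close> has no poles outside \<open>D\<close>, and its residue at \<open>P\<^sub>i\<close> is \<open>f(P\<^sub>i) h(P\<^sub>i)\<close>.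
  Equality follows as the Riemann-Roch theorem makes the dimensions add up to the length of the
  codes (\<open>dual_code_eq\<close>). An element of the hull is thus the common vector of values of some
  \<open>f \<in> L(G)\<close> and \<open>h \<in> L(A)\<close>. The difference \<open>f - h\<close> vanishes on \<open>D\<close>, so it lies in \<open>L(G \<or> A - D)\<close>,
  and \<open>G \<or> A - D = K - G \<and> A\<close> since \<open>G + A = D + K\<close>. The pairs with \<open>f = h\<close> form \<open>L(G \<and> A)\<close>, whence
  the first bound (\<open>dim_hull_le\<close>).

  Put \<open>M = G \<and> A\<close>. If \<open>L(M)\<close> and \<open>L(K - M)\<close> are both nonzero, let \<open>S\<close> and \<open>T\<close> be the sets of orders
  at one rational point of their nonzero elements. A space of functions has as many orders as its
  dimension, products of functions have the sums of orders, and \<open>|S + T| \<ge> |S| + |T| - 1\<close> for sets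
  of integers; so \<open>\<ell>(M) + \<ell>(K - M) \<le> \<ell>(K) + 1 = g + 1\<close> (\<open>ell_add_le\<close>). If one of the spaces is zero,
  the Riemann-Roch theorem and the bounds for \<open>deg M\<close> give at most \<open>g - 1\<close>.

  The residue theorem and the Riemann-Roch theorem are proved for a function field over a finite
  field of constants that has a rational place. Finite constants have two effects on the method.
  Dimensions are compared by counting elements. And for the number \<open>q\<close> of constants every function
  is uniquely \<open>\<Sum>i<q. a\<^sub>i\<^sup>q t\<^sup>i\<close>, where \<open>t\<close> is a local parameter at any place (\<open>frobenius_basis\<close>), so
  that derivations are determined by their value at \<open>t\<close> and no separating element has to be found.

  The steps are the following. Families that are independent over \<open>k[z]\<close> have bounded size
  (\<open>power_indep_bound\<close>), which replaces the degree of \<open>F\<close> over \<open>k(z)\<close>. It makes valuation rings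
  discrete, zeros of functions finite in number and residue fields finite, gives principal divisors
  degree zero, and yields the inequality of Riemann: \<open>deg G - \<ell>(G)\<close> is bounded. Where this
  difference attains its maximum, strong approximation holds.

  Residues are those of Tate: the residue of \<open>f dg\<close> at \<open>P\<close> is the trace of the commutator of \<open>f\<close> and
  \<open>g\<close>, both compressed to the valuation ring of \<open>P\<close>. No completion occurs, and the residue theorem
  comes from additivity of the trace together with strong approximation (\<open>residue_theorem\<close>). At a
  rational place and a simple pole the trace is the classical residue.

  Let \<open>x0\<close> be a parameter at a rational place \<open>Q\<close>, and \<open>K0\<close> the divisor of \<open>dx0\<close>. For a divisor \<open>G\<close>,
  consider the functionals on \<open>F\<close> that vanish on functions whose poles are bounded by \<open>G\<close> at \<open>Q\<close>,
  and also on those whose poles are bounded by \<open>G\<close> away from \<open>Q\<close>. All of them are of the form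
  \<open>z \<mapsto> res\<^sub>Q(h z dx0)\<close> with \<open>h \<in> L(K0 - G)\<close> (\<open>annihilates_multiple\<close>, \<open>annihilator_in_rr_space\<close>).
  Hence, when \<open>Q\<close> is added to a divisor, exactly one of \<open>\<ell>(G)\<close> and \<open>\<ell>(K0 - G)\<close> changes, and
  Riemann-Roch follows from large degrees.
\<close>

section \<open>Counting in finite subspaces\<close>

text \<open>
  Over a finite field a cardinality determines the dimension, so identities between dimensions can
  be obtained by counting, without choosing bases.
\<close>
lemma card_subspace:
  fixes scale :: "'a::{field,finite} \<Rightarrow> 'b::ab_group_add \<Rightarrow> 'b"
  assumes "vector_space scale" "module.subspace scale U" "finite U"
  shows "card U = CARD('a) ^ vector_space.dim scale U"
proof -
  interpret vector_space scale by fact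
  obtain B where B: "B \<subseteq> U" "independent B" "U \<subseteq> span B" "card B = dim U"
    using basis_exists[of U] by blast
  have fB: "finite B" using B(1) assms(3) finite_subset by blast
  have UB: "span B = U"
    using B(1,3) assms(2) span_minimal by blast
  have bij: "bij_betw (\<lambda>c. \<Sum>b\<in>B. scale (c b) b) (PiE B (\<lambda>_. UNIV)) U"
  proof (rule bij_betwI')
    fix c d assume c: "c \<in> B \<rightarrow>\<^sub>E (UNIV::'a set)" and d: "d \<in> B \<rightarrow>\<^sub>E (UNIV::'a set)"
    show "((\<Sum>b\<in>B. scale (c b) b) = (\<Sum>b\<in>B. scale (d b) b)) = (c = d)"
    proof
      assume "(\<Sum>b\<in>B. scale (c b) b) = (\<Sum>b\<in>B. scale (d b) b)"
      hence "(\<Sum>b\<in>B. scale (c b - d b) b) = 0"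
        by (simp add: scale_left_diff_distrib sum_subtractf)
      moreover have "\<not> (\<exists>u. (\<exists>v\<in>B. u v \<noteq> 0) \<and> (\<Sum>v\<in>B. scale (u v) v) = 0)"
        using B(2) by (subst dependent_finite[OF fB, symmetric])
      ultimately have "\<forall>b\<in>B. c b - d b = 0"
        by (auto dest: spec[where x = "\<lambda>b. c b - d b"])
      thus "c = d" using c d by (intro PiE_ext[of c B _ d]) auto
    qed simp
  next
    fix c assume "c \<in> B \<rightarrow>\<^sub>E (UNIV::'a set)"
    have "(\<Sum>b\<in>B. scale (c b) b) \<in> span B"
      by (intro span_sum span_scale span_base)
    thus "(\<Sum>b\<in>B. scale (c b) b) \<in> U" using UB by simp
  next
    fix y assume "y \<in> U"
    then obtain c where c: "y = (\<Sum>b\<in>B. scale (c b) b)"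
      using UB span_finite[OF fB] by auto
    show "\<exists>x\<in>B \<rightarrow>\<^sub>E UNIV. y = (\<Sum>b\<in>B. scale (x b) b)"
      by (rule bexI[of _ "restrict c B"]) (auto simp: c)
  qed
  have "card U = card (PiE B (\<lambda>_. UNIV :: 'a set))"
    using bij_betw_same_card[OF bij] by simp
  thus ?thesis using fB B(4) by (simp add: card_PiE)
qed

text \<open>
  The counting form of the rank formula: all fibres of an additive map are translates of its kernel.
\<close>
lemma card_fibres:
  fixes \<phi> :: "'a::ab_group_add \<Rightarrow> 'b::ab_group_add"
  assumes sub: "\<And>x y. x \<in> U \<Longrightarrow> y \<in> U \<Longrightarrow> x - y \<in> U"
    and add: "\<And>x y. x \<in> U \<Longrightarrow> y \<in> U \<Longrightarrow> \<phi> (x - y) = \<phi> x - \<phi> y"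
    and fin: "finite (\<phi> ` U)" "finite {x\<in>U. \<phi> x = 0}"
  shows "finite U" "card U = card (\<phi> ` U) * card {x\<in>U. \<phi> x = 0}"
proof -
  let ?K = "{x\<in>U. \<phi> x = 0}"
  have fib: "bij_betw (\<lambda>x. x - u) {x\<in>U. \<phi> x = \<phi> u} ?K" if u: "u \<in> U" for u
  proof (rule bij_betw_byWitness[where f' = "\<lambda>x. x + u"])
    have add': "\<phi> (x + u) = \<phi> x + \<phi> u \<and> x + u \<in> U" if x: "x \<in> U" for x
    proof -
      have z: "0 \<in> U" using sub[OF u u] by simp
      hence nu: "- u \<in> U" using sub[OF z u] by simp
      have "\<phi> 0 = 0" using add[OF u u] by simp
      hence "\<phi> (- u) = - \<phi> u" using add[OF z u] by simp
      thus ?thesis using sub[OF x nu] add[OF x nu] by simp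
    qed
    show "(\<lambda>x. x + u) ` ?K \<subseteq> {x\<in>U. \<phi> x = \<phi> u}" using add' by auto
  qed (use sub add u in auto)
  have U: "U = (\<Union>y\<in>\<phi> ` U. {x\<in>U. \<phi> x = y})" by auto
  have fin': "finite {x\<in>U. \<phi> x = y}" and card': "card {x\<in>U. \<phi> x = y} = card ?K"
    if y: "y \<in> \<phi> ` U" for y
  proof -
    obtain u where u: "u \<in> U" "y = \<phi> u" using y by blast
    show "finite {x\<in>U. \<phi> x = y}" "card {x\<in>U. \<phi> x = y} = card ?K"
      using bij_betw_finite[OF fib[OF u(1)]] bij_betw_same_card[OF fib[OF u(1)]] fin(2) u(2)
      by simp_all
  qed
  show "finite U" by (subst U) (use fin' fin in blast)
  have "card U = (\<Sum>y\<in>\<phi> ` U. card {x\<in>U. \<phi> x = y})"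
    by (subst U, rule card_UN_disjoint) (use fin fin' in auto)
  thus "card U = card (\<phi> ` U) * card ?K" using card' by simp
qed

section \<open>The field of constants\<close>

locale constant_field =
  fixes \<iota> :: "'k::{field,finite} \<Rightarrow> 'f::field"
  assumes embedding: "field_embedding \<iota>"
begin

lemma iota_1 [simp]: "\<iota> 1 = 1"
  and iota_add: "\<iota> (a + b) = \<iota> a + \<iota> b"
  and iota_mult: "\<iota> (a * b) = \<iota> a * \<iota> b"
  using embedding by (auto simp: field_embedding_def)

lemma iota_0 [simp]: "\<iota> 0 = 0"
  proof -
  have "\<iota> 0 + \<iota> 0 = \<iota> 0 + 0" by (subst iota_add[symmetric]) simp
  thus ?thesis by (rule add_left_imp_eq)
qed

lemma iota_minus: "\<iota> (- a) = - \<iota> a"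
proof -
  have "\<iota> (- a) + \<iota> a = 0" by (subst iota_add[symmetric]) simp
  thus ?thesis by (simp add: eq_neg_iff_add_eq_0)
qed

lemma iota_diff: "\<iota> (a - b) = \<iota> a - \<iota> b"
  using iota_add[of a "- b"] by (simp add: iota_minus)

lemma iota_sum: "\<iota> (\<Sum>i\<in>I. f i) = (\<Sum>i\<in>I. \<iota> (f i))"
  by (induction I rule: infinite_finite_induct) (auto simp: iota_add)

lemma iota_power: "\<iota> (a ^ n) = \<iota> a ^ n"
  by (induction n) (auto simp: iota_mult)

lemma iota_eq_0_iff [simp]: "\<iota> a = 0 \<longleftrightarrow> a = 0"
proof
  assume "\<iota> a = 0"
  hence "\<iota> (a * inverse a) = 0" by (simp add: iota_mult)
  thus "a = 0" by (cases "a = 0") auto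
qed simp

lemma iota_eq_iff [simp]: "\<iota> a = \<iota> b \<longleftrightarrow> a = b"
  using iota_eq_0_iff[of "a - b"] by (simp add: iota_diff)

lemma iota_inverse: "\<iota> (inverse a) = inverse (\<iota> a)"
proof (cases "a = 0")
  case False
  hence "\<iota> a * \<iota> (inverse a) = 1" by (subst iota_mult[symmetric]) simp
  thus ?thesis using inverse_unique by metis
qed simp

lemma iota_of_nat: "\<iota> (of_nat n) = of_nat n"
  by (induction n) (auto simp: iota_add)

sublocale k: vector_space "const_scale \<iota>"
  by unfold_locales (auto simp: const_scale_def iota_add iota_mult algebra_simps)

text \<open>
  The number of constants, counted in \<open>F\<close> so that \<open>\<iota>\<close> determines the type of constants in the
  definition.
\<close>
definition q :: nat where "q = card (range \<iota>)"

lemma card_k: "CARD('k) = q"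
  unfolding q_def by (rule card_image[symmetric]) (auto simp: inj_on_def)

lemma q_ge_2: "2 \<le> q"
proof -
  have "card {0, 1 :: 'k} \<le> CARD('k)" by (rule card_mono) auto
  thus ?thesis by (simp add: card_k)
qed

lemma card_eq_dim:
  assumes "k.subspace U" "finite U"
  shows "card U = q ^ k.dim U"
  using card_subspace[OF k.vector_space_axioms assms] by (simp add: card_k)

lemma card_span_le:
  assumes "finite S"
  shows "finite (k.span S)" "card (k.span S) \<le> q ^ card S"
proof -
  have eq: "k.span S = (\<lambda>c. \<Sum>b\<in>S. const_scale \<iota> (c b) b) ` (PiE S (\<lambda>_. UNIV :: 'k set))" (is "_ = ?f ` ?D")
  proof
    show "k.span S \<subseteq> ?f ` ?D"
    proof
      fix y assume "y \<in> k.span S"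
      then obtain c where c: "y = (\<Sum>b\<in>S. const_scale \<iota> (c b) b)"
        using k.span_finite[OF assms] by auto
      show "y \<in> ?f ` ?D"
        by (rule image_eqI[of _ _ "restrict c S"]) (auto simp: c)
    qed
    show "?f ` ?D \<subseteq> k.span S"
      by (auto intro!: k.span_sum k.span_scale intro: k.span_base)
  qed
  have fD: "finite ?D" using assms by (intro finite_PiE) auto
  show "finite (k.span S)" by (simp only: eq) (rule finite_imageI[OF fD])
  show "card (k.span S) \<le> q ^ card S"
    by (simp only: eq) (rule order.trans[OF card_image_le[OF fD]], simp add: card_PiE card_k assms)
qed

lemma subspace_diff: "k.subspace U \<Longrightarrow> x \<in> U \<Longrightarrow> y \<in> U \<Longrightarrow> x - y \<in> U"
  by (rule k.subspace_diff)

end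

section \<open>Places\<close>

text \<open>
  The fractional ideals of a place. The element \<open>0\<close> always belongs, as if its order were infinite;
  arguments about ideals thereby avoid the convention that a place maps \<open>0\<close> to \<open>0\<close>.
\<close>
definition val_ge :: "'f::field place \<Rightarrow> int \<Rightarrow> 'f set" where
  "val_ge P n = {x. x = 0 \<or> n \<le> P x}"

lemma local_ring_eq: "local_ring P = val_ge P 0"
  by (auto simp: local_ring_def val_ge_def)

lemma max_ideal_eq: "max_ideal P = val_ge P 1"
  by (auto simp: max_ideal_def val_ge_def)

lemma zero_in_val_ge [simp]: "0 \<in> val_ge P n"
  by (simp add: val_ge_def)

lemma val_ge_mono: "m \<le> n \<Longrightarrow> x \<in> val_ge P n \<Longrightarrow> x \<in> val_ge P m"
  by (auto simp: val_ge_def)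

lemma val_geD: "x \<in> val_ge P n \<Longrightarrow> x \<noteq> 0 \<Longrightarrow> n \<le> P x"
  by (auto simp: val_ge_def)

context constant_field
begin

context
  fixes P :: "'f place"
  assumes P: "P \<in> places \<iota>"
begin

lemma place_0 [simp]: "P 0 = 0"
  using P by (simp add: places_def)

lemma place_iota [simp]: "P (\<iota> a) = 0"
  using P by (cases "a = 0") (simp_all add: places_def)

lemma place_mult: "x \<noteq> 0 \<Longrightarrow> y \<noteq> 0 \<Longrightarrow> P (x * y) = P x + P y"
  and place_add_ge: "x \<noteq> 0 \<Longrightarrow> y \<noteq> 0 \<Longrightarrow> x + y \<noteq> 0 \<Longrightarrow> min (P x) (P y) \<le> P (x + y)"
  using P by (auto simp: places_def)

lemma place_uniformizer: "\<exists>t. P t = 1"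
  using P by (auto simp: places_def)

lemma place_1 [simp]: "P 1 = 0"
  using place_iota[of 1] by simp

lemma place_minus [simp]: "P (- x) = P x"
proof (cases "x = 0")
  case False
  have "P (\<iota> (- 1) * x) = P (\<iota> (- 1)) + P x" using False by (intro place_mult) auto
  thus ?thesis unfolding place_iota by (simp add: iota_minus)
qed simp

lemma place_inverse [simp]: "P (inverse x) = - P x"
proof (cases "x = 0")
  case False
  have "P (x * inverse x) = P x + P (inverse x)" using False by (intro place_mult) auto
  thus ?thesis using False by simp
qed simp

lemma place_divide: "x \<noteq> 0 \<Longrightarrow> y \<noteq> 0 \<Longrightarrow> P (x / y) = P x - P y"
  by (simp add: divide_inverse place_mult)

lemma place_power [simp]: "P (x ^ n) = int n * P x"
proof (cases "x = 0")
  case False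
  thus ?thesis by (induction n) (auto simp: place_mult algebra_simps)
qed (cases n; simp)

lemma place_add_eq:
  assumes "x \<noteq> 0" "y \<noteq> 0" "P x < P y"
  shows "x + y \<noteq> 0" "P (x + y) = P x"
proof -
  show ne: "x + y \<noteq> 0"
  proof
    assume "x + y = 0"
    hence "y = - x" by (simp add: add_eq_0_iff)
    thus False using assms by simp
  qed
  have "min (P (x + y)) (P (- y)) \<le> P ((x + y) + (- y))"
    by (rule place_add_ge) (use ne assms in auto)
  moreover have "min (P x) (P y) \<le> P (x + y)" by (rule place_add_ge) (use ne assms in auto)
  ultimately show "P (x + y) = P x" using assms by auto
qed

lemma val_ge_add: "x \<in> val_ge P n \<Longrightarrow> y \<in> val_ge P n \<Longrightarrow> x + y \<in> val_ge P n"
  using place_add_ge[of x y] unfolding val_ge_def min_def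
  by (cases "x = 0"; cases "y = 0"; cases "x + y = 0") (auto split: if_splits)

lemma val_ge_minus [simp]: "- x \<in> val_ge P n \<longleftrightarrow> x \<in> val_ge P n"
  by (auto simp: val_ge_def)

lemma val_ge_diff: "x \<in> val_ge P n \<Longrightarrow> y \<in> val_ge P n \<Longrightarrow> x - y \<in> val_ge P n"
  using val_ge_add[of x n "- y"] by simp

lemma val_ge_mult: "x \<in> val_ge P m \<Longrightarrow> y \<in> val_ge P n \<Longrightarrow> x * y \<in> val_ge P (m + n)"
  by (cases "x = 0"; cases "y = 0") (auto simp: val_ge_def place_mult)

lemma val_ge_mult': "x \<in> val_ge P m \<Longrightarrow> y \<in> val_ge P n \<Longrightarrow> l \<le> m + n \<Longrightarrow> x * y \<in> val_ge P l"
  using val_ge_mono[of l "m + n" "x * y" P] val_ge_mult[of x m y n] by simp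

lemma val_ge_mult_iff: "x \<noteq> 0 \<Longrightarrow> x * y \<in> val_ge P n \<longleftrightarrow> y \<in> val_ge P (n - P x)"
  by (cases "y = 0") (auto simp: val_ge_def place_mult)

lemma val_ge_iota [simp]: "n \<le> 0 \<Longrightarrow> \<iota> a \<in> val_ge P n"
  by (auto simp: val_ge_def)

lemma val_ge_1 [simp]: "n \<le> 0 \<Longrightarrow> 1 \<in> val_ge P n"
  by (auto simp: val_ge_def)

lemma val_ge_sum: "(\<And>i. i \<in> I \<Longrightarrow> f i \<in> val_ge P n) \<Longrightarrow> sum f I \<in> val_ge P n"
  by (induction I rule: infinite_finite_induct) (auto intro: val_ge_add)

lemma val_ge_power: "x \<in> val_ge P 0 \<Longrightarrow> x ^ n \<in> val_ge P 0"
  by (auto simp: val_ge_def)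

lemma val_ge_iota_mult: "x \<in> val_ge P n \<Longrightarrow> \<iota> a * x \<in> val_ge P n"
  using val_ge_mult[of "\<iota> a" 0 x n] by simp

lemma val_ge_subspace: "k.subspace (val_ge P n)"
  by (auto simp: k.subspace_def const_scale_def val_ge_add val_ge_iota_mult)

lemma val_ge_self: "x \<in> val_ge P (P x)"
  by (simp add: val_ge_def)

end

end

section \<open>Independence over the polynomials in one element\<close>

text \<open>
  Linear independence of the family \<open>u\<close> over the polynomials in \<open>z\<close>: the coefficient of \<open>u i\<close> is
  \<open>\<Sum>a\<le>n. c i a z\<^sup>a\<close>, and \<open>n\<close> bounds the degrees of all coefficients at once.
\<close>
definition (in constant_field) power_indep :: "'f \<Rightarrow> ('i \<Rightarrow> 'f) \<Rightarrow> 'i set \<Rightarrow> bool" where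
  "power_indep z u I \<longleftrightarrow> (\<forall>(n::nat) c. (\<Sum>i\<in>I. \<Sum>a\<le>n. \<iota> (c i a) * (z ^ a * u i)) = 0 \<longrightarrow>
     (\<forall>i\<in>I. \<forall>a\<le>n. c i a = 0))"

text \<open>
  Different coefficients below degree \<open>n + 1\<close> give different elements of \<open>U\<close>. The factor \<open>w\<close> serves
  to clear denominators.
\<close>
lemma (in constant_field) power_indep_card:
  assumes ind: "power_indep z u I" and I: "finite I" and w: "w \<noteq> 0"
    and U: "k.subspace U" "finite U" "\<And>i a. i \<in> I \<Longrightarrow> a \<le> n \<Longrightarrow> w * (z ^ a * u i) \<in> U"
  shows "q ^ (card I * Suc n) \<le> card U"
proof -
  let ?D = "PiE (I \<times> {..n}) (\<lambda>_. UNIV :: 'k set)"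
  let ?S = "\<lambda>c. \<Sum>i\<in>I. \<Sum>a\<le>n. \<iota> (c (i, a)) * (z ^ a * u i)"
  have "inj_on (\<lambda>c. w * ?S c) ?D"
  proof (rule inj_onI)
    fix c d assume c: "c \<in> ?D" and d: "d \<in> ?D" and "w * ?S c = w * ?S d"
    hence "?S c - ?S d = 0" using w by simp
    hence "(\<Sum>i\<in>I. \<Sum>a\<le>n. \<iota> (c (i, a) - d (i, a)) * (z ^ a * u i)) = 0"
      by (simp add: iota_diff sum_subtractf[symmetric] left_diff_distrib)
    from ind[unfolded power_indep_def, rule_format, OF this]
    have "\<forall>i\<in>I. \<forall>a\<le>n. c (i, a) - d (i, a) = 0" by blast
    thus "c = d" by (intro PiE_ext[OF c d]) auto
  qed
  moreover have "(\<lambda>c. w * ?S c) ` ?D \<subseteq> U"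
  proof (rule image_subsetI)
    fix c
    have "w * ?S c = (\<Sum>i\<in>I. \<Sum>a\<le>n. const_scale \<iota> (c (i, a)) (w * (z ^ a * u i)))"
      by (simp add: sum_distrib_left const_scale_def mult_ac)
    also have "\<dots> \<in> U" by (intro k.subspace_sum k.subspace_scale U) auto
    finally show "w * ?S c \<in> U" .
  qed
  ultimately have "card ?D \<le> card U" using U(2) by (rule card_inj_on_le)
  thus ?thesis using I by (simp add: card_PiE card_k card_cartesian_product power_mult)
qed

locale function_field = constant_field \<iota> for \<iota> :: "'k::{field,finite} \<Rightarrow> 'f::field" +
  assumes one_variable: "function_field_one_var \<iota>"
begin

text \<open>
  This bound replaces the degree of \<open>F\<close> over \<open>k(z)\<close>, and compares rates of growth. Products of a
  spanning set of \<open>F\<close> over \<open>k(x)\<close> with powers of \<open>x\<close> form spaces \<open>V m\<close> of dimension linear in \<open>m\<close>. A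
  common denominator \<open>d\<close> turns multiplication by \<open>z\<close> into a map that shifts this filtration by a
  constant \<open>s\<close>, so the multiples of the family by the powers of \<open>z\<close> up to \<open>j\<close> lie in a space of
  dimension about \<open>j s |B|\<close>.
\<close>
theorem power_indep_bound:
  obtains N where "\<And>u (I :: 'i set). finite I \<Longrightarrow> power_indep z u I \<Longrightarrow> card I \<le> N"
proof -
  obtain x B where B: "finite B"
    and sp: "\<And>y. \<exists>c. (\<forall>b\<in>B. c b \<in> simple_extension \<iota> x) \<and> y = (\<Sum>b\<in>B. c b * b)"
    using one_variable unfolding function_field_one_var_def by blast
  define gen where "gen m = (\<lambda>(a, b). x ^ a * b) ` ({..m} \<times> B)" for m :: nat
  define V where "V m = k.span (gen m)" for m
  have gen_mono: "m \<le> m' \<Longrightarrow> gen m \<subseteq> gen m'" for m m'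
    unfolding gen_def by (intro image_mono) auto
  have V_mono: "m \<le> m' \<Longrightarrow> v \<in> V m \<Longrightarrow> v \<in> V m'" for m m' v
    unfolding V_def using k.span_mono[OF gen_mono] by blast
  have subV: "k.subspace (V m)" for m unfolding V_def by simp
  have fin_gen: "finite (gen m)" for m using B by (auto simp: gen_def)
  have cardV: "finite (V m)" "card (V m) \<le> q ^ (Suc m * card B)" for m
  proof -
    show "finite (V m)" unfolding V_def by (rule card_span_le(1)[OF fin_gen])
    have "card (gen m) \<le> card ({..m} \<times> B)" unfolding gen_def
      by (rule card_image_le) (use B in auto)
    hence "card (gen m) \<le> Suc m * card B" by (simp add: card_cartesian_product)
    hence "q ^ card (gen m) \<le> q ^ (Suc m * card B)"
      using q_ge_2 by (intro power_increasing) auto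
    thus "card (V m) \<le> q ^ (Suc m * card B)" unfolding V_def
      using card_span_le(2)[OF fin_gen] order.trans by blast
  qed
  have mult_span: "y * v \<in> V m'" if "\<And>g. g \<in> gen m \<Longrightarrow> y * g \<in> V m'" "v \<in> V m" for y v m m'
    using that(2) unfolding V_def
  proof (induction rule: k.span_induct_alt)
    case base show ?case using k.subspace_0[OF subV[of m']] by (simp add: V_def)
  next
    case (step c g v)
    have "y * (const_scale \<iota> c g + v) = const_scale \<iota> c (y * g) + y * v"
      by (simp add: const_scale_def algebra_simps)
    also have "\<dots> \<in> V m'" using step that(1)[OF step(1)]
      by (intro k.subspace_add k.subspace_scale subV) (auto simp: V_def)
    finally show ?case by (simp add: V_def)
  qed
  have xV: "x ^ a * v \<in> V (m + a)" if "v \<in> V m" for a v m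
  proof (rule mult_span[OF _ that])
    fix g assume "g \<in> gen m"
    then obtain a' b where "g = x ^ a' * b" "a' \<le> m" "b \<in> B" by (auto simp: gen_def)
    hence "x ^ a * g \<in> gen (m + a)" unfolding gen_def
      by (intro image_eqI[of _ _ "(a + a', b)"]) (auto simp: power_add)
    thus "x ^ a * g \<in> V (m + a)" unfolding V_def by (rule k.span_base)
  qed
  define ev where "ev p = poly (map_poly \<iota> p) x" for p
  have ev_eq: "ev p = (\<Sum>i\<le>degree p. \<iota> (coeff p i) * x ^ i)" for p
    unfolding ev_def poly_altdef by (simp add: degree_map_poly coeff_map_poly)
  have evV: "ev p * v \<in> V (m + degree p)" if "v \<in> V m" for p v m
  proof -
    have "ev p * v = (\<Sum>i\<le>degree p. const_scale \<iota> (coeff p i) (x ^ i * v))"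
      by (simp add: ev_eq sum_distrib_right sum_distrib_left const_scale_def mult_ac)
    also have "\<dots> \<in> V (m + degree p)"
      by (intro k.subspace_sum k.subspace_scale subV V_mono[OF _ xV[OF that]]) auto
    finally show ?thesis .
  qed
  \<comment> \<open>the denominators: multiplication by them shifts the filtration by a bounded amount\<close>
  define D where "D = {d. d \<noteq> 0 \<and> (\<exists>s. \<forall>m. \<forall>v\<in>V m. d * v \<in> V (m + s))}"
  have D_ev: "ev p \<in> D" if "ev p \<noteq> 0" for p unfolding D_def using that evV by blast
  have D_mult: "d * e \<in> D" if de: "d \<in> D" "e \<in> D" for d e
  proof -
    obtain s where s: "\<And>m v. v \<in> V m \<Longrightarrow> d * v \<in> V (m + s)"
      using de(1) by (auto simp: D_def)
    obtain s' where s': "\<And>m v. v \<in> V m \<Longrightarrow> e * v \<in> V (m + s')"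
      using de(2) by (auto simp: D_def)
    have "(d * e) * v \<in> V (m + (s' + s))" if "v \<in> V m" for m v
      using s[OF s'[OF that]] by (simp add: mult.assoc add.assoc)
    thus ?thesis using de unfolding D_def by auto
  qed
  have D_1: "1 \<in> D" unfolding D_def by (auto intro: exI[of _ 0])
  have common: "\<exists>d\<in>D. \<exists>m. \<forall>y\<in>Y. d * y \<in> V m"
    if "finite Y" "\<And>y. y \<in> Y \<Longrightarrow> \<exists>d\<in>D. \<exists>m. d * y \<in> V m" for Y
    using that
  proof (induction Y rule: finite_induct)
    case empty thus ?case using D_1 by auto
  next
    case (insert y Y)
    then obtain d m where d: "d \<in> D" "\<forall>y\<in>Y. d * y \<in> V m" by blast
    obtain e l where e: "e \<in> D" "e * y \<in> V l" using insert.prems by blast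
    obtain s where s: "\<And>m v. v \<in> V m \<Longrightarrow> d * v \<in> V (m + s)" using d(1) by (auto simp: D_def)
    obtain s' where s': "\<And>m v. v \<in> V m \<Longrightarrow> e * v \<in> V (m + s')" using e(1) by (auto simp: D_def)
    have "(d * e) * y' \<in> V (m + s' + l + s)" if y': "y' \<in> insert y Y" for y'
    proof (cases "y' = y")
      case True
      show ?thesis using V_mono[OF _ s[OF e(2)], of "m + s' + l + s"] True by (simp add: mult_ac)
    next
      case False
      hence "d * y' \<in> V m" using y' d by auto
      thus ?thesis using V_mono[OF _ s'[of _ m], of "m + s' + l + s" "d * y'"] by (simp add: mult_ac)
    qed
    thus ?case using D_mult[OF d(1) e(1)] by blast
  qed
  have den: "\<exists>d\<in>D. \<exists>m. d * y \<in> V m" for y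
  proof -
    obtain c where c: "\<And>b. b \<in> B \<Longrightarrow> c b \<in> simple_extension \<iota> x" "y = (\<Sum>b\<in>B. c b * b)"
      using sp by blast
    have "\<exists>d\<in>D. \<exists>m. \<forall>y\<in>(\<lambda>b. c b * b) ` B. d * y \<in> V m"
    proof (rule common)
      fix y' assume "y' \<in> (\<lambda>b. c b * b) ` B"
      then obtain b where b: "b \<in> B" "y' = c b * b" by blast
      obtain p r where pr: "c b = ev p / ev r" "ev r \<noteq> 0"
        using c(1)[OF b(1)] unfolding simple_extension_def ev_def by blast
      have "b \<in> V 0" unfolding V_def gen_def
        by (intro k.span_base image_eqI[of _ _ "(0, b)"]) (use b in auto)
      from evV[OF this, of p] have "ev r * y' \<in> V (0 + degree p)" using pr b by simp
      thus "\<exists>d\<in>D. \<exists>m. d * y' \<in> V m" using D_ev[OF pr(2)] by blast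
    qed (use B in simp)
    then obtain d m where d: "d \<in> D" "\<And>b. b \<in> B \<Longrightarrow> d * (c b * b) \<in> V m" by auto
    have "d * y \<in> V m" unfolding c(2) sum_distrib_left by (intro k.subspace_sum subV d(2))
    thus ?thesis using d(1) by blast
  qed
  obtain d s0 where d: "d \<in> D" "\<forall>y\<in>(\<lambda>b. z * b) ` B. d * y \<in> V s0"
    using common[of "(\<lambda>b. z * b) ` B"] den B by blast
  obtain s1 where s1: "\<And>m v. v \<in> V m \<Longrightarrow> d * v \<in> V (m + s1)" using d(1) by (auto simp: D_def)
  define s where "s = s0 + s1"
  have shift_d: "d * v \<in> V (m + s)" if "v \<in> V m" for m v
    using V_mono[OF _ s1[OF that]] by (simp add: s_def)
  have shift_dz: "(d * z) * v \<in> V (m + s)" if "v \<in> V m" for m v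
  proof (rule mult_span[OF _ that])
    fix g assume "g \<in> gen m"
    then obtain a b where ab: "g = x ^ a * b" "a \<le> m" "b \<in> B" by (auto simp: gen_def)
    have "x ^ a * (d * (z * b)) \<in> V (s0 + a)" using d(2) ab(3) by (intro xV) auto
    hence "x ^ a * (d * (z * b)) \<in> V (m + s)" by (rule V_mono[rotated]) (use ab s_def in auto)
    thus "(d * z) * g \<in> V (m + s)" by (simp add: ab(1) mult_ac)
  qed
  show thesis
  proof (rule that[of "s * card B"])
    fix u and I :: "'i set" assume I: "finite I" "power_indep z u I"
    obtain g c where g: "g \<in> D" "\<forall>y\<in>u ` I. g * y \<in> V c"
      using common[of "u ` I"] den I(1) by blast
    have step: "d ^ j * (z ^ a * v) \<in> V (c + j * s)" if "v \<in> V c" "a \<le> j" for v j a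
      using that(2)
    proof (induction j arbitrary: a)
      case 0 thus ?case using that(1) by simp
    next
      case (Suc j)
      show ?case
      proof (cases "a \<le> j")
        case True
        from shift_d[OF Suc.IH[OF True]] show ?thesis by (simp add: mult_ac add_ac)
      next
        case False
        hence a: "a = Suc j" using Suc.prems by simp
        from shift_dz[OF Suc.IH[of j]] show ?thesis by (simp add: a mult_ac add_ac)
      qed
    qed
    have ineq: "card I * Suc j \<le> Suc (c + j * s) * card B" for j
    proof -
      have "q ^ (card I * Suc j) \<le> card (V (c + j * s))"
      proof (rule power_indep_card[OF I(2) I(1)])
        show "d ^ j * g \<noteq> 0" using d(1) g(1) by (auto simp: D_def)
        fix i a assume "i \<in> I" "a \<le> j"
        hence "d ^ j * (z ^ a * (g * u i)) \<in> V (c + j * s)" using g(2) by (intro step) auto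
        thus "(d ^ j * g) * (z ^ a * u i) \<in> V (c + j * s)" by (simp add: mult_ac)
      qed (use cardV subV in auto)
      also have "\<dots> \<le> q ^ (Suc (c + j * s) * card B)" by (rule cardV)
      finally show ?thesis by (rule power_le_imp_le_exp[rotated]) (use q_ge_2 in simp)
    qed
    \<comment> \<open>both sides of \<open>ineq\<close> are linear in \<open>j\<close>, and this compares the slopes\<close>
    show "card I \<le> s * card B"
    proof (rule ccontr)
      assume "\<not> card I \<le> s * card B"
      hence "Suc (s * card B) * Suc (Suc c * card B) \<le> card I * Suc (Suc c * card B)"
        by (intro mult_le_mono1) simp
      also have "\<dots> \<le> Suc (c + (Suc c * card B) * s) * card B" by (rule ineq)
      finally show False by (simp add: algebra_simps)
    qed
  qed
qed

end

section \<open>Existence of places\<close>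

definition (in constant_field) subalgebra :: "'f set \<Rightarrow> bool" where
  "subalgebra S \<longleftrightarrow> range \<iota> \<subseteq> S \<and> (\<forall>x\<in>S. \<forall>y\<in>S. x + y \<in> S \<and> x * y \<in> S)"

locale valuation_subring = function_field \<iota> for \<iota> :: "'k::{field,finite} \<Rightarrow> 'f::field" +
  fixes R :: "'f set"
  assumes alg: "subalgebra R"
    and total: "\<And>z. z \<in> R \<or> inverse z \<in> R"
begin

lemma R_add: "x \<in> R \<Longrightarrow> y \<in> R \<Longrightarrow> x + y \<in> R"
  and R_mult: "x \<in> R \<Longrightarrow> y \<in> R \<Longrightarrow> x * y \<in> R"
  and R_const: "\<iota> a \<in> R"
  using alg by (auto simp: subalgebra_def)

lemma R_0: "0 \<in> R" and R_1: "1 \<in> R"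
  using R_const[of 0] R_const[of 1] by simp_all

lemma R_power: "x \<in> R \<Longrightarrow> x ^ n \<in> R"
  by (induction n) (auto intro: R_1 R_mult)

text \<open>The set of nonunits of \<open>R\<close>, which is its maximal ideal.\<close>
definition M :: "'f set" where "M = {z \<in> R. z = 0 \<or> inverse z \<notin> R}"

lemma M_R: "x \<in> M \<Longrightarrow> x \<in> R" by (simp add: M_def)

lemma M_mult: assumes "a \<in> R" "y \<in> M" shows "a * y \<in> M"
proof (cases "a * y = 0")
  case False
  have "inverse (a * y) \<notin> R"
  proof
    assume "inverse (a * y) \<in> R"
    hence "a * inverse (a * y) \<in> R" using assms by (intro R_mult)
    thus False using False assms(2) by (auto simp: M_def field_simps)
  qed
  thus ?thesis using assms by (auto simp: M_def R_mult)
qed (auto simp: M_def R_0)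

lemma M_add: assumes "x \<in> M" "y \<in> M" shows "x + y \<in> M"
proof -
  have *: "x + y \<in> M" if "x \<in> M" "y \<in> M" "x / y \<in> R" for x y
  proof (cases "y = 0")
    case False
    have "(x / y + 1) * y \<in> M" using that R_1 by (intro M_mult R_add)
    moreover have "(x / y + 1) * y = x + y" using False by (simp add: distrib_right)
    ultimately show ?thesis by simp
  qed (use that in simp)
  have "x / y \<in> R \<or> y / x \<in> R" using total[of "x / y"] by simp
  thus ?thesis using *[of x y] *[of y x] assms by (auto simp: add.commute)
qed

lemma const_notin_M: "a \<noteq> 0 \<Longrightarrow> \<iota> a \<notin> M"
  using R_const[of "inverse a"] by (auto simp: M_def iota_inverse)

text \<open>
  After division by the term that all others are multiples of, every other summand lies in the
  maximal ideal, and a nonzero constant would have to lie there too.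
\<close>
lemma comparable_indep:
  assumes "finite E" "E \<noteq> {}" "\<And>i. i \<in> E \<Longrightarrow> e i \<noteq> 0" "\<And>i. i \<in> E \<Longrightarrow> c i \<noteq> 0"
    and cmp: "\<And>i j. i \<in> E \<Longrightarrow> j \<in> E \<Longrightarrow> i \<noteq> j \<Longrightarrow> e i / e j \<in> M \<or> e j / e i \<in> M"
  shows "(\<Sum>i\<in>E. \<iota> (c i) * e i) \<noteq> 0"
proof -
  have "\<exists>m\<in>E. \<forall>i\<in>E - {m}. e i / e m \<in> M"
    using assms(1,2,3) cmp
  proof (induction E rule: finite_ne_induct)
    case (insert x F)
    obtain m where m: "m \<in> F" "\<forall>i\<in>F - {m}. e i / e m \<in> M"
      using insert.IH insert.prems by blast
    have ne: "e x \<noteq> 0" "e m \<noteq> 0" using m(1) insert.prems(1) by auto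
    consider "e x / e m \<in> M" | "e m / e x \<in> M"
      using insert.prems(2)[of x m] m(1) insert.hyps by auto
    thus ?case
    proof cases
      case 1 thus ?thesis using m by (intro bexI[of _ m]) auto
    next
      case 2
      have "e i / e x \<in> M" if "i \<in> F" for i
      proof (cases "i = m")
        case False
        hence "(e i / e m) * (e m / e x) \<in> M" using m that 2 by (intro M_mult M_R) auto
        thus ?thesis using ne by simp
      qed (use 2 in simp)
      thus ?thesis by (intro bexI[of _ x]) auto
    qed
  qed auto
  then obtain m where m: "m \<in> E" "\<And>i. i \<in> E - {m} \<Longrightarrow> e i / e m \<in> M" by blast
  show ?thesis
  proof
    assume "(\<Sum>i\<in>E. \<iota> (c i) * e i) = 0"
    hence "0 = (\<Sum>i\<in>E. \<iota> (c i) * e i) / e m" by simp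
    also have "\<dots> = (\<Sum>i\<in>E. \<iota> (c i) * (e i / e m))" by (simp add: sum_divide_distrib)
    also have "\<dots> = \<iota> (c m) + (\<Sum>i\<in>E - {m}. \<iota> (c i) * (e i / e m))"
      using assms(1,3) m(1) by (subst sum.remove[of E m]) auto
    finally have eq: "\<iota> (- c m) = (\<Sum>i\<in>E - {m}. \<iota> (c i) * (e i / e m))"
      by (simp add: iota_minus neg_eq_iff_add_eq_0)
    have sum_M: "sum f A \<in> M" if "\<And>i. i \<in> A \<Longrightarrow> f i \<in> M" for f and A :: "'b set"
      using that by (induction A rule: infinite_finite_induct) (auto simp: M_add, simp_all add: M_def R_0)
    have "\<iota> (- c m) \<in> M" unfolding eq using m(2) by (intro sum_M M_mult R_const) auto
    thus False using const_notin_M[of "- c m"] assms(4)[OF m(1)] by simp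
  qed
qed

text \<open>
  A chain starts at \<open>z\<close> and each member is a proper multiple of the next one, so its length counts
  how often \<open>z\<close> can be divided.
\<close>
definition chain :: "'f \<Rightarrow> nat \<Rightarrow> (nat \<Rightarrow> 'f) \<Rightarrow> bool" where
  "chain z r f \<longleftrightarrow> f 0 = z \<and> (\<forall>i<r. f i \<in> M \<and> f i \<noteq> 0) \<and> (\<forall>i. Suc i < r \<longrightarrow> f i / f (Suc i) \<in> M)"

lemma chain_less:
  assumes "chain z r f" "i < j" "j < r" shows "f i / f j \<in> M"
  using assms(2,3)
proof (induction j)
  case (Suc j)
  have s: "f j / f (Suc j) \<in> M" using Suc.prems assms(1) by (auto simp: chain_def)
  show ?case
  proof (cases "i = j")
    case False
    have "f i / f j \<in> R" using False Suc by (intro M_R Suc.IH) auto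
    hence "(f i / f j) * (f j / f (Suc j)) \<in> M" using s by (rule M_mult)
    moreover have "f j \<noteq> 0" using Suc.prems assms(1) by (auto simp: chain_def)
    ultimately show ?thesis by simp
  qed (use s in simp)
qed simp

text \<open>
  The elements \<open>z\<^sup>a f\<^sub>i\<close> are pairwise comparable in the sense of \<open>comparable_indep\<close>: the members of
  the chain divide \<open>z\<close> and are not units, so no quotient of two of them compensates a factor \<open>z\<close>.
\<close>
lemma chain_indep:
  assumes ch: "chain z r f" shows "power_indep z f {..<r}"
  unfolding power_indep_def
proof (intro allI impI ballI, rule ccontr)
  fix n :: nat and c i a
  assume sum0: "(\<Sum>i<r. \<Sum>a\<le>n. \<iota> (c i a) * (z ^ a * f i)) = 0" and i: "i \<in> {..<r}" "a \<le> n" "c i a \<noteq> 0"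
  let ?E = "{(i, a). i < r \<and> a \<le> n \<and> c i a \<noteq> 0}" and ?e = "\<lambda>(i, a). z ^ a * f i"
  have fM: "f i \<in> M" "f i \<noteq> 0" if "i < r" for i using ch that by (auto simp: chain_def)
  have z: "z = f 0" using ch by (auto simp: chain_def)
  have z0: "z \<noteq> 0" "z \<in> M" using fM[of 0] i(1) z by auto
  have less: "z ^ b * f j / (z ^ a * f i) \<in> M" if "a < b" "i < r" "j < r" for a b i j
  proof -
    have "f 0 / f i \<in> R"
      using chain_less[OF ch, of 0 i] that(2) fM[of i] R_1 M_R by (cases "i = 0") auto
    hence "(z ^ (b - Suc a) * (f 0 / f i)) * f j \<in> M"
      using fM(1)[OF that(3)] z0 M_R by (intro M_mult R_mult R_power) auto
    moreover have "z ^ b = z ^ a * (z * z ^ (b - Suc a))"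
      using that(1) by (simp flip: power_Suc power_add)
    ultimately show ?thesis using z z0 fM(2)[OF that(2)] by (simp add: field_simps)
  qed
  have "?E \<subseteq> {..<r} \<times> {..n}" by auto
  hence fin: "finite ?E" by (rule finite_subset) auto
  have "(\<Sum>p\<in>?E. \<iota> ((\<lambda>(i, a). c i a) p) * ?e p) \<noteq> 0"
  proof (rule comparable_indep[OF fin])
    show "?E \<noteq> {}" using i by auto
    show "?e p / ?e p' \<in> M \<or> ?e p' / ?e p \<in> M" if pp: "p \<in> ?E" "p' \<in> ?E" "p \<noteq> p'" for p p'
    proof -
      obtain i a j b where p: "p = (i, a)" "p' = (j, b)" by fastforce
      have b: "i < r" "j < r" using pp p by auto
      consider "a < b" | "b < a" | "a = b" "i < j" | "a = b" "j < i" using pp p by fastforce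
      thus ?thesis
        by cases (use less[of a b i j] less[of b a j i] chain_less[OF ch, of i j]
            chain_less[OF ch, of j i] b p z0 in \<open>auto simp: field_simps\<close>)
    qed
  qed (use fM(2) z0 in auto)
  also have "(\<Sum>p\<in>?E. \<iota> ((\<lambda>(i, a). c i a) p) * ?e p) =
      (\<Sum>p\<in>{..<r} \<times> {..n}. \<iota> ((\<lambda>(i, a). c i a) p) * ?e p)"
    by (rule sum.mono_neutral_left) auto
  also have "\<dots> = (\<Sum>i<r. \<Sum>a\<le>n. \<iota> (c i a) * (z ^ a * f i))"
    by (simp add: sum.cartesian_product split_def)
  finally show False using sum0 by simp
qed

text \<open>This makes the valuation discrete.\<close>
lemma chain_bound: "\<exists>N. \<forall>r f. chain z r f \<longrightarrow> r \<le> N"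
proof -
  obtain N where "\<And>u (I :: nat set). finite I \<Longrightarrow> power_indep z u I \<Longrightarrow> card I \<le> N"
    using power_indep_bound[of z] by metis
  from this[OF _ chain_indep] show ?thesis by (intro exI[of _ N]) auto
qed

text \<open>
  The last member of a longest chain divides every element of the maximal ideal, since otherwise the
  chain could be continued.
\<close>
lemma uniformizer_exists:
  assumes w: "w \<in> M" "w \<noteq> 0"
  obtains t where "t \<in> M" "t \<noteq> 0" "\<And>y. y \<in> M \<Longrightarrow> y / t \<in> R"
proof -
  have ex: "\<exists>f. chain w 1 f" using w by (intro exI[of _ "\<lambda>_. w"]) (auto simp: chain_def)
  obtain N where N: "\<And>r f. chain w r f \<Longrightarrow> r \<le> N" using chain_bound[of w] by blast
  define r where "r = (GREATEST r. \<exists>f. chain w r f)"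
  have r: "\<exists>f. chain w r f" unfolding r_def
    by (rule GreatestI_nat[where b = N and k = 1 and P = "\<lambda>r. \<exists>f. chain w r f"]) (use N ex in blast)+
  have rmax: "r' \<le> r" if "chain w r' f" for r' f unfolding r_def
    by (rule Greatest_le_nat[where b = N and P = "\<lambda>r. \<exists>f. chain w r f"]) (use N that in blast)+
  obtain f where f: "chain w r f" using r by blast
  have r1: "1 \<le> r" using rmax ex by blast
  show thesis
  proof (rule that[of "f (r - 1)"])
    show t: "f (r - 1) \<in> M" "f (r - 1) \<noteq> 0" using f r1 by (auto simp: chain_def)
    fix y assume y: "y \<in> M"
    show "y / f (r - 1) \<in> R"
    proof (rule ccontr)
      assume n: "y / f (r - 1) \<notin> R"
      hence y0: "y \<noteq> 0" using R_0 by auto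
      have "f (r - 1) / y \<in> M" using n total[of "f (r - 1) / y"] by (auto simp: M_def)
      hence "chain w (Suc r) (f(r := y))"
        using f y y0 r1 unfolding chain_def by (auto simp: less_Suc_eq)
      thus False using rmax by fastforce
    qed
  qed
qed

text \<open>
  With a generator \<open>t\<close> of the maximal ideal every nonzero element is a unit times a power of \<open>t\<close>:
  the exponent cannot grow beyond the bound for chains. The exponent is the normalised valuation.
\<close>
lemma place_of_valuation_subring:
  assumes w: "w \<in> M" "w \<noteq> 0"
  shows "\<exists>P\<in>places \<iota>. 0 < P w \<and> R \<subseteq> local_ring P"
proof -
  obtain t where t: "t \<in> M" "t \<noteq> 0" "\<And>y. y \<in> M \<Longrightarrow> y / t \<in> R" using uniformizer_exists[OF w] by metis
  have t': "inverse t \<notin> R" using t by (auto simp: M_def)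
  define U where "U = {u. u \<in> R \<and> inverse u \<in> R \<and> u \<noteq> 0}"
  have U_mult: "u * u' \<in> U" if "u \<in> U" "u' \<in> U" for u u' using that by (auto simp: U_def R_mult)
  have U_inv: "inverse u \<in> U" if "u \<in> U" for u using that by (auto simp: U_def)
  have dec0: "\<exists>m. z * t powi (- m) \<in> U" if z: "z \<in> R" "z \<noteq> 0" for z
  proof -
    obtain N where N: "\<And>r f. chain z r f \<Longrightarrow> r \<le> N" using chain_bound[of z] by blast
    have bound: "m \<le> N" if m: "z / t ^ m \<in> R" for m
    proof (cases "m = 0")
      case False
      have red: "z / t ^ i \<in> M" if "i < m" for i
      proof -
        have "(z / t ^ m * t ^ (m - Suc i)) * t \<in> M"
          using m t by (intro M_mult R_mult R_power M_R[of t])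
        moreover have "t ^ m = t ^ i * (t * t ^ (m - Suc i))"
          using that by (simp flip: power_Suc power_add)
        ultimately show ?thesis using t(2) by (simp add: field_simps)
      qed
      \<comment> \<open>a chain of length \<open>m\<close> from \<open>z\<close> through descending powers of \<open>t\<close>\<close>
      have "chain z m (\<lambda>i. if i = 0 then z else t ^ (m - i))"
        unfolding chain_def
      proof (intro conjI allI impI)
        fix i assume i: "i < m"
        have "t ^ (m - Suc i) * t \<in> M" by (intro M_mult R_power M_R t(1))
        thus "(if i = 0 then z else t ^ (m - i)) \<in> M"
          using red[of 0] i by (auto simp flip: power_Suc2 simp: Suc_diff_Suc)
        show "(if i = 0 then z else t ^ (m - i)) \<noteq> 0" using z t by auto
      next
        fix i assume i: "Suc i < m"
        show "(if i = 0 then z else t ^ (m - i)) / (if Suc i = 0 then z else t ^ (m - Suc i)) \<in> M"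
        proof (cases "i = 0")
          case False
          have "t ^ (m - i) = t * t ^ (m - Suc i)" using i by (simp flip: power_Suc add: Suc_diff_Suc)
          thus ?thesis using False t by simp
        qed (use red[of "m - 1"] i in auto)
      qed simp
      thus ?thesis by (rule N)
    qed simp
    define m where "m = (GREATEST m. z / t ^ m \<in> R)"
    have ex: "z / t ^ 0 \<in> R" using z by simp
    have m: "z / t ^ m \<in> R" unfolding m_def
      by (rule GreatestI_nat[where b = N and k = 0 and P = "\<lambda>m. z / t ^ m \<in> R"]) (use ex bound in blast)+
    have "z / t ^ m / t \<notin> R"
    proof
      assume "z / t ^ m / t \<in> R"
      hence "z / t ^ Suc m \<in> R" by (simp add: field_simps)
      hence "Suc m \<le> m" unfolding m_def by (rule Greatest_le_nat[where b = N and P = "\<lambda>m. z / t ^ m \<in> R"]) (use bound in blast)+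
      thus False by simp
    qed
    hence "z / t ^ m \<notin> M" using t(3) by blast
    hence "z / t ^ m \<in> U" using m z t by (auto simp: M_def U_def)
    thus ?thesis using t(2) by (intro exI[of _ "int m"]) (simp add: power_int_minus divide_inverse)
  qed
  have dec: "\<exists>m. z * t powi (- m) \<in> U" if z: "z \<noteq> 0" for z
  proof (cases "z \<in> R")
    case False
    hence "inverse z \<in> R" using total by blast
    then obtain m where "inverse z * t powi (- m) \<in> U" using dec0[of "inverse z"] z by auto
    from U_inv[OF this] show ?thesis
      by (intro exI[of _ "- m"]) (simp add: power_int_minus field_simps)
  qed (use dec0 z in blast)
  have pos: "0 \<le> m" if "z \<in> R" "z * t powi (- m) \<in> U" for z m
  proof (rule ccontr)
    assume "\<not> 0 \<le> m"
    then obtain n where n: "m = - int (Suc n)" by (metis negD not_le)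
    have iu: "inverse (z * t powi (- m)) \<in> R" using that(2) by (simp add: U_def)
    have "z * inverse (z * t powi (- m)) * t ^ n \<in> R"
      by (rule R_mult[OF R_mult[OF that(1) iu] R_power[OF M_R[OF t(1)]]])
    moreover have "z \<noteq> 0" using that by (auto simp: U_def)
    moreover have "t powi (- m) = t * t ^ n"
      unfolding n by (simp add: power_int_def nat_add_distrib)
    ultimately have "inverse t \<in> R" using t(2) by (simp add: field_simps)
    thus False using t' by blast
  qed
  have uniq: "m = n" if "z * t powi (- m) \<in> U" "z * t powi (- n) \<in> U" for z m n
  proof -
    have *: "m \<le> n" if "z * t powi (- m) \<in> U" "z * t powi (- n) \<in> U" for m n
    proof -
      have "t powi (- m) * t powi (- (n - m)) = t powi (- n)"
        using t(2) by (subst power_int_add[symmetric]) auto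
      hence eq: "(z * t powi (- m)) * t powi (- (n - m)) = z * t powi (- n)"
        by (simp only: mult.assoc)
      have "z * t powi (- m) \<in> R" using that(1) by (simp only: U_def mem_Collect_eq)
      from pos[OF this] that(2) have "0 \<le> n - m" by (simp only: eq)
      thus ?thesis by simp
    qed
    show ?thesis using *[of m n] *[of n m] that by simp
  qed
  define v where "v z = (if z = 0 then 0 else THE m. z * t powi (- m) \<in> U)" for z
  have v_eqI: "v z = m" if "z * t powi (- m) \<in> U" for z m
  proof -
    have "z \<noteq> 0" using that by (auto simp: U_def)
    thus ?thesis unfolding v_def using that uniq by (auto intro!: the_equality)
  qed
  have v_U: "z * t powi (- v z) \<in> U" if "z \<noteq> 0" for z
    using dec[OF that] v_eqI by blast
  have v_R: "0 \<le> v z" if "z \<in> R" for z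
    using pos[OF that v_U] by (cases "z = 0") (auto simp: v_def)
  have v_mult: "v (x * y) = v x + v y" if "x \<noteq> 0" "y \<noteq> 0" for x y
  proof (rule v_eqI)
    have "(x * t powi (- v x)) * (y * t powi (- v y)) \<in> U"
      by (rule U_mult[OF v_U[OF that(1)] v_U[OF that(2)]])
    thus "x * y * t powi (- (v x + v y)) \<in> U"
      using t(2) by (simp add: power_int_add power_int_minus power_int_diff field_simps)
  qed
  have v_1: "v t = 1" by (rule v_eqI) (use t R_1 in \<open>auto simp: U_def power_int_minus\<close>)
  have v_powi: "v (t powi m) = m" for m
    by (rule v_eqI) (use t R_1 in \<open>auto simp: U_def power_int_minus\<close>)
  have v_add: "v x \<le> v (x + y)" if "x \<noteq> 0" "y \<noteq> 0" "x + y \<noteq> 0" "v x \<le> v y" for x y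
  proof -
    define n where "n = nat (v y - v x)"
    have n: "v y = v x + int n" using that(4) by (simp add: n_def)
    have vR: "z * t powi (- v z) \<in> R" if "z \<noteq> 0" for z
      using v_U[OF that] by (simp only: U_def mem_Collect_eq)
    have "x * t powi (- v x) + (y * t powi (- v y)) * t ^ n \<in> R"
      by (rule R_add[OF vR[OF that(1)] R_mult[OF vR[OF that(2)] R_power[OF M_R[OF t(1)]]]])
    hence "(x + y) * t powi (- v x) \<in> R"
      using t(2) unfolding n by (simp add: power_int_add power_int_minus power_int_diff field_simps)
    from v_R[OF this] show ?thesis using that t(2) by (subst (asm) v_mult) (auto simp: v_powi)
  qed
  have "v \<in> places \<iota>"
    unfolding places_def
  proof (safe intro!: exI[of _ t])
    show "v (\<iota> a) = 0" if "a \<noteq> 0" for a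
      by (rule v_eqI) (use that R_const[of a] R_const[of "inverse a"] in \<open>auto simp: U_def iota_inverse\<close>)
    show "min (v x) (v y) \<le> v (x + y)" if "x \<noteq> 0" "y \<noteq> 0" "x + y \<noteq> 0" for x y
      using v_add[of x y] v_add[of y x] that by (auto simp: min_def add.commute)
  qed (auto simp: v_1 v_mult, simp add: v_def)
  moreover have "0 < v w"
  proof -
    have "0 \<le> v (w / t)" using t(3)[OF w(1)] by (rule v_R)
    moreover have "v (t * (w / t)) = v t + v (w / t)" using w t by (intro v_mult) auto
    ultimately show ?thesis using v_1 t(2) by simp
  qed
  moreover have "R \<subseteq> local_ring v" using v_R by (auto simp: local_ring_def)
  ultimately show ?thesis by blast
qed

end

context function_field
begin

text \<open>
  By Zorn's lemma there is a subalgebra that contains \<open>S0\<close> and is maximal among those that avoid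
  \<open>1/w\<close>. It is a valuation ring: for \<open>z\<close> outside it, maximality expresses \<open>1/w\<close> as a polynomial in
  \<open>z\<close>, and if this also held for \<open>1/z\<close>, the two polynomials would reduce each other's degrees.
\<close>
theorem place_exists:
  assumes S0: "subalgebra S0" "w \<in> S0" "inverse w \<notin> S0" and w0: "w \<noteq> 0"
  shows "\<exists>P\<in>places \<iota>. 0 < P w \<and> S0 \<subseteq> local_ring P"
proof -
  define \<A> where "\<A> = {S. subalgebra S \<and> S0 \<subseteq> S \<and> inverse w \<notin> S}"
  have "\<exists>R\<in>\<A>. \<forall>S\<in>\<A>. R \<subseteq> S \<longrightarrow> S = R"
  proof (rule subset_Zorn_nonempty)
    have "S0 \<in> \<A>" using S0 by (simp add: \<A>_def)
    thus "\<A> \<noteq> {}" by blast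
    fix \<C> assume C: "\<C> \<noteq> {}" "subset.chain \<A> \<C>"
    have sub: "\<And>S. S \<in> \<C> \<Longrightarrow> subalgebra S \<and> S0 \<subseteq> S \<and> inverse w \<notin> S"
      using C(2) unfolding subset.chain_def \<A>_def by blast
    have "subalgebra (\<Union>\<C>)"
      unfolding subalgebra_def
    proof (intro conjI ballI)
      show "range \<iota> \<subseteq> \<Union>\<C>" using C(1) sub by (fastforce simp: subalgebra_def)
      fix x y assume "x \<in> \<Union>\<C>" "y \<in> \<Union>\<C>"
      then obtain S T where ST: "S \<in> \<C>" "T \<in> \<C>" "x \<in> S" "y \<in> T" by blast
      have "S \<subseteq> T \<or> T \<subseteq> S" using C(2) ST by (auto simp: subset.chain_def)
      then obtain T' where T': "T' \<in> \<C>" "x \<in> T'" "y \<in> T'" using ST by blast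
      hence "x + y \<in> T'" "x * y \<in> T'" using sub[of T'] by (auto simp: subalgebra_def)
      thus "x + y \<in> \<Union>\<C>" "x * y \<in> \<Union>\<C>" using T'(1) by blast+
    qed
    thus "\<Union>\<C> \<in> \<A>" using sub C(1) by (auto simp: \<A>_def)
  qed
  then obtain R where RA: "R \<in> \<A>" and Rmax: "\<forall>S\<in>\<A>. R \<subseteq> S \<longrightarrow> S = R" by (rule bexE)
  have R: "subalgebra R" "S0 \<subseteq> R" "inverse w \<notin> R" using RA by (simp_all add: \<A>_def)
  have max: "S = R" if "subalgebra S" "R \<subseteq> S" "inverse w \<notin> S" for S
  proof -
    have "S \<in> \<A>" using that R(2) by (simp add: \<A>_def)
    thus ?thesis using Rmax that(2) by blast
  qed
  have R_add: "x \<in> R \<Longrightarrow> y \<in> R \<Longrightarrow> x + y \<in> R"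
    and R_mult: "x \<in> R \<Longrightarrow> y \<in> R \<Longrightarrow> x * y \<in> R"
    and R_const: "\<iota> a \<in> R" for x y a
    using R(1) by (auto simp: subalgebra_def)
  have R_minus: "- x \<in> R" if "x \<in> R" for x
    using R_mult[OF R_const[of "- 1"] that] by (simp add: iota_minus)
  have R_01: "0 \<in> R" "1 \<in> R" using R_const[of 0] R_const[of 1] by simp_all
  have R_sum: "sum f A \<in> R" if "\<And>i. i \<in> A \<Longrightarrow> f i \<in> R" for f and A :: "nat set"
    using that by (induction A rule: infinite_finite_induct) (auto intro: R_add R_01)
  have R_pow: "x ^ n \<in> R" if "x \<in> R" for x n
    using that by (induction n) (auto intro: R_mult R_01)
  have wR: "w \<in> R" using S0 R by blast
  \<comment> \<open>\<open>1/w\<close> is a polynomial of degree at most \<open>n\<close> in \<open>z\<close> over \<open>R\<close>\<close>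
  define Q where "Q z n \<longleftrightarrow> (\<exists>c. (\<forall>i. c i \<in> R) \<and> w * (\<Sum>i\<le>n. c i * z ^ i) = 1)" for z and n :: nat
  have Q_mono: "Q z n'" if Qn: "Q z n" "n \<le> n'" for z n n'
  proof -
    obtain c where c: "\<forall>i. c i \<in> R" "w * (\<Sum>i\<le>n. c i * z ^ i) = 1" using Qn(1) Q_def by blast
    have "(\<Sum>i\<le>n'. (if i \<le> n then c i else 0) * z ^ i) = (\<Sum>i\<le>n. (if i \<le> n then c i else 0) * z ^ i)"
      using Qn(2) by (intro sum.mono_neutral_right) auto
    thus ?thesis unfolding Q_def using c R_01 by (intro exI[of _ "\<lambda>i. if i \<le> n then c i else 0"]) auto
  qed
  have Q_ex: "\<exists>n. Q z n" if "z \<notin> R" for z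
  proof -
    define T where "T = {poly p z | p. \<forall>i. coeff p i \<in> R}"
    have "subalgebra T"
      unfolding subalgebra_def
    proof (intro conjI ballI)
      show "range \<iota> \<subseteq> T"
      proof
        fix y assume "y \<in> range \<iota>"
        then obtain a where "y = \<iota> a" by blast
        thus "y \<in> T" unfolding T_def
          by (auto intro!: exI[of _ "[:\<iota> a:]"] simp: coeff_pCons R_const R_01 split: nat.splits)
      qed
      fix x y assume "x \<in> T" "y \<in> T"
      then obtain p r where pr: "x = poly p z" "\<forall>i. coeff p i \<in> R" "y = poly r z" "\<forall>i. coeff r i \<in> R"
        unfolding T_def by blast
      show "x + y \<in> T" unfolding T_def using pr by (auto intro!: exI[of _ "p + r"] R_add)
      show "x * y \<in> T" unfolding T_def using pr
        by (auto intro!: exI[of _ "p * r"] R_sum R_mult simp: coeff_mult)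
    qed
    moreover have "R \<subseteq> T"
    proof
      fix y assume "y \<in> R"
      thus "y \<in> T" unfolding T_def
        by (auto intro!: exI[of _ "[:y:]"] simp: coeff_pCons R_01 split: nat.splits)
    qed
    moreover have "z \<in> T" unfolding T_def
      by (auto intro!: exI[of _ "[:0, 1:]"] simp: coeff_pCons R_01 split: nat.splits)
    ultimately have "inverse w \<in> T" using max[of T] that by blast
    then obtain p where p: "inverse w = poly p z" "\<forall>i. coeff p i \<in> R" unfolding T_def by blast
    have "w * (\<Sum>i\<le>degree p. coeff p i * z ^ i) = 1"
      using p(1) w0 by (simp add: poly_altdef[symmetric] flip: p(1))
    thus ?thesis unfolding Q_def using p(2) by blast
  qed
  have Q_0: "\<not> Q z 0" for z
  proof
    assume "Q z 0"
    then obtain c :: "nat \<Rightarrow> 'f" where "\<forall>i. c i \<in> R" "w * c 0 = 1" by (auto simp: Q_def)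
    thus False using R(3) inverse_unique[of w "c 0"] by auto
  qed
  \<comment> \<open>a power of \<open>1 - w a\<close> is again of this form, so clearing denominators in the
    polynomial that expresses \<open>1/w\<close> by the inverse of \<open>1 - w a\<close> puts \<open>1/w\<close> into \<open>R\<close>\<close>
  have unit: "1 - w * a \<noteq> 0" "inverse (1 - w * a) \<in> R" if a: "a \<in> R" for a
  proof -
    show ne: "1 - w * a \<noteq> 0"
    proof
      assume "1 - w * a = 0"
      thus False using R(3) a inverse_unique[of w a] by simp
    qed
    show "inverse (1 - w * a) \<in> R"
    proof (rule ccontr)
      let ?u = "1 - w * a"
      assume "inverse ?u \<notin> R"
      then obtain n c where c: "\<forall>i. c i \<in> R" "w * (\<Sum>i\<le>n. c i * inverse ?u ^ i) = 1"
        using Q_ex Q_def by blast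
      have pow: "\<exists>b\<in>R. ?u ^ m = 1 - w * b" for m
      proof (induction m)
        case 0 show ?case using R_01 by (intro bexI[of _ 0]) auto
      next
        case (Suc m)
        then obtain b where b: "b \<in> R" "?u ^ m = 1 - w * b" by blast
        have "?u ^ Suc m = 1 - w * (b + a + - (w * a * b))" unfolding power_Suc b(2) by (simp add: algebra_simps)
        moreover have "b + a + - (w * a * b) \<in> R" using a b(1) wR by (intro R_add R_minus R_mult)
        ultimately show ?case by blast
      qed
      obtain b where b: "b \<in> R" "?u ^ n = 1 - w * b" using pow by blast
      have "c i * inverse ?u ^ i * ?u ^ n = c i * ?u ^ (n - i)" if "i \<le> n" for i
        using ne that by (simp add: power_diff power_inverse divide_inverse mult_ac)
      hence "w * (\<Sum>i\<le>n. c i * inverse ?u ^ i) * ?u ^ n = w * (\<Sum>i\<le>n. c i * ?u ^ (n - i))"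
        unfolding mult.assoc[of w] sum_distrib_right
        by (intro arg_cong[where f = "(*) w"] sum.cong) auto
      hence "1 - w * b = w * (\<Sum>i\<le>n. c i * ?u ^ (n - i))" by (simp only: c(2) b(2) mult_1_left)
      hence "w * ((\<Sum>i\<le>n. c i * ?u ^ (n - i)) + b) = 1" by (simp add: algebra_simps)
      moreover have "?u \<in> R" using R_add[OF R_01(2) R_minus[OF R_mult[OF wR a]]] by simp
      hence "(\<Sum>i\<le>n. c i * ?u ^ (n - i)) + b \<in> R"
        using c(1) b(1) by (intro R_add R_sum R_mult R_pow) auto
      ultimately show False using R(3) inverse_unique[of w "(\<Sum>i\<le>n. c i * ?u ^ (n - i)) + b"] by simp
    qed
  qed
  \<comment> \<open>the relation for \<open>1/z\<close>, multiplied by \<open>z ^ Suc n\<close>, expresses that power by lower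
    ones\<close>
  have step: "Q z n" if z: "z \<noteq> 0" and Qz: "Q z (Suc n)" "Q (inverse z) (Suc n)" for z n
  proof -
    obtain c where c: "\<forall>i. c i \<in> R" "w * (\<Sum>i\<le>Suc n. c i * z ^ i) = 1" using Qz(1) Q_def by blast
    obtain d where d: "\<forall>i. d i \<in> R" "w * (\<Sum>i\<le>Suc n. d i * inverse z ^ i) = 1" using Qz(2) Q_def by blast
    define u where "u = inverse (1 - w * d 0)"
    have u: "u \<in> R" "u * (1 - w * d 0) = 1" using unit[of "d 0"] d(1) by (auto simp: u_def)
    have "d i * inverse z ^ i * z ^ Suc n = d i * z ^ (Suc n - i)" if "i \<le> Suc n" for i
      using z that by (simp add: power_diff power_inverse divide_inverse mult_ac del: power_Suc)
    hence "w * (\<Sum>i\<le>Suc n. d i * inverse z ^ i) * z ^ Suc n = w * (\<Sum>i\<le>Suc n. d i * z ^ (Suc n - i))"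
      unfolding mult.assoc[of w] sum_distrib_right
      by (intro arg_cong[where f = "(*) w"] sum.cong) auto
    hence "z ^ Suc n = w * (\<Sum>i\<le>Suc n. d i * z ^ (Suc n - i))" by (simp only: d(2) mult_1_left)
    also have "(\<Sum>i\<le>Suc n. d i * z ^ (Suc n - i)) = d 0 * z ^ Suc n + (\<Sum>i\<le>n. d (Suc i) * z ^ (n - i))"
      by (subst sum.atMost_Suc_shift) simp
    also have "(\<Sum>i\<le>n. d (Suc i) * z ^ (n - i)) = (\<Sum>i\<le>n. d (Suc (n - i)) * z ^ i)"
      by (rule sum.reindex_bij_witness[of _ "\<lambda>i. n - i" "\<lambda>i. n - i"]) auto
    finally have zd: "z ^ Suc n * (1 - w * d 0) = w * (\<Sum>i\<le>n. d (Suc (n - i)) * z ^ i)"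
      by (simp add: algebra_simps del: power_Suc)
    have "z ^ Suc n = u * (z ^ Suc n * (1 - w * d 0))"
      by (subst mult.left_commute) (simp only: u(2) mult_1_right)
    hence zn: "z ^ Suc n = w * u * (\<Sum>i\<le>n. d (Suc (n - i)) * z ^ i)"
      unfolding zd by (simp only: mult_ac)
    let ?c = "\<lambda>i. c i + c (Suc n) * (w * u * d (Suc (n - i)))"
    have "(\<Sum>i\<le>n. ?c i * z ^ i) = (\<Sum>i\<le>n. c i * z ^ i) + c (Suc n) * z ^ Suc n"
      unfolding zn by (simp add: sum.distrib distrib_right sum_distrib_left mult.assoc del: power_Suc)
    hence "w * (\<Sum>i\<le>n. ?c i * z ^ i) = 1" using c(2) by simp
    moreover have "\<forall>i. ?c i \<in> R" using c(1) d(1) u(1) wR by (auto intro!: R_add R_mult)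
    ultimately show ?thesis unfolding Q_def by (intro exI[of _ ?c]) blast
  qed
  have total: "z \<in> R \<or> inverse z \<in> R" for z
  proof (rule ccontr)
    assume "\<not> ?thesis"
    hence n: "z \<notin> R" "inverse z \<notin> R" by auto
    hence z: "z \<noteq> 0" using R_01 by auto
    obtain m m' where "Q z m" "Q (inverse z) m'" using Q_ex n by blast
    hence ex: "\<exists>n. Q z n \<and> Q (inverse z) n" using Q_mono[of z m "m + m'"] Q_mono[of _ m' "m + m'"] by auto
    define n where "n = (LEAST n. Q z n \<and> Q (inverse z) n)"
    have Qn: "Q z n" "Q (inverse z) n" using LeastI_ex[OF ex] by (auto simp: n_def)
    then obtain n' where n': "n = Suc n'" using Q_0 by (cases n) auto
    have "Q z n' \<and> Q (inverse z) n'" using step[of z n'] step[of "inverse z" n'] z Qn n' by auto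
    hence "n \<le> n'" unfolding n_def by (rule Least_le)
    thus False using n' by simp
  qed
  interpret V: valuation_subring \<iota> R by unfold_locales (use R total in auto)
  have "w \<in> V.M" using wR w0 R(3) by (auto simp: V.M_def)
  from V.place_of_valuation_subring[OF this w0] show ?thesis using R(2) by blast
qed

end

section \<open>Weak approximation\<close>

context constant_field
begin

text \<open>
  If every function regular at \<open>v\<close> were regular at \<open>w\<close>, units at \<open>v\<close> would be units at \<open>w\<close>, so \<open>w\<close>
  would be a multiple of \<open>v\<close> and equal to it, as both are normalised. A quotient of functions
  obtained in this way for the two orders of the places separates them.
\<close>
lemma places_separate:
  assumes v: "v \<in> places \<iota>" and w: "w \<in> places \<iota>" and ne: "v \<noteq> w"
  shows "\<exists>z. 0 < v z \<and> w z < 0"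
proof -
  have ex: "\<exists>a. a \<noteq> 0 \<and> 0 \<le> v a \<and> w a < 0" if v: "v \<in> places \<iota>" and w: "w \<in> places \<iota>" and ne: "v \<noteq> w" for v w
  proof (rule ccontr)
    assume "\<not> ?thesis"
    hence *: "0 \<le> w a" if "a \<noteq> 0" "0 \<le> v a" for a using that by force
    have unit: "w a = 0" if "a \<noteq> 0" "v a = 0" for a
      using *[of a] *[of "inverse a"] that v w by simp
    obtain t where t: "v t = 1" using place_uniformizer[OF v] by blast
    have t0: "t \<noteq> 0" using t v by auto
    have vt: "v (t powi n) = n" "w (t powi n) = n * w t" for n
      using t v w by (auto simp: power_int_def simp flip: power_inverse)
    have w_eq: "w z = v z * w t" if z: "z \<noteq> 0" for z
    proof -
      have "w (z / t powi v z) = 0"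
        by (rule unit) (use z t0 v vt in \<open>auto simp: place_divide\<close>)
      thus ?thesis using z t0 w vt by (simp add: place_divide)
    qed
    obtain s where s: "w s = 1" using place_uniformizer[OF w] by blast
    hence "s \<noteq> 0" using w by auto
    hence "v s * w t = 1" using w_eq s by simp
    moreover have "0 \<le> w t" using *[OF t0] t by simp
    ultimately have "w t = 1" using zmult_eq_1_iff by force
    hence "v z = w z" for z using w_eq[of z] v w by (cases "z = 0") auto
    thus False using ne by blast
  qed
  obtain a b where ab: "a \<noteq> 0" "0 \<le> v a" "w a < 0" "b \<noteq> 0" "0 \<le> w b" "v b < 0"
    using ex[OF v w ne] ex[OF w v] ne by blast
  thus ?thesis using v w by (intro exI[of _ "a / b"]) (auto simp: place_divide)
qed

text \<open>
  If \<open>z\<close> works for the earlier places and \<open>y\<close> for the new one, \<open>z + y\<^sup>r\<close> works for all of them once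
  \<open>r\<close> is so large that the two summands have different orders at every place of the set.
\<close>
lemma places_separate_finite:
  assumes "finite S" "S \<subseteq> places \<iota>" and P: "P \<in> places \<iota>" "P \<notin> S"
  shows "\<exists>z. 0 < P z \<and> (\<forall>R\<in>S. R z < 0)"
  using assms(1,2) P(2)
proof (induction S rule: finite_induct)
  case empty
  obtain t where "P t = 1" using place_uniformizer[OF P(1)] by blast
  thus ?case by (intro exI[of _ t]) auto
next
  case (insert R S)
  obtain z where z: "0 < P z" "\<And>R. R \<in> S \<Longrightarrow> R z < 0" using insert by auto
  have R: "R \<in> places \<iota>" "P \<noteq> R" using insert by auto
  obtain y where y: "0 < P y" "R y < 0" using places_separate[OF P(1) R] by blast
  have z0: "z \<noteq> 0" "y \<noteq> 0" using z y P by auto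
  show ?case
  proof (cases "R z < 0")
    case False
    define b where "b = (\<Sum>T\<in>S. nat \<bar>T z\<bar>)"
    define r where "r = Suc b"
    have neg: "z + y ^ r \<noteq> 0 \<and> T (z + y ^ r) < 0" if T: "T \<in> insert R S" for T
    proof -
      have Tp: "T \<in> places \<iota>" using T insert.prems by auto
      have cmp: "T z \<noteq> int r * T y \<and> min (T z) (int r * T y) < 0"
      proof (cases "T = R")
        case True
        have "int r * R y < 0" by (rule mult_pos_neg) (use y(2) r_def in auto)
        thus ?thesis using False True by auto
      next
        case F: False
        hence TS: "T \<in> S" using T by simp
        hence "nat \<bar>T z\<bar> \<le> b" unfolding b_def by (intro member_le_sum) (use insert.hyps in auto)
        hence lt: "\<bar>T z\<bar> < int r" by (simp add: r_def)
        have "T z \<noteq> int r * T y"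
        proof
          assume eq: "T z = int r * T y"
          hence "T y \<noteq> 0" using z(2)[OF TS] by auto
          hence "1 \<le> \<bar>T y\<bar>" by simp
          hence "int r * 1 \<le> int r * \<bar>T y\<bar>" by (intro mult_left_mono) auto
          thus False using eq lt by (simp add: abs_mult)
        qed
        thus ?thesis using z(2)[OF TS] by (simp add: min_def)
      qed
      consider "T z < int r * T y" | "int r * T y < T z" using cmp by linarith
      thus ?thesis
      proof cases
        case 1
        thus ?thesis using place_add_eq[OF Tp, of z "y ^ r"] cmp z0 Tp by auto
      next
        case 2
        thus ?thesis using place_add_eq[OF Tp, of "y ^ r" z] cmp z0 Tp by (auto simp: add.commute)
      qed
    qed
    have "0 < int r * P y" by (rule mult_pos_pos) (use y(1) r_def in auto)
    hence "0 < P (y ^ r)" using P by simp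
    hence "0 < P (z + y ^ r)"
      using place_add_ge[OF P(1), of z "y ^ r"] z(1) z0 neg[of R] by auto
    thus ?thesis using neg by blast
  qed (use z in auto)
qed

text \<open>
  The function \<open>1/(1 + z\<^sup>r)\<close>, with \<open>z\<close> vanishing at \<open>P\<close> and having poles on \<open>S\<close>, is close to \<open>1\<close> at
  \<open>P\<close> and to \<open>0\<close> on \<open>S\<close>.
\<close>
lemma approx_indicator:
  assumes S: "finite S" "S \<subseteq> places \<iota>" and P: "P \<in> places \<iota>" "P \<notin> S"
  shows "\<exists>e. e - 1 \<in> val_ge P (int m) \<and> (\<forall>R\<in>S. e \<in> val_ge R (int m))"
proof -
  obtain z where z: "0 < P z" "\<And>R. R \<in> S \<Longrightarrow> R z < 0" using places_separate_finite[OF assms] by blast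
  define r where "r = Suc m"
  have z0: "z \<noteq> 0" using z(1) P by auto
  have Pz: "int r \<le> P (z ^ r)" using z(1) P mult_left_mono[of 1 "P z" "int r"] by simp
  have "z ^ r \<noteq> - 1"
  proof
    assume "z ^ r = - 1"
    hence "P (z ^ r) = 0" using P by simp
    thus False using Pz r_def by simp
  qed
  hence n0: "1 + z ^ r \<noteq> 0" by (simp add: add_eq_0_iff)
  define e where "e = inverse (1 + z ^ r)"
  have P1: "P (1 + z ^ r) = 0" using place_add_eq[OF P(1), of 1 "z ^ r"] Pz z0 P r_def by auto
  have "e - 1 = - (z ^ r / (1 + z ^ r))" using n0 by (simp add: e_def field_simps)
  moreover have "z ^ r / (1 + z ^ r) \<in> val_ge P (int m)"
    using P Pz P1 n0 z0 by (simp add: val_ge_def place_divide r_def)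
  ultimately have "e - 1 \<in> val_ge P (int m)" using P by simp
  moreover have "e \<in> val_ge R (int m)" if R: "R \<in> S" for R
  proof -
    have Rp: "R \<in> places \<iota>" using R S by auto
    have "int r * R z \<le> int r * (- 1)" using z(2)[OF R] by (intro mult_left_mono) auto
    moreover have Rz: "R (z ^ r) = int r * R z" using Rp by simp
    moreover have "int r * R z < 0" by (rule mult_pos_neg) (use z(2)[OF R] r_def in auto)
    moreover have "R e = - R (z ^ r + 1)" using Rp by (simp add: e_def add.commute)
    moreover have "R (z ^ r + 1) = R (z ^ r)"
      by (rule place_add_eq(2)[OF Rp]) (use z0 Rz \<open>int r * R z < 0\<close> Rp in auto)
    ultimately have "int m \<le> R e" by (simp add: r_def)
    thus ?thesis by (simp add: val_ge_def)
  qed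
  ultimately show ?thesis by blast
qed

theorem weak_approximation:
  assumes S: "finite S" "S \<subseteq> places \<iota>"
  shows "\<exists>z. \<forall>P\<in>S. z - y P \<in> val_ge P m"
proof -
  define b where "b = (\<Sum>R\<in>S. \<Sum>P\<in>S. nat \<bar>R (y P)\<bar>)"
  define N where "N = nat \<bar>m\<bar> + b"
  have N: "m - R (y P) \<le> int N" if "R \<in> S" "P \<in> S" for R P
  proof -
    have "nat \<bar>R (y P)\<bar> \<le> (\<Sum>P\<in>S. nat \<bar>R (y P)\<bar>)" by (rule member_le_sum) (use that S in auto)
    also have "\<dots> \<le> b" unfolding b_def
      by (rule member_le_sum[where f = "\<lambda>R. \<Sum>P\<in>S. nat \<bar>R (y P)\<bar>"]) (use that S in auto)
    finally show ?thesis by (simp add: N_def)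
  qed
  have "\<forall>P\<in>S. \<exists>e. e - 1 \<in> val_ge P (int N) \<and> (\<forall>R\<in>S - {P}. e \<in> val_ge R (int N))"
    using S by (intro ballI approx_indicator) auto
  then obtain e where e: "\<And>P. P \<in> S \<Longrightarrow> e P - 1 \<in> val_ge P (int N)"
    "\<And>P R. P \<in> S \<Longrightarrow> R \<in> S \<Longrightarrow> R \<noteq> P \<Longrightarrow> e P \<in> val_ge R (int N)" by (metis DiffI singletonD)
  have "(\<Sum>P\<in>S. y P * e P) - y R \<in> val_ge R m" if R: "R \<in> S" for R
  proof -
    have Rp: "R \<in> places \<iota>" using R S by auto
    have "(\<Sum>P\<in>S. y P * e P) - y R = y R * (e R - 1) + (\<Sum>P\<in>S - {R}. y P * e P)"
      using S R by (subst sum.remove[of S R]) (auto simp: algebra_simps)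
    also have "\<dots> \<in> val_ge R m"
    proof (intro val_ge_add[OF Rp] val_ge_sum[OF Rp])
      show "y R * (e R - 1) \<in> val_ge R m"
        by (rule val_ge_mult'[OF Rp val_ge_self[OF Rp] e(1)[OF R]]) (use N[OF R R] in simp)
      show "y P * e P \<in> val_ge R m" if "P \<in> S - {R}" for P
        by (rule val_ge_mult'[OF Rp val_ge_self[OF Rp] e(2)[of P R]]) (use N[OF R, of P] that R in auto)
    qed
    finally show ?thesis .
  qed
  thus ?thesis by blast
qed

end

section \<open>Residue fields\<close>

context constant_field
begin

text \<open>
  The constant term of a relation over \<open>k[z]\<close> is divisible by \<open>z\<close>, so it vanishes; dividing by \<open>z\<close>
  lowers the degree of the relation.
\<close>
lemma power_indep_mod:
  assumes P: "S \<subseteq> places \<iota>" and z: "z \<noteq> 0" "\<And>P. P \<in> S \<Longrightarrow> 0 < P z"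
    and u: "\<And>P i. P \<in> S \<Longrightarrow> i \<in> I \<Longrightarrow> u i \<in> val_ge P 0"
    and ind: "\<And>c. (\<And>P. P \<in> S \<Longrightarrow> (\<Sum>i\<in>I. \<iota> (c i) * u i) \<in> val_ge P (P z)) \<Longrightarrow> \<forall>i\<in>I. c i = 0"
  shows "power_indep z u I"
proof -
  have *: "\<forall>i\<in>I. \<forall>a\<le>n. c i a = 0" if "(\<Sum>a\<le>n. z ^ a * (\<Sum>i\<in>I. \<iota> (c i a) * u i)) = 0" for n :: nat and c
    using that
  proof (induction n arbitrary: c)
    case 0
    hence "\<forall>i\<in>I. c i 0 = 0" by (intro ind) simp
    thus ?case by simp
  next
    case (Suc n)
    let ?w = "\<lambda>a. \<Sum>i\<in>I. \<iota> (c i a) * u i"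
    have eq: "?w 0 + z * (\<Sum>a\<le>n. z ^ a * ?w (Suc a)) = 0"
      using Suc.prems by (subst (asm) sum.atMost_Suc_shift) (simp add: sum_distrib_left mult.assoc)
    have "\<forall>i\<in>I. c i 0 = 0"
    proof (rule ind)
      fix P assume PS: "P \<in> S"
      hence Pp: "P \<in> places \<iota>" and Pz: "0 < P z" using P z by auto
      have w: "?w a \<in> val_ge P 0" for a
        using u[OF PS] by (intro val_ge_sum[OF Pp] val_ge_iota_mult[OF Pp])
      have za: "z ^ a \<in> val_ge P 0" for a using Pz Pp by (simp add: val_ge_def)
      have "(\<Sum>a\<le>n. z ^ a * ?w (Suc a)) \<in> val_ge P 0"
        by (rule val_ge_sum[OF Pp], rule val_ge_mult'[OF Pp za w]) simp
      hence "z * (\<Sum>a\<le>n. z ^ a * ?w (Suc a)) \<in> val_ge P (P z)"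
        by (rule val_ge_mult'[OF Pp val_ge_self[OF Pp]]) simp
      moreover have "?w 0 = - (z * (\<Sum>a\<le>n. z ^ a * ?w (Suc a)))"
        using eq by (simp add: eq_neg_iff_add_eq_0)
      ultimately show "?w 0 \<in> val_ge P (P z)" by (simp only: val_ge_minus[OF Pp])
    qed
    hence "?w 0 = 0" by simp
    hence "(\<Sum>a\<le>n. z ^ a * ?w (Suc a)) = 0" using eq z(1) by simp
    from Suc.IH[of "\<lambda>i a. c i (Suc a)", OF this] \<open>\<forall>i\<in>I. c i 0 = 0\<close>
    show ?case by (metis Suc_le_mono not0_implies_Suc)
  qed
  show ?thesis
    unfolding power_indep_def
  proof (intro allI impI)
    fix n :: nat and c assume "(\<Sum>i\<in>I. \<Sum>a\<le>n. \<iota> (c i a) * (z ^ a * u i)) = 0"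
    hence "(\<Sum>a\<le>n. z ^ a * (\<Sum>i\<in>I. \<iota> (c i a) * u i)) = 0"
      by (subst (asm) sum.swap) (simp add: sum_distrib_left mult_ac)
    thus "\<forall>i\<in>I. \<forall>a\<le>n. c i a = 0" by (rule *)
  qed
qed

lemma local_param:
  assumes "P \<in> places \<iota>"
  shows "P (local_param P) = 1" "local_param P \<noteq> 0"
proof -
  show 1: "P (local_param P) = 1" unfolding local_param_def
    by (rule someI_ex) (rule place_uniformizer[OF assms])
  show "local_param P \<noteq> 0" using 1 assms by auto
qed

lemma place_powi [simp]: "P \<in> places \<iota> \<Longrightarrow> P (local_param P powi n) = n"
  by (auto simp: power_int_def local_param simp flip: power_inverse)

end

context function_field
begin

text \<open>
  Representatives that are independent modulo the maximal ideal are independent over the polynomials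
  in a local parameter, so their number is bounded and a largest set of them is a basis.
\<close>
lemma residue_basis_exists:
  assumes P: "P \<in> places \<iota>"
  shows "\<exists>B. residue_basis \<iota> P B"
proof -
  define ind where "ind B \<longleftrightarrow> finite B \<and> B \<subseteq> val_ge P 0 \<and>
    (\<forall>c. (\<Sum>b\<in>B. \<iota> (c b) * b) \<in> val_ge P 1 \<longrightarrow> (\<forall>b\<in>B. c b = 0))" for B
  let ?t = "local_param P"
  obtain N where N: "\<And>u (I :: 'f set). finite I \<Longrightarrow> power_indep ?t u I \<Longrightarrow> card I \<le> N"
    using power_indep_bound[of ?t] by metis
  have bound: "card B \<le> N" if "ind B" for B
  proof (rule N)
    show "power_indep ?t id B"
      by (rule power_indep_mod[of "{P}"]) (use that P in \<open>auto simp: ind_def local_param\<close>)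
  qed (use that in \<open>simp add: ind_def\<close>)
  have "ind {}" by (simp add: ind_def)
  then obtain B where B: "ind B" and max: "\<And>B'. ind B' \<Longrightarrow> card B' \<le> card B"
    using ex_has_greatest_nat[of ind "{}" card "Suc N"] bound by (auto simp: less_Suc_eq_le)
  have fB: "finite B" "B \<subseteq> val_ge P 0" using B by (auto simp: ind_def)
  have uniq: "c = d" if "\<forall>b. b \<notin> B \<longrightarrow> c b = 0" "\<forall>b. b \<notin> B \<longrightarrow> d b = 0"
    "x - (\<Sum>b\<in>B. \<iota> (c b) * b) \<in> val_ge P 1" "x - (\<Sum>b\<in>B. \<iota> (d b) * b) \<in> val_ge P 1" for c d x
  proof -
    have "(\<Sum>b\<in>B. \<iota> (d b - c b) * b) \<in> val_ge P 1"
      using val_ge_diff[OF P that(3,4)] by (simp add: iota_diff sum_subtractf left_diff_distrib)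
    hence "\<forall>b\<in>B. d b - c b = 0" using B by (auto simp: ind_def)
    thus ?thesis using that(1,2) by (intro ext) (metis right_minus_eq)
  qed
  have ex: "\<exists>c. (\<forall>b. b \<notin> B \<longrightarrow> c b = 0) \<and> x - (\<Sum>b\<in>B. \<iota> (c b) * b) \<in> val_ge P 1"
    if x: "x \<in> val_ge P 0" for x
  proof (rule ccontr)
    assume none: "\<not> ?thesis"
    have none': "x - (\<Sum>b\<in>B. \<iota> (c b) * b) \<notin> val_ge P 1" for c
    proof
      assume *: "x - (\<Sum>b\<in>B. \<iota> (c b) * b) \<in> val_ge P 1"
      have "(\<Sum>b\<in>B. \<iota> (if b \<in> B then c b else 0) * b) = (\<Sum>b\<in>B. \<iota> (c b) * b)"
        by (rule sum.cong) auto
      thus False using none * by (auto dest: spec[of _ "\<lambda>b. if b \<in> B then c b else 0"])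
    qed
    have xB: "x \<notin> B"
    proof
      assume "x \<in> B"
      hence "(\<Sum>b\<in>B. \<iota> (if b = x then 1 else 0) * b) = x"
        using fB by (simp add: if_distrib[of \<iota>] if_distrib[where f = "\<lambda>y. y * _"] cong: if_cong)
      thus False using none'[of "\<lambda>b. if b = x then 1 else 0"] by simp
    qed
    have "ind (insert x B)"
      unfolding ind_def
    proof (intro conjI allI impI)
      fix c assume c: "(\<Sum>b\<in>insert x B. \<iota> (c b) * b) \<in> val_ge P 1"
      hence c': "\<iota> (c x) * x + (\<Sum>b\<in>B. \<iota> (c b) * b) \<in> val_ge P 1" using fB xB by simp
      have cx: "c x = 0"
      proof (rule ccontr)
        assume n: "c x \<noteq> 0"
        have "\<iota> (inverse (c x)) * (\<iota> (c x) * x + (\<Sum>b\<in>B. \<iota> (c b) * b)) \<in> val_ge P 1"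
          using c' P by (intro val_ge_iota_mult)
        also have "\<iota> (inverse (c x)) * (\<iota> (c x) * x + (\<Sum>b\<in>B. \<iota> (c b) * b)) =
            x - (\<Sum>b\<in>B. \<iota> (- (inverse (c x) * c b)) * b)"
          using n by (simp add: iota_minus iota_mult iota_inverse distrib_left sum_distrib_left sum_negf mult.assoc)
        finally show False using none'[of "\<lambda>b. - (inverse (c x) * c b)"] by contradiction
      qed
      hence "\<forall>b\<in>B. c b = 0" using c' B by (simp add: ind_def)
      thus "\<forall>b\<in>insert x B. c b = 0" using cx by blast
    qed (use fB x in auto)
    from max[OF this] show False using fB xB by simp
  qed
  have "residue_basis \<iota> P B"
    unfolding residue_basis_def local_ring_eq max_ideal_eq
    using fB ex uniq by (intro conjI ballI ex_ex1I) blast+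
  thus ?thesis by blast
qed

definition rbasis :: "'f place \<Rightarrow> 'f set" where
  "rbasis P = (SOME B. residue_basis \<iota> P B)"

lemma rbasis:
  assumes "P \<in> places \<iota>"
  shows "finite (rbasis P)" "rbasis P \<subseteq> val_ge P 0" "card (rbasis P) = place_degree \<iota> P"
    "x \<in> val_ge P 0 \<Longrightarrow> \<exists>!c. (\<forall>b. b \<notin> rbasis P \<longrightarrow> c b = 0) \<and> x - (\<Sum>b\<in>rbasis P. \<iota> (c b) * b) \<in> val_ge P 1"
proof -
  have "residue_basis \<iota> P (rbasis P)"
    unfolding rbasis_def by (rule someI_ex[OF residue_basis_exists[OF assms]])
  thus "finite (rbasis P)" "rbasis P \<subseteq> val_ge P 0"
    "x \<in> val_ge P 0 \<Longrightarrow> \<exists>!c. (\<forall>b. b \<notin> rbasis P \<longrightarrow> c b = 0) \<and> x - (\<Sum>b\<in>rbasis P. \<iota> (c b) * b) \<in> val_ge P 1"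
    by (auto simp: residue_basis_def local_ring_eq max_ideal_eq)
  show "card (rbasis P) = place_degree \<iota> P" by (simp add: rbasis_def place_degree_def)
qed

definition coord :: "'f place \<Rightarrow> 'f \<Rightarrow> 'f \<Rightarrow> 'k" where
  "coord P x = (THE c. (\<forall>b. b \<notin> rbasis P \<longrightarrow> c b = 0) \<and> x - (\<Sum>b\<in>rbasis P. \<iota> (c b) * b) \<in> val_ge P 1)"

definition lift :: "'f place \<Rightarrow> ('f \<Rightarrow> 'k) \<Rightarrow> 'f" where
  "lift P c = (\<Sum>b\<in>rbasis P. \<iota> (c b) * b)"

context
  fixes P assumes P: "P \<in> places \<iota>"
begin

lemma coord:
  assumes "x \<in> val_ge P 0"
  shows "b \<notin> rbasis P \<Longrightarrow> coord P x b = 0" "x - lift P (coord P x) \<in> val_ge P 1"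
  using theI'[OF rbasis(4)[OF P assms]] unfolding coord_def lift_def by auto

lemma coord_eqI:
  assumes "x \<in> val_ge P 0" "\<And>b. b \<notin> rbasis P \<Longrightarrow> c b = 0" "x - lift P c \<in> val_ge P 1"
  shows "coord P x = c"
  unfolding coord_def using assms by (intro the1_equality[OF rbasis(4)[OF P]]) (auto simp: lift_def)

lemma lift_in: "lift P c \<in> val_ge P 0"
  unfolding lift_def using rbasis(2)[OF P] by (intro val_ge_sum[OF P] val_ge_iota_mult[OF P]) auto

lemma lift_diff: "lift P (c - d) = lift P c - lift P d"
  by (simp add: lift_def iota_diff left_diff_distrib sum_subtractf)

lemma coord_diff:
  assumes "x \<in> val_ge P 0" "y \<in> val_ge P 0"
  shows "coord P (x - y) = coord P x - coord P y"
proof (rule coord_eqI)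
  have "(x - lift P (coord P x)) - (y - lift P (coord P y)) \<in> val_ge P 1"
    by (rule val_ge_diff[OF P coord(2)[OF assms(1)] coord(2)[OF assms(2)]])
  thus "x - y - lift P (coord P x - coord P y) \<in> val_ge P 1" by (simp add: lift_diff algebra_simps)
qed (use assms val_ge_diff[OF P] coord(1) in auto)

lemma coord_eq_0_iff:
  assumes "x \<in> val_ge P 0"
  shows "coord P x = 0 \<longleftrightarrow> x \<in> val_ge P 1"
proof
  assume "coord P x = 0"
  thus "x \<in> val_ge P 1" using coord(2)[OF assms] by (simp add: lift_def)
next
  assume "x \<in> val_ge P 1"
  thus "coord P x = 0" using assms by (intro coord_eqI) (auto simp: lift_def)
qed

lemma coord_range:
  assumes "U \<subseteq> val_ge P 0"
  shows "finite (coord P ` U)" "card (coord P ` U) \<le> q ^ place_degree \<iota> P"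
proof -
  let ?E = "PiE (rbasis P) (\<lambda>_. UNIV :: 'k set)"
  have inj: "inj_on (\<lambda>c. restrict c (rbasis P)) (coord P ` U)"
  proof (rule inj_onI)
    fix c d assume c: "c \<in> coord P ` U" and d: "d \<in> coord P ` U"
      and eq: "restrict c (rbasis P) = restrict d (rbasis P)"
    obtain x y where xy: "c = coord P x" "x \<in> val_ge P 0" "d = coord P y" "y \<in> val_ge P 0"
      using c d assms by blast
    show "c = d"
    proof
      fix b show "c b = d b"
        using coord(1)[OF xy(2), of b] coord(1)[OF xy(4), of b] xy(1,3) fun_cong[OF eq, of b]
        by (cases "b \<in> rbasis P") auto
    qed
  qed
  have sub: "(\<lambda>c. restrict c (rbasis P)) ` (coord P ` U) \<subseteq> ?E" by auto
  have fE: "finite ?E" using rbasis(1)[OF P] by (intro finite_PiE) auto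
  show "finite (coord P ` U)" by (rule inj_on_finite[OF inj sub fE])
  have "card (coord P ` U) \<le> card ?E" by (rule card_inj_on_le[OF inj sub fE])
  thus "card (coord P ` U) \<le> q ^ place_degree \<iota> P"
    using rbasis(1,3)[OF P] by (simp add: card_PiE card_k)
qed

text \<open>The leading coefficient of order \<open>n\<close> at \<open>P\<close>, in coordinates of the residue field.\<close>
definition lead :: "int \<Rightarrow> 'f \<Rightarrow> 'f \<Rightarrow> 'k" where
  "lead n x = coord P (x * local_param P powi (- n))"

lemma shift_in: "x \<in> val_ge P n \<longleftrightarrow> x * local_param P powi (- m) \<in> val_ge P (n - m)"
  using val_ge_mult_iff[OF P, of "local_param P powi (- m)" x "n - m"] local_param[OF P] P
  by (simp add: mult.commute)

lemma lead_diff: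
  assumes "x \<in> val_ge P n" "y \<in> val_ge P n"
  shows "lead n (x - y) = lead n x - lead n y"
  using assms shift_in[of _ n n] by (simp add: lead_def left_diff_distrib coord_diff)

lemma lead_eq_0_iff: "x \<in> val_ge P n \<Longrightarrow> lead n x = 0 \<longleftrightarrow> x \<in> val_ge P (n + 1)"
  using shift_in[of x n n] shift_in[of x "n + 1" n] by (simp add: lead_def coord_eq_0_iff)

lemma lead_range:
  assumes "U \<subseteq> val_ge P n"
  shows "finite (lead n ` U)" "card (lead n ` U) \<le> q ^ place_degree \<iota> P"
proof -
  let ?V = "(\<lambda>x. x * local_param P powi (- n)) ` U"
  have V: "?V \<subseteq> val_ge P 0" using shift_in[of _ n n] assms by auto
  have "lead n ` U = coord P ` ?V" by (auto simp: lead_def image_image)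
  thus "finite (lead n ` U)" "card (lead n ` U) \<le> q ^ place_degree \<iota> P" using coord_range[OF V] by auto
qed

end

lemma place_degree_pos:
  assumes P: "P \<in> places \<iota>" shows "0 < place_degree \<iota> P"
proof (rule ccontr)
  assume "\<not> ?thesis"
  hence "rbasis P = {}" using rbasis(1,3)[OF P] by auto
  hence "1 \<in> val_ge P 1" using coord(2)[OF P, of 1] P by (simp add: lift_def)
  thus False using P by (simp add: val_ge_def)
qed

text \<open>
  This is the inequality \<open>\<Sum>v\<^sub>P(z) deg P \<le> [F : k(z)]\<close> of the theory of extensions of valuations. The
  index \<open>(P, l, b)\<close> stands for a function that is close to \<open>t\<^sup>l b\<close> at \<open>P\<close>, where \<open>t\<close> is a local
  parameter and \<open>b\<close> an element of the residue basis, and close to \<open>0\<close> at the other places. These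
  functions are independent modulo \<open>z\<close> by comparison of expansions at \<open>P\<close> up to order \<open>v\<^sub>P(z)\<close>.
\<close>
theorem power_indep_zeros:
  assumes S: "finite S" "S \<subseteq> places \<iota>" and z: "z \<noteq> 0" "\<And>P. P \<in> S \<Longrightarrow> 0 < P z"
  obtains I :: "('f place \<times> nat \<times> 'f) set" and u
  where "finite I" "int (card I) = (\<Sum>P\<in>S. P z * int (place_degree \<iota> P))" "power_indep z u I"
proof -
  define e where "e P = nat (P z)" for P :: "'f place"
  have e: "P z = int (e P)" if "P \<in> S" for P using z(2)[OF that] by (simp add: e_def)
  define I where "I = Sigma S (\<lambda>P. {..<e P} \<times> rbasis P)"
  have Sp: "\<And>P. P \<in> S \<Longrightarrow> P \<in> places \<iota>" using S by auto
  have fI: "finite I" unfolding I_def using S rbasis(1)[OF Sp] by auto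
  have cI: "int (card I) = (\<Sum>P\<in>S. P z * int (place_degree \<iota> P))"
    unfolding I_def using S rbasis(1,3)[OF Sp] e
    by (subst card_SigmaI) (auto simp: card_cartesian_product)
  define m where "m = Max (insert 0 (e ` S))"
  have m: "e P \<le> m" if "P \<in> S" for P unfolding m_def using S that by (intro Max_ge) auto
  define y where "y i R = (case i of (P, l, b) \<Rightarrow> if R = P then local_param P ^ l * b else 0)"
    for i :: "'f place \<times> nat \<times> 'f" and R :: "'f place"
  have "\<forall>i. \<exists>x. \<forall>R\<in>S. x - y i R \<in> val_ge R (int m)"
    using weak_approximation[OF S] by blast
  then obtain u where u: "\<And>i R. R \<in> S \<Longrightarrow> u i - y i R \<in> val_ge R (int m)" by metis
  have u': "u i - y i R \<in> val_ge R (R z)" if "R \<in> S" for i R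
    using u[OF that, of i] by (rule val_ge_mono[rotated]) (use m[OF that] e[OF that] in simp)
  have y_in: "y i R \<in> val_ge R 0" if iR: "i \<in> I" "R \<in> S" for i R
  proof -
    obtain P l b where i: "i = (P, l, b)" "P \<in> S" "b \<in> rbasis P" using iR(1) by (cases i) (auto simp: I_def)
    have "local_param P \<in> val_ge P 0" using local_param[OF Sp[OF i(2)]] by (simp add: val_ge_def)
    hence "local_param P ^ l * b \<in> val_ge P 0"
      using rbasis(2)[OF Sp[OF i(2)]] i(3) Sp[OF i(2)]
      by (intro val_ge_mult'[of P _ 0 _ 0] val_ge_power) auto
    thus ?thesis by (simp add: y_def i)
  qed
  have "power_indep z u I"
  proof (rule power_indep_mod[where S = S])
    show "S \<subseteq> places \<iota>" "z \<noteq> 0" by fact+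
    show "0 < P z" if "P \<in> S" for P using that by (rule z(2))
    fix P i assume PS: "P \<in> S" and i: "i \<in> I"
    have "(u i - y i P) + y i P \<in> val_ge P 0"
      by (rule val_ge_add[OF Sp[OF PS] val_ge_mono[OF _ u[OF PS]] y_in[OF i PS]]) simp
    thus "u i \<in> val_ge P 0" by simp
  next
    fix c assume c: "\<And>P. P \<in> S \<Longrightarrow> (\<Sum>i\<in>I. \<iota> (c i) * u i) \<in> val_ge P (P z)"
    have "c (P, l, b) = 0" if PS: "P \<in> S" and lb: "l < e P" "b \<in> rbasis P" for P l b
    proof -
      note Pp = Sp[OF PS]
      define t where "t = local_param P"
      have t: "P t = 1" "t \<noteq> 0" using local_param[OF Pp] by (auto simp: t_def)
      define w where "w l = lift P (\<lambda>b. if b \<in> rbasis P then c (P, l, b) else 0)" for l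
      have "(\<Sum>i\<in>I. \<iota> (c i) * u i) - (\<Sum>i\<in>I. \<iota> (c i) * (u i - y i P)) \<in> val_ge P (P z)"
        by (rule val_ge_diff[OF Pp c[OF PS]], rule val_ge_sum[OF Pp], rule val_ge_iota_mult[OF Pp u'[OF PS]])
      also have "(\<Sum>i\<in>I. \<iota> (c i) * u i) - (\<Sum>i\<in>I. \<iota> (c i) * (u i - y i P)) = (\<Sum>i\<in>I. \<iota> (c i) * y i P)"
        by (simp add: sum_subtractf[symmetric] algebra_simps)
      also have "\<dots> = (\<Sum>R\<in>S. \<Sum>l<e R. \<Sum>b\<in>rbasis R. \<iota> (c (R, l, b)) * y (R, l, b) P)"
        unfolding I_def using S rbasis(1)[OF Sp] by (simp add: sum.Sigma split_def)
      also have "\<dots> = (\<Sum>R\<in>S. if R = P then \<Sum>l<e P. t ^ l * w l else 0)"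
      proof (rule sum.cong[OF refl])
        fix R assume "R \<in> S"
        show "(\<Sum>l<e R. \<Sum>b\<in>rbasis R. \<iota> (c (R, l, b)) * y (R, l, b) P) =
            (if R = P then \<Sum>l<e P. t ^ l * w l else 0)"
          by (auto simp: y_def w_def lift_def t_def sum_distrib_left mult_ac intro!: sum.cong)
      qed
      also have "\<dots> = (\<Sum>l<e P. t ^ l * w l)" using S PS by simp
      finally have sum_in: "(\<Sum>l<e P. t ^ l * w l) \<in> val_ge P (int (e P))" using e[OF PS] by simp
      have w_in: "w l \<in> val_ge P 0" for l unfolding w_def by (rule lift_in[OF Pp])
      have w0: "c (P, l, b) = 0" if "w l \<in> val_ge P 1" "b \<in> rbasis P" for l b
      proof -
        have "coord P (w l) = 0" using coord_eq_0_iff[OF Pp w_in] that(1) by simp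
        moreover have "coord P (w l) = (\<lambda>b. if b \<in> rbasis P then c (P, l, b) else 0)"
          by (rule coord_eqI[OF Pp w_in]) (auto simp: w_def)
        ultimately show ?thesis using fun_cong[of _ _ b] that(2) by fastforce
      qed
      \<comment> \<open>the coefficients vanish one after the other, starting with the lowest power of
        \<open>t\<close>\<close>
      have w_M: "(\<Sum>l<n. t ^ l * w (k + l)) \<in> val_ge P (int n) \<Longrightarrow> k \<le> l' \<Longrightarrow> l' < k + n \<Longrightarrow>
          w l' \<in> val_ge P 1" for n k l'
      proof (induction n arbitrary: k)
        case (Suc n)
        let ?r = "\<Sum>l<n. t ^ l * w (Suc k + l)"
        have eq: "(\<Sum>l<Suc n. t ^ l * w (k + l)) = w k + t * ?r"
          by (subst sum.lessThan_Suc_shift) (simp add: sum_distrib_left mult.assoc)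
        have tl: "t ^ l \<in> val_ge P 0" for l using t(1) Pp by (simp add: val_ge_def)
        have r_in: "?r \<in> val_ge P 0"
          by (rule val_ge_sum[OF Pp], rule val_ge_mult'[OF Pp tl w_in]) simp
        have "t * ?r \<in> val_ge P 1"
          by (rule val_ge_mult'[OF Pp val_ge_self[OF Pp] r_in]) (use t(1) in simp)
        moreover have "w k + t * ?r \<in> val_ge P 1" using Suc.prems(1) unfolding eq by (rule val_ge_mono[rotated]) simp
        ultimately have "(w k + t * ?r) - t * ?r \<in> val_ge P 1" by (intro val_ge_diff[OF Pp])
        hence wk: "w k \<in> val_ge P 1" by simp
        hence "w k = 0" using w0[OF wk] by (auto simp: w_def lift_def intro!: sum.neutral)
        hence "?r \<in> val_ge P (int n)" using Suc.prems(1) unfolding eq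
          using val_ge_mult_iff[OF Pp t(2), of ?r] t(1) by simp
        from Suc.IH[of "Suc k", OF this] wk show ?case
          using Suc.prems by (cases "l' = k") auto
      qed simp
      have "w l \<in> val_ge P 1" by (rule w_M[of 0 "e P" l]) (use sum_in lb in simp_all)
      thus ?thesis using w0 lb by blast
    qed
    thus "\<forall>i\<in>I. c i = 0" by (auto simp: I_def)
  qed
  thus thesis using that fI cI by blast
qed

end

section \<open>Divisors and their spaces of functions\<close>

context constant_field
begin

lemma divisorsI: "finite S \<Longrightarrow> S \<subseteq> places \<iota> \<Longrightarrow> (\<And>P. P \<notin> S \<Longrightarrow> G P = 0) \<Longrightarrow> G \<in> divisors \<iota>"
  unfolding divisors_def supp_def by (auto intro: finite_subset[of _ S])

lemma divisor_outside: "G \<in> divisors \<iota> \<Longrightarrow> P \<notin> places \<iota> \<Longrightarrow> G P = 0"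
  by (auto simp: divisors_def supp_def)

lemma divisor_finite: "G \<in> divisors \<iota> \<Longrightarrow> finite {P. G P \<noteq> 0}"
  by (simp add: divisors_def supp_def)

lemma divisor_combine:
  assumes "G \<in> divisors \<iota>" "H \<in> divisors \<iota>" "f 0 0 = 0"
  shows "(\<lambda>P. f (G P) (H P)) \<in> divisors \<iota>"
proof (rule divisorsI)
  show "finite ({P. G P \<noteq> 0} \<union> {P. H P \<noteq> 0})" using assms divisor_finite by blast
  show "{P. G P \<noteq> 0} \<union> {P. H P \<noteq> 0} \<subseteq> places \<iota>" using assms divisor_outside by blast
qed (use assms(3) in auto)

lemma divisor_add [intro, simp]: "G \<in> divisors \<iota> \<Longrightarrow> H \<in> divisors \<iota> \<Longrightarrow> G + H \<in> divisors \<iota>"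
  unfolding plus_fun_def by (rule divisor_combine) auto

lemma divisor_diff [intro, simp]: "G \<in> divisors \<iota> \<Longrightarrow> H \<in> divisors \<iota> \<Longrightarrow> G - H \<in> divisors \<iota>"
  unfolding fun_diff_def by (rule divisor_combine) auto

lemma divisor_0 [intro, simp]: "0 \<in> divisors \<iota>"
  by (rule divisorsI[of "{}"]) auto

lemma divisor_minus [intro, simp]: "G \<in> divisors \<iota> \<Longrightarrow> - G \<in> divisors \<iota>"
  using divisor_diff[of 0 G] by simp

lemma divisor_max [intro, simp]:
  "G \<in> divisors \<iota> \<Longrightarrow> H \<in> divisors \<iota> \<Longrightarrow> (\<lambda>P. max (G P) (H P)) \<in> divisors \<iota>"
  by (rule divisor_combine) auto

lemma divisor_mult [intro, simp]: "G \<in> divisors \<iota> \<Longrightarrow> (\<lambda>P. n * G P) \<in> divisors \<iota>"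
  using divisor_combine[of G G "\<lambda>a b. n * a"] by simp

lemma prime_divisor_apply: "prime_divisor P R = (if R = P then 1 else 0)"
  by (simp add: prime_divisor_def)

lemma divisor_prime [intro, simp]: "P \<in> places \<iota> \<Longrightarrow> prime_divisor P \<in> divisors \<iota>"
  by (rule divisorsI[of "{P}"]) (auto simp: prime_divisor_apply)

abbreviation deg :: "'f divisor \<Rightarrow> int" where "deg \<equiv> div_degree \<iota>"

lemma deg_eq:
  assumes "finite S" "{P. G P \<noteq> 0} \<subseteq> S"
  shows "deg G = (\<Sum>P\<in>S. G P * int (place_degree \<iota> P))"
  unfolding div_degree_def supp_def using assms by (intro sum.mono_neutral_left) auto

lemma deg_combine:
  assumes "G \<in> divisors \<iota>" "H \<in> divisors \<iota>"
  shows "deg (G + H) = deg G + deg H" "deg (G - H) = deg G - deg H"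
proof -
  let ?S = "{P. G P \<noteq> 0} \<union> {P. H P \<noteq> 0}"
  have S: "finite ?S" using assms divisor_finite by blast
  have "deg G = (\<Sum>P\<in>?S. G P * int (place_degree \<iota> P))"
    "deg H = (\<Sum>P\<in>?S. H P * int (place_degree \<iota> P))"
    "deg (G + H) = (\<Sum>P\<in>?S. (G + H) P * int (place_degree \<iota> P))"
    "deg (G - H) = (\<Sum>P\<in>?S. (G - H) P * int (place_degree \<iota> P))"
    by (rule deg_eq[OF S], force)+
  thus "deg (G + H) = deg G + deg H" "deg (G - H) = deg G - deg H"
    by (simp_all add: distrib_right left_diff_distrib sum.distrib sum_subtractf)
qed

lemmas deg_add = deg_combine(1) and deg_diff = deg_combine(2)

lemma deg_0 [simp]: "deg 0 = 0" by (simp add: div_degree_def supp_def)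

lemma deg_mult: "G \<in> divisors \<iota> \<Longrightarrow> deg (\<lambda>P. n * G P) = n * deg G"
  using deg_eq[OF divisor_finite order.refl, of G] deg_eq[of "{P. G P \<noteq> 0}" "\<lambda>P. n * G P"] divisor_finite[of G]
  by (auto simp: sum_distrib_left mult.assoc)

lemma deg_prime [simp]: "deg (prime_divisor P) = int (place_degree \<iota> P)"
  using deg_eq[of "{P}" "prime_divisor P"] by (auto simp: prime_divisor_apply)

lemma deg_nonneg: "(\<And>P. 0 \<le> G P) \<Longrightarrow> 0 \<le> deg G"
  unfolding div_degree_def by (intro sum_nonneg) auto

lemma deg_mono: "G \<in> divisors \<iota> \<Longrightarrow> H \<in> divisors \<iota> \<Longrightarrow> G \<le> H \<Longrightarrow> deg G \<le> deg H"
  using deg_nonneg[of "H - G"] deg_diff[of H G] by (simp add: le_fun_def)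

lemma effective_induct [consumes 2, case_names zero add]:
  assumes "E \<in> divisors \<iota>" "0 \<le> E"
    and zero: "Pr 0"
    and add: "\<And>E P. E \<in> divisors \<iota> \<Longrightarrow> 0 \<le> E \<Longrightarrow> P \<in> places \<iota> \<Longrightarrow> Pr E \<Longrightarrow> Pr (E + prime_divisor P)"
  shows "Pr E"
  using assms(1,2)
proof (induction "\<Sum>P\<in>{P. E P \<noteq> 0}. nat (E P)" arbitrary: E rule: less_induct)
  case less
  have nn: "0 \<le> E P" for P using less.prems by (simp add: le_fun_def)
  have fin: "finite {P. E P \<noteq> 0}" using less.prems divisor_finite by blast
  show ?case
  proof (cases "E = 0")
    case False
    then obtain P where P: "E P \<noteq> 0" by (metis ext zero_fun_apply)
    hence Pp: "P \<in> places \<iota>" using divisor_outside less.prems by blast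
    have EP: "0 < E P" using P nn[of P] by simp
    let ?E = "E - prime_divisor P"
    have E: "?E \<in> divisors \<iota>" "0 \<le> ?E" using less.prems Pp nn EP
      by (auto simp: le_fun_def prime_divisor_apply)
    have "(\<Sum>P\<in>{P. ?E P \<noteq> 0}. nat (?E P)) \<le> (\<Sum>R\<in>{P. E P \<noteq> 0}. nat (?E R))"
      by (rule sum_mono2) (use fin P in \<open>auto simp: prime_divisor_apply split: if_splits\<close>)
    also have "\<dots> < (\<Sum>R\<in>{P. E P \<noteq> 0}. nat (E R))"
    proof (rule sum_strict_mono_ex1[OF fin])
      show "\<exists>a\<in>{P. E P \<noteq> 0}. nat (?E a) < nat (E a)"
        using P EP by (intro bexI[of _ P]) (auto simp: prime_divisor_apply)
    qed (auto simp: prime_divisor_apply)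
    finally have "Pr ?E" using less.hyps E by blast
    from add[OF E Pp this] show ?thesis by simp
  qed (use zero in simp)
qed

lemma rr_space_iff:
  assumes "G \<in> divisors \<iota>"
  shows "h \<in> rr_space \<iota> G \<longleftrightarrow> (\<forall>P\<in>places \<iota>. h \<in> val_ge P (- G P))"
proof -
  have "0 \<le> (fun_div \<iota> h + G) P \<longleftrightarrow> (P \<in> places \<iota> \<longrightarrow> - G P \<le> P h)" for P
    using divisor_outside[OF assms] by (auto simp: fun_div_def)
  thus ?thesis by (cases "h = 0") (auto simp: rr_space_def val_ge_def)
qed

lemma rr_space_subspace: "G \<in> divisors \<iota> \<Longrightarrow> k.subspace (rr_space \<iota> G)"
  using val_ge_subspace unfolding k.subspace_def by (auto simp: rr_space_iff)

lemma rr_space_mono: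
  "G \<in> divisors \<iota> \<Longrightarrow> H \<in> divisors \<iota> \<Longrightarrow> G \<le> H \<Longrightarrow> rr_space \<iota> G \<subseteq> rr_space \<iota> H"
  using val_ge_mono[of "- H P" "- G P" for P] by (fastforce simp: rr_space_iff le_fun_def)

end

context function_field
begin

text \<open>
  A large finite set of zeros would give a large family that is independent over \<open>k[z]\<close>.
\<close>
lemma finite_zeros:
  assumes z: "z \<noteq> 0" shows "finite {P \<in> places \<iota>. 0 < P z}"
proof (rule ccontr)
  assume inf: "infinite {P \<in> places \<iota>. 0 < P z}"
  obtain N where N: "\<And>u (I :: ('f place \<times> nat \<times> 'f) set). finite I \<Longrightarrow> power_indep z u I \<Longrightarrow> card I \<le> N"
    using power_indep_bound[of z] by metis
  obtain S where S: "finite S" "card S = Suc N" "S \<subseteq> {P \<in> places \<iota>. 0 < P z}"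
    using infinite_arbitrarily_large[OF inf, of "Suc N"] by blast
  obtain I :: "('f place \<times> nat \<times> 'f) set" and u where I: "finite I"
    "int (card I) = (\<Sum>P\<in>S. P z * int (place_degree \<iota> P))" "power_indep z u I"
    by (rule power_indep_zeros[of S z]) (use S z in auto)
  have "int (card S) = (\<Sum>P\<in>S. 1 * int 1)" by simp
  also have "\<dots> \<le> (\<Sum>P\<in>S. P z * int (place_degree \<iota> P))"
    using S place_degree_pos by (intro sum_mono mult_mono) (auto simp: Suc_le_eq int_one_le_iff_zero_less)
  finally show False using N[OF I(1,3)] I(2) S(2) by simp
qed

lemma fun_div_divisor [intro, simp]:
  assumes "z \<noteq> 0" shows "fun_div \<iota> z \<in> divisors \<iota>"
proof (rule divisorsI)
  show "finite ({P \<in> places \<iota>. 0 < P z} \<union> {P \<in> places \<iota>. 0 < P (inverse z)})"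
    using finite_zeros assms by auto
qed (auto simp: fun_div_def)

lemma common_pole_divisor:
  assumes "finite Y"
  shows "\<exists>C\<in>divisors \<iota>. 0 \<le> C \<and> (\<forall>y\<in>Y. \<forall>P\<in>places \<iota>. y \<in> val_ge P (- C P))"
  using assms
proof (induction Y rule: finite_induct)
  case (insert y Y)
  then obtain C where C: "C \<in> divisors \<iota>" "0 \<le> C" "\<forall>y\<in>Y. \<forall>P\<in>places \<iota>. y \<in> val_ge P (- C P)" by blast
  show ?case
  proof (cases "y = 0")
    case False
    let ?C = "\<lambda>P. max (C P) (- fun_div \<iota> y P)"
    have "(\<lambda>P. - fun_div \<iota> y P) = - fun_div \<iota> y" by (rule ext) simp
    hence "?C \<in> divisors \<iota>" using divisor_max[OF C(1), of "- fun_div \<iota> y"] False by simp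
    moreover have "y' \<in> val_ge P (- ?C P)" if "y' \<in> insert y Y" "P \<in> places \<iota>" for y' P
    proof (cases "y' = y")
      case True
      thus ?thesis using that by (auto simp: val_ge_def fun_div_def max_def)
    next
      case False
      hence "y' \<in> val_ge P (- C P)" using C(3) that by auto
      thus ?thesis by (rule val_ge_mono[rotated]) simp
    qed
    moreover have "0 \<le> ?C" using C(2) by (simp add: le_fun_def le_max_iff_disj)
    ultimately show ?thesis by blast
  next
    case True
    hence "0 \<le> C \<and> (\<forall>y'\<in>insert y Y. \<forall>P\<in>places \<iota>. y' \<in> val_ge P (- C P))" using C by auto
    thus ?thesis by (rule bexI[OF _ C(1)])
  qed
next
  case empty
  have "(0 :: 'f divisor) \<le> 0 \<and> (\<forall>y\<in>{}. \<forall>P\<in>places \<iota>. y \<in> val_ge P (- (0 :: 'f divisor) P))" by simp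
  thus ?case by (intro bexI[of _ "0 :: 'f divisor"] divisor_0)
qed

text \<open>
  The kernel of the leading coefficient at \<open>P\<close> is the smaller space. Hence adding a place changes
  dimensions by at most its degree.
\<close>
lemma rr_space_step:
  assumes G: "G \<in> divisors \<iota>" and P: "P \<in> places \<iota>"
  defines "U \<equiv> rr_space \<iota> (G + prime_divisor P)"
  shows "U \<subseteq> val_ge P (- G P - 1)" "{h \<in> U. lead P (- G P - 1) h = 0} = rr_space \<iota> G"
proof -
  have G': "G + prime_divisor P \<in> divisors \<iota>" using G P by simp
  show U: "U \<subseteq> val_ge P (- G P - 1)"
  proof
    fix h assume "h \<in> U"
    hence "h \<in> val_ge P (- (G + prime_divisor P) P)" using P unfolding U_def rr_space_iff[OF G'] by blast
    thus "h \<in> val_ge P (- G P - 1)" by (simp add: prime_divisor_apply)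
  qed
  have "h \<in> U \<and> h \<in> val_ge P (- G P) \<longleftrightarrow> h \<in> rr_space \<iota> G" for h
    using P val_ge_mono[of "- G P - 1" "- G P" h P]
    unfolding U_def rr_space_iff[OF G'] rr_space_iff[OF G] prime_divisor_apply by force
  thus "{h \<in> U. lead P (- G P - 1) h = 0} = rr_space \<iota> G"
    using U lead_eq_0_iff[OF P, of _ "- G P - 1"] by fastforce
qed

lemma rr_space_step_card:
  assumes G: "G \<in> divisors \<iota>" and P: "P \<in> places \<iota>" and fin: "finite (rr_space \<iota> G)"
  defines "U \<equiv> rr_space \<iota> (G + prime_divisor P)"
  shows "finite U" "card U = card (lead P (- G P - 1) ` U) * card (rr_space \<iota> G)"
proof -
  note st = rr_space_step[OF G P, folded U_def]
  have sub: "k.subspace U" unfolding U_def using G P by (intro rr_space_subspace) auto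
  have fin': "finite {h \<in> U. lead P (- G P - 1) h = 0}" using fin st(2) by simp
  have diff: "lead P (- G P - 1) (x - y) = lead P (- G P - 1) x - lead P (- G P - 1) y"
    if "x \<in> U" "y \<in> U" for x y by (rule lead_diff[OF P]) (use st(1) that in blast)+
  note fib = card_fibres[where \<phi> = "lead P (- G P - 1)", OF subspace_diff[OF sub] diff
      lead_range(1)[OF P st(1)] fin']
  have "finite U \<and> card U = card (lead P (- G P - 1) ` U) * card {h \<in> U. lead P (- G P - 1) h = 0}"
    by (intro conjI fib)
  thus "finite U" "card U = card (lead P (- G P - 1) ` U) * card (rr_space \<iota> G)" by (simp_all add: st(2))
qed

end

section \<open>Rational places and constants\<close>

context function_field
begin

lemma rational_place_value:
  assumes P: "rational_place \<iota> P" and x: "x \<in> val_ge P 0"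
  shows "\<exists>!a. x - \<iota> a \<in> val_ge P 1"
proof -
  have Pp: "P \<in> places \<iota>" using P by (simp add: rational_place_def)
  obtain b where b: "rbasis P = {b}"
    using rbasis(3)[OF Pp] P by (auto simp: rational_place_def card_1_singleton_iff)
  obtain c where c: "1 - \<iota> c * b \<in> val_ge P 1"
    using coord(2)[OF Pp, of 1] Pp by (auto simp: lift_def b)
  obtain d where d: "x - \<iota> d * b \<in> val_ge P 1"
    using coord(2)[OF Pp x] by (auto simp: lift_def b)
  have "c \<noteq> 0" using c Pp by (auto simp: val_ge_def)
  have "(x - \<iota> d * b) - \<iota> (d / c) * (1 - \<iota> c * b) \<in> val_ge P 1"
    by (rule val_ge_diff[OF Pp d val_ge_iota_mult[OF Pp c]])
  moreover have "\<iota> (d / c) * \<iota> c = \<iota> d" using \<open>c \<noteq> 0\<close> by (simp flip: iota_mult)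
  ultimately have "x - \<iota> (d / c) \<in> val_ge P 1"
    by (simp add: right_diff_distrib mult.assoc[symmetric])
  moreover have "a = a'" if "x - \<iota> a \<in> val_ge P 1" "x - \<iota> a' \<in> val_ge P 1" for a a'
  proof -
    have "\<iota> (a' - a) \<in> val_ge P 1" using val_ge_diff[OF Pp that] by (simp add: iota_diff)
    thus ?thesis using Pp by (auto simp: val_ge_def)
  qed
  ultimately show ?thesis by blast
qed

lemma eval_at:
  assumes "rational_place \<iota> P" "x \<in> val_ge P 0"
  shows "x - \<iota> (eval_at \<iota> P x) \<in> val_ge P 1" "x - \<iota> a \<in> val_ge P 1 \<Longrightarrow> eval_at \<iota> P x = a"
  using theI'[OF rational_place_value[OF assms]] the1_equality[OF rational_place_value[OF assms], of a]
  unfolding eval_at_def max_ideal_eq by blast+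

end

locale pointed_curve = function_field \<iota> for \<iota> :: "'k::{field,finite} \<Rightarrow> 'f::field" +
  fixes Q :: "'f place"
  assumes rational_Q: "rational_place \<iota> Q"
begin

lemma Q [simp]: "Q \<in> places \<iota>" and degree_Q [simp]: "place_degree \<iota> Q = 1"
  using rational_Q by (auto simp: rational_place_def)

text \<open>
  Suppose \<open>z\<close> is not constant, and let \<open>y = z - z(Q)\<close> and \<open>w = 1/y\<close>. The elements of \<open>k[w]\<close> have
  nonpositive order at \<open>Q\<close>, so \<open>1/w = y\<close> is not among them, and there is a place where \<open>w\<close> vanishes;
  there \<open>z\<close> has a pole.
\<close>
theorem no_poles_const:
  assumes z: "\<And>P. P \<in> places \<iota> \<Longrightarrow> z \<in> val_ge P 0"
  shows "z \<in> range \<iota>"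
proof (rule ccontr)
  assume nz: "z \<notin> range \<iota>"
  define y where "y = z - \<iota> (eval_at \<iota> Q z)"
  have y: "y \<in> val_ge Q 1" unfolding y_def using eval_at(1)[OF rational_Q z] Q by blast
  have y0: "y \<noteq> 0" using nz by (auto simp: y_def)
  define w where "w = inverse y"
  have w: "w \<noteq> 0" "Q w < 0" using y y0 Q by (auto simp: w_def val_ge_def)
  define S where "S = {poly p w | p. \<forall>i. coeff p i \<in> range \<iota>}"
  have "subalgebra S"
    unfolding subalgebra_def
  proof (intro conjI ballI)
    show "range \<iota> \<subseteq> S"
    proof
      fix y assume "y \<in> range \<iota>"
      moreover have "0 \<in> range \<iota>" using rangeI[of \<iota> 0] by simp
      ultimately have "\<forall>i. coeff [:y:] i \<in> range \<iota>" by (simp add: coeff_pCons split: nat.splits)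
      moreover have "y = poly [:y:] w" by simp
      ultimately show "y \<in> S" unfolding S_def by blast
    qed
    fix x y assume "x \<in> S" "y \<in> S"
    then obtain p r where pr: "x = poly p w" "\<forall>i. coeff p i \<in> range \<iota>" "y = poly r w" "\<forall>i. coeff r i \<in> range \<iota>"
      unfolding S_def by blast
    have "\<forall>i. \<exists>a. coeff p i = \<iota> a" "\<forall>i. \<exists>a. coeff r i = \<iota> a" using pr(2,4) by blast+
    then obtain f g where fg: "\<And>i. coeff p i = \<iota> (f i)" "\<And>i. coeff r i = \<iota> (g i)" by metis
    have "coeff (p + r) i = \<iota> (f i + g i)" for i by (simp add: fg iota_add)
    hence "\<forall>i. coeff (p + r) i \<in> range \<iota>" by blast
    moreover have "x + y = poly (p + r) w" by (simp add: pr)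
    ultimately show "x + y \<in> S" unfolding S_def by blast
    have "coeff (p * r) i = \<iota> (\<Sum>j\<le>i. f j * g (i - j))" for i
      by (simp add: coeff_mult fg iota_sum iota_mult)
    hence "\<forall>i. coeff (p * r) i \<in> range \<iota>" by blast
    moreover have "x * y = poly (p * r) w" by (simp add: pr)
    ultimately show "x * y \<in> S" unfolding S_def by blast
  qed
  moreover have "w \<in> S"
  proof -
    have 01: "0 \<in> range \<iota>" "1 \<in> range \<iota>" using rangeI[of \<iota> 0] rangeI[of \<iota> 1] by simp_all
    hence "coeff [:0, 1:] i \<in> range \<iota>" for i by (simp add: coeff_pCons split: nat.splits)
    hence "\<forall>i. coeff [:0, 1:] i \<in> range \<iota>" by blast
    moreover have "w = poly [:0, 1:] w" by simp
    ultimately show ?thesis unfolding S_def by blast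
  qed
  moreover have "poly p w = 0 \<or> Q (poly p w) \<le> 0" if "\<forall>i. coeff p i \<in> range \<iota>" for p
    using that
  proof (induction p)
    case (pCons a p)
    have "\<forall>i. coeff p i \<in> range \<iota>" using pCons.prems by (metis coeff_pCons_Suc)
    hence IH: "poly p w = 0 \<or> Q (poly p w) \<le> 0" by (rule pCons.IH)
    obtain b where b: "a = \<iota> b" using pCons.prems by (metis coeff_pCons_0 rangeE)
    show ?case
    proof (cases "poly p w = 0")
      case False
      hence neg: "w * poly p w \<noteq> 0" "Q (w * poly p w) < 0" using IH w by (auto simp: place_mult)
      show ?thesis
      proof (cases "a = 0")
        case False
        have "Q (w * poly p w + a) = Q (w * poly p w)"
          by (rule place_add_eq) (use neg False b in auto)
        thus ?thesis using neg by (simp add: add.commute)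
      qed (use neg in simp)
    qed (use b in simp)
  qed simp
  hence "\<And>f. f \<in> S \<Longrightarrow> f = 0 \<or> Q f \<le> 0" unfolding S_def by blast
  hence "inverse w \<notin> S" using y y0 by (force simp: w_def val_ge_def)
  ultimately obtain P where P: "P \<in> places \<iota>" "0 < P w" using place_exists[of S w] w by blast
  have "y \<in> val_ge P 0" unfolding y_def using z[OF P(1)] P(1) by (intro val_ge_diff) auto
  thus False using P y0 by (simp add: w_def val_ge_def)
qed

lemma rr_space_0: "rr_space \<iota> 0 = range \<iota>"
  using no_poles_const by (auto simp: rr_space_iff)

lemma rr_space_finite [intro, simp]:
  assumes G: "G \<in> divisors \<iota>" shows "finite (rr_space \<iota> G)"
proof -
  have "finite (rr_space \<iota> E)" if "E \<in> divisors \<iota>" "0 \<le> E" for E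
    using that
  proof (induction rule: effective_induct)
    case zero
    have "finite (rr_space \<iota> 0)" by (simp add: rr_space_0)
    thus ?case .
  next
    case (add E P)
    from rr_space_step_card(1)[OF add.hyps(1,3) add.IH] show ?case .
  qed
  hence "finite (rr_space \<iota> (\<lambda>P. max (G P) ((0 :: 'f divisor) P)))"
    using G divisor_max[OF G divisor_0] by (auto simp: le_fun_def)
  moreover have "rr_space \<iota> G \<subseteq> rr_space \<iota> (\<lambda>P. max (G P) ((0 :: 'f divisor) P))"
    using G divisor_max[OF G divisor_0] by (intro rr_space_mono) (auto simp: le_fun_def)
  ultimately show ?thesis by (rule rev_finite_subset)
qed

abbreviation ell :: "'f divisor \<Rightarrow> int" where "ell G \<equiv> int (rr_dim \<iota> G)"

lemma card_rr_space: "G \<in> divisors \<iota> \<Longrightarrow> card (rr_space \<iota> G) = q ^ rr_dim \<iota> G"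
  unfolding rr_dim_def by (rule card_eq_dim) (auto intro: rr_space_subspace)

lemma q_power_le_iff [simp]: "q ^ m \<le> q ^ n \<longleftrightarrow> m \<le> n"
  using q_ge_2 by (intro power_increasing_iff) simp

lemma q_power_eq_iff [simp]: "q ^ m = q ^ n \<longleftrightarrow> m = n"
  using q_ge_2 by (intro power_inject_exp) simp

lemma ell_0: "ell 0 = 1"
proof -
  have "q ^ rr_dim \<iota> 0 = q ^ 1" using card_rr_space[of 0] by (simp add: rr_space_0 q_def)
  thus ?thesis unfolding q_power_eq_iff by simp
qed

lemma ell_step:
  assumes G: "G \<in> divisors \<iota>" and P: "P \<in> places \<iota>"
  shows "ell G \<le> ell (G + prime_divisor P)" "ell (G + prime_divisor P) \<le> ell G + int (place_degree \<iota> P)"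
proof -
  let ?U = "rr_space \<iota> (G + prime_divisor P)"
  have G': "G + prime_divisor P \<in> divisors \<iota>" using G P by simp
  have "rr_space \<iota> G \<subseteq> ?U"
    using G G' by (intro rr_space_mono) (auto simp: le_fun_def prime_divisor_apply)
  hence "card (rr_space \<iota> G) \<le> card ?U" by (intro card_mono rr_space_finite G')
  thus "ell G \<le> ell (G + prime_divisor P)" using G G' by (simp add: card_rr_space)
  have "card ?U \<le> q ^ place_degree \<iota> P * card (rr_space \<iota> G)"
    unfolding rr_space_step_card(2)[OF G P rr_space_finite[OF G]]
    by (intro mult_le_mono1 lead_range[OF P] rr_space_step(1)[OF G P])
  hence "q ^ rr_dim \<iota> (G + prime_divisor P) \<le> q ^ (place_degree \<iota> P + rr_dim \<iota> G)"
    using G G' by (simp add: card_rr_space power_add)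
  thus "ell (G + prime_divisor P) \<le> ell G + int (place_degree \<iota> P)"
    unfolding q_power_le_iff by simp
qed

definition s :: "'f divisor \<Rightarrow> int" where "s G = deg G - ell G"

text \<open>The dimension grows by at most the degree of each place that is added.\<close>
lemma s_mono:
  assumes "G \<in> divisors \<iota>" "H \<in> divisors \<iota>" "G \<le> H"
  shows "s G \<le> s H" "ell G \<le> ell H"
proof -
  have "s G \<le> s (G + E) \<and> ell G \<le> ell (G + E)" if "E \<in> divisors \<iota>" "0 \<le> E" for E
    using that
  proof (induction rule: effective_induct)
    case zero
    have "s G \<le> s (G + 0) \<and> ell G \<le> ell (G + 0)" by simp
    thus ?case .
  next
    case (add E P)
    have "s (G + E) \<le> s (G + E + prime_divisor P)"
      using ell_step(2)[of "G + E" P] add.hyps assms by (simp add: s_def deg_add)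
    moreover have "ell (G + E) \<le> ell (G + E + prime_divisor P)"
      using add.hyps assms(1) by (intro ell_step) auto
    moreover have "s G \<le> s (G + E)" "ell G \<le> ell (G + E)" using add.IH by blast+
    ultimately have "s G \<le> s (G + E + prime_divisor P) \<and> ell G \<le> ell (G + E + prime_divisor P)" by linarith
    thus ?case unfolding add.assoc .
  qed
  moreover have "H - G \<in> divisors \<iota>" "0 \<le> H - G" "G + (H - G) = H"
    using assms by (simp_all add: le_fun_def)
  ultimately show "s G \<le> s H" "ell G \<le> ell H" by metis+
qed

lemma ell_le_effective: "E \<in> divisors \<iota> \<Longrightarrow> 0 \<le> E \<Longrightarrow> ell E \<le> deg E + 1"
  using s_mono(1)[of 0 E] by (simp add: s_def ell_0)

section \<open>The degree of a principal divisor\<close>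

text \<open>
  The zeros supply a family that is independent over \<open>k[z]\<close>. Its multiples by powers of \<open>z\<close> up to
  \<open>n\<close> have poles bounded by \<open>n\<close> times the poles of \<open>z\<close> and a fixed divisor. Their number grows like
  \<open>n\<close> times the degree of the zeros, and the dimension of the space containing them like \<open>n\<close> times
  the degree of the poles.
\<close>
lemma deg_zeros_le_poles:
  assumes z: "z \<noteq> 0"
  shows "deg (\<lambda>P. max 0 (fun_div \<iota> z P)) \<le> deg (\<lambda>P. max 0 (- fun_div \<iota> z P))"
proof -
  let ?Z = "\<lambda>P. max 0 (fun_div \<iota> z P)" and ?X = "\<lambda>P. max 0 (- fun_div \<iota> z P)"
  define S where "S = {P \<in> places \<iota>. 0 < P z}"
  have S: "finite S" using finite_zeros[OF z] by (simp add: S_def)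
  have X: "?X \<in> divisors \<iota>"
    using divisor_combine[OF divisor_0 fun_div_divisor[OF z], of "\<lambda>a b. max 0 (- b)"] by simp
  obtain I :: "('f place \<times> nat \<times> 'f) set" and u where I: "finite I"
    "int (card I) = (\<Sum>P\<in>S. P z * int (place_degree \<iota> P))" "power_indep z u I"
    by (rule power_indep_zeros[of S z]) (use S S_def z in auto)
  have degZ: "deg ?Z = int (card I)"
    unfolding I(2) by (subst deg_eq[OF S]) (auto simp: S_def fun_div_def split: if_splits intro!: sum.cong)
  obtain C where C: "C \<in> divisors \<iota>" "0 \<le> C" "\<forall>y\<in>u ` I. \<forall>P\<in>places \<iota>. y \<in> val_ge P (- C P)"
    using common_pole_divisor[of "u ` I"] I(1) by blast
  have ineq: "int (card I) * (int n + 1) \<le> int n * deg ?X + deg C + 1" for n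
  proof -
    let ?G = "(\<lambda>P. int n * ?X P) + C"
    have G: "?G \<in> divisors \<iota>" by (intro divisor_add divisor_mult X C)
    have "q ^ (card I * Suc n) \<le> card (rr_space \<iota> ?G)"
    proof (rule power_indep_card[OF I(3,1), of 1])
      fix i a assume i: "i \<in> I" "a \<le> n"
      show "1 * (z ^ a * u i) \<in> rr_space \<iota> ?G"
        unfolding rr_space_iff[OF G]
      proof
        fix P assume P: "P \<in> places \<iota>"
        have "- (int n * ?X P) \<le> - (int a * ?X P)" using i(2) by (simp add: mult_right_mono)
        also have "\<dots> \<le> int a * P z" using P by (cases "P z \<ge> 0") (auto simp: fun_div_def max_def)
        finally have "z ^ a \<in> val_ge P (- (int n * ?X P))" using P by (simp add: val_ge_def)
        moreover have "u i \<in> val_ge P (- C P)" using C i P by blast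
        ultimately show "1 * (z ^ a * u i) \<in> val_ge P (- ?G P)" using val_ge_mult'[OF P] by simp
      qed
    qed (use G rr_space_subspace in auto)
    hence "int (card I * Suc n) \<le> ell ?G" using G by (simp only: card_rr_space q_power_le_iff of_nat_le_iff)
    also have "\<dots> \<le> deg ?G + 1" using G C(2) by (intro ell_le_effective) (auto simp: le_fun_def)
    also have "deg ?G = int n * deg ?X + deg C" using X C by (simp add: deg_add deg_mult)
    finally show ?thesis by (simp add: algebra_simps)
  qed
  show ?thesis
  proof (rule ccontr)
    assume "\<not> ?thesis"
    hence lt: "deg ?X + 1 \<le> int (card I)" using degZ by simp
    have C0: "0 \<le> deg C" using C(2) by (intro deg_nonneg) (simp add: le_fun_def)
    define n where "n = nat (deg C + 1)"
    have "int n * deg ?X + int n \<le> int n * int (card I)"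
      using mult_left_mono[OF lt, of "int n"] by (simp add: algebra_simps)
    hence "int n + int (card I) \<le> deg C + 1" using ineq[of n] by (simp add: algebra_simps)
    moreover have "0 \<le> deg ?X" by (rule deg_nonneg) simp
    ultimately show False using lt C0 by (simp add: n_def)
  qed
qed

theorem deg_fun_div [simp]:
  assumes z: "z \<noteq> 0" shows "deg (fun_div \<iota> z) = 0"
proof -
  have inv: "fun_div \<iota> (inverse z) = - fun_div \<iota> z" by (rule ext) (simp add: fun_div_def)
  let ?Z = "\<lambda>P. max 0 (fun_div \<iota> z P)" and ?X = "\<lambda>P. max 0 (- fun_div \<iota> z P)"
  have ZX: "?Z \<in> divisors \<iota>" "?X \<in> divisors \<iota>"
    using divisor_combine[OF divisor_0 fun_div_divisor[OF z], of "\<lambda>a b. max 0 b"]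
      divisor_combine[OF divisor_0 fun_div_divisor[OF z], of "\<lambda>a b. max 0 (- b)"] by simp_all
  have eq: "fun_div \<iota> z = ?Z - ?X" by (rule ext) simp
  have "deg ?Z = deg ?X"
    using deg_zeros_le_poles[OF z] deg_zeros_le_poles[of "inverse z"] z inv by simp
  hence "deg (?Z - ?X) = 0" by (simp only: deg_diff[OF ZX] diff_self)
  thus ?thesis by (simp only: eq[symmetric])
qed

lemma rr_space_shift:
  assumes z: "z \<noteq> 0" and G: "G \<in> divisors \<iota>"
  shows "bij_betw (\<lambda>h. z * h) (rr_space \<iota> (G + fun_div \<iota> z)) (rr_space \<iota> G)"
proof (rule bij_betw_byWitness[where f' = "\<lambda>h. inverse z * h"])
  have *: "h \<in> rr_space \<iota> (G + fun_div \<iota> z) \<longleftrightarrow> z * h \<in> rr_space \<iota> G" for h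
  proof -
    have G': "G + fun_div \<iota> z \<in> divisors \<iota>" using z G by simp
    have "h \<in> val_ge P (- (G + fun_div \<iota> z) P) \<longleftrightarrow> z * h \<in> val_ge P (- G P)" if "P \<in> places \<iota>" for P
      using val_ge_mult_iff[OF that z, of h "- G P"] that by (simp add: fun_div_def)
    thus ?thesis unfolding rr_space_iff[OF G] rr_space_iff[OF G'] by blast
  qed
  show "(\<lambda>h. z * h) ` rr_space \<iota> (G + fun_div \<iota> z) \<subseteq> rr_space \<iota> G" using * by blast
  show "(\<lambda>h. inverse z * h) ` rr_space \<iota> G \<subseteq> rr_space \<iota> (G + fun_div \<iota> z)"
    unfolding image_subset_iff * using z by (simp add: mult.assoc[symmetric])
qed (use z in auto)

lemma ell_shift: "z \<noteq> 0 \<Longrightarrow> G \<in> divisors \<iota> \<Longrightarrow> ell (G + fun_div \<iota> z) = ell G"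
  using bij_betw_same_card[OF rr_space_shift, of z G] by (simp add: card_rr_space)

lemma s_shift: "z \<noteq> 0 \<Longrightarrow> G \<in> divisors \<iota> \<Longrightarrow> s (G + fun_div \<iota> z) = s G"
  by (simp add: s_def ell_shift deg_add)

text \<open>A nonzero element of \<open>L(H - G)\<close> moves \<open>H\<close> above \<open>G\<close> within its class.\<close>
lemma exists_shift_above:
  assumes G: "G \<in> divisors \<iota>" and H: "H \<in> divisors \<iota>" and pos: "0 < ell (H - G)"
  obtains z where "z \<noteq> 0" "G \<le> H + fun_div \<iota> z"
proof -
  have HG: "H - G \<in> divisors \<iota>" using G H by simp
  have "q ^ 1 \<le> card (rr_space \<iota> (H - G))" unfolding card_rr_space[OF HG] q_power_le_iff using pos by simp
  hence "\<not> card (rr_space \<iota> (H - G)) \<le> card {0 :: 'f}" using q_ge_2 by simp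
  hence "\<not> rr_space \<iota> (H - G) \<subseteq> {0}" using card_mono[of "{0 :: 'f}"] by blast
  then obtain z where z: "z \<in> rr_space \<iota> (H - G)" "z \<noteq> 0" by blast
  have "G P \<le> (H + fun_div \<iota> z) P" for P
    using z(1) z(2) divisor_outside[OF G] divisor_outside[OF H]
    unfolding rr_space_iff[OF HG] by (cases "P \<in> places \<iota>") (auto simp: fun_div_def val_ge_def)
  thus thesis using that z(2) by (simp add: le_fun_def)
qed

section \<open>The inequality of Riemann\<close>

text \<open>
  For the divisor \<open>Z\<close> of zeros of a function \<open>z\<close> the independent family of \<open>power_indep_zeros\<close>,
  times powers of \<open>z\<close> from \<open>-n\<close> to \<open>0\<close>, fills \<open>L(n Z)\<close> up to a bounded error. Every divisor lies
  below one equivalent to a multiple of \<open>Z\<close>, because \<open>n Z\<close> minus an effective divisor has sections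
  for large \<open>n\<close>.
\<close>
theorem riemann: "\<exists>c. \<forall>G\<in>divisors \<iota>. s G \<le> c"
proof -
  define z where "z = local_param Q"
  have z: "z \<noteq> 0" "Q z = 1" using local_param[OF Q] by (auto simp: z_def)
  let ?Z = "\<lambda>P. max 0 (fun_div \<iota> z P)"
  define S where "S = {P \<in> places \<iota>. 0 < P z}"
  have S: "finite S" using finite_zeros[OF z(1)] by (simp add: S_def)
  have Z: "?Z \<in> divisors \<iota>"
    using divisor_combine[OF divisor_0 fun_div_divisor[OF z(1)], of "\<lambda>a b. max 0 b"] by simp
  obtain I :: "('f place \<times> nat \<times> 'f) set" and u where I: "finite I"
    "int (card I) = (\<Sum>P\<in>S. P z * int (place_degree \<iota> P))" "power_indep z u I"
    by (rule power_indep_zeros[of S z]) (use S S_def z in auto)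
  have degZ: "deg ?Z = int (card I)"
    unfolding I(2) by (subst deg_eq[OF S]) (auto simp: S_def fun_div_def split: if_splits intro!: sum.cong)
  have "prime_divisor Q \<le> ?Z" using z by (auto simp: le_fun_def prime_divisor_apply fun_div_def)
  hence degZ1: "1 \<le> deg ?Z" using deg_mono[OF divisor_prime[OF Q] Z] by simp
  obtain C where C: "C \<in> divisors \<iota>" "0 \<le> C" "\<forall>y\<in>u ` I. \<forall>P\<in>places \<iota>. y \<in> val_ge P (- C P)"
    using common_pole_divisor[of "u ` I"] I(1) by blast
  have bound: "s (\<lambda>P. int n * ?Z P) \<le> deg C" for n
  proof -
    let ?G = "(\<lambda>P. int n * ?Z P) + C"
    have G: "?G \<in> divisors \<iota>" by (intro divisor_add divisor_mult Z C)
    have "q ^ (card I * Suc n) \<le> card (rr_space \<iota> ?G)"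
    proof (rule power_indep_card[OF I(3,1), of "inverse z ^ n"])
      fix i a assume i: "i \<in> I" "a \<le> n"
      show "inverse z ^ n * (z ^ a * u i) \<in> rr_space \<iota> ?G"
        unfolding rr_space_iff[OF G]
      proof
        fix P assume P: "P \<in> places \<iota>"
        have "P z \<le> ?Z P" using P by (simp add: fun_div_def)
        hence "int (n - a) * P z \<le> int (n - a) * ?Z P" by (intro mult_left_mono) auto
        also have "\<dots> \<le> int n * ?Z P" by (intro mult_right_mono) auto
        finally have "- (int n * ?Z P) \<le> P (inverse z ^ n * z ^ a)"
          using P z i by (simp add: place_mult of_nat_diff algebra_simps)
        hence "inverse z ^ n * z ^ a \<in> val_ge P (- (int n * ?Z P))" by (simp add: val_ge_def)
        moreover have "u i \<in> val_ge P (- C P)" using C i P by blast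
        ultimately show "inverse z ^ n * (z ^ a * u i) \<in> val_ge P (- ?G P)"
          using val_ge_mult'[OF P, of "inverse z ^ n * z ^ a" _ "u i"] by (simp add: mult.assoc)
      qed
    qed (use G rr_space_subspace z in auto)
    hence "int (card I * Suc n) \<le> ell ?G" using G by (simp only: card_rr_space q_power_le_iff of_nat_le_iff)
    moreover have "deg ?G = int n * deg ?Z + deg C" using Z C by (simp add: deg_add deg_mult)
    ultimately have "s ?G \<le> deg C" using degZ by (simp add: s_def algebra_simps)
    moreover have "s (\<lambda>P. int n * ?Z P) \<le> s ?G"
      using C G by (intro s_mono divisor_mult Z) (auto simp: le_fun_def)
    ultimately show ?thesis by simp
  qed
  have "s G \<le> deg C" if G: "G \<in> divisors \<iota>" for G
  proof -
    define A where "A = (\<lambda>P. max (G P) ((0 :: 'f divisor) P))"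
    have A: "A \<in> divisors \<iota>" "G \<le> A" "0 \<le> A"
      unfolding A_def using divisor_max[OF G divisor_0] by (auto simp: le_fun_def)
    define n where "n = nat (deg C + deg A + 1)"
    let ?H = "\<lambda>P. int n * ?Z P"
    have H: "?H \<in> divisors \<iota>" using Z by auto
    have nn: "0 \<le> deg C" "0 \<le> deg A" using C(2) A(3) by (auto intro!: deg_nonneg simp: le_fun_def)
    have "s (?H - A) \<le> s ?H" using H A by (intro s_mono) (auto simp: le_fun_def)
    hence "int n * deg ?Z - deg A - deg C \<le> ell (?H - A)"
      using bound[of n] H A Z by (simp add: s_def deg_diff deg_mult)
    moreover have "int n \<le> int n * deg ?Z" using degZ1 mult_left_mono[of 1 "deg ?Z" "int n"] by simp
    moreover have "int n = deg C + deg A + 1" using nn by (simp add: n_def)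
    ultimately have "0 < ell (?H - A)" by linarith
    then obtain y where y: "y \<noteq> 0" "A \<le> ?H + fun_div \<iota> y" using exists_shift_above[OF A(1) H] by blast
    have "s G \<le> s A" using G A by (intro s_mono)
    also have "\<dots> \<le> s (?H + fun_div \<iota> y)" using A H y by (intro s_mono) auto
    also have "\<dots> = s ?H" using y H by (intro s_shift)
    also have "\<dots> \<le> deg C" by (rule bound)
    finally show ?thesis .
  qed
  thus ?thesis by blast
qed

text \<open>The genus minus one.\<close>
definition smax :: int where
  "smax = (THE m. (\<exists>B\<in>divisors \<iota>. s B = m) \<and> (\<forall>G\<in>divisors \<iota>. s G \<le> m))"

lemma smax: "\<exists>B\<in>divisors \<iota>. s B = smax" "G \<in> divisors \<iota> \<Longrightarrow> s G \<le> smax"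
proof -
  obtain c where c: "\<And>G. G \<in> divisors \<iota> \<Longrightarrow> s G \<le> c" using riemann by blast
  have s0: "s 0 = - 1" by (simp add: s_def ell_0)
  let ?Pr = "\<lambda>G. G \<in> divisors \<iota> \<and> -1 \<le> s G"
  obtain B where B: "?Pr B" "\<And>G. ?Pr G \<Longrightarrow> nat (s G + 1) \<le> nat (s B + 1)"
    using ex_has_greatest_nat[of ?Pr 0 "\<lambda>G. nat (s G + 1)" "Suc (nat (c + 1))"] c s0
    by (force simp: less_Suc_eq_le intro!: nat_mono)
  have max: "s G \<le> s B" if "G \<in> divisors \<iota>" for G
    using B(1) B(2)[of G] that by (cases "- 1 \<le> s G") auto
  have "smax = s B" unfolding smax_def using B(1) max by (intro the_equality) (auto intro!: antisym)
  thus "\<exists>B\<in>divisors \<iota>. s B = smax" "G \<in> divisors \<iota> \<Longrightarrow> s G \<le> smax" using B(1) max by auto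
qed

lemma s_eq_smax_mono:
  "G \<in> divisors \<iota> \<Longrightarrow> H \<in> divisors \<iota> \<Longrightarrow> G \<le> H \<Longrightarrow> s G = smax \<Longrightarrow> s H = smax"
  using s_mono(1)[of G H] smax(2)[of H] by simp

text \<open>
  If \<open>B\<close> attains the maximum and \<open>G\<close> has large degree, \<open>G - B\<close> has a section, so a divisor
  equivalent to \<open>G\<close> lies above \<open>B\<close>.
\<close>
lemma s_large_degree: obtains c where "\<And>G. G \<in> divisors \<iota> \<Longrightarrow> c \<le> deg G \<Longrightarrow> s G = smax"
proof -
  obtain B where B: "B \<in> divisors \<iota>" "s B = smax" using smax(1) by blast
  have "s G = smax" if G: "G \<in> divisors \<iota>" "deg B + smax + 1 \<le> deg G" for G
  proof -
    have "s (G - B) \<le> smax" using G B by (intro smax) auto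
    hence "0 < ell (G - B)" using G B by (simp add: s_def deg_diff)
    then obtain z where z: "z \<noteq> 0" "B \<le> G + fun_div \<iota> z" using exists_shift_above[OF B(1) G(1)] by blast
    have "G + fun_div \<iota> z \<in> divisors \<iota>" using G(1) z(1) by simp
    hence "s (G + fun_div \<iota> z) = smax" by (rule s_eq_smax_mono[OF B(1) _ z(2) B(2)])
    thus ?thesis using s_shift[OF z(1) G(1)] by simp
  qed
  thus thesis by (rule that)
qed

lemma ell_negative_degree:
  assumes "G \<in> divisors \<iota>" "deg G < 0" shows "ell G = 0"
proof (rule ccontr)
  assume "ell G \<noteq> 0"
  then obtain z where z: "z \<noteq> 0" "0 \<le> G + fun_div \<iota> z" using exists_shift_above[of 0 G] assms by auto
  hence "0 \<le> deg (G + fun_div \<iota> z)" by (intro deg_nonneg) (auto simp: le_fun_def)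
  thus False using assms z by (simp add: deg_add)
qed

section \<open>Strong approximation\<close>

text \<open>
  Where \<open>s\<close> is maximal, adding \<open>P\<close> must raise the dimension by the full degree of \<open>P\<close>, which leaves
  room for every leading coefficient.
\<close>
lemma lead_surjective:
  assumes G: "G \<in> divisors \<iota>" "s G = smax" and P: "P \<in> places \<iota>" and y: "y \<in> val_ge P (- G P - 1)"
  obtains f where "f \<in> rr_space \<iota> (G + prime_divisor P)" "f - y \<in> val_ge P (- G P)"
proof -
  let ?n = "- G P - 1" and ?U = "rr_space \<iota> (G + prime_divisor P)"
  have G': "G + prime_divisor P \<in> divisors \<iota>" using G P by simp
  have "s (G + prime_divisor P) = smax"
    by (rule s_eq_smax_mono[OF G(1) G' _ G(2)]) (simp add: le_fun_def prime_divisor_apply)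
  hence "ell (G + prime_divisor P) = int (place_degree \<iota> P) + ell G"
    using G P by (simp add: s_def deg_add)
  hence e: "rr_dim \<iota> (G + prime_divisor P) = place_degree \<iota> P + rr_dim \<iota> G" by linarith
  have "card (lead P ?n ` ?U) * q ^ rr_dim \<iota> G = q ^ place_degree \<iota> P * q ^ rr_dim \<iota> G"
    using rr_space_step_card(2)[OF G(1) P rr_space_finite[OF G(1)]]
    by (simp only: card_rr_space[OF G(1)] card_rr_space[OF G'] e power_add)
  hence c: "card (lead P ?n ` ?U) = q ^ place_degree \<iota> P" using q_ge_2 by simp
  have "lead P ?n ` ?U = lead P ?n ` val_ge P ?n"
  proof (rule card_seteq)
    show "finite (lead P ?n ` val_ge P ?n)" by (rule lead_range(1)[OF P]) simp
    show "lead P ?n ` ?U \<subseteq> lead P ?n ` val_ge P ?n" using rr_space_step(1)[OF G(1) P] by blast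
    show "card (lead P ?n ` val_ge P ?n) \<le> card (lead P ?n ` ?U)"
      unfolding c by (rule lead_range(2)[OF P]) simp
  qed
  then obtain f where f: "f \<in> ?U" "lead P ?n y = lead P ?n f" using y by blast
  have fn: "f \<in> val_ge P ?n" using f rr_space_step(1)[OF G(1) P] by blast
  have "lead P ?n (f - y) = 0" using f lead_diff[OF P fn y] by simp
  hence "f - y \<in> val_ge P (?n + 1)"
    using lead_eq_0_iff[OF P val_ge_diff[OF P fn y]] by simp
  thus thesis using that f(1) by simp
qed

text \<open>
  The targets are enlarged by an effective divisor \<open>E\<close> that bounds their poles, and \<open>E\<close> is removed
  one place at a time with \<open>lead_surjective\<close>.
\<close>
theorem strong_approximation:
  assumes G: "G \<in> divisors \<iota>" "s G = smax" and S: "finite S" "S \<subseteq> places \<iota>"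
  obtains r where "\<And>P. P \<in> S \<Longrightarrow> r - y P \<in> val_ge P (- G P)"
    "\<And>P. P \<in> places \<iota> \<Longrightarrow> P \<notin> S \<Longrightarrow> r \<in> val_ge P (- G P)"
proof -
  have *: "\<exists>r. \<forall>P\<in>places \<iota>. r - y P \<in> val_ge P (- G P)"
    if "E \<in> divisors \<iota>" "0 \<le> E" "\<And>P. P \<in> places \<iota> \<Longrightarrow> y P \<in> val_ge P (- G P - E P)" for E y
    using that
  proof (induction arbitrary: y rule: effective_induct)
    case zero
    have "\<forall>P\<in>places \<iota>. 0 - y P \<in> val_ge P (- G P)" using zero by auto
    thus ?case by (rule exI[of _ 0])
  next
    case (add E P0)
    have GE: "G + E \<in> divisors \<iota>" using G add by simp
    have sGE: "s (G + E) = smax"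
      by (rule s_eq_smax_mono[OF G(1) GE _ G(2)]) (use add in \<open>simp add: le_fun_def\<close>)
    have "- G P0 - (E + prime_divisor P0) P0 = - (G + E) P0 - 1" by (simp add: prime_divisor_apply)
    hence "y P0 \<in> val_ge P0 (- (G + E) P0 - 1)" using add.prems[OF add.hyps(3)] by (simp only:)
    then obtain f where f: "f \<in> rr_space \<iota> (G + E + prime_divisor P0)" "f - y P0 \<in> val_ge P0 (- (G + E) P0)"
      by (rule lead_surjective[OF GE sGE add.hyps(3)])
    have GE_eq: "- (G + E) P = - G P - E P" for P by simp
    have "y P - f \<in> val_ge P (- G P - E P)" if P: "P \<in> places \<iota>" for P
    proof (cases "P = P0")
      case True
      have "- (f - y P0) \<in> val_ge P0 (- (G + E) P0)" using f(2) add.hyps(3) by (simp only: val_ge_minus)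
      thus ?thesis using True by (simp only: GE_eq minus_diff_eq)
    next
      case False
      have GEP: "G + E + prime_divisor P0 \<in> divisors \<iota>" using GE add.hyps(3) by simp
      have "- (G + E + prime_divisor P0) P = - G P - E P" "- G P - (E + prime_divisor P0) P = - G P - E P"
        using False by (simp_all add: prime_divisor_apply)
      hence "f \<in> val_ge P (- G P - E P)" "y P \<in> val_ge P (- G P - E P)"
        using f(1) P add.prems[OF P] unfolding rr_space_iff[OF GEP] by metis+
      thus ?thesis using P by (intro val_ge_diff)
    qed
    from add.IH[of "\<lambda>P. y P - f", OF this] obtain r where
      r: "\<forall>P\<in>places \<iota>. r - (y P - f) \<in> val_ge P (- G P)" by blast
    show ?case by (rule exI[of _ "r + f"]) (use r in \<open>simp add: algebra_simps\<close>)
  qed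
  let ?E = "\<lambda>P. if P \<in> S then max 0 (- P (y P) - G P) else 0"
  have E: "?E \<in> divisors \<iota>" by (rule divisorsI[OF S]) auto
  obtain r where r: "\<forall>P\<in>places \<iota>. r - (if P \<in> S then y P else 0) \<in> val_ge P (- G P)"
    using *[OF E, of "\<lambda>P. if P \<in> S then y P else 0"] by (force simp: le_fun_def val_ge_def)
  show thesis
  proof (rule that[of r])
    show "r - y P \<in> val_ge P (- G P)" if "P \<in> S" for P using r that S by (auto dest: bspec[of _ _ P])
    show "r \<in> val_ge P (- G P)" if "P \<in> places \<iota>" "P \<notin> S" for P using r that by (auto dest: bspec[of _ _ P])
  qed
qed

end

section \<open>The trace of an operator of finite rank\<close>

context constant_field
begin

definition lin :: "('f \<Rightarrow> 'f) \<Rightarrow> bool" where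
  "lin T \<longleftrightarrow> (\<forall>x y. T (x + y) = T x + T y) \<and> (\<forall>a x. T (\<iota> a * x) = \<iota> a * T x)"

text \<open>
  Functionals with values in the constants, in contrast to the operators of \<open>lin\<close>, whose values lie
  in \<open>F\<close>.
\<close>
definition linf :: "('f \<Rightarrow> 'k) \<Rightarrow> bool" where
  "linf \<phi> \<longleftrightarrow> (\<forall>x y. \<phi> (x + y) = \<phi> x + \<phi> y) \<and> (\<forall>a x. \<phi> (\<iota> a * x) = a * \<phi> x)"

lemma linD: assumes "lin T"
  shows "T (x + y) = T x + T y" "T (\<iota> a * x) = \<iota> a * T x" "T 0 = 0" "T (x - y) = T x - T y"
proof -
  show 1: "T (x + y) = T x + T y" for x y using assms by (simp add: lin_def)
  show "T (\<iota> a * x) = \<iota> a * T x" using assms by (simp add: lin_def)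
  have "T (\<iota> 0 * 0) = \<iota> 0 * T 0" using assms by (simp only: lin_def)
  thus "T 0 = 0" by simp
  show "T (x - y) = T x - T y" using 1[of "x - y" y] by simp
qed

lemma linfD: assumes "linf \<phi>"
  shows "\<phi> (x + y) = \<phi> x + \<phi> y" "\<phi> (\<iota> a * x) = a * \<phi> x" "\<phi> 0 = 0" "\<phi> (x - y) = \<phi> x - \<phi> y"
proof -
  show 1: "\<phi> (x + y) = \<phi> x + \<phi> y" for x y using assms by (simp add: linf_def)
  show "\<phi> (\<iota> a * x) = a * \<phi> x" using assms by (simp add: linf_def)
  have "\<phi> (\<iota> 0 * 0) = 0 * \<phi> 0" using assms by (simp only: linf_def)
  thus "\<phi> 0 = 0" by simp
  show "\<phi> (x - y) = \<phi> x - \<phi> y" using 1[of "x - y" y] by simp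
qed

lemma linf_sum: "linf \<phi> \<Longrightarrow> \<phi> (\<Sum>i\<in>I. f i) = (\<Sum>i\<in>I. \<phi> (f i))"
  by (induction I rule: infinite_finite_induct) (auto simp: linfD)

lemma lin_sum: "lin T \<Longrightarrow> T (\<Sum>i\<in>I. f i) = (\<Sum>i\<in>I. T (f i))"
  by (induction I rule: infinite_finite_induct) (auto simp: linD)

lemma lin_comp [intro, simp]: "lin S \<Longrightarrow> lin T \<Longrightarrow> lin (S \<circ> T)"
  and lin_add [intro, simp]: "lin S \<Longrightarrow> lin T \<Longrightarrow> lin (S + T)"
  and lin_diff [intro, simp]: "lin S \<Longrightarrow> lin T \<Longrightarrow> lin (S - T)"
  and lin_mult [intro, simp]: "lin ((*) f)"
  and lin_id [intro, simp]: "lin id"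
  by (auto simp: lin_def algebra_simps)

lemma lin_span:
  assumes T: "lin T" and x: "x \<in> k.span S"
  shows "T x \<in> k.span (T ` S)"
  using x
proof (induction rule: k.span_induct_alt)
  case base thus ?case by (simp add: linD[OF T] k.span_zero)
next
  case (step c x y)
  have "T (const_scale \<iota> c x + y) = const_scale \<iota> c (T x) + T y" by (simp add: const_scale_def linD[OF T])
  also have "\<dots> \<in> k.span (T ` S)" using step by (intro k.span_add k.span_scale) (auto intro: k.span_base)
  finally show ?case .
qed

text \<open>
  A fixed basis of \<open>F\<close> over the constants. The trace is read off from it, and \<open>tr_sum\<close> shows that
  the choice does not matter.
\<close>
definition hamel :: "'f set" where "hamel = k.extend_basis {}"

lemma hamel: "k.independent hamel" "x \<in> k.span hamel"
  unfolding hamel_def by (simp_all add: k.independent_extend_basis k.independent_empty)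

abbreviation hamel_coeff :: "'f \<Rightarrow> 'f \<Rightarrow> 'k" where "hamel_coeff \<equiv> k.representation hamel"

lemma linf_hamel_coeff: "linf (\<lambda>x. hamel_coeff x b)"
  using k.representation_add[OF hamel(1,2,2)] k.representation_scale[OF hamel]
  by (simp add: linf_def const_scale_def)

definition finrank :: "('f \<Rightarrow> 'f) \<Rightarrow> bool" where
  "finrank T \<longleftrightarrow> lin T \<and> (\<exists>S. finite S \<and> range T \<subseteq> k.span S)"

definition tr :: "('f \<Rightarrow> 'f) \<Rightarrow> 'k" where
  "tr T = (\<Sum>b\<in>{b\<in>hamel. hamel_coeff (T b) b \<noteq> 0}. hamel_coeff (T b) b)"

lemma finrank_lin: "finrank T \<Longrightarrow> lin T" by (simp add: finrank_def)

lemma finrank_expand: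
  assumes "finrank T"
  obtains J :: "'f set" and \<phi> where "finite J" "\<And>j. j \<in> J \<Longrightarrow> linf (\<phi> j)" "T = (\<lambda>x. \<Sum>j\<in>J. \<iota> (\<phi> j x) * j)"
proof -
  obtain S where S: "finite S" "range T \<subseteq> k.span S" and T: "lin T" using assms by (auto simp: finrank_def)
  obtain B where B: "B \<subseteq> S" "k.independent B" "S \<subseteq> k.span B"
    using k.maximal_independent_subset[of S] by metis
  have fB: "finite B" using B S finite_subset by blast
  have sp: "T x \<in> k.span B" for x
    using S(2) B(3) k.span_minimal[OF _ k.subspace_span, of S B] by blast
  show thesis
  proof (rule that[OF fB])
    show "linf (\<lambda>x. k.representation B (T x) j)" for j
      using k.representation_add[OF B(2) sp sp] k.representation_scale[OF B(2) sp] linD[OF T]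
      by (simp add: linf_def const_scale_def)
    show "T = (\<lambda>x. \<Sum>j\<in>B. \<iota> (k.representation B (T x) j) * j)"
      using k.sum_representation_eq[OF B(2) sp fB] by (simp add: const_scale_def)
  qed
qed

text \<open>
  The trace of a sum of operators of rank one, for arbitrary vectors \<open>u j\<close>. All properties of the
  trace below come from choosing such a representation.
\<close>
lemma tr_sum:
  assumes J: "finite J" and \<phi>: "\<And>j. j \<in> J \<Longrightarrow> linf (\<phi> j)" and T: "T = (\<lambda>x. \<Sum>j\<in>J. \<iota> (\<phi> j x) * u j)"
  shows "tr T = (\<Sum>j\<in>J. \<phi> j (u j))"
proof -
  define Z where "Z = (\<Union>j\<in>J. {b. hamel_coeff (u j) b \<noteq> 0})"
  have Z: "finite Z" "Z \<subseteq> hamel"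
    unfolding Z_def using J k.finite_representation k.representation_ne_zero by auto
  have r: "hamel_coeff (T b) c = (\<Sum>j\<in>J. \<phi> j b * hamel_coeff (u j) c)" for b c
    by (simp add: T linf_sum[OF linf_hamel_coeff] linfD(2)[OF linf_hamel_coeff])
  have u: "u j = (\<Sum>b\<in>Z. \<iota> (hamel_coeff (u j) b) * b)" if "j \<in> J" for j
  proof -
    have "u j = (\<Sum>b\<in>{b. hamel_coeff (u j) b \<noteq> 0}. \<iota> (hamel_coeff (u j) b) * b)"
      using k.sum_nonzero_representation_eq[OF hamel] by (simp add: const_scale_def)
    also have "\<dots> = (\<Sum>b\<in>Z. \<iota> (hamel_coeff (u j) b) * b)"
      by (rule sum.mono_neutral_left) (use that Z in \<open>auto simp: Z_def\<close>)
    finally show ?thesis .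
  qed
  have "tr T = (\<Sum>b\<in>Z. hamel_coeff (T b) b)"
    unfolding tr_def
  proof (rule sum.mono_neutral_left[OF Z(1)])
    show "{b \<in> hamel. hamel_coeff (T b) b \<noteq> 0} \<subseteq> Z"
    proof
      fix b assume "b \<in> {b \<in> hamel. hamel_coeff (T b) b \<noteq> 0}"
      hence "(\<Sum>j\<in>J. \<phi> j b * hamel_coeff (u j) b) \<noteq> 0" by (simp add: r)
      then obtain j where "j \<in> J" "\<phi> j b * hamel_coeff (u j) b \<noteq> 0" by (rule sum.not_neutral_contains_not_neutral)
      thus "b \<in> Z" by (auto simp: Z_def)
    qed
  qed (use Z in auto)
  also have "\<dots> = (\<Sum>j\<in>J. \<Sum>b\<in>Z. hamel_coeff (u j) b * \<phi> j b)"
    unfolding r by (subst sum.swap) (simp add: mult.commute)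
  also have "\<dots> = (\<Sum>j\<in>J. \<phi> j (u j))"
  proof (rule sum.cong[OF refl])
    fix j assume j: "j \<in> J"
    have "\<phi> j (u j) = \<phi> j (\<Sum>b\<in>Z. \<iota> (hamel_coeff (u j) b) * b)" using u[OF j] by simp
    thus "(\<Sum>b\<in>Z. hamel_coeff (u j) b * \<phi> j b) = \<phi> j (u j)"
      by (simp add: linf_sum[OF \<phi>[OF j]] linfD(2)[OF \<phi>[OF j]])
  qed
  finally show ?thesis .
qed

lemma finrankI: "lin T \<Longrightarrow> finite S \<Longrightarrow> (\<And>x. T x \<in> k.span S) \<Longrightarrow> finrank T"
  by (auto simp: finrank_def)

lemma finrank_0 [intro, simp]: "finrank 0"
  by (rule finrankI[of _ "{}"]) (auto simp: lin_def)

lemma finrank_add [intro]: assumes "finrank S" "finrank T" shows "finrank (S + T)"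
proof -
  obtain A B where "finite A" "range S \<subseteq> k.span A" "finite B" "range T \<subseteq> k.span B"
    using assms by (auto simp: finrank_def)
  thus ?thesis using assms k.span_mono[of A "A \<union> B"] k.span_mono[of B "A \<union> B"]
    by (intro finrankI[of _ "A \<union> B"]) (auto intro!: k.span_add simp: finrank_def)
qed

lemma finrank_left [intro]: assumes T: "lin T" and R: "finrank R" shows "finrank (T \<circ> R)"
proof -
  obtain A where "finite A" "range R \<subseteq> k.span A" using R by (auto simp: finrank_def)
  thus ?thesis using assms lin_span[OF T] by (intro finrankI[of _ "T ` A"]) (auto simp: finrank_def)
qed

lemma finrank_right [intro]: "lin T \<Longrightarrow> finrank R \<Longrightarrow> finrank (R \<circ> T)"
  by (auto simp: finrank_def)

lemma finrank_diff [intro]: assumes "finrank S" "finrank T" shows "finrank (S - T)"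
proof -
  have "lin (uminus :: 'f \<Rightarrow> 'f)" by (simp add: lin_def)
  from finrank_add[OF assms(1) finrank_left[OF this assms(2)]] show ?thesis
    by (simp add: fun_diff_def plus_fun_def o_def)
qed

lemma finrank_finite_diag: assumes "finrank T" shows "finite {b\<in>hamel. hamel_coeff (T b) b \<noteq> 0}"
proof -
  obtain J :: "'f set" and \<phi> where J: "finite J" "\<And>j. j \<in> J \<Longrightarrow> linf (\<phi> j)" "T = (\<lambda>x. \<Sum>j\<in>J. \<iota> (\<phi> j x) * j)"
    using finrank_expand[OF assms] by blast
  have "{b\<in>hamel. hamel_coeff (T b) b \<noteq> 0} \<subseteq> (\<Union>j\<in>J. {b. hamel_coeff j b \<noteq> 0})"
  proof
    fix b assume "b \<in> {b \<in> hamel. hamel_coeff (T b) b \<noteq> 0}"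
    hence "(\<Sum>j\<in>J. \<phi> j b * hamel_coeff j b) \<noteq> 0"
      by (simp add: J(3) linf_sum[OF linf_hamel_coeff] linfD(2)[OF linf_hamel_coeff])
    then obtain j where "j \<in> J" "\<phi> j b * hamel_coeff j b \<noteq> 0" by (rule sum.not_neutral_contains_not_neutral)
    thus "b \<in> (\<Union>j\<in>J. {b. hamel_coeff j b \<noteq> 0})" by auto
  qed
  thus ?thesis by (rule finite_subset) (use J(1) k.finite_representation in auto)
qed

lemma tr_add: assumes "finrank S" "finrank T" shows "tr (S + T) = tr S + tr T"
proof -
  let ?d = "\<lambda>T. {b\<in>hamel. hamel_coeff (T b) b \<noteq> 0}"
  let ?Z = "?d S \<union> ?d T"
  have fin: "finite ?Z" using finrank_finite_diag assms by blast
  have *: "tr R = (\<Sum>b\<in>?Z. hamel_coeff (R b) b)" if "?d R \<subseteq> ?Z" for R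
    unfolding tr_def by (rule sum.mono_neutral_left[OF fin that]) auto
  have "tr (S + T) = (\<Sum>b\<in>?Z. hamel_coeff ((S + T) b) b)"
    by (rule *) (auto simp: linfD(1)[OF linf_hamel_coeff])
  also have "\<dots> = tr S + tr T"
    using *[of S] *[of T] by (simp add: linfD(1)[OF linf_hamel_coeff] sum.distrib)
  finally show ?thesis .
qed

lemma tr_diff: assumes "finrank S" "finrank T" shows "tr (S - T) = tr S - tr T"
  using tr_add[OF finrank_diff[OF assms] assms(2)] by simp

lemma tr_0 [simp]: "tr 0 = 0"
  by (simp add: tr_def linfD(3)[OF linf_hamel_coeff])

lemma tr_commute:
  assumes R: "finrank R" and T: "lin T"
  shows "tr (T \<circ> R) = tr (R \<circ> T)"
proof -
  obtain J :: "'f set" and \<phi> where J: "finite J" "\<And>j. j \<in> J \<Longrightarrow> linf (\<phi> j)" "R = (\<lambda>x. \<Sum>j\<in>J. \<iota> (\<phi> j x) * j)"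
    using finrank_expand[OF R] by blast
  have "tr (T \<circ> R) = (\<Sum>j\<in>J. \<phi> j (T j))"
    by (rule tr_sum[OF J(1,2)]) (auto simp: J(3) o_def lin_sum[OF T] linD[OF T])
  moreover have "tr (R \<circ> T) = (\<Sum>j\<in>J. \<phi> j (T j))"
  proof (rule tr_sum[where \<phi> = "\<lambda>j x. \<phi> j (T x)" and u = "\<lambda>j. j", OF J(1)])
    show "linf (\<lambda>x. \<phi> j (T x))" if "j \<in> J" for j
      using J(2)[OF that] T by (simp add: linf_def lin_def)
  qed (auto simp: J(3))
  ultimately show ?thesis by simp
qed

section \<open>Commutators of compressions\<close>

definition commutator :: "('f \<Rightarrow> 'f) \<Rightarrow> ('f \<Rightarrow> 'f) \<Rightarrow> 'f \<Rightarrow> 'f" where "commutator W Y = (W \<circ> Y) - (Y \<circ> W)"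

lemma commutator_finrank:
  assumes "finrank R" "lin T"
  shows "finrank (commutator R T)" "tr (commutator R T) = 0" "finrank (commutator T R)" "tr (commutator T R) = 0"
proof -
  have f: "finrank (R \<circ> T)" "finrank (T \<circ> R)" using assms by auto
  show "finrank (commutator R T)" "finrank (commutator T R)" unfolding commutator_def using f by auto
  show "tr (commutator R T) = 0" "tr (commutator T R) = 0"
    unfolding commutator_def tr_diff[OF f] tr_diff[OF f(2,1)] by (simp_all add: tr_commute[OF assms])
qed

text \<open>
  Changing either operator by one of finite rank changes the commutator by commutators with an
  operator of finite rank, whose trace is zero.
\<close>
lemma commutator_cong:
  assumes l: "lin W" "lin Y" "lin W'" "lin Y'"
    and f: "finrank (W - W')" "finrank (Y - Y')" "finrank (commutator W Y)"
  shows "finrank (commutator W' Y')" "tr (commutator W' Y') = tr (commutator W Y)"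
proof -
  let ?d = "commutator (W - W') Y + commutator W' (Y - Y')"
  have d: "finrank ?d" "tr ?d = 0"
    using commutator_finrank[OF f(1) l(2)] commutator_finrank[OF f(2) l(3)] by (auto simp: tr_add)
  have eq: "commutator W' Y' = commutator W Y - ?d"
    by (rule ext) (simp add: commutator_def linD l)
  show "finrank (commutator W' Y')" unfolding eq using f(3) d(1) by (rule finrank_diff)
  show "tr (commutator W' Y') = tr (commutator W Y)" unfolding eq tr_diff[OF f(3) d(1)] using d(2) by simp
qed

definition proj :: "('f \<Rightarrow> 'f) \<Rightarrow> 'f set \<Rightarrow> bool" where
  "proj \<pi> A \<longleftrightarrow> lin \<pi> \<and> (\<forall>x. \<pi> x \<in> A) \<and> (\<forall>a\<in>A. \<pi> a = a)"

lemma projD: "proj \<pi> A \<Longrightarrow> lin \<pi>" "proj \<pi> A \<Longrightarrow> \<pi> x \<in> A" "proj \<pi> A \<Longrightarrow> a \<in> A \<Longrightarrow> \<pi> a = a"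
  by (auto simp: proj_def)

lemma proj_exists:
  assumes "k.subspace A" shows "\<exists>\<pi>. proj \<pi> A"
proof -
  interpret p: vector_space_pair "const_scale \<iota>" "const_scale \<iota>" ..
  have "Vector_Spaces.linear (const_scale \<iota>) (const_scale \<iota>) (\<lambda>x :: 'f. x)"
    by (rule k.linear_id[unfolded id_def])
  from p.linear_exists_left_inverse_on[OF this assms]
  obtain g where g: "g ` UNIV \<subseteq> A" "Vector_Spaces.linear (const_scale \<iota>) (const_scale \<iota>) g" "\<forall>v\<in>A. g v = v"
    by (auto simp: inj_on_def)
  have "lin g" using g(2) by (simp add: Vector_Spaces.linear_iff lin_def const_scale_def)
  thus ?thesis using g unfolding proj_def by blast
qed

text \<open>
  Multiplication by \<open>f\<close> maps \<open>A\<close> into \<open>A\<close> up to a space of finite dimension. This is what makes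
  commutators of compressions have finite rank.
\<close>
definition almost_stable :: "'f set \<Rightarrow> 'f \<Rightarrow> bool" where
  "almost_stable A f \<longleftrightarrow> (\<exists>S. finite S \<and> (\<forall>a\<in>A. f * a \<in> k.span (A \<union> S)))"

lemma almost_stable_mult:
  assumes "almost_stable A f" "almost_stable A g" shows "almost_stable A (f * g)"
proof -
  obtain S where S: "finite S" "\<And>a. a \<in> A \<Longrightarrow> f * a \<in> k.span (A \<union> S)"
    using assms(1) by (auto simp: almost_stable_def)
  obtain T where T: "finite T" "\<And>a. a \<in> A \<Longrightarrow> g * a \<in> k.span (A \<union> T)"
    using assms(2) by (auto simp: almost_stable_def)
  let ?W = "A \<union> (S \<union> (*) f ` T)"
  have "f * x \<in> k.span ?W" if x: "x \<in> k.span (A \<union> T)" for x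
  proof -
    have "f * x \<in> k.span ((*) f ` (A \<union> T))" using lin_span[OF lin_mult x] .
    moreover have "(*) f ` (A \<union> T) \<subseteq> k.span ?W"
    proof
      fix y assume "y \<in> (*) f ` (A \<union> T)"
      then consider a where "a \<in> A" "y = f * a" | t where "t \<in> T" "y = f * t" by blast
      thus "y \<in> k.span ?W"
      proof cases
        case 1
        thus ?thesis using S(2) k.span_mono[of "A \<union> S" ?W] by blast
      qed (auto intro: k.span_base)
    qed
    ultimately show ?thesis using k.span_minimal[OF _ k.subspace_span] by blast
  qed
  thus ?thesis unfolding almost_stable_def using S(1) T
    by (intro exI[of _ "S \<union> (*) f ` T"]) (auto simp: mult.assoc)
qed

definition compression :: "('f \<Rightarrow> 'f) \<Rightarrow> 'f \<Rightarrow> 'f \<Rightarrow> 'f" where "compression \<pi> f = \<pi> \<circ> (*) f \<circ> \<pi>"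

lemma lin_compression [intro, simp]: "lin \<pi> \<Longrightarrow> lin (compression \<pi> f)"
  unfolding compression_def by auto

lemma span_diff_kernel:
  assumes T: "lin T" and A: "\<And>a. a \<in> A \<Longrightarrow> T a = 0" and x: "x \<in> k.span (A \<union> S)"
  shows "T x \<in> k.span (T ` S)"
proof -
  have "T x \<in> k.span (T ` (A \<union> S))" by (rule lin_span[OF T x])
  moreover have "T ` (A \<union> S) \<subseteq> k.span (T ` S)" using A by (auto intro: k.span_base simp: k.span_zero)
  ultimately show ?thesis using k.span_minimal[OF _ k.subspace_span] by blast
qed

text \<open>
  The part of \<open>f A\<close> inside \<open>A\<close> is killed by \<open>T\<close>, and only finitely many dimensions are left.
\<close>
lemma finrank_vanishing:
  assumes \<pi>: "proj \<pi> A" and f: "almost_stable A f" and T: "lin T" "\<And>a. a \<in> A \<Longrightarrow> T a = 0"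
  shows "finrank (T \<circ> (*) f \<circ> \<pi>)"
proof -
  obtain S where S: "finite S" "\<And>a. a \<in> A \<Longrightarrow> f * a \<in> k.span (A \<union> S)"
    using f by (auto simp: almost_stable_def)
  show ?thesis
    by (rule finrankI[of _ "T ` S"]) (use S T \<pi> span_diff_kernel[OF T] in \<open>auto simp: proj_def\<close>)
qed

lemma finrank_defect:
  assumes \<pi>: "proj \<pi> A" and f: "almost_stable A f"
  shows "finrank ((id - \<pi>) \<circ> (*) f \<circ> \<pi>)"
  by (rule finrank_vanishing[OF \<pi> f]) (use \<pi> in \<open>auto simp: proj_def\<close>)

lemma compression_mult:
  assumes \<pi>: "proj \<pi> A"
  shows "compression \<pi> (f * g) - (compression \<pi> f \<circ> compression \<pi> g) = \<pi> \<circ> (*) f \<circ> ((id - \<pi>) \<circ> (*) g \<circ> \<pi>)"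
  by (rule ext) (simp add: compression_def linD[OF projD(1)[OF \<pi>]] projD[OF \<pi>] right_diff_distrib mult.assoc)

lemma finrank_compression_mult:
  assumes "proj \<pi> A" "almost_stable A g"
  shows "finrank (compression \<pi> (f * g) - (compression \<pi> f \<circ> compression \<pi> g))"
  unfolding compression_mult[OF assms(1)]
  by (rule finrank_left[OF lin_comp[OF projD(1)[OF assms(1)] lin_mult] finrank_defect[OF assms]])

lemma finrank_commutator:
  assumes "proj \<pi> A" "almost_stable A f" "almost_stable A g"
  shows "finrank (commutator (compression \<pi> f) (compression \<pi> g))"
proof -
  have "commutator (compression \<pi> f) (compression \<pi> g) =
      (compression \<pi> (g * f) - (compression \<pi> g \<circ> compression \<pi> f)) - (compression \<pi> (f * g) - (compression \<pi> f \<circ> compression \<pi> g))"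
    by (simp add: commutator_def mult.commute)
  thus ?thesis using finrank_compression_mult[OF assms(1)] assms by auto
qed

text \<open>
  Tate's abstract residue of \<open>f dg\<close> with respect to \<open>A\<close>. By \<open>res_eq\<close> every projection onto \<open>A\<close> gives
  the same value.
\<close>
definition res :: "'f set \<Rightarrow> 'f \<Rightarrow> 'f \<Rightarrow> 'k" where
  "res A f g = (let \<pi> = (SOME \<pi>. proj \<pi> A) in tr (commutator (compression \<pi> f) (compression \<pi> g)))"

lemma tr_eq_on_range:
  assumes \<pi>: "proj \<pi> A" and f: "finrank S" "finrank T" and A: "\<And>x. S x \<in> A" "\<And>x. T x \<in> A"
    and eq: "\<And>a. a \<in> A \<Longrightarrow> S a = T a"
  shows "tr S = tr T"
proof -
  let ?N = "S - T"
  have N: "finrank ?N" using f by auto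
  have l: "lin S" "lin T" using f by (auto simp: finrank_def)
  have "\<pi> \<circ> ?N = ?N" by (rule ext) (simp add: linD[OF projD(1)[OF \<pi>]] projD(3)[OF \<pi>] A)
  moreover have "?N \<circ> \<pi> = 0" by (rule ext) (simp add: eq projD(2)[OF \<pi>])
  ultimately have "tr ?N = 0" using tr_commute[OF N projD(1)[OF \<pi>]] by simp
  thus ?thesis using tr_diff[OF f] by simp
qed

text \<open>
  The operators \<open>\<pi> f \<rho>\<close> interpolate between two projections \<open>\<rho>\<close> and \<open>\<pi>\<close>: they differ from \<open>\<rho> f \<rho>\<close> by
  finite rank and agree with \<open>\<pi> f \<pi>\<close> on \<open>A\<close>.
\<close>
lemma res_eq:
  assumes A: "k.subspace A" and \<pi>: "proj \<pi> A" and s: "almost_stable A f" "almost_stable A g"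
  shows "res A f g = tr (commutator (compression \<pi> f) (compression \<pi> g))"
proof -
  define \<rho> where "\<rho> = (SOME \<pi>. proj \<pi> A)"
  have \<rho>: "proj \<rho> A" unfolding \<rho>_def by (rule someI_ex[OF proj_exists[OF A]])
  let ?X = "\<lambda>f. \<pi> \<circ> (*) f \<circ> \<rho>"
  note l = projD(1)[OF \<pi>] projD(1)[OF \<rho>]
  have fX: "finrank (compression \<rho> f - ?X f)" if "almost_stable A f" for f
  proof -
    have "compression \<rho> f - ?X f = (\<rho> - \<pi>) \<circ> (*) f \<circ> \<rho>" by (rule ext) (simp add: compression_def)
    thus ?thesis using finrank_vanishing[OF \<rho> that, of "\<rho> - \<pi>"] l projD(3)[OF \<pi>] projD(3)[OF \<rho>] by simp
  qed
  have lX: "lin (?X f)" for f using l by auto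
  note c = commutator_cong[OF lin_compression lin_compression lX lX fX[OF s(1)] fX[OF s(2)] finrank_commutator[OF \<rho> s], OF l(2) l(2)]
  have sub: "commutator W Y x \<in> A" if "\<And>x. W x \<in> A" "\<And>x. Y x \<in> A" for W Y x
    unfolding commutator_def using subspace_diff[OF A] that by simp
  have "tr (commutator (?X f) (?X g)) = tr (commutator (compression \<pi> f) (compression \<pi> g))"
  proof (rule tr_eq_on_range[OF \<pi> c(1) finrank_commutator[OF \<pi> s]])
    show "commutator (?X f) (?X g) a = commutator (compression \<pi> f) (compression \<pi> g) a" if "a \<in> A" for a
      by (simp add: commutator_def compression_def projD[OF \<pi>] projD[OF \<rho>] that)
  qed (auto intro!: sub simp: compression_def projD[OF \<pi>])
  thus ?thesis using c(2) unfolding res_def Let_def \<rho>_def by simp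
qed

text \<open>
  Projections onto the two spaces can be chosen so that they differ by an operator of finite rank,
  and so do the compressions.
\<close>
lemma res_commensurable:
  assumes A: "k.subspace A" and A': "k.subspace A'" and sub: "A \<subseteq> A'" "finite S" "A' \<subseteq> k.span (A \<union> S)"
    and s: "almost_stable A f" "almost_stable A g" "almost_stable A' f" "almost_stable A' g"
  shows "res A f g = res A' f g"
proof -
  obtain \<pi>' \<epsilon> where p: "proj \<pi>' A'" "proj \<epsilon> A" using proj_exists A A' by blast
  define \<pi> where "\<pi> = \<epsilon> \<circ> \<pi>'"
  note l = projD(1)[OF p(1)] projD(1)[OF p(2)]
  have \<pi>: "proj \<pi> A" unfolding \<pi>_def proj_def using p sub(1) by (auto simp: proj_def)
  have dl: "lin (\<pi>' - \<pi>)" using l projD(1)[OF \<pi>] by auto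
  have d: "finrank (\<pi>' - \<pi>)"
  proof (rule finrankI[OF dl])
    fix x
    have "\<pi>' x \<in> k.span (A \<union> S)" using projD(2)[OF p(1), of x] sub(3) by blast
    hence "(id - \<epsilon>) (\<pi>' x) \<in> k.span ((id - \<epsilon>) ` S)"
      by (rule span_diff_kernel[OF lin_diff[OF lin_id l(2)], rotated]) (simp add: projD(3)[OF p(2)])
    thus "(\<pi>' - \<pi>) x \<in> k.span ((id - \<epsilon>) ` S)" by (simp add: \<pi>_def)
  qed (use sub in auto)
  have f: "finrank (compression \<pi>' f - compression \<pi> f)" for f
  proof -
    have "compression \<pi>' f - compression \<pi> f = ((\<pi>' - \<pi>) \<circ> ((*) f \<circ> \<pi>')) + ((\<pi> \<circ> (*) f) \<circ> (\<pi>' - \<pi>))"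
      by (rule ext) (simp add: compression_def linD[OF projD(1)[OF \<pi>]] right_diff_distrib)
    moreover have "finrank ((\<pi>' - \<pi>) \<circ> ((*) f \<circ> \<pi>'))" using l d by (intro finrank_right) auto
    moreover have "finrank ((\<pi> \<circ> (*) f) \<circ> (\<pi>' - \<pi>))" using projD(1)[OF \<pi>] d by (intro finrank_left) auto
    ultimately show ?thesis by (simp add: finrank_add)
  qed
  have "tr (commutator (compression \<pi> f) (compression \<pi> g)) = tr (commutator (compression \<pi>' f) (compression \<pi>' g))"
    using l projD(1)[OF \<pi>] f finrank_commutator[OF p(1) s(3,4)] by (intro commutator_cong(2)) auto
  thus ?thesis using res_eq[OF A \<pi> s(1,2)] res_eq[OF A' p(1) s(3,4)] by simp
qed

lemma res_stable:
  assumes A: "k.subspace A" and s: "\<And>a. a \<in> A \<Longrightarrow> f * a \<in> A" "\<And>a. a \<in> A \<Longrightarrow> g * a \<in> A"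
  shows "res A f g = 0"
proof -
  obtain \<pi> where \<pi>: "proj \<pi> A" using proj_exists A by blast
  have st: "almost_stable A h" if "\<And>a. a \<in> A \<Longrightarrow> h * a \<in> A" for h
    unfolding almost_stable_def using that by (intro exI[of _ "{}"]) (auto intro: k.span_base)
  have "commutator (compression \<pi> f) (compression \<pi> g) = 0"
    by (rule ext) (simp add: commutator_def compression_def projD[OF \<pi>] s mult.left_commute)
  thus ?thesis using res_eq[OF A \<pi> st st] s by simp
qed

lemma res_add:
  assumes A: "k.subspace A" and s: "almost_stable A f" "almost_stable A g" "almost_stable A h" "almost_stable A (f + g)"
  shows "res A (f + g) h = res A f h + res A g h"
proof -
  obtain \<pi> where \<pi>: "proj \<pi> A" using proj_exists A by blast
  have "commutator (compression \<pi> (f + g)) (compression \<pi> h) = commutator (compression \<pi> f) (compression \<pi> h) + commutator (compression \<pi> g) (compression \<pi> h)"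
    by (rule ext) (simp add: commutator_def compression_def linD[OF projD(1)[OF \<pi>]] distrib_left distrib_right)
  thus ?thesis using tr_add[OF finrank_commutator[OF \<pi> s(1,3)] finrank_commutator[OF \<pi> s(2,3)]]
    res_eq[OF A \<pi> s(1,3)] res_eq[OF A \<pi> s(2,3)] res_eq[OF A \<pi> s(4,3)] by simp
qed

lemma res_anticomm:
  assumes A: "k.subspace A" and s: "almost_stable A f" "almost_stable A g"
  shows "res A f g = - res A g f"
proof -
  obtain \<pi> where \<pi>: "proj \<pi> A" using proj_exists A by blast
  have "commutator (compression \<pi> f) (compression \<pi> g) = 0 - commutator (compression \<pi> g) (compression \<pi> f)" by (simp add: commutator_def)
  hence "tr (commutator (compression \<pi> f) (compression \<pi> g)) = tr 0 - tr (commutator (compression \<pi> g) (compression \<pi> f))"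
    using tr_diff[OF finrank_0 finrank_commutator[OF \<pi> s(2,1)]] by simp
  thus ?thesis using res_eq[OF A \<pi> s] res_eq[OF A \<pi> s(2,1)] by simp
qed

text \<open>
  The three commutators \<open>[f g, h]\<close>, \<open>[g h, f]\<close> and \<open>[h f, g]\<close> add up to zero for any three
  operators. Compression respects products up to finite rank.
\<close>
lemma res_cyclic:
  assumes A: "k.subspace A" and s: "almost_stable A f" "almost_stable A g" "almost_stable A h"
  shows "res A (f * g) h + res A (g * h) f + res A (h * f) g = 0"
proof -
  obtain \<pi> where \<pi>: "proj \<pi> A" using proj_exists A by blast
  note l = projD(1)[OF \<pi>]
  let ?T = "compression \<pi>"
  have *: "finrank (commutator (?T f \<circ> ?T g) (?T h)) \<and> res A (f * g) h = tr (commutator (?T f \<circ> ?T g) (?T h))"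
    if s: "almost_stable A f" "almost_stable A g" "almost_stable A h" for f g h
  proof -
    have fg: "almost_stable A (f * g)" by (rule almost_stable_mult[OF s(1,2)])
    have z: "finrank (?T h - ?T h)" by simp
    have ll: "lin (?T f \<circ> ?T g)" "lin (?T (f * g))" "lin (?T h)" using l by auto
    note c = commutator_cong[OF ll(2) ll(3) ll(1) ll(3) finrank_compression_mult[OF \<pi> s(2)] z finrank_commutator[OF \<pi> fg s(3)]]
    show ?thesis using c res_eq[OF A \<pi> fg s(3)] by simp
  qed
  have "commutator (?T f \<circ> ?T g) (?T h) + commutator (?T g \<circ> ?T h) (?T f) + commutator (?T h \<circ> ?T f) (?T g) = 0"
    by (rule ext) (simp add: commutator_def)
  moreover note *[OF s] *[OF s(2,3,1)] *[OF s(3,1,2)]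
  ultimately show ?thesis by (metis tr_add tr_0 finrank_add)
qed

text \<open>The cyclic identity, read as the rule \<open>z d(f g) = z f dg + z g df\<close>.\<close>
lemma res_leibniz:
  assumes A: "k.subspace A" and s: "almost_stable A z" "almost_stable A f" "almost_stable A g"
  shows "res A z (f * g) = res A (z * f) g + res A (z * g) f"
proof -
  have "res A z (f * g) = - res A (f * g) z"
    by (rule res_anticomm[OF A s(1) almost_stable_mult[OF s(2,3)]])
  also have "\<dots> = res A (g * z) f + res A (z * f) g"
    using res_cyclic[OF A s(2,3,1)] by (simp add: eq_neg_iff_add_eq_0 neg_eq_iff_add_eq_0 add.assoc)
  finally show ?thesis by (simp add: mult.commute add.commute)
qed

lemma direct_proj:
  assumes A: "k.subspace A" and B: "k.subspace B" and int: "A \<inter> B = {0}" and sum: "\<And>y. \<exists>a\<in>A. y - a \<in> B"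
  shows "\<exists>\<pi>. proj \<pi> A \<and> (\<forall>y. y - \<pi> y \<in> B)"
proof -
  obtain \<pi> where \<pi>: "\<And>y. \<pi> y \<in> A \<and> y - \<pi> y \<in> B" using sum by metis
  have uniq: "\<pi> y = a" if "a \<in> A" "y - a \<in> B" for y a
  proof -
    have "\<pi> y - a \<in> A" using \<pi> that A subspace_diff by blast
    moreover have "(y - a) - (y - \<pi> y) \<in> B" using \<pi> that B subspace_diff by blast
    ultimately have "\<pi> y - a \<in> A \<inter> B" by simp
    thus ?thesis using int by simp
  qed
  have "lin \<pi>"
    unfolding lin_def
  proof (intro conjI allI uniq)
    fix x y and c
    show "\<pi> x + \<pi> y \<in> A" using k.subspace_add[OF A] \<pi> by blast
    have "(x - \<pi> x) + (y - \<pi> y) \<in> B" using k.subspace_add[OF B] \<pi> by blast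
    thus "x + y - (\<pi> x + \<pi> y) \<in> B" by (simp add: algebra_simps)
    show "\<iota> c * \<pi> x \<in> A" using k.subspace_scale[OF A, of "\<pi> x" c] \<pi> by (simp add: const_scale_def)
    have "\<iota> c * (x - \<pi> x) \<in> B" using k.subspace_scale[OF B, of "x - \<pi> x" c] \<pi> by (simp add: const_scale_def)
    thus "\<iota> c * x - \<iota> c * \<pi> x \<in> B" by (simp add: algebra_simps)
  qed
  moreover have "\<pi> a = a" if "a \<in> A" for a using that k.subspace_0[OF B] by (intro uniq) auto
  ultimately show ?thesis unfolding proj_def using \<pi> by blast
qed

text \<open>The complement of \<open>A\<close> is chosen inside \<open>B\<close>, as a complement of \<open>A \<inter> B\<close> there.\<close>
lemma complement_proj:
  assumes A: "k.subspace A" and B: "k.subspace B" and sum: "\<And>y. \<exists>a\<in>A. y - a \<in> B"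
  shows "\<exists>\<pi>. proj \<pi> A \<and> (\<forall>y. y - \<pi> y \<in> B)"
proof -
  have I: "k.subspace (A \<inter> B)" using A B by (rule k.subspace_inter)
  then obtain e where e: "proj e (A \<inter> B)" using proj_exists by blast
  let ?B = "{b \<in> B. e b = 0}"
  have B1: "k.subspace ?B"
    using B linD[OF projD(1)[OF e]] by (auto simp: k.subspace_def const_scale_def)
  have "\<exists>a\<in>A. y - a \<in> ?B" for y
  proof -
    obtain a where a: "a \<in> A" "y - a \<in> B" using sum by blast
    have "a + e (y - a) \<in> A" using a(1) projD(2)[OF e, of "y - a"] k.subspace_add[OF A] by blast
    moreover have "(y - a) - e (y - a) \<in> B"
      using a(2) projD(2)[OF e, of "y - a"] subspace_diff[OF B] by blast
    moreover have "e ((y - a) - e (y - a)) = 0"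
      using linD(4)[OF projD(1)[OF e]] projD(3)[OF e projD(2)[OF e]] by simp
    ultimately show ?thesis by (intro bexI[of _ "a + e (y - a)"]) (auto simp: algebra_simps)
  qed
  moreover have "A \<inter> ?B = {0}"
    using projD(3)[OF e] k.subspace_0[OF A] k.subspace_0[OF B] linD(3)[OF projD(1)[OF e]] by force
  ultimately obtain \<pi> where "proj \<pi> A \<and> (\<forall>y. y - \<pi> y \<in> ?B)" using direct_proj[OF A B1] by blast
  thus ?thesis by blast
qed

lemma tr_commutator:
  assumes \<pi>: "proj \<pi> A" and s: "almost_stable A f" "almost_stable A g"
  shows "tr (commutator (compression \<pi> f) (compression \<pi> g)) = tr ((*) g \<circ> ((id - \<pi>) \<circ> (*) f \<circ> \<pi>)) - tr ((*) f \<circ> ((id - \<pi>) \<circ> (*) g \<circ> \<pi>))"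
proof -
  note l = projD(1)[OF \<pi>]
  let ?D = "\<lambda>f. (id - \<pi>) \<circ> (*) f \<circ> \<pi>"
  have F: "finrank ((*) h \<circ> ?D f)" if "almost_stable A f" for f h
    using finrank_defect[OF \<pi> that] by auto
  have F': "finrank (\<pi> \<circ> ((*) h \<circ> ?D f))" if "almost_stable A f" for f h
    using F[OF that] l by auto
  have "commutator (compression \<pi> f) (compression \<pi> g) = (\<pi> \<circ> ((*) g \<circ> ?D f)) - (\<pi> \<circ> ((*) f \<circ> ?D g))"
    by (rule ext) (simp add: commutator_def compression_def linD[OF l] projD[OF \<pi>] right_diff_distrib mult.left_commute)
  moreover have "tr (\<pi> \<circ> ((*) h \<circ> ?D f)) = tr ((*) h \<circ> ?D f)" if "almost_stable A f" for f h
  proof -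
    have "((*) h \<circ> ?D f) \<circ> \<pi> = (*) h \<circ> ?D f" by (rule ext) (simp add: projD[OF \<pi>])
    thus ?thesis using tr_commute[OF F[OF that] l, of h] by simp
  qed
  ultimately show ?thesis using tr_diff[OF F'[OF s(1)] F'[OF s(2)]] s by simp
qed

text \<open>
  The space \<open>F\<close> is decomposed into \<open>A \<inter> B\<close>, a complement of it in \<open>A\<close> and one in \<open>B\<close>, with
  projections \<open>\<delta>\<close>, \<open>\<alpha>\<close> and \<open>\<beta>\<close>. All three residues become sums of traces of blocks between these
  summands. The two kinds of blocks between the complements occur only on the right hand side, and
  cancel as the trace is cyclic.
\<close>
theorem res_inter:
  assumes A: "k.subspace A" and B: "k.subspace B" and sum: "\<And>y. \<exists>a\<in>A. y - a \<in> B"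
    and s: "almost_stable A f" "almost_stable A g" "almost_stable B f" "almost_stable B g"
      "almost_stable (A \<inter> B) f" "almost_stable (A \<inter> B) g"
  shows "res (A \<inter> B) f g = res A f g + res B f g"
proof -
  have sum': "\<exists>b\<in>B. y - b \<in> A" for y
  proof -
    obtain a where "a \<in> A" "y - a \<in> B" using sum by blast
    thus ?thesis by (intro bexI[of _ "y - a"]) auto
  qed
  obtain \<pi> where \<pi>: "proj \<pi> A" "\<And>y. y - \<pi> y \<in> B" using complement_proj[OF A B sum] by blast
  obtain \<rho> where \<rho>: "proj \<rho> B" "\<And>y. y - \<rho> y \<in> A" using complement_proj[OF B A sum'] by blast
  define \<alpha> where "\<alpha> = id - \<rho>"
  define \<beta> where "\<beta> = id - \<pi>"
  define \<delta> where "\<delta> = \<pi> - \<alpha>"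
  note lp = projD(1)[OF \<pi>(1)] projD(1)[OF \<rho>(1)]
  have l: "lin \<alpha>" "lin \<beta>" "lin \<delta>" unfolding \<alpha>_def \<beta>_def \<delta>_def using lp by auto
  have ra: "\<alpha> y \<in> A" and rb: "\<beta> y \<in> B" for y using \<pi> \<rho> by (auto simp: \<alpha>_def \<beta>_def)
  have ka: "\<alpha> y = 0" if "y \<in> B" for y using projD(3)[OF \<rho>(1) that] by (simp add: \<alpha>_def)
  have kb: "\<beta> y = 0" if "y \<in> A" for y using projD(3)[OF \<pi>(1) that] by (simp add: \<beta>_def)
  have ia: "\<alpha> (\<alpha> y) = \<alpha> y" for y
    using ka[OF projD(2)[OF \<rho>(1), of y]] linD(4)[OF l(1)] by (simp add: \<alpha>_def)
  have ib: "\<beta> (\<beta> y) = \<beta> y" for y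
    using kb[OF projD(2)[OF \<pi>(1), of y]] linD(4)[OF l(2)] by (simp add: \<beta>_def)
  have d_eq: "\<delta> = \<rho> - \<beta>" by (rule ext) (simp add: \<delta>_def \<alpha>_def \<beta>_def)
  have \<delta>: "proj \<delta> (A \<inter> B)"
    unfolding proj_def
  proof (intro conjI allI ballI l IntI)
    fix x
    show "\<delta> x \<in> A" unfolding \<delta>_def using subspace_diff[OF A projD(2)[OF \<pi>(1)] ra] by simp
    show "\<delta> x \<in> B" unfolding d_eq using subspace_diff[OF B projD(2)[OF \<rho>(1)] rb] by simp
  next
    fix a assume "a \<in> A \<inter> B"
    thus "\<delta> a = a" using ka projD(3)[OF \<pi>(1)] by (simp add: \<delta>_def)
  qed
  have dB: "\<delta> x \<in> A" "\<delta> x \<in> B" for x using projD(2)[OF \<delta>] by auto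
  have bf: "finrank (\<beta> \<circ> (*) h \<circ> \<pi>)" if "almost_stable A h" for h
    using finrank_defect[OF \<pi>(1) that] by (simp add: \<beta>_def)
  have af: "finrank (\<alpha> \<circ> (*) h \<circ> \<rho>)" if "almost_stable B h" for h
    using finrank_defect[OF \<rho>(1) that] by (simp add: \<alpha>_def)
  have F1: "finrank (\<beta> \<circ> (*) h \<circ> \<alpha>)" "finrank (\<beta> \<circ> (*) h \<circ> \<delta>)" if "almost_stable A h" for h
  proof -
    have "(\<beta> \<circ> (*) h \<circ> \<pi>) \<circ> \<alpha> = \<beta> \<circ> (*) h \<circ> \<alpha>" "(\<beta> \<circ> (*) h \<circ> \<pi>) \<circ> \<delta> = \<beta> \<circ> (*) h \<circ> \<delta>"
      by (rule ext, simp add: projD(3)[OF \<pi>(1)] ra dB)+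
    thus "finrank (\<beta> \<circ> (*) h \<circ> \<alpha>)" "finrank (\<beta> \<circ> (*) h \<circ> \<delta>)"
      using finrank_right[OF l(1) bf[OF that]] finrank_right[OF l(3) bf[OF that]] by simp_all
  qed
  have F2: "finrank (\<alpha> \<circ> (*) h \<circ> \<beta>)" "finrank (\<alpha> \<circ> (*) h \<circ> \<delta>)" if "almost_stable B h" for h
  proof -
    have "(\<alpha> \<circ> (*) h \<circ> \<rho>) \<circ> \<beta> = \<alpha> \<circ> (*) h \<circ> \<beta>" "(\<alpha> \<circ> (*) h \<circ> \<rho>) \<circ> \<delta> = \<alpha> \<circ> (*) h \<circ> \<delta>"
      by (rule ext, simp add: projD(3)[OF \<rho>(1)] rb dB)+
    thus "finrank (\<alpha> \<circ> (*) h \<circ> \<beta>)" "finrank (\<alpha> \<circ> (*) h \<circ> \<delta>)"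
      using finrank_right[OF l(2) af[OF that]] finrank_right[OF l(3) af[OF that]] by simp_all
  qed
  define t where "t x y h h' = tr ((*) h' \<circ> (x \<circ> (*) h \<circ> y))" for x y :: "'f \<Rightarrow> 'f" and h h'
  have split: "tr ((*) h' \<circ> (x \<circ> (*) h \<circ> (y + z))) = t x y h h' + t x z h h'"
    if "lin x" "finrank (x \<circ> (*) h \<circ> y)" "finrank (x \<circ> (*) h \<circ> z)" for x y z h h'
  proof -
    have "(*) h' \<circ> (x \<circ> (*) h \<circ> (y + z)) = ((*) h' \<circ> (x \<circ> (*) h \<circ> y)) + ((*) h' \<circ> (x \<circ> (*) h \<circ> z))"
      by (rule ext) (simp add: linD[OF that(1)] distrib_left)
    thus ?thesis using tr_add[OF finrank_left[OF lin_mult that(2)] finrank_left[OF lin_mult that(3)]]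
      by (simp add: t_def)
  qed
  have split': "tr ((*) h' \<circ> ((x + y) \<circ> (*) h \<circ> z)) = t x z h h' + t y z h h'"
    if "finrank (x \<circ> (*) h \<circ> z)" "finrank (y \<circ> (*) h \<circ> z)" for x y z h h'
  proof -
    have "(*) h' \<circ> ((x + y) \<circ> (*) h \<circ> z) = ((*) h' \<circ> (x \<circ> (*) h \<circ> z)) + ((*) h' \<circ> (y \<circ> (*) h \<circ> z))"
      by (rule ext) (simp add: distrib_left)
    thus ?thesis using tr_add[OF finrank_left[OF lin_mult that(1)] finrank_left[OF lin_mult that(2)]]
      by (simp add: t_def)
  qed
  have p_eq: "\<pi> = \<delta> + \<alpha>" "\<rho> = \<delta> + \<beta>" "id - \<delta> = \<alpha> + \<beta>"
    by (rule ext, simp add: \<delta>_def \<alpha>_def \<beta>_def)+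
  have rA: "res A f g = t \<beta> \<delta> f g + t \<beta> \<alpha> f g - (t \<beta> \<delta> g f + t \<beta> \<alpha> g f)"
    unfolding res_eq[OF A \<pi>(1) s(1,2)] tr_commutator[OF \<pi>(1) s(1,2)] \<beta>_def[symmetric]
    unfolding p_eq(1) using split[OF l(2)] F1 s by simp
  have rB: "res B f g = t \<alpha> \<delta> f g + t \<alpha> \<beta> f g - (t \<alpha> \<delta> g f + t \<alpha> \<beta> g f)"
    unfolding res_eq[OF B \<rho>(1) s(3,4)] tr_commutator[OF \<rho>(1) s(3,4)] \<alpha>_def[symmetric]
    unfolding p_eq(2) using split[OF l(1)] F2 s by simp
  have rI: "res (A \<inter> B) f g = t \<alpha> \<delta> f g + t \<beta> \<delta> f g - (t \<alpha> \<delta> g f + t \<beta> \<delta> g f)"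
    unfolding res_eq[OF k.subspace_inter[OF A B] \<delta> s(5,6)] tr_commutator[OF \<delta> s(5,6)] p_eq(3)
    using split' F1 F2 s by simp
  have swap: "t \<beta> \<alpha> h h' = t \<alpha> \<beta> h' h" if "almost_stable A h" "almost_stable B h'" for h h'
  proof -
    let ?R = "\<beta> \<circ> (*) h \<circ> \<alpha>" and ?R' = "(*) h \<circ> (\<alpha> \<circ> (*) h' \<circ> \<beta>)"
    have "t \<beta> \<alpha> h h' = tr (((*) h' \<circ> \<beta>) \<circ> ?R)"
      unfolding t_def by (rule arg_cong[where f = tr], rule ext) (simp add: ib)
    also have "\<dots> = tr (?R \<circ> ((*) h' \<circ> \<beta>))" using F1(1)[OF that(1)] l by (intro tr_commute) auto
    also have "?R \<circ> ((*) h' \<circ> \<beta>) = \<beta> \<circ> ?R'" by (rule ext) simp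
    also have "tr (\<beta> \<circ> ?R') = tr (?R' \<circ> \<beta>)"
      using finrank_left[OF lin_mult F2(1)[OF that(2)]] l(2) by (rule tr_commute)
    also have "?R' \<circ> \<beta> = ?R'" by (rule ext) (simp add: ib)
    finally show ?thesis unfolding t_def .
  qed
  show ?thesis unfolding rA rB rI using swap[OF s(1,4)] swap[OF s(2,3)] by simp
qed

end

section \<open>The residue theorem\<close>

context function_field
begin

definition lattice :: "'f place set \<Rightarrow> ('f place \<Rightarrow> int) \<Rightarrow> 'f set" where
  "lattice S n = {x. \<forall>P\<in>S. x \<in> val_ge P (n P)}"

lemma lattice_subspace: "S \<subseteq> places \<iota> \<Longrightarrow> k.subspace (lattice S n)"
  using val_ge_subspace unfolding k.subspace_def lattice_def by blast

lemma finite_image_span: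
  fixes \<phi> :: "'f \<Rightarrow> 'b::ab_group_add"
  assumes U: "\<And>x y. x \<in> U \<Longrightarrow> y \<in> U \<Longrightarrow> x - y \<in> U"
    and \<phi>: "\<And>x y. x \<in> U \<Longrightarrow> y \<in> U \<Longrightarrow> \<phi> (x - y) = \<phi> x - \<phi> y" and fin: "finite (\<phi> ` U)"
  shows "\<exists>T. finite T \<and> U \<subseteq> k.span ({u\<in>U. \<phi> u = 0} \<union> T)"
proof -
  have "\<forall>y\<in>\<phi> ` U. \<exists>u\<in>U. \<phi> u = y" by blast
  then obtain g where g: "\<And>y. y \<in> \<phi> ` U \<Longrightarrow> g y \<in> U \<and> \<phi> (g y) = y" by metis
  have "u \<in> k.span ({u\<in>U. \<phi> u = 0} \<union> g ` \<phi> ` U)" if u: "u \<in> U" for u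
  proof -
    have gu: "g (\<phi> u) \<in> U" "\<phi> (g (\<phi> u)) = \<phi> u" using g u by auto
    have "u - g (\<phi> u) \<in> {u\<in>U. \<phi> u = 0}" using U[OF u gu(1)] \<phi>[OF u gu(1)] gu(2) by simp
    hence "u - g (\<phi> u) \<in> k.span ({u\<in>U. \<phi> u = 0} \<union> g ` \<phi> ` U)" by (intro k.span_base) blast
    moreover have "g (\<phi> u) \<in> k.span ({u\<in>U. \<phi> u = 0} \<union> g ` \<phi> ` U)" using u by (intro k.span_base) blast
    ultimately have "(u - g (\<phi> u)) + g (\<phi> u) \<in> k.span ({u\<in>U. \<phi> u = 0} \<union> g ` \<phi> ` U)" by (rule k.span_add)
    thus ?thesis by simp
  qed
  thus ?thesis using fin by (intro exI[of _ "g ` \<phi> ` U"]) auto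
qed

lemma span_trans_Un:
  assumes "A \<subseteq> k.span (B \<union> S)" "B \<subseteq> k.span (C \<union> T)" shows "A \<subseteq> k.span (C \<union> (S \<union> T))"
proof -
  have "B \<union> S \<subseteq> k.span (C \<union> (S \<union> T))"
    using assms(2) k.span_mono[of "C \<union> T" "C \<union> (S \<union> T)"] k.span_superset[of "C \<union> (S \<union> T)"] by auto
  thus ?thesis using assms(1) k.span_minimal[OF _ k.subspace_span] by blast
qed

text \<open>
  Raising one bound by one cuts out the kernel of a leading coefficient, whose values are finite in
  number.
\<close>
lemma lattice_commensurable:
  assumes S: "finite S" "S \<subseteq> places \<iota>"
  shows "\<exists>T. finite T \<and> lattice S n \<subseteq> k.span (lattice S m \<union> T)"
proof -
  have le: "\<exists>T. finite T \<and> lattice S n \<subseteq> k.span (lattice S m \<union> T)" if "\<forall>P\<in>S. n P \<le> m P" for n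
    using that
  proof (induction "\<Sum>P\<in>S. nat (m P - n P)" arbitrary: n rule: less_induct)
    case less
    show ?case
    proof (cases "\<forall>P\<in>S. n P = m P")
      case True
      hence "lattice S n = lattice S m" by (simp add: lattice_def)
      thus ?thesis using k.span_superset by (intro exI[of _ "{}"]) auto
    next
      case False
      then obtain P where P: "P \<in> S" "n P < m P" using less.prems by force
      have Pp: "P \<in> places \<iota>" using P S by auto
      define n' where "n' = n(P := n P + 1)"
      have "(\<Sum>R\<in>S. nat (m R - n' R)) < (\<Sum>R\<in>S. nat (m R - n R))"
        by (rule sum_strict_mono_ex1[OF S(1)]) (use P in \<open>auto simp: n'_def\<close>)
      moreover have "\<forall>P\<in>S. n' P \<le> m P" using less.prems P by (simp add: n'_def)
      ultimately obtain T where T: "finite T" "lattice S n' \<subseteq> k.span (lattice S m \<union> T)"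
        using less.hyps by blast
      have U: "lattice S n \<subseteq> val_ge P (n P)" using P by (auto simp: lattice_def)
      have "\<exists>T'. finite T' \<and> lattice S n \<subseteq> k.span ({u \<in> lattice S n. lead P (n P) u = 0} \<union> T')"
        by (rule finite_image_span[OF subspace_diff[OF lattice_subspace[OF S(2)]] lead_diff[OF Pp]
            lead_range(1)[OF Pp U]]) (use U in blast)+
      then obtain T' where T': "finite T'" "lattice S n \<subseteq> k.span ({u \<in> lattice S n. lead P (n P) u = 0} \<union> T')"
        by (elim exE conjE)
      have "{u \<in> lattice S n. lead P (n P) u = 0} \<subseteq> lattice S n'"
      proof
        fix u assume u: "u \<in> {u \<in> lattice S n. lead P (n P) u = 0}"
        hence "u \<in> val_ge P (n P + 1)" using lead_eq_0_iff[OF Pp, of u "n P"] U by auto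
        thus "u \<in> lattice S n'" using u by (auto simp: lattice_def n'_def)
      qed
      hence "lattice S n \<subseteq> k.span (lattice S n' \<union> T')"
        using T'(2) k.span_mono[of "{u \<in> lattice S n. lead P (n P) u = 0} \<union> T'" "lattice S n' \<union> T'"] by blast
      from span_trans_Un[OF this T(2)] show ?thesis using T(1) T'(1) by blast
    qed
  qed
  have "lattice S n \<subseteq> lattice S (\<lambda>P. min (n P) (m P))"
    unfolding lattice_def using val_ge_mono[of "min (n P) (m P)" "n P" for P] by auto
  moreover obtain T where "finite T" "lattice S (\<lambda>P. min (n P) (m P)) \<subseteq> k.span (lattice S m \<union> T)"
    using le[of "\<lambda>P. min (n P) (m P)"] by auto
  ultimately show ?thesis by blast
qed

lemma lattice_almost_stable:
  assumes S: "finite S" "S \<subseteq> places \<iota>" shows "almost_stable (lattice S n) f"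
proof (cases "f = 0")
  case True
  thus ?thesis unfolding almost_stable_def by (intro exI[of _ "{}"]) (auto simp: k.span_zero)
next
  case False
  obtain T where T: "finite T" "lattice S (\<lambda>P. n P + P f) \<subseteq> k.span (lattice S n \<union> T)"
    using lattice_commensurable[OF S] by blast
  have "f * a \<in> lattice S (\<lambda>P. n P + P f)" if a: "a \<in> lattice S n" for a
    unfolding lattice_def
  proof (intro CollectI ballI)
    fix P assume "P \<in> S"
    hence "P \<in> places \<iota>" "a \<in> val_ge P (n P)" using a S by (auto simp: lattice_def)
    thus "f * a \<in> val_ge P (n P + P f)" using val_ge_mult[of P f "P f" a "n P"] val_ge_self[of P f]
      by (simp add: add.commute)
  qed
  thus ?thesis using T unfolding almost_stable_def by blast
qed

text \<open>The residue of \<open>f dg\<close> at \<open>P\<close>.\<close>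
definition resP :: "'f place \<Rightarrow> 'f \<Rightarrow> 'f \<Rightarrow> 'k" where "resP P = res (val_ge P 0)"

lemma val_ge_lattice: "val_ge P n = lattice {P} (\<lambda>_. n)"
  by (simp add: lattice_def)

lemma val_ge_almost_stable: "P \<in> places \<iota> \<Longrightarrow> almost_stable (val_ge P n) f"
  unfolding val_ge_lattice by (rule lattice_almost_stable) auto

lemma resP_leibniz: "P \<in> places \<iota> \<Longrightarrow> resP P z (f * g) = resP P (z * f) g + resP P (z * g) f"
  unfolding resP_def by (intro res_leibniz val_ge_subspace val_ge_almost_stable)

lemma resP_anticomm: "P \<in> places \<iota> \<Longrightarrow> resP P f g = - resP P g f"
  unfolding resP_def by (intro res_anticomm val_ge_subspace val_ge_almost_stable)

lemma resP_add: "P \<in> places \<iota> \<Longrightarrow> resP P (f + g) h = resP P f h + resP P g h"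
  unfolding resP_def by (intro res_add val_ge_subspace val_ge_almost_stable)

lemma resP_add_right: "P \<in> places \<iota> \<Longrightarrow> resP P h (f + g) = resP P h f + resP P h g"
  using resP_anticomm[of P h] resP_add[of P f g h] by simp

lemma resP_regular: "P \<in> places \<iota> \<Longrightarrow> f \<in> val_ge P 0 \<Longrightarrow> g \<in> val_ge P 0 \<Longrightarrow> resP P f g = 0"
  unfolding resP_def using val_ge_mult[of P _ 0 _ 0] by (intro res_stable val_ge_subspace) auto

lemma resP_const:
  assumes P: "P \<in> places \<iota>" shows "resP P f (\<iota> a) = 0"
proof -
  obtain \<pi> where \<pi>: "proj \<pi> (val_ge P 0)" using proj_exists[OF val_ge_subspace[OF P]] by blast
  have "commutator (compression \<pi> f) (compression \<pi> (\<iota> a)) = 0"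
    by (rule ext) (simp add: commutator_def compression_def linD[OF projD(1)[OF \<pi>]] projD[OF \<pi>] mult.left_commute[of _ "\<iota> a"])
  thus ?thesis
    using res_eq[OF val_ge_subspace[OF P] \<pi> val_ge_almost_stable[OF P] val_ge_almost_stable[OF P]]
    unfolding resP_def by simp
qed

lemma resP_0 [simp]: "P \<in> places \<iota> \<Longrightarrow> resP P 0 g = 0" "P \<in> places \<iota> \<Longrightarrow> resP P g 0 = 0"
  using resP_const[of P g 0] resP_anticomm[of P 0 g] by simp_all

lemma resP_scale:
  assumes P: "P \<in> places \<iota>" shows "resP P (\<iota> a * f) g = a * resP P f g"
proof -
  obtain \<pi> where \<pi>: "proj \<pi> (val_ge P 0)" using proj_exists[OF val_ge_subspace[OF P]] by blast
  note st = val_ge_almost_stable[OF P]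
  note eq = res_eq[OF val_ge_subspace[OF P] \<pi> st st]
  let ?C = "commutator (compression \<pi> f) (compression \<pi> g)" and ?s = "(*) (\<iota> a)"
  have "commutator (compression \<pi> (\<iota> a * f)) (compression \<pi> g) = ?s \<circ> ?C"
    by (rule ext) (simp add: commutator_def compression_def linD[OF projD(1)[OF \<pi>]] projD[OF \<pi>] right_diff_distrib mult.assoc mult.left_commute[of _ "\<iota> a"])
  moreover have "tr (?s \<circ> T) = a * tr T" if fT: "finrank T" for T
  proof -
    obtain J :: "'f set" and \<phi> where J: "finite J" "\<And>j. j \<in> J \<Longrightarrow> linf (\<phi> j)" "T = (\<lambda>x. \<Sum>j\<in>J. \<iota> (\<phi> j x) * j)"
      using finrank_expand[OF fT] by blast
    have "tr T = (\<Sum>j\<in>J. \<phi> j j)" by (rule tr_sum[OF J])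
    moreover have "tr (?s \<circ> T) = (\<Sum>j\<in>J. \<phi> j (\<iota> a * j))"
      by (rule tr_sum[OF J(1,2)]) (auto simp: J(3) sum_distrib_left mult_ac)
    ultimately show ?thesis using J(2) by (simp add: linfD(2) sum_distrib_left)
  qed
  ultimately show ?thesis using eq finrank_commutator[OF \<pi> st st] unfolding resP_def by simp
qed

lemma resP_sum: "P \<in> places \<iota> \<Longrightarrow> resP P (\<Sum>i\<in>I. f i) g = (\<Sum>i\<in>I. resP P (f i) g)"
  by (induction I rule: infinite_finite_induct) (auto simp: resP_add)

lemma resP_sum_right: "P \<in> places \<iota> \<Longrightarrow> resP P g (\<Sum>i\<in>I. f i) = (\<Sum>i\<in>I. resP P g (f i))"
  by (induction I rule: infinite_finite_induct) (auto simp: resP_add_right)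

lemma resP_power: "P \<in> places \<iota> \<Longrightarrow> resP P z (f ^ n) = resP P (z * (of_nat n * f ^ (n - 1))) f"
proof (induction n arbitrary: z)
  case 0 thus ?case using resP_const[of P z 1] by simp
next
  case (Suc n)
  have "resP P z (f ^ Suc n) = resP P (z * f) (f ^ n) + resP P (z * f ^ n) f"
    using resP_leibniz[OF Suc.prems, of z f "f ^ n"] by simp
  also have "\<dots> = resP P (z * f * (of_nat n * f ^ (n - 1)) + z * f ^ n) f"
    by (simp add: Suc.IH[OF Suc.prems] resP_add[OF Suc.prems])
  also have "z * f * (of_nat n * f ^ (n - 1)) + z * f ^ n = z * (of_nat (Suc n) * f ^ (Suc n - 1))"
    by (cases n) (auto simp: algebra_simps)
  finally show ?case .
qed

text \<open>
  Weak approximation writes every function as a sum of one that is regular at \<open>P\<close> and one that is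
  regular on \<open>S\<close>, as \<open>res_inter\<close> requires.
\<close>
lemma res_lattice_sum:
  assumes "finite S" "S \<subseteq> places \<iota>"
  shows "res (lattice S (\<lambda>_. 0)) f g = (\<Sum>P\<in>S. resP P f g)"
  using assms
proof (induction S rule: finite_induct)
  case empty
  have "lattice {} (\<lambda>_. 0) = (UNIV :: 'f set)" by (simp add: lattice_def)
  thus ?case using res_stable[of UNIV f g] by simp
next
  case (insert P S)
  have P: "P \<in> places \<iota>" "S \<subseteq> places \<iota>" using insert by auto
  have eq: "lattice (insert P S) (\<lambda>_. 0) = val_ge P 0 \<inter> lattice S (\<lambda>_. 0)" by (auto simp: lattice_def)
  have "\<exists>a\<in>val_ge P 0. y - a \<in> lattice S (\<lambda>_. 0)" for y
  proof -
    have "\<exists>a. \<forall>R\<in>insert P S. a - (if R = P then 0 else y) \<in> val_ge R 0"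
      by (rule weak_approximation) (use insert in auto)
    then obtain a where a: "\<And>R. R \<in> insert P S \<Longrightarrow> a - (if R = P then 0 else y) \<in> val_ge R 0" by blast
    have "y - a \<in> val_ge R 0" if R: "R \<in> S" for R
    proof -
      have "R \<noteq> P" using R insert by auto
      hence "a - y \<in> val_ge R 0" using a[of R] R by simp
      moreover have "R \<in> places \<iota>" using R P(2) by blast
      ultimately have "- (a - y) \<in> val_ge R 0" by (simp only: val_ge_minus)
      thus ?thesis by simp
    qed
    thus ?thesis using a[of P] by (intro bexI[of _ a]) (auto simp: lattice_def)
  qed
  moreover have "almost_stable (val_ge P 0 \<inter> lattice S (\<lambda>_. 0)) h" for h
    unfolding eq[symmetric] using insert by (intro lattice_almost_stable) auto
  ultimately have "res (val_ge P 0 \<inter> lattice S (\<lambda>_. 0)) f g = resP P f g + res (lattice S (\<lambda>_. 0)) f g"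
    unfolding resP_def using P insert.hyps
    by (intro res_inter val_ge_subspace lattice_subspace val_ge_almost_stable lattice_almost_stable)
  thus ?case using insert.IH[OF P(2)] insert.hyps unfolding eq by simp
qed

lemma res_finite:
  assumes A: "k.subspace A" "finite A" shows "res A f g = 0" "almost_stable A f"
proof -
  have st: "almost_stable A f" for f
    unfolding almost_stable_def using A(2) by (intro exI[of _ "(*) f ` A"]) (auto intro: k.span_base)
  thus "almost_stable A f" .
  have z: "almost_stable {0} f" for f
    unfolding almost_stable_def by (intro exI[of _ "{}"]) (auto simp: k.span_zero)
  have "res {0} f g = res A f g"
    by (rule res_commensurable[OF k.subspace_single_0 A(1) _ A(2) _ z z st st])
       (use k.subspace_0[OF A(1)] k.span_superset[of "{0} \<union> A"] in auto)
  moreover have "res {0} f g = 0" by (rule res_stable[OF k.subspace_single_0]) auto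
  ultimately show "res A f g = 0" by simp
qed

end

context pointed_curve
begin

text \<open>
  Let \<open>A\<close> consist of the functions that are regular on \<open>S\<close>, except for a pole of bounded order at
  \<open>Q\<close>, and \<open>B\<close> of those that are regular outside \<open>S\<close> and \<open>Q\<close>. Strong approximation gives
  \<open>A + B = F\<close>, and \<open>A \<inter> B\<close> is a finite space \<open>L(G)\<close>. So the residues of \<open>A\<close> and of \<open>B\<close> add up to
  zero. The first is the sum of the local residues, and the second vanishes as \<open>f\<close> and \<open>g\<close> leave \<open>B\<close>
  stable.
\<close>
theorem residue_theorem:
  assumes S: "finite S" "S \<subseteq> places \<iota>"
    and reg: "\<And>P. P \<in> places \<iota> \<Longrightarrow> P \<notin> S \<Longrightarrow> f \<in> val_ge P 0 \<and> g \<in> val_ge P 0"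
  shows "(\<Sum>P\<in>S. resP P f g) = 0"
proof -
  define S' where "S' = insert Q S"
  have S': "finite S'" "S' \<subseteq> places \<iota>" using S by (auto simp: S'_def)
  obtain c where c: "\<And>G. G \<in> divisors \<iota> \<Longrightarrow> c \<le> deg G \<Longrightarrow> s G = smax" using s_large_degree by metis
  define n where "n = nat c"
  let ?G = "\<lambda>P. int n * prime_divisor Q P"
  have G: "?G \<in> divisors \<iota>" by (intro divisor_mult divisor_prime Q)
  \<comment> \<open>the pole allowed at \<open>Q\<close> makes the degree large enough for strong approximation\<close>
  have "s ?G = smax" by (rule c[OF G]) (simp add: deg_mult n_def)
  note sa = strong_approximation[OF G this S']
  let ?A = "lattice S' (\<lambda>P. - ?G P)" and ?B = "{h. \<forall>P\<in>places \<iota> - S'. h \<in> val_ge P 0}"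
  have B_lat: "?B = lattice (places \<iota> - S') (\<lambda>_. 0)" by (simp add: lattice_def)
  have B: "k.subspace ?B" unfolding B_lat by (rule lattice_subspace) auto
  have Bst: "f * b \<in> ?B" "g * b \<in> ?B" if "b \<in> ?B" for b
    using that reg val_ge_mult[of _ _ 0 b 0] by (auto simp: S'_def)
  have G0: "?G P = 0" if "P \<notin> S'" for P using that by (simp add: S'_def prime_divisor_apply)
  have AB: "?A \<inter> ?B = rr_space \<iota> ?G"
  proof (rule Set.set_eqI)
    fix x
    have "x \<in> ?A \<inter> ?B \<longleftrightarrow> (\<forall>P\<in>places \<iota>. x \<in> val_ge P (- ?G P))"
      unfolding lattice_def using S'(2) G0 by fastforce
    thus "x \<in> ?A \<inter> ?B \<longleftrightarrow> x \<in> rr_space \<iota> ?G" by (simp only: rr_space_iff[OF G])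
  qed
  have sum: "\<exists>a\<in>?A. y - a \<in> ?B" for y
  proof -
    obtain r where r: "\<And>P. P \<in> S' \<Longrightarrow> r - y \<in> val_ge P (- ?G P)"
      "\<And>P. P \<in> places \<iota> \<Longrightarrow> P \<notin> S' \<Longrightarrow> r \<in> val_ge P (- ?G P)"
      using sa[of "\<lambda>_. y"] by blast
    have "y - r \<in> ?A"
      unfolding lattice_def
    proof (intro CollectI ballI)
      fix P assume P: "P \<in> S'"
      hence "- (r - y) \<in> val_ge P (- ?G P)" using r(1)[OF P] S'(2) by (subst val_ge_minus) auto
      thus "y - r \<in> val_ge P (- ?G P)" by simp
    qed
    moreover have "r \<in> ?B" using r(2) G0 by auto
    ultimately show ?thesis by (intro bexI[of _ "y - r"]) auto
  qed
  have A: "k.subspace ?A" using S' by (intro lattice_subspace)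
  have fin: "k.subspace (?A \<inter> ?B)" "finite (?A \<inter> ?B)"
    unfolding AB using rr_space_subspace[OF G] rr_space_finite[OF G] by auto
  have stA: "almost_stable ?A h" for h using S' by (intro lattice_almost_stable)
  have stB: "almost_stable ?B f" "almost_stable ?B g"
    unfolding almost_stable_def using Bst
    by (intro exI[of _ "{}"] conjI ballI finite.emptyI, simp add: k.span_base)+
  have "res (?A \<inter> ?B) f g = res ?A f g + res ?B f g"
    by (rule res_inter[OF A B sum stA stA stB res_finite(2)[OF fin] res_finite(2)[OF fin]])
  moreover have "res ?B f g = 0" by (rule res_stable[OF B Bst])
  ultimately have "res ?A f g = 0" using res_finite(1)[OF fin] by simp
  moreover have "res (lattice S' (\<lambda>_. 0)) f g = res ?A f g"
  proof -
    obtain T where T: "finite T" "?A \<subseteq> k.span (lattice S' (\<lambda>_. 0) \<union> T)"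
      using lattice_commensurable[OF S'] by blast
    have "- ?G P \<le> 0" for P by (simp add: prime_divisor_apply)
    hence "lattice S' (\<lambda>_. 0) \<subseteq> ?A"
      unfolding lattice_def using val_ge_mono by blast
    thus ?thesis
      using T S' by (intro res_commensurable[OF _ A _ T] lattice_subspace lattice_almost_stable) auto
  qed
  ultimately have *: "(\<Sum>P\<in>S'. resP P f g) = 0" using res_lattice_sum[OF S'] by simp
  show ?thesis
  proof (cases "Q \<in> S")
    case False
    hence "resP Q f g = 0" using reg by (intro resP_regular) auto
    thus ?thesis using * False S(1) by (simp add: S'_def)
  next
    case True
    hence "S' = S" by (auto simp: S'_def)
    thus ?thesis using * by (simp only:)
  qed
qed

end

section \<open>Frobenius and the derivation with respect to a local parameter\<close>

context constant_field
begin

lemma of_nat_q [simp]: "of_nat q = (0 :: 'f)"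
proof -
  have "(\<Sum>c\<in>UNIV. c + 1) = (\<Sum>c\<in>UNIV. c :: 'k)"
    by (rule sum.reindex_bij_witness[of _ "\<lambda>c. c - 1" "\<lambda>c. c + 1"]) auto
  hence "of_nat CARD('k) = (0 :: 'k)" by (simp add: sum.distrib)
  thus ?thesis using iota_of_nat[of q] by (simp add: card_k)
qed

lemma power_q: "(a :: 'k) ^ q = a"
proof (cases "a = 0")
  case False
  have "(\<Prod>c\<in>UNIV - {0}. a * c) = (\<Prod>c\<in>UNIV - {0 :: 'k}. c)"
    by (rule prod.reindex_bij_witness[of _ "\<lambda>c. c / a" "\<lambda>c. a * c"]) (use False in auto)
  moreover have "(\<Prod>c\<in>UNIV - {0 :: 'k}. c) \<noteq> 0" by simp
  ultimately have "a ^ (q - 1) = 1" by (simp add: prod.distrib card_Diff_singleton card_k)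
  moreover have "a ^ q = a * a ^ (q - 1)" using q_ge_2 by (subst power_Suc[symmetric]) simp
  ultimately show ?thesis by simp
qed (use q_ge_2 in simp)

lemma iota_q: "\<iota> a ^ q = \<iota> a"
  by (simp add: power_q flip: iota_power)

text \<open>
  The two sides differ by a polynomial of degree less than \<open>q\<close> in each variable that vanishes on all
  pairs of constants.
\<close>
lemma frob_add: "(x + y :: 'f) ^ q = x ^ q + y ^ q"
proof -
  define p where "p b = [:b, 1:] ^ q - monom 1 q - [:b ^ q:]" for b :: 'f
  have eval: "poly (p b) x = (x + b) ^ q - x ^ q - b ^ q" for b x
    by (simp add: p_def poly_monom add.commute)
  have p0: "p b = 0" if "\<And>c. poly (p b) (\<iota> c) = 0" for b
  proof (rule ccontr)
    assume n: "p b \<noteq> 0"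
    have "degree (p b) \<le> q" unfolding p_def
      by (intro degree_diff_le) (auto simp: degree_linear_power degree_monom_eq)
    moreover have "coeff (p b) q = 0"
      using q_ge_2 coeff_linear_power[of b q] by (simp add: p_def coeff_pCons split: nat.splits)
    ultimately have "degree (p b) < q" using n
      by (metis le_neq_implies_less leading_coeff_0_iff)
    moreover have "q \<le> card {x. poly (p b) x = 0}"
      unfolding q_def by (rule card_mono[OF poly_roots_finite[OF n]]) (use that in auto)
    ultimately show False using card_poly_roots_bound[OF n] by simp
  qed
  have "p (\<iota> d) = 0" for d
  proof (rule p0)
    fix c
    show "poly (p (\<iota> d)) (\<iota> c) = 0"
      unfolding eval iota_add[symmetric] by (simp add: iota_q) (simp add: iota_add)
  qed
  moreover have "poly (p y) (\<iota> d) = poly (p (\<iota> d)) y" for d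
    unfolding eval by (simp add: algebra_simps)
  ultimately have "poly (p y) (\<iota> d) = 0" for d by simp
  hence "p y = 0" by (rule p0)
  thus ?thesis using eval[of y x] by (simp add: algebra_simps)
qed

lemma frob_diff: "(x - y :: 'f) ^ q = x ^ q - y ^ q"
  using frob_add[of "x - y" y] by simp

lemma sum_distinct_places:
  assumes P: "P \<in> places \<iota>"
    and "finite I" "I \<noteq> {}" "\<And>i. i \<in> I \<Longrightarrow> e i \<noteq> 0" "inj_on (\<lambda>i. P (e i)) I"
  shows "(\<Sum>i\<in>I. e i) \<noteq> 0 \<and> (\<exists>i\<in>I. P (\<Sum>i\<in>I. e i) = P (e i) \<and> (\<forall>j\<in>I. P (e i) \<le> P (e j)))"
  using assms(2-)
proof (induction I rule: finite_ne_induct)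
  case (insert x I)
  obtain i where i: "i \<in> I" "(\<Sum>i\<in>I. e i) \<noteq> 0" "P (\<Sum>i\<in>I. e i) = P (e i)" "\<forall>j\<in>I. P (e i) \<le> P (e j)"
    using insert.IH insert.prems by auto
  have ne: "P (e x) \<noteq> P (e i)" using insert.prems(2) insert.hyps i(1) by (auto simp: inj_on_def)
  have e0: "e x \<noteq> 0" using insert.prems by simp
  show ?case
  proof (cases "P (e x) < P (e i)")
    case True
    have "e x + sum e I \<noteq> 0 \<and> P (e x + sum e I) = P (e x)"
      using place_add_eq[OF P e0 i(2)] True i(3) by simp
    thus ?thesis using insert.hyps True i(4) by (intro conjI bexI[of _ x]) force+
  next
    case False
    have "sum e I + e x \<noteq> 0 \<and> P (sum e I + e x) = P (e i)"
      using place_add_eq[OF P i(2) e0] False ne i(3) by simp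
    thus ?thesis using insert.hyps False i by (intro conjI bexI[of _ i]) (auto simp: add.commute)
  qed
qed simp

text \<open>
  The combinations of \<open>1, t, \<dots>, t\<^sup>q\<^sup>-\<^sup>1\<close> with \<open>q\<close>-th powers as coefficients. By \<open>frobenius_basis\<close>
  they are all of \<open>F\<close> when \<open>t\<close> has order one somewhere.
\<close>
definition frob_comb :: "'f \<Rightarrow> (nat \<Rightarrow> 'f) \<Rightarrow> 'f" where "frob_comb t a = (\<Sum>i<q. a i ^ q * t ^ i)"

lemma frob_comb_add: "frob_comb t a + frob_comb t b = frob_comb t (\<lambda>i. a i + b i)"
  by (simp add: frob_comb_def frob_add sum.distrib distrib_right)

lemma frob_comb_diff: "frob_comb t a - frob_comb t b = frob_comb t (\<lambda>i. a i - b i)"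
  by (simp add: frob_comb_def frob_diff sum_subtractf left_diff_distrib)

lemma frob_comb_scale: "c ^ q * frob_comb t a = frob_comb t (\<lambda>i. c * a i)"
  by (simp add: frob_comb_def sum_distrib_left power_mult_distrib mult.assoc)

text \<open>
  The coefficients of \<open>t\<close> times a combination: the top term wraps around, as \<open>t\<^sup>q\<close> is a \<open>q\<close>-th
  power.
\<close>
definition shift :: "'f \<Rightarrow> (nat \<Rightarrow> 'f) \<Rightarrow> nat \<Rightarrow> 'f" where
  "shift t a i = (case i of 0 \<Rightarrow> a (q - 1) * t | Suc j \<Rightarrow> a j)"

lemma frob_comb_shift: "t * frob_comb t a = frob_comb t (shift t a)"
proof -
  obtain m where m: "q = Suc m" using q_ge_2 by (cases q) auto
  have "frob_comb t (shift t a) = (a m * t) ^ q * t ^ 0 + (\<Sum>i<m. a i ^ q * t ^ Suc i)"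
    unfolding frob_comb_def by (subst (2) m, subst sum.lessThan_Suc_shift) (simp add: shift_def m)
  also have "(a m * t) ^ q * t ^ 0 = a m ^ q * t ^ Suc m"
    by (subst m[symmetric]) (simp add: power_mult_distrib)
  also have "a m ^ q * t ^ Suc m + (\<Sum>i<m. a i ^ q * t ^ Suc i) = (\<Sum>i<q. a i ^ q * t ^ Suc i)"
    by (subst (4) m) (simp add: add.commute)
  finally show ?thesis by (simp add: frob_comb_def sum_distrib_left mult_ac)
qed

text \<open>
  The orders of the summands are congruent to their indices modulo \<open>q\<close>, so they are distinct and
  nothing cancels.
\<close>
lemma frob_comb_terms:
  assumes P: "P \<in> places \<iota>" and t: "P t = 1" and i: "i < q"
  shows "frob_comb t a = 0 \<Longrightarrow> a i = 0" "frob_comb t a \<in> val_ge P n \<Longrightarrow> a i ^ q * t ^ i \<in> val_ge P n"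
proof -
  define I where "I = {i\<in>{..<q}. a i \<noteq> 0}"
  have t0: "t \<noteq> 0" using t P by auto
  have val: "P (a i ^ q * t ^ i) = int q * P (a i) + int i" if "i \<in> I" for i
    using that t t0 P by (simp add: I_def place_mult)
  have inj: "inj_on (\<lambda>i. P (a i ^ q * t ^ i)) I"
  proof (rule inj_onI)
    fix i j assume ij: "i \<in> I" "j \<in> I" "P (a i ^ q * t ^ i) = P (a j ^ q * t ^ j)"
    hence "(int q * P (a i) + int i) mod int q = (int q * P (a j) + int j) mod int q" by (simp add: val)
    thus "i = j" using ij by (simp add: I_def)
  qed
  have eq: "frob_comb t a = (\<Sum>i\<in>I. a i ^ q * t ^ i)"
    unfolding frob_comb_def I_def by (rule sum.mono_neutral_right) (use q_ge_2 in \<open>auto simp: zero_power\<close>)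
  note sd = sum_distinct_places[OF P _ _ _ inj, folded eq]
  have fin: "finite I" by (simp add: I_def)
  show "a i = 0" if "frob_comb t a = 0"
  proof (rule ccontr)
    assume "a i \<noteq> 0"
    hence "I \<noteq> {}" using i by (auto simp: I_def)
    thus False using sd fin t0 that by (auto simp: I_def)
  qed
  show "a i ^ q * t ^ i \<in> val_ge P n" if w: "frob_comb t a \<in> val_ge P n"
  proof (cases "a i = 0")
    case False
    hence iI: "i \<in> I" using i by (simp add: I_def)
    hence "I \<noteq> {}" by blast
    then obtain j where "frob_comb t a \<noteq> 0" "j \<in> I" "P (frob_comb t a) = P (a j ^ q * t ^ j)"
      "\<forall>l\<in>I. P (a j ^ q * t ^ j) \<le> P (a l ^ q * t ^ l)"
      using sd fin t0 by (auto simp: I_def)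
    thus ?thesis using w iI by (force simp: val_ge_def)
  qed (use q_ge_2 in \<open>simp add: zero_power\<close>)
qed

end

context pointed_curve
begin

text \<open>
  The combinations form a field. If \<open>y\<close> were missing from it, the sums of a combination and \<open>y\<close>
  times a combination, with coefficients from \<open>L(n Q)\<close>, would form a space of dimension about
  \<open>2 q n\<close>. Their poles are those of a fixed divisor and of order \<open>q n\<close> at \<open>Q\<close>, which leaves room for
  about \<open>q n\<close> dimensions only.
\<close>
theorem frobenius_basis:
  assumes P: "P \<in> places \<iota>" and t: "P t = 1"
  shows "\<exists>a. y = frob_comb t a"
proof (rule ccontr)
  assume ny: "\<nexists>a. y = frob_comb t a"
  define W where "W = range (frob_comb t)"
  have t0: "t \<noteq> 0" using t P by auto
  have W_add: "u + v \<in> W" if "u \<in> W" "v \<in> W" for u v using that frob_comb_add by (auto simp: W_def)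
  have W_scale: "c ^ q * u \<in> W" if "u \<in> W" for c u using that frob_comb_scale by (auto simp: W_def)
  have W_t: "t ^ i * u \<in> W" if "u \<in> W" for i u
    using that by (induction i) (auto simp: W_def mult.assoc frob_comb_shift)
  have W_0: "0 \<in> W" unfolding W_def by (rule image_eqI[of _ _ "\<lambda>_. 0"]) (use q_ge_2 in \<open>auto simp: frob_comb_def zero_power\<close>)
  have W_sum: "sum f A \<in> W" if "\<And>i. i \<in> A \<Longrightarrow> f i \<in> W" for f and A :: "nat set"
    using that by (induction A rule: infinite_finite_induct) (auto intro: W_add W_0)
  have W_mult: "u * v \<in> W" if u: "u \<in> W" and v: "v \<in> W" for u v
  proof -
    obtain a where a: "u = frob_comb t a" using u by (auto simp: W_def)
    have "u * v = (\<Sum>i<q. a i ^ q * (t ^ i * v))" by (simp add: a frob_comb_def sum_distrib_right mult.assoc)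
    also have "\<dots> \<in> W" by (intro W_sum W_scale W_t v)
    finally show ?thesis .
  qed
  have W_1: "1 \<in> W"
  proof -
    have "(\<Sum>i<q. (if i = 0 then 1 else 0) ^ q * t ^ i) = (\<Sum>i<q. if i = 0 then 1 else (0 :: 'f))"
      by (rule sum.cong) (use q_ge_2 in \<open>auto simp: zero_power\<close>)
    also have "\<dots> = 1" using q_ge_2 by simp
    finally have w1: "frob_comb t (\<lambda>i. if i = 0 then 1 else 0) = 1" by (simp add: frob_comb_def)
    show ?thesis unfolding W_def using rangeI[of "frob_comb t" "\<lambda>i. if i = 0 then 1 else 0"] by (simp only: w1)
  qed
  have W_pow: "u ^ n \<in> W" if "u \<in> W" for u n using that by (induction n) (auto intro: W_1 W_mult)
  have W_inv: "inverse u \<in> W" if "u \<in> W" for u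
  proof (cases "u = 0")
    case False
    have "inverse u ^ q * u ^ (q - 1) \<in> W" by (intro W_scale W_pow that)
    moreover have "u ^ q = u * u ^ (q - 1)" using q_ge_2 by (subst power_Suc[symmetric]) simp
    ultimately show ?thesis using False by (simp add: power_inverse field_simps)
  qed (use W_0 in simp)
  have yW: "y \<notin> W" using ny by (auto simp: W_def)
  have indep: "a i = 0 \<and> b i = 0" if "frob_comb t a + y * frob_comb t b = 0" "i < q" for a b i
  proof -
    have "frob_comb t b = 0"
    proof (rule ccontr)
      assume n: "frob_comb t b \<noteq> 0"
      have "frob_comb t (\<lambda>i. - a i) = - frob_comb t a"
        using frob_comb_diff[of t "\<lambda>_. 0" a] frob_comb_diff[of t a a] by simp
      also have "\<dots> = y * frob_comb t b" using that(1) by (simp add: neg_eq_iff_add_eq_0)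
      finally have "y = frob_comb t (\<lambda>i. - a i) * inverse (frob_comb t b)" using n by simp
      moreover have "\<dots> \<in> W" by (intro W_mult W_inv) (auto simp: W_def)
      ultimately show False using yW by simp
    qed
    moreover hence "frob_comb t a = 0" using that(1) by simp
    ultimately show ?thesis using frob_comb_terms(1)[OF P t that(2)] by blast
  qed
  obtain C where C: "C \<in> divisors \<iota>" "0 \<le> C"
    "\<forall>x\<in>(\<lambda>i. t ^ i) ` {..<q} \<union> (\<lambda>i. y * t ^ i) ` {..<q}. \<forall>P\<in>places \<iota>. x \<in> val_ge P (- C P)"
    using common_pole_divisor[of "(\<lambda>i. t ^ i) ` {..<q} \<union> (\<lambda>i. y * t ^ i) ` {..<q}"] by blast
  have ineq: "2 * int q * (int n - smax) \<le> int q * int n + deg C + 1" for n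
  proof -
    let ?G = "\<lambda>P. int n * prime_divisor Q P"
    let ?H = "(\<lambda>P. int (q * n) * prime_divisor Q P) + C"
    have G: "?G \<in> divisors \<iota>" by (intro divisor_mult divisor_prime Q)
    have H': "(\<lambda>P. int (q * n) * prime_divisor Q P) \<in> divisors \<iota>" by (intro divisor_mult divisor_prime Q)
    have H: "?H \<in> divisors \<iota>" by (rule divisor_add[OF H' C(1)])
    let ?L = "rr_space \<iota> ?G"
    let ?D = "PiE {..<q} (\<lambda>_. ?L) \<times> PiE {..<q} (\<lambda>_. ?L)"
    let ?f = "\<lambda>(a, b). frob_comb t a + y * frob_comb t b"
    have inj: "inj_on ?f ?D"
    proof (rule inj_onI, clarify)
      fix a b a' b' assume D: "a \<in> {..<q} \<rightarrow>\<^sub>E ?L" "b \<in> {..<q} \<rightarrow>\<^sub>E ?L" "a' \<in> {..<q} \<rightarrow>\<^sub>E ?L" "b' \<in> {..<q} \<rightarrow>\<^sub>E ?L"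
        and eq: "frob_comb t a + y * frob_comb t b = frob_comb t a' + y * frob_comb t b'"
      have "frob_comb t (\<lambda>i. a i - a' i) + y * frob_comb t (\<lambda>i. b i - b' i) = 0"
        unfolding frob_comb_diff[symmetric] using eq by (simp add: algebra_simps)
      from indep[OF this] have "a i = a' i \<and> b i = b' i" if "i < q" for i using that by fastforce
      thus "a = a' \<and> b = b'" using PiE_ext[OF D(1,3)] PiE_ext[OF D(2,4)] by auto
    qed
    have sub: "?f ` ?D \<subseteq> rr_space \<iota> ?H"
    proof clarify
      fix a b assume D: "a \<in> {..<q} \<rightarrow>\<^sub>E ?L" "b \<in> {..<q} \<rightarrow>\<^sub>E ?L"
      have term_in: "a i ^ q * x \<in> rr_space \<iota> ?H"
        if "a i \<in> ?L" "\<forall>P\<in>places \<iota>. x \<in> val_ge P (- C P)" for a i x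
        unfolding rr_space_iff[OF H]
      proof
        fix R assume R: "R \<in> places \<iota>"
        have "a i \<in> val_ge R (- ?G R)" using that(1) R unfolding rr_space_iff[OF G] by blast
        hence "a i ^ q \<in> val_ge R (int q * (- ?G R))"
          using R q_ge_2 mult_left_mono[of "- ?G R" "R (a i)" "int q"] by (auto simp: val_ge_def zero_power)
        thus "a i ^ q * x \<in> val_ge R (- ?H R)"
          using that(2) R by (intro val_ge_mult'[OF R, of _ "int q * (- ?G R)" _ "- C R"]) auto
      qed
      have "?f (a, b) = (\<Sum>i<q. a i ^ q * t ^ i) + (\<Sum>i<q. b i ^ q * (y * t ^ i))"
        by (simp add: frob_comb_def sum_distrib_left mult.left_commute)
      also have "\<dots> \<in> rr_space \<iota> ?H"
        by (intro k.subspace_add[OF rr_space_subspace[OF H]] k.subspace_sum[OF rr_space_subspace[OF H]] term_in)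
           (use D C(3) in auto)
      finally show "frob_comb t a + y * frob_comb t b \<in> rr_space \<iota> ?H" by simp
    qed
    have "card ?D \<le> card (rr_space \<iota> ?H)" by (rule card_inj_on_le[OF inj sub rr_space_finite[OF H]])
    moreover have "card ?D = q ^ (2 * q * rr_dim \<iota> ?G)"
      using card_rr_space[OF G] by (simp add: card_cartesian_product card_PiE power_mult[symmetric] power_add[symmetric] mult_2 algebra_simps)
    ultimately have "2 * q * rr_dim \<iota> ?G \<le> rr_dim \<iota> ?H"
      by (simp only: card_rr_space[OF H] q_power_le_iff)
    hence "int (2 * q * rr_dim \<iota> ?G) \<le> ell ?H" by (simp only: of_nat_le_iff)
    hence "2 * int q * ell ?G \<le> ell ?H" by (simp only: of_nat_mult of_nat_numeral)
    also have "ell ?H \<le> deg ?H + 1" using C(2) by (intro ell_le_effective H) (auto simp: le_fun_def prime_divisor_apply)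
    also have "deg ?H = int (q * n) + deg C"
      unfolding deg_add[OF H' C(1)] deg_mult[OF divisor_prime[OF Q]] by simp
    finally have "2 * int q * ell ?G \<le> int q * int n + deg C + 1" by simp
    moreover have "int n - smax \<le> ell ?G"
      using smax(2)[OF G] unfolding s_def deg_mult[OF divisor_prime[OF Q]] by simp
    hence "2 * int q * (int n - smax) \<le> 2 * int q * ell ?G" by (intro mult_left_mono) auto
    ultimately show ?thesis by linarith
  qed
  define c where "c = 2 * int q * smax + deg C + 1"
  define n where "n = nat (c + 1)"
  have "int q * int n \<le> c" using ineq[of n] by (simp add: c_def algebra_simps)
  moreover have "1 * int n \<le> int q * int n" using q_ge_2 by (intro mult_right_mono) auto
  moreover have "c + 1 \<le> int n" by (simp add: n_def)
  ultimately show False by simp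
qed

text \<open>Such elements are separating, which \<open>frobenius_basis\<close> makes explicit.\<close>
definition sep :: "'f \<Rightarrow> bool" where "sep t \<longleftrightarrow> (\<exists>P\<in>places \<iota>. P t = 1)"

text \<open>
  The derivation with \<open>dt/dt = 1\<close>; it kills \<open>q\<close>-th powers. The choice of coefficients is unique, see
  \<open>ddt_frob_comb\<close>.
\<close>
definition ddt :: "'f \<Rightarrow> 'f \<Rightarrow> 'f" where
  "ddt t y = (let a = SOME a. y = frob_comb t a in \<Sum>i<q. of_nat i * a i ^ q * t ^ (i - 1))"

lemma sep_expand: "sep t \<Longrightarrow> \<exists>a. y = frob_comb t a"
  unfolding sep_def using frobenius_basis by blast

lemma ddt_frob_comb:
  assumes "sep t" shows "ddt t (frob_comb t a) = (\<Sum>i<q. of_nat i * a i ^ q * t ^ (i - 1))"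
proof -
  define b where "b = (SOME b. frob_comb t a = frob_comb t b)"
  have b: "frob_comb t a = frob_comb t b" unfolding b_def by (rule someI[where x = a]) (rule refl)
  obtain P where P: "P \<in> places \<iota>" "P t = 1" using assms by (auto simp: sep_def)
  have "frob_comb t (\<lambda>i. b i - a i) = 0" using b frob_comb_diff[of t b a] by simp
  hence "b i = a i" if "i < q" for i using frob_comb_terms(1)[OF P that] by fastforce
  thus ?thesis unfolding ddt_def Let_def b_def[symmetric] by (intro sum.cong) auto
qed

lemma ddt_add: assumes t: "sep t" shows "ddt t (x + y) = ddt t x + ddt t y"
proof -
  obtain a b where "x = frob_comb t a" "y = frob_comb t b" using sep_expand[OF t] by metis
  thus ?thesis by (simp add: frob_comb_add ddt_frob_comb[OF t] frob_add sum.distrib algebra_simps)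
qed

lemma ddt_scale: assumes t: "sep t" shows "ddt t (c ^ q * y) = c ^ q * ddt t y"
proof -
  obtain a where a: "y = frob_comb t a" using sep_expand[OF t] by metis
  show ?thesis unfolding a frob_comb_scale ddt_frob_comb[OF t]
    by (simp add: power_mult_distrib sum_distrib_left mult_ac)
qed

lemma ddt_0 [simp]: "sep t \<Longrightarrow> ddt t 0 = 0"
  using ddt_add[of t 0 0] by (metis add_0 add_left_cancel add.right_neutral)

lemma ddt_sum: "sep t \<Longrightarrow> ddt t (\<Sum>i\<in>I. f i) = (\<Sum>i\<in>I. ddt t (f i))"
  by (induction I rule: infinite_finite_induct) (auto simp: ddt_add)

text \<open>
  The Leibniz rule for the factor \<open>t\<close>. The wrap-around term of \<open>shift\<close> causes no trouble, as \<open>q = 0\<close>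
  in \<open>F\<close>.
\<close>
lemma ddt_times_param: assumes t: "sep t" shows "ddt t (t * y) = y + t * ddt t y"
proof -
  obtain a where a: "y = frob_comb t a" using sep_expand[OF t] by metis
  obtain m where m: "q = Suc m" using q_ge_2 by (cases q) auto
  have "ddt t (t * y) = (\<Sum>i<Suc m. of_nat i * shift t a i ^ q * t ^ (i - 1))"
    unfolding a frob_comb_shift ddt_frob_comb[OF t] m[symmetric] ..
  also have "\<dots> = (\<Sum>i<m. of_nat (Suc i) * a i ^ q * t ^ i)"
    by (subst sum.lessThan_Suc_shift) (simp add: shift_def)
  also have "\<dots> = (\<Sum>i<Suc m. of_nat (Suc i) * a i ^ q * t ^ i)"
  proof -
    have "of_nat (Suc m) = (0 :: 'f)" using of_nat_q unfolding m .
    thus ?thesis by (simp only: sum.lessThan_Suc mult_zero_left add_0_right)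
  qed
  also have "\<dots> = (\<Sum>i<q. a i ^ q * t ^ i) + (\<Sum>i<q. of_nat i * a i ^ q * t ^ i)"
    unfolding m[symmetric] by (simp add: distrib_right sum.distrib)
  also have "(\<Sum>i<q. of_nat i * a i ^ q * t ^ i) = t * (\<Sum>i<q. of_nat i * a i ^ q * t ^ (i - 1))"
    unfolding sum_distrib_left
  proof (rule sum.cong[OF refl])
    fix i show "of_nat i * a i ^ q * t ^ i = t * (of_nat i * a i ^ q * t ^ (i - 1))"
      by (cases i) (auto simp: mult_ac)
  qed
  finally show ?thesis by (simp add: a ddt_frob_comb[OF t] frob_comb_def[symmetric])
qed

lemma ddt_times_power: assumes t: "sep t" shows "ddt t (t ^ n * y) = of_nat n * t ^ (n - 1) * y + t ^ n * ddt t y"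
proof (induction n)
  case (Suc n)
  have "ddt t (t ^ Suc n * y) = t ^ n * y + t * (of_nat n * t ^ (n - 1) * y + t ^ n * ddt t y)"
    using ddt_times_param[OF t, of "t ^ n * y"] Suc by (simp add: mult.assoc)
  also have "\<dots> = of_nat (Suc n) * t ^ (Suc n - 1) * y + t ^ Suc n * ddt t y"
    by (cases n) (auto simp: algebra_simps)
  finally show ?case .
qed simp

lemma ddt_mult: assumes t: "sep t" shows "ddt t (x * y) = x * ddt t y + y * ddt t x"
proof -
  obtain a where a: "x = frob_comb t a" using sep_expand[OF t] by metis
  have "ddt t (x * y) = (\<Sum>i<q. a i ^ q * ddt t (t ^ i * y))"
    by (simp add: a frob_comb_def sum_distrib_right mult.assoc ddt_sum[OF t] ddt_scale[OF t])
  also have "\<dots> = (\<Sum>i<q. a i ^ q * t ^ i * ddt t y + y * (of_nat i * a i ^ q * t ^ (i - 1)))"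
    by (rule sum.cong[OF refl], subst ddt_times_power[OF t]) (simp add: algebra_simps)
  also have "\<dots> = (\<Sum>i<q. a i ^ q * t ^ i) * ddt t y + y * (\<Sum>i<q. of_nat i * a i ^ q * t ^ (i - 1))"
    by (simp add: sum_distrib_left sum_distrib_right sum.distrib)
  finally show ?thesis by (simp add: a ddt_frob_comb[OF t] frob_comb_def[symmetric])
qed

lemma ddt_1: assumes t: "sep t" shows "ddt t 1 = 0"
proof -
  have "ddt t 1 + 0 = ddt t 1 + ddt t 1" using ddt_mult[OF t, of 1 1] by simp
  thus ?thesis by (metis add_left_cancel)
qed

lemma ddt_self: assumes t: "sep t" shows "ddt t t = 1"
  using ddt_times_param[OF t, of 1] ddt_1[OF t] by simp

lemma ddt_iota: assumes t: "sep t" shows "ddt t (\<iota> a) = 0"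
  using ddt_scale[OF t, of "\<iota> a" 1] ddt_1[OF t] by (simp add: iota_q)

lemma ddt_derivation: "sep t \<Longrightarrow> ddt t \<in> derivations \<iota>"
  by (simp add: derivations_def ddt_add ddt_mult ddt_iota)

text \<open>
  Every derivation kills \<open>q\<close>-th powers, so its value at a combination is determined by its value at
  \<open>t\<close>.
\<close>
lemma derivation_eq:
  assumes \<delta>: "\<delta> \<in> derivations \<iota>" and t: "sep t" shows "\<delta> y = ddt t y * \<delta> t"
proof -
  have add: "\<delta> (x + y) = \<delta> x + \<delta> y" and mult: "\<delta> (x * y) = x * \<delta> y + y * \<delta> x" for x y
    using \<delta> by (auto simp: derivations_def)
  have c: "\<delta> (\<iota> a) = 0" for a using \<delta> by (auto simp: derivations_def)
  have pow: "\<delta> (x ^ n) = of_nat n * x ^ (n - 1) * \<delta> x" for x n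
  proof (induction n)
    case 0 thus ?case using c[of 1] by simp
  next
    case (Suc n) thus ?case by (cases n) (auto simp: mult algebra_simps)
  qed
  have sum: "\<delta> (\<Sum>i\<in>I. f i) = (\<Sum>i\<in>I. \<delta> (f i))" for f and I :: "nat set"
    using c[of 0] by (induction I rule: infinite_finite_induct) (auto simp: add)
  obtain a where a: "y = frob_comb t a" using sep_expand[OF t] by metis
  have "\<delta> y = (\<Sum>i<q. a i ^ q * \<delta> (t ^ i))"
    unfolding a frob_comb_def sum by (simp add: mult pow[of _ q])
  thus ?thesis by (simp add: a ddt_frob_comb[OF t] pow[of t] sum_distrib_left sum_distrib_right mult_ac)
qed

text \<open>The residue is a derivation in its second argument and kills \<open>q\<close>-th powers there.\<close>
lemma resP_ddt:
  assumes P: "P \<in> places \<iota>" and t: "sep t" shows "resP P z y = resP P (z * ddt t y) t"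
proof -
  obtain a where a: "y = frob_comb t a" using sep_expand[OF t] by metis
  have q: "resP P z (c ^ q) = 0" for z c using resP_power[OF P, of z c q] P by simp
  have "resP P z y = (\<Sum>i<q. resP P (z * a i ^ q) (t ^ i))"
    unfolding a frob_comb_def resP_sum_right[OF P] by (simp add: resP_leibniz[OF P] q)
  also have "\<dots> = resP P (\<Sum>i<q. z * a i ^ q * (of_nat i * t ^ (i - 1))) t"
    unfolding resP_sum[OF P] by (rule sum.cong[OF refl resP_power[OF P]])
  finally show ?thesis by (simp add: a ddt_frob_comb[OF t] sum_distrib_left mult_ac)
qed

lemma ddt_chain: "sep t \<Longrightarrow> sep x \<Longrightarrow> ddt t x * ddt x t = 1"
  using derivation_eq[OF ddt_derivation, of x t x] by (simp add: ddt_self mult.commute)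

text \<open>
  Each summand of a regular combination is regular, and a coefficient with a pole would give its
  summand a pole, since \<open>i < q\<close>.
\<close>
lemma ddt_regular:
  assumes P: "P \<in> places \<iota>" and t: "P t = 1" and y: "y \<in> val_ge P 0" shows "ddt t y \<in> val_ge P 0"
proof -
  have st: "sep t" using P t by (auto simp: sep_def)
  have t0: "t \<noteq> 0" using t P by auto
  obtain a where a: "y = frob_comb t a" using sep_expand[OF st] by metis
  show ?thesis
    unfolding a ddt_frob_comb[OF st]
  proof (rule val_ge_sum[OF P])
    fix i assume i: "i \<in> {..<q}"
    have m: "a i ^ q * t ^ i \<in> val_ge P 0" using frob_comb_terms(2)[OF P t, of i a 0] i y a by simp
    have "a i \<in> val_ge P 0"
    proof (cases "a i = 0")
      case False
      hence "0 \<le> int q * P (a i) + int i" using m t t0 P by (auto simp: val_ge_def place_mult)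
      hence "- int q < int q * P (a i)" using i by simp
      hence "int q * (- 1) < int q * P (a i)" by simp
      hence "- 1 < P (a i)" by (rule mult_left_less_imp_less) simp
      thus ?thesis by (simp add: val_ge_def)
    qed simp
    moreover have "t ^ (i - 1) \<in> val_ge P 0" using t P by (simp add: val_ge_def)
    moreover have "of_nat i \<in> val_ge P 0" using val_ge_iota[OF P, of 0 "of_nat i"] by (simp add: iota_of_nat)
    ultimately show "of_nat i * a i ^ q * t ^ (i - 1) \<in> val_ge P 0"
      using val_ge_power[OF P] val_ge_mult[OF P, of _ 0 _ 0] by simp
  qed
qed

end

section \<open>The residue at a simple pole\<close>

text \<open>
  The residue field is realised inside \<open>F\<close> by representatives, since Tate's residue is a trace on
  \<open>F\<close>.
\<close>
locale residue_field = function_field \<iota> for \<iota> :: "'k::{field,finite} \<Rightarrow> 'f::field" +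
  fixes P :: "'f place" and t :: 'f and \<pi> :: "'f \<Rightarrow> 'f"
  assumes P: "P \<in> places \<iota>" and t: "P t = 1" and \<pi>: "proj \<pi> (val_ge P 0)"
begin

lemma t0: "t \<noteq> 0" using t P by auto

abbreviation R where "R \<equiv> val_ge P 0"
abbreviation M where "M \<equiv> val_ge P 1"

lemma RM: "x \<in> R \<Longrightarrow> y \<in> M \<Longrightarrow> x * y \<in> M" "y \<in> M \<Longrightarrow> x \<in> R \<Longrightarrow> y * x \<in> M" "y \<in> M \<Longrightarrow> y \<in> R"
  "x \<in> R \<Longrightarrow> z \<in> R \<Longrightarrow> x * z \<in> R"
  using val_ge_mult[OF P, of x 0 y 1] val_ge_mult[OF P, of y 1 x 0] val_ge_mono[of 0 1 y P]
    val_ge_mult[OF P, of x 0 z 0] by simp_all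

lemma M_prime: "x \<in> R \<Longrightarrow> x \<notin> M \<Longrightarrow> x * y \<in> M \<Longrightarrow> y \<in> M"
  using val_ge_mult_iff[OF P, of x y 1] by (auto simp: val_ge_def)

text \<open>
  The difference of the projections onto \<open>R\<close> and onto \<open>t R\<close>: a projection of \<open>F\<close> onto a space of
  representatives of the residue field that vanishes on the maximal ideal.
\<close>
definition E :: "'f \<Rightarrow> 'f" where "E x = \<pi> x - t * \<pi> (\<pi> x / t)"

lemma E_lin: "lin E"
proof -
  have "E = \<pi> - ((*) t \<circ> \<pi> \<circ> (*) (inverse t) \<circ> \<pi>)"
    by (rule ext) (simp add: E_def divide_inverse mult.commute)
  thus ?thesis using projD(1)[OF \<pi>] by auto
qed

lemma E_in: "E x \<in> R"
  unfolding E_def using projD(2)[OF \<pi>] t P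
  by (intro val_ge_diff[OF P] RM(4)) (auto simp: val_ge_def)

lemma E_cong: assumes "x \<in> R" shows "x - E x \<in> M"
proof -
  have "t * \<pi> (\<pi> x / t) \<in> val_ge P (1 + 0)" by (rule val_ge_mult[OF P]) (use t projD(2)[OF \<pi>] in \<open>auto simp: val_ge_def\<close>)
  thus ?thesis using projD(3)[OF \<pi> assms] by (simp add: E_def)
qed

lemma E_M: assumes "x \<in> M" shows "E x = 0"
proof -
  have "x / t \<in> R" using assms t t0 P by (cases "x = 0") (auto simp: val_ge_def place_divide)
  thus ?thesis using projD(3)[OF \<pi>] RM(3)[OF assms] t0 by (simp add: E_def)
qed

lemma E_eqI: assumes "x - y \<in> M" shows "E x = E y"
  using E_M[OF assms] linD(4)[OF E_lin] by simp

lemma E_eq_iff: assumes "x \<in> R" "y \<in> R" shows "E x = E y \<longleftrightarrow> x - y \<in> M"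
proof
  assume "E x = E y"
  hence "x - y = (x - E x) - (y - E y)" by simp
  thus "x - y \<in> M" using val_ge_diff[OF P E_cong[OF assms(1)] E_cong[OF assms(2)]] by simp
qed (rule E_eqI)

lemma E_E [simp]: "E (E x) = E x"
proof -
  have "\<pi> (\<pi> x) = \<pi> x" using projD(3)[OF \<pi> projD(2)[OF \<pi>]] .
  hence e: "E (\<pi> x) = E x" by (simp add: E_def)
  have "E (\<pi> x) = E (E (\<pi> x))" by (rule E_eqI[OF E_cong[OF projD(2)[OF \<pi>]]])
  thus ?thesis by (simp add: e)
qed

lemma E_span: "E x \<in> k.span (E ` rbasis P)"
proof -
  have px: "\<pi> x \<in> R" by (rule projD(2)[OF \<pi>])
  have "\<pi> (\<pi> x) = \<pi> x" using projD(3)[OF \<pi> px] .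
  hence "E x = E (\<pi> x)" by (simp add: E_def)
  also have "\<dots> = E (lift P (coord P (\<pi> x)))" by (rule E_eqI[OF coord(2)[OF P px]])
  also have "\<dots> = (\<Sum>b\<in>rbasis P. const_scale \<iota> (coord P (\<pi> x) b) (E b))"
    by (simp add: lift_def lin_sum[OF E_lin] linD[OF E_lin] const_scale_def)
  also have "\<dots> \<in> k.span (E ` rbasis P)" by (intro k.span_sum k.span_scale) (auto intro: k.span_base)
  finally show ?thesis .
qed

lemma E_finrank: "lin T \<Longrightarrow> (\<And>x. T x = E (T x)) \<Longrightarrow> finrank T"
  using E_span rbasis(1)[OF P] by (intro finrankI[of T "E ` rbasis P"]) (auto, metis)

text \<open>The trace of multiplication by \<open>w\<close> on the residue field, which \<open>E\<close> realises in \<open>F\<close>.\<close>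
definition residue_trace :: "'f \<Rightarrow> 'k" where "residue_trace w = tr (E \<circ> (*) w \<circ> E)"

text \<open>
  The commutator of the compressions of \<open>w/t\<close> and \<open>t\<close> maps \<open>x \<in> R\<close> to \<open>w x - t \<pi> (w x / t)\<close>, and
  this is \<open>E (w x)\<close>.
\<close>
lemma resP_simple_pole:
  assumes w: "w \<in> R" shows "resP P (w / t) t = residue_trace w"
proof -
  have tp: "t * a \<in> R" if "a \<in> R" for a using that t by (intro RM(4)) (auto simp: val_ge_def)
  have "commutator (compression \<pi> (w / t)) (compression \<pi> t) = E \<circ> (*) w \<circ> E"
  proof
    fix x
    have px: "\<pi> x \<in> R" by (rule projD(2)[OF \<pi>])
    have "commutator (compression \<pi> (w / t)) (compression \<pi> t) x = w * \<pi> x - t * \<pi> (w * \<pi> x / t)"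
      using t0 px RM(4)[OF w px] projD(2)[OF \<pi>] by (simp add: commutator_def compression_def projD(3)[OF \<pi>] tp)
    also have "\<dots> = E (w * \<pi> x)" using RM(4)[OF w px] by (simp add: E_def projD(3)[OF \<pi>])
    also have "\<dots> = E (w * E x)"
    proof (rule E_eqI)
      have "E (\<pi> x) = E x" using projD(3)[OF \<pi> px] by (simp add: E_def)
      thus "w * \<pi> x - w * E x \<in> M" using RM(1)[OF w E_cong[OF px]] by (simp add: right_diff_distrib)
    qed
    finally show "commutator (compression \<pi> (w / t)) (compression \<pi> t) x = (E \<circ> (*) w \<circ> E) x" by simp
  qed
  thus ?thesis
    using res_eq[OF val_ge_subspace[OF P] \<pi> val_ge_almost_stable[OF P] val_ge_almost_stable[OF P]]
    by (simp add: resP_def residue_trace_def)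
qed

text \<open>At a rational place the operator has rank one.\<close>
lemma residue_trace_rational:
  assumes "rational_place \<iota> P" and w: "w \<in> R" shows "residue_trace w = eval_at \<iota> P w"
proof -
  note ev = eval_at[OF assms(1)]
  let ?\<phi> = "\<lambda>x. eval_at \<iota> P (w * E x)"
  have in_R: "w * E x \<in> R" for x by (rule RM(4)[OF w E_in])
  have "tr (E \<circ> (*) w \<circ> E) = (\<Sum>j\<in>{()}. ?\<phi> (E 1))"
  proof (rule tr_sum[where \<phi> = "\<lambda>_. ?\<phi>"])
    show "linf ?\<phi>"
      unfolding linf_def
    proof (intro conjI allI)
      fix x y c
      have "(w * E x - \<iota> (?\<phi> x)) + (w * E y - \<iota> (?\<phi> y)) \<in> M" by (intro val_ge_add[OF P] ev(1) in_R)
      thus "?\<phi> (x + y) = ?\<phi> x + ?\<phi> y"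
        by (intro ev(2) in_R) (simp add: linD[OF E_lin] iota_add algebra_simps)
      have "\<iota> c * (w * E x - \<iota> (?\<phi> x)) \<in> M" by (intro val_ge_iota_mult[OF P] ev(1) in_R)
      also have "\<iota> c * (w * E x - \<iota> (?\<phi> x)) = w * E (\<iota> c * x) - \<iota> (c * ?\<phi> x)"
        unfolding linD(2)[OF E_lin] iota_mult by (simp add: algebra_simps)
      finally show "?\<phi> (\<iota> c * x) = c * ?\<phi> x" by (intro ev(2) in_R)
    qed
    show "E \<circ> (*) w \<circ> E = (\<lambda>x. \<Sum>j\<in>{()}. \<iota> (?\<phi> x) * E 1)"
    proof
      fix x
      have "E (w * E x) = E (\<iota> (?\<phi> x) * 1)" by (rule E_eqI) (use ev(1)[OF in_R] in simp)
      thus "(E \<circ> (*) w \<circ> E) x = (\<Sum>j\<in>{()}. \<iota> (?\<phi> x) * E 1)" unfolding linD(2)[OF E_lin] by simp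
    qed
  qed simp
  also have "\<dots> = eval_at \<iota> P w"
  proof -
    have "1 - E 1 \<in> M" using P by (intro E_cong) simp
    hence "(w - \<iota> (eval_at \<iota> P w)) - w * (1 - E 1) \<in> M"
      by (intro val_ge_diff[OF P ev(1)[OF w]] RM(1)[OF w])
    hence "w * E 1 - \<iota> (eval_at \<iota> P w) \<in> M" by (simp add: algebra_simps)
    thus ?thesis using ev(2)[OF in_R, of 1] by simp
  qed
  finally show ?thesis by (simp add: residue_trace_def)
qed

section \<open>Nondegeneracy of the trace of the residue field\<close>

lemma poly_in_R: "(\<And>i. coeff p i \<in> R) \<Longrightarrow> s \<in> R \<Longrightarrow> poly p s \<in> R"
  unfolding poly_altdef by (intro val_ge_sum[OF P] RM(4) val_ge_power[OF P]) auto

lemma synthetic_div_coeff: "(\<And>i. coeff p i \<in> R) \<Longrightarrow> s \<in> R \<Longrightarrow> coeff (synthetic_div p s) i \<in> R"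
proof (induction p arbitrary: i)
  case (pCons a p)
  have "coeff p i \<in> R" for i using pCons.prems(1)[of "Suc i"] by simp
  thus ?case using pCons.IH pCons.prems(2) poly_in_R[of p s] by (cases i) auto
qed simp

text \<open>
  The bound for the number of roots of a polynomial over the residue field, in terms of
  representatives.
\<close>
lemma root_bound:
  assumes "\<And>i. coeff p i \<in> R" "lead_coeff p \<notin> M" "finite S" "S \<subseteq> R"
    "\<And>s s'. s \<in> S \<Longrightarrow> s' \<in> S \<Longrightarrow> s \<noteq> s' \<Longrightarrow> s' - s \<notin> M" "\<And>s. s \<in> S \<Longrightarrow> poly p s \<in> M"
  shows "card S \<le> degree p"
  using assms
proof (induction "degree p" arbitrary: p S)
  case 0
  then obtain a where p: "p = [:a:]" by (metis degree_eq_zeroE)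
  have "S = {}" using 0 p by force
  thus ?case by simp
next
  case (Suc n)
  show ?case
  proof (cases "S = {}")
    case False
    then obtain s where s: "s \<in> S" by blast
    have sR: "s \<in> R" using s Suc.prems by blast
    define h where "h = synthetic_div p s"
    have ph: "[:- s, 1:] * h + [:poly p s:] = p" unfolding h_def by (rule synthetic_div_correct')
    have dh: "degree h = n" unfolding h_def degree_synthetic_div using Suc.hyps(2) by simp
    have h0: "h \<noteq> 0" using Suc.hyps(2) ph by (metis add_0 degree_pCons_0 mult_zero_right nat.distinct(1))
    have "degree ([:- s, 1:] * h) = Suc n" using h0 dh by (subst degree_mult_eq) auto
    hence "lead_coeff p = coeff ([:- s, 1:] * h + [:poly p s:]) (Suc n)"
      using ph Suc.hyps(2) by simp
    also have "\<dots> = lead_coeff ([:- s, 1:] * h)" using \<open>degree ([:- s, 1:] * h) = Suc n\<close> by simp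
    also have "\<dots> = lead_coeff h" by (subst lead_coeff_mult) simp
    finally have lead: "lead_coeff h \<notin> M" using Suc.prems(2) by simp
    have "card (S - {s}) \<le> degree h"
    proof (rule Suc.hyps(1)[OF dh[symmetric] _ lead])
      show "coeff h i \<in> R" for i unfolding h_def using Suc.prems(1) sR by (rule synthetic_div_coeff)
      fix s' assume s': "s' \<in> S - {s}"
      have ne: "s' - s \<notin> M" using Suc.prems(5)[of s s'] s s' by auto
      have s'R: "s' \<in> R" using s' Suc.prems(4) by blast
      have "poly p s' = (s' - s) * poly h s' + poly p s" using arg_cong[OF ph, of "\<lambda>p. poly p s'"] by (simp add: algebra_simps)
      hence "(s' - s) * poly h s' = poly p s' - poly p s" by simp
      also have "\<dots> \<in> M" using Suc.prems(6) s s' by (intro val_ge_diff[OF P]) auto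
      finally show "poly h s' \<in> M" using M_prime[OF val_ge_diff[OF P s'R sR] ne] by blast
    qed (use Suc.prems in auto)
    thus ?thesis using s Suc.hyps(2) Suc.prems(3) dh by simp
  qed simp
qed

text \<open>One representative for each residue class.\<close>
definition K where "K = E ` R"

lemma K_card: "finite K" "card K = q ^ place_degree \<iota> P"
proof -
  let ?D = "PiE (rbasis P) (\<lambda>_. UNIV :: 'k set)"
  let ?z = "\<lambda>c b. if b \<in> rbasis P then c b else (0 :: 'k)"
  have ls: "lift P (?z c) = lift P c" for c unfolding lift_def by (rule sum.cong) auto
  have "bij_betw (\<lambda>c. E (lift P c)) ?D K"
  proof (rule bij_betwI')
    fix c d assume c: "c \<in> ?D" and d: "d \<in> ?D"
    show "(E (lift P c) = E (lift P d)) = (c = d)"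
    proof
      assume "E (lift P c) = E (lift P d)"
      hence "lift P (?z c) - lift P (?z d) \<in> M" unfolding ls using E_eq_iff lift_in[OF P] by blast
      hence m: "lift P (?z c - ?z d) \<in> M" by (simp only: lift_diff[OF P])
      have "coord P (lift P (?z c - ?z d)) = ?z c - ?z d"
        by (rule coord_eqI[OF P lift_in[OF P]]) auto
      moreover have "coord P (lift P (?z c - ?z d)) = 0"
        using m by (subst coord_eq_0_iff[OF P lift_in[OF P]])
      ultimately have "?z c - ?z d = 0" by (simp only:)
      hence z: "(?z c - ?z d) b = 0" for b by (simp only: zero_fun_apply)
      have "c b = d b" if "b \<in> rbasis P" for b using z[of b] that by simp
      thus "c = d" by (intro PiE_ext[OF c d]) auto
    qed simp
  next
    fix c show "E (lift P c) \<in> K" unfolding K_def using lift_in[OF P] by blast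
  next
    fix y assume "y \<in> K"
    then obtain x where x: "x \<in> R" "y = E x" by (auto simp: K_def)
    have "y = E (lift P (coord P x))" using E_eqI[OF coord(2)[OF P x(1)]] x(2) by simp
    also have "lift P (coord P x) = lift P (restrict (coord P x) (rbasis P))"
      unfolding lift_def by (rule sum.cong) auto
    finally show "\<exists>c\<in>?D. y = E (lift P c)" by (intro bexI[of _ "restrict (coord P x) (rbasis P)"]) auto
  qed
  moreover have "finite ?D" "card ?D = q ^ place_degree \<iota> P"
    using rbasis(1,3)[OF P] by (auto simp: card_PiE card_k intro!: finite_PiE)
  ultimately show "finite K" "card K = q ^ place_degree \<iota> P"
    using bij_betw_finite bij_betw_same_card by metis+
qed

lemma K_R: "K \<subseteq> R" using E_in by (auto simp: K_def)

lemma K_E: "r \<in> K \<Longrightarrow> E r = r" by (auto simp: K_def)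

lemma K_incongruent: "r \<in> K \<Longrightarrow> r' \<in> K \<Longrightarrow> r \<noteq> r' \<Longrightarrow> r' - r \<notin> M"
  using E_eqI[of r' r] K_E by auto

lemma prod_cong_M:
  assumes "\<And>i. i \<in> I \<Longrightarrow> f i \<in> R \<and> g i \<in> R \<and> f i - g i \<in> M"
  shows "(\<Prod>i\<in>I. f i) - (\<Prod>i\<in>I. g i) \<in> M \<and> (\<Prod>i\<in>I. f i) \<in> R \<and> (\<Prod>i\<in>I. g i) \<in> R"
  using assms
proof (induction I rule: infinite_finite_induct)
  case (insert x I)
  let ?f = "\<Prod>i\<in>I. f i" and ?g = "\<Prod>i\<in>I. g i"
  have IH: "?f - ?g \<in> M" "?f \<in> R" "?g \<in> R" using insert by auto
  have x: "f x \<in> R" "g x \<in> R" "f x - g x \<in> M" using insert.prems by auto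
  have "f x * (?f - ?g) + (f x - g x) * ?g \<in> M"
    by (rule val_ge_add[OF P RM(1)[OF x(1) IH(1)] RM(2)[OF x(3) IH(3)]])
  thus ?case using insert.hyps IH x by (auto simp: algebra_simps intro: RM(4))
qed (use P in auto)

lemma prod_unit:
  assumes "\<And>i. i \<in> I \<Longrightarrow> f i \<in> R \<and> f i \<notin> M"
  shows "(\<Prod>i\<in>I. f i) \<in> R \<and> (\<Prod>i\<in>I. f i) \<notin> M"
proof -
  have "1 \<in> R \<and> 1 \<notin> M" using P by (simp add: val_ge_def)
  thus ?thesis using assms
  proof (induction I rule: infinite_finite_induct)
    case (insert x I)
    hence x: "f x \<in> R" "f x \<notin> M" and I: "(\<Prod>i\<in>I. f i) \<in> R" "(\<Prod>i\<in>I. f i) \<notin> M" by auto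
    show ?case using RM(4)[OF x(1) I(1)] M_prime[OF x] I(2) insert.hyps by auto
  qed auto
qed

lemma power_cong_M: "x \<in> R \<Longrightarrow> y \<in> R \<Longrightarrow> x - y \<in> M \<Longrightarrow> x ^ n - y ^ n \<in> M"
  using prod_cong_M[of "{..<n}" "\<lambda>_. x" "\<lambda>_. y"] by simp

text \<open>
  Multiplication by a unit permutes the nonzero residue classes, so their product does not change.
\<close>
lemma residue_power_card:
  assumes x: "x \<in> R" shows "x ^ (q ^ place_degree \<iota> P) - x \<in> M"
proof (cases "x \<in> M")
  case True
  obtain n where n: "q ^ place_degree \<iota> P = Suc n" using q_ge_2 by (cases "q ^ place_degree \<iota> P") auto
  have "x * x ^ n \<in> M" using True RM(2)[OF True val_ge_power[OF P x]] by simp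
  thus ?thesis using True val_ge_diff[OF P] by (simp add: n)
next
  case False
  let ?K = "K - {0}"
  have K0: "r \<notin> M" if "r \<in> ?K" for r using that E_M[of r] K_E[of r] by auto
  have zK: "0 \<in> K" unfolding K_def by (rule image_eqI[of _ _ 0]) (simp_all add: linD[OF E_lin])
  have xr: "x * r \<in> R" if "r \<in> ?K" for r using x K_R that by (intro RM(4)) auto
  have map: "E (x * r) \<in> ?K" if "r \<in> ?K" for r
  proof -
    have "E (x * r) \<noteq> 0"
    proof
      assume "E (x * r) = 0"
      hence "x * r \<in> M" using E_cong[OF xr[OF that]] by simp
      thus False using M_prime[OF x False] K0[OF that] by blast
    qed
    thus ?thesis using xr[OF that] by (simp add: K_def)
  qed
  have inj: "inj_on (\<lambda>r. E (x * r)) ?K"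
  proof (rule inj_onI)
    fix r r' assume r: "r \<in> ?K" "r' \<in> ?K" "E (x * r) = E (x * r')"
    hence "x * (r - r') \<in> M" using E_eq_iff[OF xr xr] by (simp add: right_diff_distrib)
    hence "r - r' \<in> M" using M_prime[OF x False] by blast
    thus "r = r'" using K_incongruent[of r' r] r by auto
  qed
  have fin: "finite ?K" using K_card by simp
  have img: "(\<lambda>r. E (x * r)) ` ?K = ?K"
    by (rule card_subset_eq[OF fin]) (use map inj in \<open>auto simp: card_image\<close>)
  have "(\<Prod>r\<in>?K. r) = (\<Prod>r\<in>?K. E (x * r))"
    using prod.reindex[OF inj, of "\<lambda>r. r"] by (simp add: img)
  moreover have "(\<Prod>r\<in>?K. x * r) - (\<Prod>r\<in>?K. E (x * r)) \<in> M"
    using prod_cong_M[of ?K "\<lambda>r. x * r" "\<lambda>r. E (x * r)"] xr E_in E_cong by blast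
  ultimately have "x ^ card ?K * (\<Prod>r\<in>?K. r) - (\<Prod>r\<in>?K. r) \<in> M" by (simp add: prod.distrib)
  hence "(\<Prod>r\<in>?K. r) * (x ^ card ?K - 1) \<in> M" by (simp add: algebra_simps)
  moreover have "(\<Prod>r\<in>?K. r) \<in> R \<and> (\<Prod>r\<in>?K. r) \<notin> M"
    by (rule prod_unit) (use K0 K_R in auto)
  ultimately have "x ^ card ?K - 1 \<in> M" using M_prime by blast
  hence "x * (x ^ card ?K - 1) \<in> M" by (rule RM(1)[OF x])
  moreover have "Suc (card ?K) = q ^ place_degree \<iota> P" using card.remove[OF K_card(1) zK] K_card(2) by simp
  ultimately show ?thesis by (simp add: right_diff_distrib flip: power_Suc)
qed

lemma frob_pow_add: "(x + y :: 'f) ^ (q ^ i) = x ^ (q ^ i) + y ^ (q ^ i)"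
proof (induction i)
  case (Suc i)
  have "(x + y) ^ (q ^ Suc i) = ((x + y) ^ (q ^ i)) ^ q" by (simp flip: power_mult add: mult.commute)
  thus ?case by (simp add: Suc frob_add flip: power_mult) (simp add: mult.commute)
qed simp

lemma iota_pow: "\<iota> a ^ (q ^ i) = \<iota> a"
proof (induction i)
  case (Suc i)
  have "\<iota> a ^ (q ^ Suc i) = (\<iota> a ^ (q ^ i)) ^ q" by (simp flip: power_mult add: mult.commute)
  thus ?case by (simp add: Suc iota_q)
qed simp

text \<open>The trace polynomial of the residue field, the sum of the powers of Frobenius.\<close>
definition T :: "'f \<Rightarrow> 'f" where "T x = (\<Sum>i<place_degree \<iota> P. x ^ (q ^ i))"

lemma T_lin: "lin T"
  by (simp add: lin_def T_def frob_pow_add sum.distrib power_mult_distrib iota_pow sum_distrib_left)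

lemma T_in: "x \<in> R \<Longrightarrow> T x \<in> R"
  unfolding T_def by (intro val_ge_sum[OF P] val_ge_power[OF P])

lemma T_cong: "x \<in> R \<Longrightarrow> y \<in> R \<Longrightarrow> x - y \<in> M \<Longrightarrow> T x - T y \<in> M"
  unfolding T_def sum_subtractf[symmetric] by (intro val_ge_sum[OF P] power_cong_M)

lemma frobenius_poly:
  assumes "2 \<le> n"
  defines "p \<equiv> monom (1 :: 'f) n - monom 1 1"
  shows "coeff p i \<in> R" "lead_coeff p \<notin> M" "degree p = n" "poly p x = x ^ n - x"
proof -
  show "poly p x = x ^ n - x" by (simp add: p_def poly_monom)
  have "degree (monom (1 :: 'f) 1) < degree (monom (1 :: 'f) n)" using assms(1) by (simp add: degree_monom_eq)
  hence d: "degree p = n" unfolding p_def using degree_add_eq_left[of "- monom (1 :: 'f) 1" "monom 1 n"] by (simp add: degree_monom_eq)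
  thus "degree p = n" .
  show "lead_coeff p \<notin> M" unfolding d using assms(1) P by (simp add: p_def val_ge_def)
  show "coeff p i \<in> R" unfolding p_def using P by (auto simp: val_ge_def)
qed

text \<open>The constants already are \<open>q\<close> roots of \<open>x\<^sup>q - x\<close> in the residue field.\<close>
lemma residue_const:
  assumes y: "y \<in> R" "y ^ q - y \<in> M" shows "\<exists>c. y - \<iota> c \<in> M"
proof (rule ccontr)
  assume n: "\<not> ?thesis"
  let ?S = "insert y (range \<iota>)"
  have m: "\<iota> c - y \<notin> M" for c
    using n val_ge_minus[OF P, of "y - \<iota> c" 1] by auto
  have c: "\<iota> a - \<iota> b \<notin> M" if "a \<noteq> b" for a b
    unfolding iota_diff[symmetric] using that P by (simp add: val_ge_def)
  have "card ?S \<le> degree (monom (1 :: 'f) q - monom 1 1)"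
  proof (rule root_bound)
    show "?S \<subseteq> R" using y P by auto
    show "s' - s \<notin> M" if "s \<in> ?S" "s' \<in> ?S" "s \<noteq> s'" for s s' using that n m c by auto
  qed (use frobenius_poly[OF q_ge_2] y in \<open>auto simp: iota_q\<close>)
  also have "\<dots> = q" by (rule frobenius_poly(3)[OF q_ge_2])
  also have "card ?S = Suc q"
  proof -
    have "y \<noteq> \<iota> c" for c using m[of c] by auto
    hence "y \<notin> range \<iota>" by blast
    thus ?thesis by (simp add: q_def)
  qed
  finally show False by simp
qed

lemma T_const: assumes x: "x \<in> R" shows "\<exists>c. T x - \<iota> c \<in> M"
proof (rule residue_const[OF T_in[OF x]])
  have fs: "(\<Sum>i\<in>I. f i :: 'f) ^ q = (\<Sum>i\<in>I. f i ^ q)" for f and I :: "nat set"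
    using q_ge_2 by (induction I rule: infinite_finite_induct) (auto simp: frob_add zero_power)
  obtain d where d: "place_degree \<iota> P = Suc d" using place_degree_pos[OF P] by (cases "place_degree \<iota> P") auto
  have "T x ^ q = (\<Sum>i<place_degree \<iota> P. x ^ (q ^ Suc i))"
    unfolding T_def fs by (simp add: power_mult[symmetric] mult.commute)
  also have "\<dots> - T x = x ^ (q ^ place_degree \<iota> P) - x"
    unfolding T_def sum_subtractf[symmetric] by (subst sum_lessThan_telescope) simp
  finally show "T x ^ q - T x \<in> M" using residue_power_card[OF x] by simp
qed

text \<open>The polynomial has smaller degree than the residue field has elements.\<close>
lemma T_nonzero: "\<exists>y\<in>R. T y \<notin> M"
proof (rule ccontr)
  assume n: "\<not> ?thesis"
  obtain d where d: "place_degree \<iota> P = Suc d" using place_degree_pos[OF P] by (cases "place_degree \<iota> P") auto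
  define p where "p = (\<Sum>i<d. monom (1 :: 'f) (q ^ i)) + monom 1 (q ^ d)"
  have ev: "poly p x = T x" for x by (simp add: p_def T_def d poly_sum poly_monom)
  have "degree (\<Sum>i<d. monom (1 :: 'f) (q ^ i)) < q ^ d"
  proof (rule degree_sum_less)
    show "degree (monom (1 :: 'f) (q ^ i)) < q ^ d" if "i \<in> {..<d}" for i
      using that q_ge_2 by (simp add: degree_monom_eq power_strict_increasing)
  qed (use q_ge_2 in simp)
  hence deg: "degree p = q ^ d" and lead: "coeff p (q ^ d) = 1"
    unfolding p_def by (simp_all add: degree_add_eq_right degree_monom_eq coeff_eq_0)
  have "card K \<le> degree p"
  proof (rule root_bound[OF _ _ K_card(1) K_R K_incongruent])
    show "lead_coeff p \<notin> M" unfolding deg lead using P by (simp add: val_ge_def)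
    show "coeff p i \<in> R" for i
      unfolding p_def coeff_add coeff_sum coeff_monom using P by (intro val_ge_add[OF P] val_ge_sum[OF P]) auto
    show "poly p s \<in> M" if "s \<in> K" for s unfolding ev using n that K_R by blast
  qed
  hence "q ^ Suc d \<le> q ^ d" by (simp only: K_card d deg)
  moreover have "q ^ d < q ^ Suc d" using q_ge_2 by (intro power_strict_increasing) auto
  ultimately show False by simp
qed

lemma frobenius_moves:
  assumes "0 < i" "i < place_degree \<iota> P" shows "\<exists>g\<in>R. g - g ^ (q ^ i) \<notin> M"
proof (rule ccontr)
  assume n: "\<not> ?thesis"
  have q2: "2 \<le> q ^ i" using q_ge_2 assms(1) self_le_power[of q i] by simp
  have "card K \<le> degree (monom (1 :: 'f) (q ^ i) - monom 1 1)"
  proof (rule root_bound[OF _ _ K_card(1) K_R K_incongruent])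
    show "poly (monom 1 (q ^ i) - monom 1 1) s \<in> M" if "s \<in> K" for s
      unfolding frobenius_poly(4)[OF q2] using n that K_R val_ge_minus[OF P, of "s - s ^ (q ^ i)" 1] by auto
  qed (use frobenius_poly[OF q2] in auto)
  hence "q ^ place_degree \<iota> P \<le> q ^ i" by (simp only: K_card frobenius_poly(3)[OF q2])
  moreover have "q ^ i < q ^ place_degree \<iota> P" using q_ge_2 assms by (intro power_strict_increasing) auto
  ultimately show False by simp
qed

text \<open>The operator \<open>x \<mapsto> w x\<^sup>r\<close> on the residue field, with \<open>r = q\<^sup>i\<close>.\<close>
definition \<Phi> :: "'f \<Rightarrow> nat \<Rightarrow> 'f \<Rightarrow> 'f" where "\<Phi> w i x = E (w * E x ^ (q ^ i))"

lemma \<Phi>_finrank: "finrank (\<Phi> w i)"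
proof (rule E_finrank)
  show "lin (\<Phi> w i)"
    by (simp add: lin_def \<Phi>_def linD[OF E_lin] frob_pow_add power_mult_distrib iota_pow distrib_left)
       (simp add: mult.left_commute[of w] linD[OF E_lin])
qed (simp add: \<Phi>_def)

text \<open>
  A nontrivial power of Frobenius moves some \<open>g\<close>, and then the operator is a commutator with the
  multiplication by \<open>g\<close>.
\<close>
lemma tr_\<Phi>:
  assumes i: "0 < i" "i < place_degree \<iota> P" and w: "w \<in> R" shows "tr (\<Phi> w i) = 0"
proof -
  obtain g where g: "g \<in> R" "g - g ^ (q ^ i) \<notin> M" using frobenius_moves[OF i] by blast
  let ?u = "g - g ^ (q ^ i)"
  have uR: "?u \<in> R" using val_ge_diff[OF P g(1) val_ge_power[OF P g(1)]] .
  have u: "?u \<noteq> 0" "P ?u = 0" using g(2) uR by (auto simp: val_ge_def)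
  define w' where "w' = w / ?u"
  have w': "w' \<in> R" using w u P by (cases "w = 0") (auto simp: w'_def val_ge_def place_divide)
  have lg: "lin (\<Phi> g 0)" using \<Phi>_finrank finrank_lin by blast
  have "commutator (\<Phi> g 0) (\<Phi> w' i) = \<Phi> w i"
  proof
    fix x
    let ?y = "E x ^ (q ^ i)"
    have yR: "?y \<in> R" by (rule val_ge_power[OF P E_in])
    have "E (g * E (w' * ?y)) = E (g * (w' * ?y))"
    proof (rule E_eqI)
      have "g * (w' * ?y - E (w' * ?y)) \<in> M" by (rule RM(1)[OF g(1) E_cong[OF RM(4)[OF w' yR]]])
      hence "- (g * (w' * ?y - E (w' * ?y))) \<in> M" using P by (simp only: val_ge_minus)
      thus "g * E (w' * ?y) - g * (w' * ?y) \<in> M" by (simp add: algebra_simps)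
    qed
    moreover have "E (w' * E (g * E x) ^ (q ^ i)) = E (w' * (g * E x) ^ (q ^ i))"
    proof (rule E_eqI)
      have "E (g * E x) - g * E x \<in> M"
        using E_cong[OF RM(4)[OF g(1) E_in[of x]]] val_ge_minus[OF P, of "g * E x - E (g * E x)" 1] by simp
      hence "E (g * E x) ^ (q ^ i) - (g * E x) ^ (q ^ i) \<in> M"
        by (intro power_cong_M E_in RM(4)[OF g(1) E_in])
      from RM(1)[OF w' this] show "w' * E (g * E x) ^ (q ^ i) - w' * (g * E x) ^ (q ^ i) \<in> M"
        by (simp add: right_diff_distrib)
    qed
    ultimately have "commutator (\<Phi> g 0) (\<Phi> w' i) x = E (g * (w' * ?y)) - E (w' * (g * E x) ^ (q ^ i))"
      by (simp add: commutator_def \<Phi>_def)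
    also have "\<dots> = E (g * (w' * ?y) - w' * (g * E x) ^ (q ^ i))" by (simp add: linD[OF E_lin])
    also have "g * (w' * ?y) - w' * (g * E x) ^ (q ^ i) = (w' * ?u) * ?y"
      by (simp add: power_mult_distrib algebra_simps)
    also have "w' * ?u = w" using u by (simp add: w'_def)
    finally show "commutator (\<Phi> g 0) (\<Phi> w' i) x = \<Phi> w i x" by (simp only: \<Phi>_def[of w i x])
  qed
  thus ?thesis using commutator_finrank(4)[OF \<Phi>_finrank[of w' i] lg] by simp
qed

lemma tr_sum_ops:
  assumes "\<And>i. i \<in> I \<Longrightarrow> finrank (f i)"
  shows "finrank (\<lambda>x. \<Sum>i\<in>I. f i x) \<and> tr (\<lambda>x. \<Sum>i\<in>I. f i x) = (\<Sum>i\<in>I. tr (f i))"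
  using assms
proof (induction I rule: infinite_finite_induct)
  case (insert j I)
  have "(\<lambda>x. \<Sum>i\<in>insert j I. f i x) = f j + (\<lambda>x. \<Sum>i\<in>I. f i x)" using insert.hyps by (intro ext) simp
  thus ?case using insert tr_add[of "f j" "\<lambda>x. \<Sum>i\<in>I. f i x"] finrank_add[of "f j" "\<lambda>x. \<Sum>i\<in>I. f i x"] by simp
qed (use finrank_0 tr_0 in \<open>simp_all add: zero_fun_def\<close>)

text \<open>
  Consider the operator \<open>x \<mapsto> T(y x)\<close> on the residue field. As its values are constants, it has rank
  one and trace \<open>T y\<close>, which is nonzero for a suitable \<open>y\<close>. As a sum of operators \<open>x \<mapsto> y\<^sup>r x\<^sup>r\<close> with
  \<open>r = q\<^sup>i\<close> it has the trace of the summand \<open>i = 0\<close>, multiplication by \<open>y\<close>, since the others have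
  trace zero by \<open>tr_\<Phi>\<close>. This replaces separability of the residue field.
\<close>
theorem residue_trace_nonzero: "\<exists>w\<in>R. residue_trace w \<noteq> 0"
proof -
  let ?d = "place_degree \<iota> P"
  obtain y where y: "y \<in> R" "T y \<notin> M" using T_nonzero by blast
  obtain d where d: "?d = Suc d" using place_degree_pos[OF P] by (cases ?d) auto
  have yx: "y * E x \<in> R" for x by (rule RM(4)[OF y(1) E_in])
  have "\<forall>x. \<exists>c. T (y * E x) - \<iota> c \<in> M" using T_const[OF yx] by blast
  then obtain \<psi> where \<psi>: "\<And>x. T (y * E x) - \<iota> (\<psi> x) \<in> M" by metis
  have uniq: "\<psi> x = c" if "T (y * E x) - \<iota> c \<in> M" for x c
  proof -
    have "\<iota> (c - \<psi> x) \<in> M" using val_ge_diff[OF P \<psi>[of x] that] by (simp add: iota_diff)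
    thus ?thesis using P by (auto simp: val_ge_def)
  qed
  have "tr (\<lambda>x. \<Sum>i<?d. \<Phi> (y ^ (q ^ i)) i x) = (\<Sum>j\<in>{()}. \<psi> (E 1))"
  proof (rule tr_sum[where \<phi> = "\<lambda>_. \<psi>"])
    show "linf \<psi>"
      unfolding linf_def
    proof (intro conjI allI uniq)
      fix a b c
      have "(T (y * E a) - \<iota> (\<psi> a)) + (T (y * E b) - \<iota> (\<psi> b)) \<in> M" by (rule val_ge_add[OF P \<psi> \<psi>])
      also have "(T (y * E a) - \<iota> (\<psi> a)) + (T (y * E b) - \<iota> (\<psi> b)) = T (y * E (a + b)) - \<iota> (\<psi> a + \<psi> b)"
        unfolding linD(1)[OF E_lin] distrib_left linD(1)[OF T_lin] iota_add by simp
      finally show "T (y * E (a + b)) - \<iota> (\<psi> a + \<psi> b) \<in> M" .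
      have "\<iota> c * (T (y * E a) - \<iota> (\<psi> a)) \<in> M" by (rule val_ge_iota_mult[OF P \<psi>])
      also have "\<iota> c * (T (y * E a) - \<iota> (\<psi> a)) = T (y * E (\<iota> c * a)) - \<iota> (c * \<psi> a)"
        unfolding linD(2)[OF E_lin] mult.left_commute[of y "\<iota> c"] linD(2)[OF T_lin] iota_mult
        by (simp add: algebra_simps)
      finally show "T (y * E (\<iota> c * a)) - \<iota> (c * \<psi> a) \<in> M" .
    qed
    show "(\<lambda>x. \<Sum>i<?d. \<Phi> (y ^ (q ^ i)) i x) = (\<lambda>x. \<Sum>j\<in>{()}. \<iota> (\<psi> x) * E 1)"
    proof
      fix x
      have "(\<Sum>i<?d. \<Phi> (y ^ (q ^ i)) i x) = E (T (y * E x))"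
        by (simp add: \<Phi>_def T_def lin_sum[OF E_lin] power_mult_distrib)
      also have "\<dots> = E (\<iota> (\<psi> x) * 1)" by (rule E_eqI) (use \<psi> in simp)
      finally show "(\<Sum>i<?d. \<Phi> (y ^ (q ^ i)) i x) = (\<Sum>j\<in>{()}. \<iota> (\<psi> x) * E 1)"
        unfolding linD(2)[OF E_lin] by simp
    qed
  qed simp
  moreover have "tr (\<lambda>x. \<Sum>i<?d. \<Phi> (y ^ (q ^ i)) i x) = (\<Sum>i<?d. tr (\<Phi> (y ^ (q ^ i)) i))"
    using tr_sum_ops[of "{..<?d}" "\<lambda>i. \<Phi> (y ^ (q ^ i)) i"] \<Phi>_finrank by simp
  moreover have "(\<Sum>i<?d. tr (\<Phi> (y ^ (q ^ i)) i)) = (\<Sum>i<?d. if i = 0 then tr (\<Phi> y 0) else 0)"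
    by (rule sum.cong) (use tr_\<Phi> y(1) val_ge_power[OF P] in auto)
  moreover have "\<dots> = tr (\<Phi> y 0)" by (simp add: d)
  moreover have "\<Phi> y 0 = E \<circ> (*) y \<circ> E" by (rule ext) (simp add: \<Phi>_def)
  ultimately have "residue_trace y = \<psi> (E 1)" by (simp add: residue_trace_def)
  moreover have "\<psi> (E 1) \<noteq> 0"
  proof
    assume "\<psi> (E 1) = 0"
    hence t1: "T (y * E 1) \<in> M" using \<psi>[of "E 1"] by simp
    have "y * (1 - E 1) \<in> M" using P by (intro RM(1)[OF y(1)] E_cong) simp
    hence "y - y * E 1 \<in> M" by (simp add: right_diff_distrib)
    hence "T y - T (y * E 1) \<in> M" by (rule T_cong[OF y(1) yx])
    from val_ge_add[OF P this t1] show False using y(2) by simp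
  qed
  ultimately show ?thesis by (intro bexI[OF _ y(1)]) simp
qed

end

context function_field
begin

theorem resP_rational:
  assumes rat: "rational_place \<iota> P" and t: "P t = 1" and w: "w \<in> val_ge P 0"
  shows "resP P (w / t) t = eval_at \<iota> P w"
proof -
  have Pp: "P \<in> places \<iota>" using rat by (simp add: rational_place_def)
  obtain \<pi> where \<pi>: "proj \<pi> (val_ge P 0)" using proj_exists[OF val_ge_subspace[OF Pp]] by blast
  interpret residue_field \<iota> P t \<pi> by unfold_locales (use Pp t \<pi> in auto)
  show ?thesis using resP_simple_pole[OF w] residue_trace_rational[OF rat w] by simp
qed

theorem resP_nondegenerate:
  assumes P: "P \<in> places \<iota>" and t: "P t = 1"
  shows "\<exists>w\<in>val_ge P 0. resP P (w / t) t \<noteq> 0"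
proof -
  obtain \<pi> where \<pi>: "proj \<pi> (val_ge P 0)" using proj_exists[OF val_ge_subspace[OF P]] by blast
  interpret residue_field \<iota> P t \<pi> by unfold_locales (use P t \<pi> in auto)
  show ?thesis using resP_simple_pole residue_trace_nonzero by metis
qed

end

section \<open>The canonical divisor\<close>

context pointed_curve
begin

definition x0 :: 'f where "x0 = local_param Q"

text \<open>
  The function \<open>f\<close> with \<open>dx0 = f dt\<close> for the local parameter \<open>t\<close> at \<open>P\<close>; so \<open>K0\<close> is the divisor of
  the differential \<open>dx0\<close>.
\<close>
definition dx :: "'f place \<Rightarrow> 'f" where "dx P = ddt (local_param P) x0"

definition K0 :: "'f divisor" where "K0 P = (if P \<in> places \<iota> then P (dx P) else 0)"

lemma x0: "Q x0 = 1" "x0 \<noteq> 0" "sep x0"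
  using local_param[OF Q] Q unfolding x0_def sep_def by blast+

lemma sep_local_param: "P \<in> places \<iota> \<Longrightarrow> sep (local_param P)"
  unfolding sep_def using local_param(1) by blast

lemma dx_nonzero: "P \<in> places \<iota> \<Longrightarrow> dx P \<noteq> 0"
  using ddt_chain[OF sep_local_param x0(3), of P] unfolding dx_def by auto

lemma K0_Q [simp]: "K0 Q = 0"
  using ddt_self[OF x0(3)] by (simp add: K0_def dx_def x0_def[symmetric])

lemma resP_x0: "P \<in> places \<iota> \<Longrightarrow> resP P z x0 = resP P (z * dx P) (local_param P)"
  unfolding dx_def by (rule resP_ddt[OF _ sep_local_param])

lemma dx_mult: "P \<in> places \<iota> \<Longrightarrow> z \<in> val_ge P (n - K0 P) \<longleftrightarrow> z * dx P \<in> val_ge P n"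
  using val_ge_mult_iff[OF _ dx_nonzero, of P P z n] by (simp add: K0_def mult.commute)

lemma resP_x0_regular: assumes P: "P \<in> places \<iota>" and z: "z \<in> val_ge P (- K0 P)" shows "resP P z x0 = 0"
proof -
  have "z * dx P \<in> val_ge P 0" using dx_mult[OF P, of z 0] z by simp
  moreover have "local_param P \<in> val_ge P 0" using local_param[OF P] by (simp add: val_ge_def)
  ultimately show ?thesis unfolding resP_x0[OF P] by (rule resP_regular[OF P])
qed

lemma finite_poles: "finite {P \<in> places \<iota>. P z < 0}"
proof (cases "z = 0")
  case False
  hence "finite {P \<in> places \<iota>. 0 < P (inverse z)}" by (intro finite_zeros) simp
  moreover have "{P \<in> places \<iota>. 0 < P (inverse z)} = {P \<in> places \<iota>. P z < 0}" by auto
  ultimately show ?thesis by simp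
next
  case True
  hence "{P \<in> places \<iota>. P z < 0} = {}" by auto
  thus ?thesis by (simp only: finite.emptyI)
qed

text \<open>
  The residue theorem for \<open>z dx0\<close>, with the sum restricted to places where the differential may have
  a pole. The theorem applies to a larger set that also contains the poles of \<open>z\<close> and \<open>x0\<close>.
\<close>
theorem residue_sum:
  assumes S: "finite S" "S \<subseteq> places \<iota>"
    and z: "\<And>P. P \<in> places \<iota> \<Longrightarrow> P \<notin> S \<Longrightarrow> z \<in> val_ge P (- K0 P)"
  shows "(\<Sum>P\<in>S. resP P z x0) = 0"
proof -
  let ?S = "S \<union> {P \<in> places \<iota>. P z < 0} \<union> {P \<in> places \<iota>. P x0 < 0}"
  have "(\<Sum>P\<in>?S. resP P z x0) = 0"
    by (rule residue_theorem) (use S finite_poles in \<open>auto simp: val_ge_def\<close>)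
  moreover have "(\<Sum>P\<in>?S. resP P z x0) = (\<Sum>P\<in>S. resP P z x0)"
    by (rule sum.mono_neutral_right) (use S finite_poles resP_x0_regular z in auto)
  ultimately show ?thesis by simp
qed

text \<open>
  The functional from which all functionals in the duality are obtained by multiplication. It
  depends only on the behaviour at \<open>Q\<close>, but the residue theorem makes it vanish on functions that
  are small everywhere else.
\<close>
definition Lam :: "'f \<Rightarrow> 'k" where "Lam z = resP Q z x0"

lemma Lam_linf: "linf Lam"
  unfolding linf_def Lam_def using resP_add[OF Q] resP_scale[OF Q] by blast

lemma Lam_outside:
  assumes "\<And>P. P \<in> places \<iota> \<Longrightarrow> P \<noteq> Q \<Longrightarrow> z \<in> val_ge P (- K0 P)" shows "Lam z = 0"
  using residue_sum[of "{Q}" z] assms by (simp add: Lam_def)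

lemma Lam_regular: "z \<in> val_ge Q 0 \<Longrightarrow> Lam z = 0"
  unfolding Lam_def by (rule resP_x0_regular) simp_all

lemma Lam_pole: assumes "z \<noteq> 0" "Q z = - 1" shows "Lam z \<noteq> 0"
proof
  assume L: "Lam z = 0"
  have zx: "z * x0 \<in> val_ge Q 0" "z * x0 \<notin> val_ge Q 1" using assms x0 by (auto simp: val_ge_def place_mult)
  have "Lam z = resP Q (z * x0 / x0) x0" using x0 by (simp add: Lam_def)
  also have "\<dots> = eval_at \<iota> Q (z * x0)" by (rule resP_rational[OF rational_Q x0(1) zx(1)])
  finally have "eval_at \<iota> Q (z * x0) = 0" using L by simp
  thus False using eval_at(1)[OF rational_Q zx(1)] zx(2) by simp
qed

lemma K0_nonneg: assumes P: "P \<in> places \<iota>" and x: "0 \<le> P x0" shows "0 \<le> K0 P"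
proof -
  have "x0 \<in> val_ge P 0" using x by (simp add: val_ge_def)
  from ddt_regular[OF P local_param(1)[OF P] this] show ?thesis
    using dx_nonzero[OF P] P by (simp add: K0_def dx_def[symmetric] val_ge_def)
qed

text \<open>
  Where \<open>x0\<close> is regular, \<open>K0\<close> is nonnegative. If it were positive at many places, strong
  approximation would write \<open>1/x0\<close> as a function small at \<open>Q\<close> plus one that is small elsewhere, in
  the sense that \<open>Lam\<close> vanishes on both; but \<open>Lam\<close> is nonzero at a simple pole.
\<close>
lemma K0_divisor: "K0 \<in> divisors \<iota>"
proof -
  define Z where "Z = {P \<in> places \<iota>. P x0 < 0}"
  have Z: "finite Z" "Z \<subseteq> places \<iota>" using finite_poles by (auto simp: Z_def)
  define W where "W = {P \<in> places \<iota>. 0 \<le> P x0 \<and> 0 < K0 P}"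
  obtain c where c: "\<And>G. G \<in> divisors \<iota> \<Longrightarrow> c \<le> deg G \<Longrightarrow> s G = smax" using s_large_degree by metis
  define c1 where "c1 = (\<Sum>P\<in>Z. K0 P * int (place_degree \<iota> P))"
  have bound: "int (card S) + c1 < c" if S: "finite S" "S \<subseteq> W" for S
  proof (rule ccontr)
    assume n: "\<not> ?thesis"
    define G where "G P = (if P \<in> S \<union> Z then K0 P else 0)" for P
    have SZ: "finite (S \<union> Z)" "S \<union> Z \<subseteq> places \<iota>" "S \<inter> Z = {}" using S Z by (auto simp: W_def Z_def)
    have G: "G \<in> divisors \<iota>" by (rule divisorsI[OF SZ(1,2)]) (simp add: G_def)
    have "int (card S) = (\<Sum>P\<in>S. 1 * int 1)" by simp
    also have "\<dots> \<le> (\<Sum>P\<in>S. K0 P * int (place_degree \<iota> P))"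
      using S place_degree_pos
      by (intro sum_mono mult_mono) (auto simp: W_def Suc_le_eq int_one_le_iff_zero_less)
    also have "\<dots> + c1 = (\<Sum>P\<in>S \<union> Z. K0 P * int (place_degree \<iota> P))"
      unfolding c1_def by (rule sum.union_disjoint[symmetric]) (use S Z SZ in auto)
    also have "\<dots> = (\<Sum>P\<in>S \<union> Z. G P * int (place_degree \<iota> P))"
      by (rule sum.cong) (auto simp: G_def)
    also have "\<dots> = deg G" by (rule deg_eq[symmetric, OF SZ(1)]) (auto simp: G_def)
    finally have "s G = smax" using n by (intro c G) simp
    note sa = strong_approximation[OF G this, of "{Q}"]
    have GK: "G P \<le> K0 P" if "P \<in> places \<iota>" for P
      using K0_nonneg[OF that] that by (auto simp: G_def Z_def)
    obtain r where r: "r - inverse x0 \<in> val_ge Q (- G Q)"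
      "\<And>P. P \<in> places \<iota> \<Longrightarrow> P \<noteq> Q \<Longrightarrow> r \<in> val_ge P (- G P)"
      using sa[of "\<lambda>_. inverse x0"] by auto
    have "Lam r = 0"
    proof (rule Lam_outside)
      fix P assume P: "P \<in> places \<iota>" "P \<noteq> Q"
      show "r \<in> val_ge P (- K0 P)" by (rule val_ge_mono[OF _ r(2)[OF P]]) (use GK[OF P(1)] in simp)
    qed
    moreover have "Lam (r - inverse x0) = 0"
      by (rule Lam_regular, rule val_ge_mono[OF _ r(1)]) (use GK[OF Q] in simp)
    ultimately have "Lam (inverse x0) = 0" by (simp add: linfD[OF Lam_linf])
    thus False using Lam_pole[of "inverse x0"] x0 by simp
  qed
  have "finite W"
  proof (rule ccontr)
    assume "infinite W"
    then obtain S where S: "S \<subseteq> W" "finite S" "card S = nat (c - c1)"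
      using infinite_arbitrarily_large[of W "nat (c - c1)"] by blast
    thus False using bound[OF S(2,1)] by (simp split: if_splits)
  qed
  show ?thesis
  proof (rule divisorsI[of "W \<union> Z"])
    show "K0 P = 0" if "P \<notin> W \<union> Z" for P
      using K0_nonneg[of P] that by (cases "P \<in> places \<iota>") (auto simp: W_def Z_def K0_def)
  qed (use \<open>finite W\<close> Z in \<open>auto simp: W_def\<close>)
qed

section \<open>Duality and the Riemann-Roch theorem\<close>

text \<open>
  These functionals play the part of Weil differentials. A function \<open>z\<close> stands for the adele that is
  \<open>z\<close> at \<open>Q\<close> and \<open>0\<close> elsewhere. This adele is bounded by \<open>G\<close> if \<open>z\<close> is so at \<open>Q\<close>, and it is
  congruent to the global function \<open>z\<close> modulo bounded adeles if \<open>z\<close> is bounded by \<open>G\<close> away from \<open>Q\<close>.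
\<close>
definition annihilates :: "('f \<Rightarrow> 'k) \<Rightarrow> 'f divisor \<Rightarrow> bool" where
  "annihilates \<phi> G \<longleftrightarrow> linf \<phi> \<and> (\<forall>z\<in>val_ge Q (- G Q). \<phi> z = 0) \<and>
     (\<forall>z. (\<forall>P\<in>places \<iota> - {Q}. z \<in> val_ge P (- G P)) \<longrightarrow> \<phi> z = 0)"

lemma annihilatesD:
  assumes "annihilates \<phi> G"
  shows "linf \<phi>" "z \<in> val_ge Q (- G Q) \<Longrightarrow> \<phi> z = 0"
    "(\<And>P. P \<in> places \<iota> \<Longrightarrow> P \<noteq> Q \<Longrightarrow> z \<in> val_ge P (- G P)) \<Longrightarrow> \<phi> z = 0"
  using assms unfolding annihilates_def by blast+

lemma Lam_annihilates: "annihilates Lam K0"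
  unfolding annihilates_def using Lam_linf Lam_regular Lam_outside by simp

definition nQ :: "nat \<Rightarrow> 'f divisor" where "nQ n = (\<lambda>P. int n * prime_divisor Q P)"

lemma nQ [simp]: "nQ n \<in> divisors \<iota>" "deg (nQ n) = int n" "nQ n Q = int n" "P \<noteq> Q \<Longrightarrow> nQ n P = 0"
  using divisor_mult[OF divisor_prime[OF Q]] deg_mult[OF divisor_prime[OF Q], of "int n"]
  unfolding nQ_def by (auto simp: prime_divisor_apply)

text \<open>
  Multiplication by \<open>a\<close> turns the bounds by \<open>G\<close> into bounds that do not depend on \<open>G\<close>, so that
  functionals for different divisors can be compared.
\<close>
lemma annihilates_mult:
  assumes \<phi>: "annihilates \<phi> G" and G: "G \<in> divisors \<iota>" and a: "a \<in> rr_space \<iota> (G + nQ n)"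
  shows "z \<in> val_ge Q (int n) \<Longrightarrow> \<phi> (a * z) = 0"
    "(\<And>P. P \<in> places \<iota> \<Longrightarrow> P \<noteq> Q \<Longrightarrow> z \<in> val_ge P 0) \<Longrightarrow> \<phi> (a * z) = 0"
proof -
  have aP: "a \<in> val_ge P (- (G + nQ n) P)" if "P \<in> places \<iota>" for P
    using a that unfolding rr_space_iff[OF divisor_add[OF G nQ(1)]] by blast
  show "\<phi> (a * z) = 0" if "z \<in> val_ge Q (int n)"
    by (rule annihilatesD(2)[OF \<phi> val_ge_mult'[OF Q aP[OF Q] that]]) simp
  show "\<phi> (a * z) = 0" if z: "\<And>P. P \<in> places \<iota> \<Longrightarrow> P \<noteq> Q \<Longrightarrow> z \<in> val_ge P 0"
  proof (rule annihilatesD(3)[OF \<phi>])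
    fix P assume P: "P \<in> places \<iota>" "P \<noteq> Q"
    show "a * z \<in> val_ge P (- G P)" by (rule val_ge_mult'[OF P(1) aP[OF P(1)] z[OF P]]) (use P in simp)
  qed
qed

lemma x0_powi [simp]: "Q (x0 powi n) = n" "x0 powi n \<noteq> 0"
  using place_powi[OF Q] x0(2) by (simp_all add: x0_def)

lemma laurent_expansion:
  assumes "z \<in> val_ge Q m"
  shows "\<exists>c. z - (\<Sum>j<n. \<iota> (c j) * x0 powi (m + int j)) \<in> val_ge Q (m + int n)"
proof (induction n)
  case 0 thus ?case using assms by simp
next
  case (Suc n)
  then obtain c where c: "z - (\<Sum>j<n. \<iota> (c j) * x0 powi (m + int j)) \<in> val_ge Q (m + int n)" by blast
  let ?e = "x0 powi (m + int n)" and ?r = "z - (\<Sum>j<n. \<iota> (c j) * x0 powi (m + int j))"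
  define a where "a = eval_at \<iota> Q (?r / ?e)"
  have eq: "?r = ?e * (?r / ?e)"
    by (simp only: times_divide_eq_right nonzero_mult_div_cancel_left[OF x0_powi(2)])
  have "?r / ?e \<in> val_ge Q 0"
    using val_ge_mult_iff[OF Q x0_powi(2)[of "m + int n"], of "?r / ?e" "m + int n"] c
    by (simp only: eq[symmetric] x0_powi(1) diff_self)
  hence "?r / ?e - \<iota> a \<in> val_ge Q 1" unfolding a_def by (rule eval_at(1)[OF rational_Q])
  hence "?e * (?r / ?e - \<iota> a) \<in> val_ge Q (m + int n + 1)"
    by (intro val_ge_mult'[OF Q val_ge_self[OF Q]]) auto
  moreover have "?e * (?r / ?e - \<iota> a) = ?r - \<iota> a * ?e"
    by (simp only: right_diff_distrib eq[symmetric] mult.commute[of "\<iota> a"])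
  ultimately have "?r - \<iota> a * ?e \<in> val_ge Q (m + int (Suc n))" by (simp add: add_ac)
  moreover have "(\<Sum>j<Suc n. \<iota> ((c(n := a)) j) * x0 powi (m + int j)) =
      (\<Sum>j<n. \<iota> (c j) * x0 powi (m + int j)) + \<iota> a * ?e" by simp
  ultimately have "z - (\<Sum>j<Suc n. \<iota> ((c(n := a)) j) * x0 powi (m + int j)) \<in> val_ge Q (m + int (Suc n))"
    by (simp only: diff_diff_add[symmetric])
  thus ?case by blast
qed

text \<open>
  The functionals \<open>z \<mapsto> Lam (a z) + \<phi> (a' z)\<close>, for \<open>a \<in> L(K0 + b Q)\<close> and \<open>a' \<in> L(G + b Q)\<close>, are
  determined by their values at the powers of \<open>x0\<close> from order \<open>-m\<close> to \<open>b - 1\<close>: strong approximation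
  bounds the order from below, and the order \<open>b\<close> is killed. These are \<open>m + b\<close> values, while the
  pairs \<open>(a, a')\<close> form a space of dimension about \<open>2 b\<close>. Hence some pair gives the functional zero.
\<close>
theorem annihilates_multiple:
  assumes \<phi>: "annihilates \<phi> G" and G: "G \<in> divisors \<iota>"
  shows "\<exists>h. \<forall>z. \<phi> z = Lam (h * z)"
proof -
  note l = annihilatesD(1)[OF \<phi>]
  obtain c where c: "\<And>G. G \<in> divisors \<iota> \<Longrightarrow> c \<le> deg G \<Longrightarrow> s G = smax" using s_large_degree by metis
  \<comment> \<open>with poles of order \<open>m\<close> allowed at \<open>Q\<close>, strong approximation applies\<close>
  define m where "m = nat c"
  have "s (nQ m) = smax" by (rule c) (simp_all add: m_def)
  note sa = strong_approximation[OF nQ(1) this, of "{Q}"]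
  \<comment> \<open>the dimension of the space of pairs exceeds \<open>m + b\<close>\<close>
  define b where "b = nat (int m + 2 * smax - deg K0 - deg G + 1)"
  define e where "e j = x0 powi (- int m + int j)" for j
  have zero: "Lam (a * z) + \<phi> (a' * z) = 0"
    if a: "a \<in> rr_space \<iota> (K0 + nQ b)" and a': "a' \<in> rr_space \<iota> (G + nQ b)"
      and e0: "\<And>j. j < m + b \<Longrightarrow> Lam (a * e j) + \<phi> (a' * e j) = 0" for a a' z
  proof -
    note A = annihilates_mult[OF Lam_annihilates K0_divisor a] and A' = annihilates_mult[OF \<phi> G a']
    obtain r where r: "r - z \<in> val_ge Q (- nQ m Q)" "\<And>P. P \<in> places \<iota> \<Longrightarrow> P \<noteq> Q \<Longrightarrow> r \<in> val_ge P (- nQ m P)"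
      using sa[of "\<lambda>_. z"] by auto
    have r': "Lam (a * r) = 0" "\<phi> (a' * r) = 0" by (rule A(2) A'(2); use r(2) in force)+
    have "r - z \<in> val_ge Q (- int m)" using r(1) by simp
    then obtain d where d: "(r - z) - (\<Sum>j<m + b. \<iota> (d j) * x0 powi (- int m + int j)) \<in> val_ge Q (- int m + int (m + b))"
      using laurent_expansion by blast
    define y where "y = (r - z) - (\<Sum>j<m + b. \<iota> (d j) * e j)"
    have "y \<in> val_ge Q (int b)" using d by (simp add: y_def e_def)
    hence y: "Lam (a * y) = 0" "\<phi> (a' * y) = 0" using A(1) A'(1) by blast+
    have lsum: "\<psi> (x * (\<Sum>j<m + b. \<iota> (d j) * e j)) = (\<Sum>j<m + b. d j * \<psi> (x * e j))" if "linf \<psi>" for \<psi> x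
      unfolding sum_distrib_left linf_sum[OF that] mult.left_commute[of x] linfD(2)[OF that] ..
    have z: "z = r - (y + (\<Sum>j<m + b. \<iota> (d j) * e j))" by (simp add: y_def)
    have "Lam (a * z) = - (\<Sum>j<m + b. d j * Lam (a * e j))"
      unfolding z right_diff_distrib distrib_left linfD[OF Lam_linf] lsum[OF Lam_linf] by (simp add: r' y)
    moreover have "\<phi> (a' * z) = - (\<Sum>j<m + b. d j * \<phi> (a' * e j))"
      unfolding z right_diff_distrib distrib_left linfD[OF l] lsum[OF l] by (simp add: r' y)
    ultimately have "Lam (a * z) + \<phi> (a' * z) = - (\<Sum>j<m + b. d j * (Lam (a * e j) + \<phi> (a' * e j)))"
      by (simp add: distrib_left sum.distrib)
    also have "(\<Sum>j<m + b. d j * (Lam (a * e j) + \<phi> (a' * e j))) = 0"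
      by (rule sum.neutral) (use e0 in simp)
    finally show ?thesis by simp
  qed
  let ?A = "rr_space \<iota> (K0 + nQ b)" and ?B = "rr_space \<iota> (G + nQ b)"
  have dA: "K0 + nQ b \<in> divisors \<iota>" and dB: "G + nQ b \<in> divisors \<iota>" using K0_divisor G by simp_all
  let ?\<Theta> = "\<lambda>(a, a'). \<lambda>j\<in>{..<m + b}. Lam (a * e j) + \<phi> (a' * e j)"
  let ?E = "PiE {..<m + b} (\<lambda>_. UNIV :: 'k set)"
  have "\<not> inj_on ?\<Theta> (?A \<times> ?B)"
  proof
    assume inj: "inj_on ?\<Theta> (?A \<times> ?B)"
    have "card (?A \<times> ?B) \<le> card ?E"
    proof (rule card_inj_on_le[OF inj])
      show "?\<Theta> ` (?A \<times> ?B) \<subseteq> ?E" by (rule image_subsetI) (simp add: split_def restrict_PiE_iff)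
    qed (simp add: finite_PiE)
    hence "q ^ (rr_dim \<iota> (K0 + nQ b) + rr_dim \<iota> (G + nQ b)) \<le> q ^ (m + b)"
      by (simp add: card_cartesian_product card_rr_space[OF dA] card_rr_space[OF dB] power_add card_PiE card_k)
    hence "ell (K0 + nQ b) + ell (G + nQ b) \<le> int m + int b" unfolding q_power_le_iff by linarith
    moreover have "deg K0 + int b - smax \<le> ell (K0 + nQ b)" "deg G + int b - smax \<le> ell (G + nQ b)"
      using smax(2)[OF dA] smax(2)[OF dB] K0_divisor G by (simp_all add: s_def deg_add)
    moreover have "int m + 2 * smax - deg K0 - deg G + 1 \<le> int b" unfolding b_def by simp
    ultimately show False by linarith
  qed
  then obtain p p' where p: "p \<in> ?A \<times> ?B" "p' \<in> ?A \<times> ?B" "p \<noteq> p'" "?\<Theta> p = ?\<Theta> p'"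
    unfolding inj_on_def by blast
  define a where "a = fst p - fst p'"
  define a' where "a' = snd p - snd p'"
  have aA: "a \<in> ?A" "a' \<in> ?B" unfolding a_def a'_def
    using p subspace_diff[OF rr_space_subspace[OF dA]] subspace_diff[OF rr_space_subspace[OF dB]] by auto
  have ne: "a \<noteq> 0 \<or> a' \<noteq> 0" using p(3) by (auto simp: a_def a'_def prod_eq_iff)
  have "Lam (a * e j) + \<phi> (a' * e j) = 0" if "j < m + b" for j
  proof -
    have "?\<Theta> p j = ?\<Theta> p' j" using p(4) by simp
    thus ?thesis using that
      by (simp add: a_def a'_def left_diff_distrib linfD(4)[OF l] linfD(4)[OF Lam_linf] split_def algebra_simps)
  qed
  note vanish = zero[OF aA this]
  \<comment> \<open>otherwise \<open>Lam\<close> would vanish on all multiples of \<open>a\<close>, that is on \<open>F\<close>\<close>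
  have "a' \<noteq> 0"
  proof
    assume a'0: "a' = 0"
    hence a0: "a \<noteq> 0" using ne by blast
    have "Lam (a * (inverse a * inverse x0)) = 0"
      using vanish[of "inverse a * inverse x0"] linfD(3)[OF l] by (simp add: a'0)
    thus False using Lam_pole[of "inverse x0"] x0 a0 by (simp add: mult.assoc[symmetric])
  qed
  have "\<phi> z = Lam (- (a / a') * z)" for z
  proof -
    have "Lam (- (a / a') * z) = Lam (0 - a * (z / a'))" by simp
    also have "\<dots> = - Lam (a * (z / a'))" by (subst linfD(4)[OF Lam_linf]) (simp only: linfD(3)[OF Lam_linf] diff_0)
    also have "\<dots> = \<phi> (a' * (z / a'))"
      using vanish[of "z / a'"] by (simp only: neg_eq_iff_add_eq_0)
    finally show ?thesis using \<open>a' \<noteq> 0\<close> by simp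
  qed
  thus ?thesis by blast
qed

text \<open>
  If \<open>h\<close> had a pole of too large an order at \<open>P\<close>, strong approximation would provide a function \<open>r\<close>
  for which \<open>h r dx0\<close> has a simple pole with nonzero residue at \<open>P\<close>, no residue at \<open>Q\<close> by
  assumption, and no other poles.
\<close>
lemma annihilator_in_rr_space:
  assumes h: "annihilates (\<lambda>z. Lam (h * z)) G" and G: "G \<in> divisors \<iota>"
  shows "h \<in> rr_space \<iota> (K0 - G)"
proof -
  have "h \<in> val_ge P (- (K0 - G) P)" if P: "P \<in> places \<iota>" for P
  proof (rule ccontr)
    assume "h \<notin> val_ge P (- (K0 - G) P)"
    hence h0: "h \<noteq> 0" and lt: "P h + K0 P < G P" by (auto simp: val_ge_def)
    show False
    proof (cases "P = Q")
      case True
      have "Lam (h * (inverse h * inverse x0)) = 0"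
        by (rule annihilatesD(2)[OF h]) (use lt h0 x0 True in \<open>simp add: val_ge_def place_mult\<close>)
      thus False using Lam_pole[of "inverse x0"] x0 h0 by (simp add: mult.assoc[symmetric])
    next
      case PQ: False
      let ?t = "local_param P"
      note t = local_param[OF P]
      define u where "u = h * dx P"
      have u: "u \<noteq> 0" "P u = P h + K0 P"
        using h0 dx_nonzero[OF P] P by (simp_all add: u_def K0_def place_mult)
      obtain w where w: "w \<in> val_ge P 0" "resP P (w / ?t) ?t \<noteq> 0" using resP_nondegenerate[OF P t(1)] by blast
      define y where "y = w / ?t / u"
      obtain c where c: "\<And>G. G \<in> divisors \<iota> \<Longrightarrow> c \<le> deg G \<Longrightarrow> s G = smax" using s_large_degree by metis
      define N0 where "N0 = (\<lambda>P. min (G P) ((K0 + fun_div \<iota> h) P))"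
      have N0: "N0 \<in> divisors \<iota>"
        unfolding N0_def by (rule divisor_combine[OF G divisor_add[OF K0_divisor fun_div_divisor[OF h0]]]) simp
      define N where "N = N0 + nQ (nat (c - deg N0))"
      have N: "N \<in> divisors \<iota>" using N0 by (simp add: N_def)
      have "s N = smax" by (rule c[OF N]) (simp add: N_def deg_add N0)
      note sa = strong_approximation[OF N this, of "{P}"]
      obtain r where r: "r - y \<in> val_ge P (- N P)" "\<And>R. R \<in> places \<iota> \<Longrightarrow> R \<noteq> P \<Longrightarrow> r \<in> val_ge R (- N R)"
        using sa[of "\<lambda>_. y"] P by auto
      have NG: "N R \<le> G R" "N R \<le> K0 R + R h" if "R \<in> places \<iota>" "R \<noteq> Q" for R
        using that by (simp_all add: N_def N0_def fun_div_def)
      have y_in: "y \<in> val_ge P (- G P)"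
      proof (cases "w = 0")
        case False
        thus ?thesis using w(1) t u lt P by (simp add: y_def val_ge_def place_divide place_mult)
      qed (simp add: y_def)
      have rG: "r \<in> val_ge R (- G R)" if R: "R \<in> places \<iota>" "R \<noteq> Q" for R
      proof (cases "R = P")
        case True
        have "r - y \<in> val_ge P (- G P)" by (rule val_ge_mono[OF _ r(1)]) (use NG[OF P PQ] in simp)
        from val_ge_add[OF P this y_in] show ?thesis using True by simp
      next
        case False
        show ?thesis by (rule val_ge_mono[OF _ r(2)[OF R(1) False]]) (use NG[OF R] in simp)
      qed
      have L0: "Lam (h * r) = 0" by (rule annihilatesD(3)[OF h rG])
      have "(\<Sum>P\<in>{Q, P}. resP P (h * r) x0) = 0"
      proof (rule residue_sum)
        fix R assume R: "R \<in> places \<iota>" "R \<notin> {Q, P}"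
        show "h * r \<in> val_ge R (- K0 R)"
          by (rule val_ge_mult'[OF R(1) val_ge_self[OF R(1)] r(2)]) (use R NG[of R] in auto)
      qed (use P in auto)
      hence "resP P (h * r) x0 = 0" using L0 PQ by (simp add: Lam_def)
      hence "resP P (u * r) ?t = 0" unfolding resP_x0[OF P] by (simp add: u_def mult_ac)
      also have "u * r = w / ?t + u * (r - y)" using u(1) by (simp add: y_def right_diff_distrib)
      also have "resP P (w / ?t + u * (r - y)) ?t = resP P (w / ?t) ?t + resP P (u * (r - y)) ?t"
        by (rule resP_add[OF P])
      also have "resP P (u * (r - y)) ?t = 0"
      proof (rule resP_regular[OF P])
        show "u * (r - y) \<in> val_ge P 0"
          by (rule val_ge_mult'[OF P val_ge_self[OF P] r(1)]) (use NG(2)[OF P PQ] u in simp)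
      qed (use t in \<open>simp add: val_ge_def\<close>)
      finally show False using w(2) by simp
    qed
  qed
  thus ?thesis using rr_space_iff[OF divisor_diff[OF K0_divisor G]] by blast
qed

text \<open>Some coordinate of \<open>x - \<pi> x\<close>, for a projection \<open>\<pi>\<close> onto \<open>U\<close>.\<close>
lemma separating_functional:
  assumes U: "k.subspace U" and y: "y \<notin> U"
  shows "\<exists>\<phi>. linf \<phi> \<and> (\<forall>u\<in>U. \<phi> u = 0) \<and> \<phi> y \<noteq> 0"
proof -
  obtain \<pi> where \<pi>: "proj \<pi> U" using proj_exists[OF U] by blast
  have "y - \<pi> y \<noteq> 0" using y projD(2)[OF \<pi>, of y] by auto
  hence "\<exists>b. hamel_coeff (y - \<pi> y) b \<noteq> 0"
    using k.sum_nonzero_representation_eq[OF hamel, of "y - \<pi> y"] by (metis (mono_tags, lifting) empty_Collect_eq sum.empty)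
  then obtain b where b: "hamel_coeff (y - \<pi> y) b \<noteq> 0" by blast
  have "linf (\<lambda>x. hamel_coeff (x - \<pi> x) b)"
    unfolding linf_def
  proof (intro conjI allI)
    fix x z a
    have "x + z - \<pi> (x + z) = (x - \<pi> x) + (z - \<pi> z)" by (simp add: linD[OF projD(1)[OF \<pi>]])
    thus "hamel_coeff (x + z - \<pi> (x + z)) b = hamel_coeff (x - \<pi> x) b + hamel_coeff (z - \<pi> z) b"
      by (simp only: linfD(1)[OF linf_hamel_coeff])
    have "\<iota> a * x - \<pi> (\<iota> a * x) = \<iota> a * (x - \<pi> x)"
      by (simp only: linD(2)[OF projD(1)[OF \<pi>]] right_diff_distrib)
    thus "hamel_coeff (\<iota> a * x - \<pi> (\<iota> a * x)) b = a * hamel_coeff (x - \<pi> x) b"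
      by (simp only: linfD(2)[OF linf_hamel_coeff])
  qed
  moreover have "\<forall>u\<in>U. hamel_coeff (u - \<pi> u) b = 0" using projD(3)[OF \<pi>] linfD(3)[OF linf_hamel_coeff] by simp
  ultimately show ?thesis using b by (intro exI[of _ "\<lambda>x. hamel_coeff (x - \<pi> x) b"]) blast
qed

lemma ell_jump:
  assumes G: "G \<in> divisors \<iota>"
  shows "ell G < ell (G + prime_divisor Q) \<longleftrightarrow>
     (\<exists>f\<in>rr_space \<iota> (G + prime_divisor Q). f \<noteq> 0 \<and> Q f = - G Q - 1)"
proof -
  let ?G = "G + prime_divisor Q"
  have G': "?G \<in> divisors \<iota>" using G by simp
  have sub: "rr_space \<iota> G \<subseteq> rr_space \<iota> ?G"
    using G G' by (intro rr_space_mono) (auto simp: le_fun_def prime_divisor_apply)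
  have "ell G < ell ?G \<longleftrightarrow> card (rr_space \<iota> G) < card (rr_space \<iota> ?G)"
    unfolding card_rr_space[OF G] card_rr_space[OF G'] using q_ge_2 by simp
  also have "\<dots> \<longleftrightarrow> rr_space \<iota> G \<noteq> rr_space \<iota> ?G"
    using psubset_card_mono[OF rr_space_finite[OF G'], of "rr_space \<iota> G"] sub by auto
  also have "\<dots> \<longleftrightarrow> (\<exists>f\<in>rr_space \<iota> ?G. f \<noteq> 0 \<and> Q f = - G Q - 1)"
  proof -
    have "f \<notin> rr_space \<iota> G \<longleftrightarrow> f \<noteq> 0 \<and> Q f = - G Q - 1" if f: "f \<in> rr_space \<iota> ?G" for f
    proof -
      have v: "f \<in> val_ge P (- ?G P)" if "P \<in> places \<iota>" for P
        using f that unfolding rr_space_iff[OF G'] by blast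
      have "f \<in> val_ge P (- G P)" if "P \<in> places \<iota>" "P \<noteq> Q" for P
        using v[OF that(1)] that(2) by (simp add: prime_divisor_apply)
      hence "f \<in> rr_space \<iota> G \<longleftrightarrow> f \<in> val_ge Q (- G Q)"
        unfolding rr_space_iff[OF G] using Q by blast
      moreover have "f \<in> val_ge Q (- G Q - 1)" using v[OF Q] by (simp add: prime_divisor_apply)
      ultimately show ?thesis by (auto simp: val_ge_def)
    qed
    thus ?thesis using sub by blast
  qed
  finally show ?thesis .
qed

text \<open>
  If both dimensions changed, the product of functions of extremal order would have a simple pole at
  \<open>Q\<close>, yet \<open>Lam\<close> would vanish on it. If \<open>\<ell>(G)\<close> does not change, a power of \<open>x0\<close> of order just below
  the bound is not a sum of functions small at \<open>Q\<close> and functions small elsewhere; a functional that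
  detects this is multiplication by some \<open>h\<close> followed by \<open>Lam\<close>, and \<open>h\<close> has the extremal order.
\<close>
lemma ell_jump_dual:
  assumes G: "G \<in> divisors \<iota>"
  shows "ell (G + prime_divisor Q) - ell G + (ell (K0 - G) - ell (K0 - (G + prime_divisor Q))) = 1"
proof -
  let ?G = "G + prime_divisor Q" and ?H = "K0 - (G + prime_divisor Q)"
  have G': "?G \<in> divisors \<iota>" and H: "?H \<in> divisors \<iota>" using G K0_divisor by simp_all
  have HK: "K0 - G = ?H + prime_divisor Q" by (rule ext) simp
  have b: "ell ?G - ell G \<in> {0..1}" "ell (K0 - G) - ell ?H \<in> {0..1}"
    using ell_step[OF G Q] ell_step[OF H Q] unfolding HK by simp_all
  have not_both: False if j: "ell G < ell ?G" "ell ?H < ell (K0 - G)"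
  proof -
    obtain f where f: "f \<in> rr_space \<iota> ?G" "f \<noteq> 0" "Q f = - G Q - 1"
      using j(1) unfolding ell_jump[OF G] by blast
    obtain h where h: "h \<in> rr_space \<iota> (?H + prime_divisor Q)" "h \<noteq> 0" "Q h = - ?H Q - 1"
      using j(2) unfolding HK ell_jump[OF H] by blast
    have "Lam (f * h) = 0"
    proof (rule Lam_outside)
      fix P assume P: "P \<in> places \<iota>" "P \<noteq> Q"
      have "f \<in> val_ge P (- ?G P)" using f(1) P(1) unfolding rr_space_iff[OF G'] by blast
      moreover have "h \<in> val_ge P (- (K0 - G) P)"
        using h(1) P(1) unfolding HK[symmetric] rr_space_iff[OF divisor_diff[OF K0_divisor G]] by blast
      ultimately show "f * h \<in> val_ge P (- K0 P)"
        by (rule val_ge_mult'[OF P(1)]) (use P in \<open>simp add: prime_divisor_apply\<close>)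
    qed
    moreover have "Q (f * h) = - 1" using f h by (simp add: place_mult prime_divisor_apply)
    ultimately show False using Lam_pole[of "f * h"] f h by simp
  qed
  have one: "ell ?H < ell (K0 - G)" if n: "\<not> ell G < ell ?G"
  proof -
    let ?R = "{z. \<forall>P\<in>places \<iota> - {Q}. z \<in> val_ge P (- G P)}"
    let ?U = "{a + b | a b. a \<in> ?R \<and> b \<in> val_ge Q (- G Q)}"
    have R: "?R = {x. \<forall>P\<in>places \<iota> - {Q}. x \<in> val_ge P ((\<lambda>P. - G P) P)}" by simp
    have sR: "k.subspace ?R"
      using lattice_subspace[of "places \<iota> - {Q}" "\<lambda>P. - G P"] by (simp add: lattice_def)
    have U: "k.subspace ?U" by (rule k.subspace_sums[OF sR val_ge_subspace[OF Q]])
    let ?y = "x0 powi (- G Q - 1)"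
    have "?y \<notin> ?U"
    proof
      assume "?y \<in> ?U"
      then obtain a c where ac: "?y = a + c" "a \<in> ?R" "c \<in> val_ge Q (- G Q)" by blast
      have Qa: "a \<noteq> 0 \<and> Q a = - G Q - 1"
      proof (cases "c = 0")
        case False
        hence lt: "Q ?y < Q (- c)" using ac(3) by (simp add: val_ge_def)
        have e: "?y + - c = a" using ac(1) by simp
        have c: "- c \<noteq> 0" using False by simp
        show ?thesis
          using place_add_eq[OF Q x0_powi(2) c lt] x0_powi(1)[of "- G Q - 1"] unfolding e by simp
      next
        case True
        hence "a = ?y" using ac(1) by simp
        thus ?thesis using x0_powi by (simp only: simp_thms)
      qed
      have "a \<in> rr_space \<iota> ?G"
        unfolding rr_space_iff[OF G']
      proof
        fix P assume P: "P \<in> places \<iota>"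
        show "a \<in> val_ge P (- ?G P)"
        proof (cases "P = Q")
          case True thus ?thesis using Qa by (simp add: val_ge_def prime_divisor_apply)
        next
          case False
          hence "a \<in> val_ge P (- G P)" using ac(2) P by blast
          thus ?thesis using False by (simp add: prime_divisor_apply)
        qed
      qed
      thus False using n Qa unfolding ell_jump[OF G] by blast
    qed
    from separating_functional[OF U this] obtain \<phi> where
      "linf \<phi> \<and> (\<forall>u\<in>?U. \<phi> u = 0) \<and> \<phi> ?y \<noteq> 0" by (rule exE)
    note \<phi> = this[THEN conjunct1] this[THEN conjunct2, THEN conjunct1, THEN bspec]
      this[THEN conjunct2, THEN conjunct2]
    have an: "annihilates \<phi> G"
      unfolding annihilates_def
    proof (intro conjI ballI allI impI)
      show "\<phi> z = 0" if nm: "z \<in> val_ge Q (- G Q)" for z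
      proof (rule \<phi>(2), rule CollectI, intro exI conjI)
        show "z = 0 + z" by simp
        show "0 \<in> ?R" by (rule k.subspace_0[OF sR])
      qed (rule nm)
      show "\<phi> z = 0" if nm: "\<forall>P\<in>places \<iota> - {Q}. z \<in> val_ge P (- G P)" for z
      proof (rule \<phi>(2), rule CollectI, intro exI conjI)
        show "z = z + 0" by simp
        show "z \<in> ?R" by (rule CollectI) (rule nm)
      qed simp
    qed (rule \<phi>(1))
    from annihilates_multiple[OF an G] obtain h where h: "\<forall>z. \<phi> z = Lam (h * z)" by (rule exE)
    have h': "\<phi> = (\<lambda>z. Lam (h * z))" by (rule ext) (rule h[THEN spec])
    have hr: "h \<in> rr_space \<iota> (?H + prime_divisor Q)"
      using annihilator_in_rr_space[OF an[unfolded h'] G] unfolding HK[symmetric] .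
    have "\<phi> ?y = Lam (h * ?y)" using h by (rule spec)
    hence "h * ?y \<notin> val_ge Q 0" using \<phi>(3) Lam_regular[of "h * ?y"] by (intro notI) simp
    hence "h \<noteq> 0" "Q h < G Q + 1" by (auto simp: val_ge_def place_mult)
    moreover have "h \<in> val_ge Q (- (?H + prime_divisor Q) Q)"
      using hr rr_space_iff[OF divisor_add[OF H divisor_prime[OF Q]]] Q by blast
    ultimately have "h \<noteq> 0 \<and> Q h = - ?H Q - 1" by (simp add: val_ge_def prime_divisor_apply)
    thus ?thesis unfolding HK ell_jump[OF H] using hr by blast
  qed
  show ?thesis
  proof (cases "ell G < ell ?G")
    case True
    hence "\<not> ell ?H < ell (K0 - G)" using not_both by blast
    thus ?thesis using True b unfolding atLeastAtMost_iff by linarith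
  next
    case False
    thus ?thesis using one b unfolding atLeastAtMost_iff by linarith
  qed
qed

text \<open>
  Adding \<open>Q\<close> changes both sides equally, and for large degree the identity is the definition of
  \<open>smax\<close>.
\<close>
theorem riemann_roch_smax:
  assumes G: "G \<in> divisors \<iota>" shows "ell G - ell (K0 - G) = deg G - smax"
proof -
  define D where "D G = ell G - ell (K0 - G) - deg G" for G
  have step: "D (G + prime_divisor Q) = D G" if "G \<in> divisors \<iota>" for G
    using ell_jump_dual[OF that] that by (simp add: D_def deg_add)
  have D: "D (G + nQ n) = D G" for n
  proof (induction n)
    case 0
    have "G + nQ 0 = G" by (rule ext) (simp add: nQ_def)
    thus ?case by simp
  next
    case (Suc n)
    have "G + nQ (Suc n) = (G + nQ n) + prime_divisor Q"
      by (rule ext) (simp add: nQ_def prime_divisor_apply)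
    moreover have "D (G + nQ n + prime_divisor Q) = D (G + nQ n)"
      by (rule step[OF divisor_add[OF G nQ(1)]])
    ultimately show ?case using Suc.IH by (simp only:)
  qed
  obtain c where c: "\<And>G. G \<in> divisors \<iota> \<Longrightarrow> c \<le> deg G \<Longrightarrow> s G = smax" using s_large_degree by metis
  define n where "n = nat (\<bar>c\<bar> + \<bar>deg K0\<bar> + \<bar>deg G\<bar> + 1)"
  have n: "int n = \<bar>c\<bar> + \<bar>deg K0\<bar> + \<bar>deg G\<bar> + 1" by (simp add: n_def)
  have d: "G + nQ n \<in> divisors \<iota>" using G by simp
  have degn: "deg (G + nQ n) = deg G + int n" using G by (simp add: deg_add)
  have "s (G + nQ n) = smax" by (rule c[OF d]) (use n degn in linarith)
  moreover have "ell (K0 - (G + nQ n)) = 0"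
  proof (rule ell_negative_degree)
    show "K0 - (G + nQ n) \<in> divisors \<iota>" using K0_divisor d by simp
    have "deg (K0 - (G + nQ n)) = deg K0 - (deg G + int n)" by (simp only: deg_diff[OF K0_divisor d] degn)
    thus "deg (K0 - (G + nQ n)) < 0" using n by linarith
  qed
  ultimately show ?thesis using D[of n] unfolding D_def s_def by linarith
qed

end

section \<open>Kaehler differentials\<close>

lemma diff_scale_vector_space:
  "vector_space (diff_scale :: 'f::field \<Rightarrow> 'f differential \<Rightarrow> 'f differential)"
  by unfold_locales (simp_all add: diff_scale_def fun_eq_iff algebra_simps)

context pointed_curve
begin

text \<open>
  A differential is a function on derivations, and derivations are determined by their value at \<open>t\<close>.
\<close>
lemma kaehler_ddt: assumes t: "sep t" shows "kaehler_d \<iota> y = diff_scale (ddt t y) (kaehler_d \<iota> t)"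
  by (rule ext) (simp add: kaehler_d_def diff_scale_def derivation_eq[OF _ t, of _ y])

lemma diff_scale_inject:
  assumes t: "sep t" shows "diff_scale f (kaehler_d \<iota> t) = diff_scale g (kaehler_d \<iota> t) \<longleftrightarrow> f = g"
proof
  assume "diff_scale f (kaehler_d \<iota> t) = diff_scale g (kaehler_d \<iota> t)"
  hence "diff_scale f (kaehler_d \<iota> t) (ddt t) = diff_scale g (kaehler_d \<iota> t) (ddt t)" by (rule arg_cong)
  thus "f = g" by (simp add: diff_scale_def kaehler_d_def ddt_derivation[OF t] ddt_self[OF t])
qed simp

abbreviation \<omega> :: "'f \<Rightarrow> 'f differential" where "\<omega> f \<equiv> diff_scale f (kaehler_d \<iota> x0)"

lemma differentials_eq: "differentials \<iota> = range \<omega>"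
proof -
  interpret D: vector_space "diff_scale :: 'f \<Rightarrow> 'f differential \<Rightarrow> 'f differential" by (rule diff_scale_vector_space)
  have "differentials \<iota> = D.span {kaehler_d \<iota> x0}"
    unfolding differentials_def
  proof (rule D.span_subspace)
    show "range (kaehler_d \<iota>) \<subseteq> D.span {kaehler_d \<iota> x0}"
    proof (rule image_subsetI)
      fix y
      have "\<omega> (ddt x0 y) \<in> D.span {kaehler_d \<iota> x0}" by (intro D.span_scale D.span_base) simp
      thus "kaehler_d \<iota> y \<in> D.span {kaehler_d \<iota> x0}" by (simp only: kaehler_ddt[OF x0(3), of y])
    qed
    show "D.span {kaehler_d \<iota> x0} \<subseteq> D.span (range (kaehler_d \<iota>))" by (intro D.span_mono) simp
    show "D.subspace (D.span {kaehler_d \<iota> x0})" by (rule D.subspace_span)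
  qed
  thus ?thesis by (simp only: D.span_singleton)
qed

lemma local_coeff_eq: assumes P: "P \<in> places \<iota>" shows "local_coeff \<iota> P (\<omega> f) = f * dx P"
proof -
  note t = sep_local_param[OF P]
  have "\<omega> f = diff_scale (f * dx P) (kaehler_d \<iota> (local_param P))"
    unfolding kaehler_ddt[OF t, of x0] by (simp add: diff_scale_def dx_def mult.assoc)
  thus ?thesis unfolding local_coeff_def by (simp only: diff_scale_inject[OF t] eq_commute[of "f * dx P"]) simp
qed

lemma diff_div_eq: assumes f: "f \<noteq> 0" shows "diff_div \<iota> (\<omega> f) = K0 + fun_div \<iota> f"
proof (rule ext)
  fix P show "diff_div \<iota> (\<omega> f) P = (K0 + fun_div \<iota> f) P"
    using f dx_nonzero[of P]
    by (simp add: diff_div_def diff_val_def local_coeff_eq K0_def fun_div_def place_mult)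
qed

lemma regular_differentials_eq: "regular_differentials \<iota> = \<omega> ` rr_space \<iota> K0"
proof -
  have "\<omega> f \<in> regular_differentials \<iota> \<longleftrightarrow> f \<in> rr_space \<iota> K0" for f
  proof (cases "f = 0")
    case True
    have "\<omega> 0 = 0" by (rule ext) (simp add: diff_scale_def)
    thus ?thesis using True differentials_eq by (simp add: regular_differentials_def rr_space_def image_iff) metis
  next
    case False
    have "\<omega> f \<noteq> 0" using diff_scale_inject[OF x0(3), of f 0] False by (auto simp: diff_scale_def fun_eq_iff)
    hence "\<omega> f \<in> regular_differentials \<iota> \<longleftrightarrow> (\<forall>P\<in>places \<iota>. 0 \<le> diff_div \<iota> (\<omega> f) P)"
      by (simp add: regular_differentials_def differentials_eq diff_div_def)
    also have "\<dots> \<longleftrightarrow> (\<forall>P\<in>places \<iota>. f \<in> val_ge P (- K0 P))"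
      using False by (auto simp: diff_div_eq fun_div_def val_ge_def)
    finally show ?thesis unfolding rr_space_iff[OF K0_divisor] .
  qed
  moreover have "regular_differentials \<iota> \<subseteq> range \<omega>" by (auto simp: regular_differentials_def differentials_eq)
  ultimately show ?thesis by blast
qed

text \<open>Multiplication of \<open>dx0\<close> identifies \<open>L(K0)\<close> with the regular differentials.\<close>
lemma genus_eq: "int (genus \<iota>) = ell K0"
proof -
  let ?sc = "\<lambda>a. (diff_scale (\<iota> a) :: 'f differential \<Rightarrow> 'f differential)"
  interpret V: vector_space ?sc
    by unfold_locales (simp_all add: diff_scale_def fun_eq_iff iota_add iota_mult algebra_simps)
  note U = rr_space_subspace[OF K0_divisor]
  have add: "\<omega> f + \<omega> g = \<omega> (f + g)" and sc: "?sc a (\<omega> f) = \<omega> (const_scale \<iota> a f)" and z: "\<omega> 0 = 0" for a f g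
    by (simp_all add: diff_scale_def const_scale_def fun_eq_iff algebra_simps)
  have "V.subspace (\<omega> ` rr_space \<iota> K0)"
  proof (rule V.subspaceI)
    show "0 \<in> \<omega> ` rr_space \<iota> K0" by (rule image_eqI[where x = 0]) (simp_all add: z k.subspace_0[OF U])
    show "x + y \<in> \<omega> ` rr_space \<iota> K0" if "x \<in> \<omega> ` rr_space \<iota> K0" "y \<in> \<omega> ` rr_space \<iota> K0" for x y
      using that k.subspace_add[OF U] by (auto simp only: add)
    show "?sc a x \<in> \<omega> ` rr_space \<iota> K0" if "x \<in> \<omega> ` rr_space \<iota> K0" for a x
      using that k.subspace_scale[OF U] by (auto simp only: sc)
  qed
  hence "card (\<omega> ` rr_space \<iota> K0) = q ^ genus \<iota>"
    using card_subspace[OF V.vector_space_axioms] rr_space_finite[OF K0_divisor]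
    unfolding genus_def regular_differentials_eq card_k by blast
  moreover have "card (\<omega> ` rr_space \<iota> K0) = q ^ rr_dim \<iota> K0"
    unfolding card_rr_space[OF K0_divisor, symmetric]
    by (rule card_image) (simp add: inj_on_def diff_scale_inject[OF x0(3)])
  ultimately show ?thesis by simp
qed

lemma smax_eq: "smax = int (genus \<iota>) - 1" and deg_K0: "deg K0 = 2 * int (genus \<iota>) - 2"
proof -
  show 1: "smax = int (genus \<iota>) - 1"
    using riemann_roch_smax[OF divisor_0] genus_eq ell_0 by simp
  show "deg K0 = 2 * int (genus \<iota>) - 2"
    using riemann_roch_smax[OF K0_divisor] genus_eq ell_0 1 by simp
qed

text \<open>
  Any differential is a multiple of \<open>dx0\<close>, so its divisor is equivalent to \<open>K0\<close>. The divisors \<open>0\<close>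
  and \<open>K0\<close> in \<open>riemann_roch_smax\<close> determine \<open>smax\<close> and the degree of \<open>K0\<close>.
\<close>
theorem riemann_roch:
  assumes \<eta>: "\<eta> \<in> differentials \<iota>" "\<eta> \<noteq> 0"
  shows "diff_div \<iota> \<eta> \<in> divisors \<iota>" "deg (diff_div \<iota> \<eta>) = 2 * int (genus \<iota>) - 2"
    "ell (diff_div \<iota> \<eta>) = int (genus \<iota>)"
    "G \<in> divisors \<iota> \<Longrightarrow> ell G - ell (diff_div \<iota> \<eta> - G) = deg G + 1 - int (genus \<iota>)"
proof -
  obtain f where f: "\<eta> = \<omega> f" using \<eta>(1) differentials_eq by blast
  hence f0: "f \<noteq> 0" using \<eta>(2) by (auto simp: diff_scale_def fun_eq_iff)
  have K: "diff_div \<iota> \<eta> = K0 + fun_div \<iota> f" using diff_div_eq[OF f0] f by simp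
  show "diff_div \<iota> \<eta> \<in> divisors \<iota>" "deg (diff_div \<iota> \<eta>) = 2 * int (genus \<iota>) - 2"
    "ell (diff_div \<iota> \<eta>) = int (genus \<iota>)"
    using f0 K0_divisor deg_K0 genus_eq by (simp_all add: K deg_add ell_shift)
  assume G: "G \<in> divisors \<iota>"
  have KG: "diff_div \<iota> \<eta> - G = K0 - G + fun_div \<iota> f" unfolding K by simp
  hence "ell (diff_div \<iota> \<eta> - G) = ell (K0 - G)"
    using ell_shift[OF f0 divisor_diff[OF K0_divisor G]] by (simp only: KG)
  thus "ell G - ell (diff_div \<iota> \<eta> - G) = deg G + 1 - int (genus \<iota>)"
    using riemann_roch_smax[OF G] smax_eq by simp
qed

end

section \<open>Linear codes\<close>

text \<open>
  A basis \<open>B\<close> of \<open>C\<close> is extended to a basis \<open>E\<close> of the whole space. An element of the dual code is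
  determined by its products with the vectors of \<open>E - B\<close>, since those with \<open>B\<close> are zero.
\<close>
lemma card_dual_code:
  fixes C :: "(('k::{field,finite})^('n::finite)) set"
  assumes C: "vec.subspace C"
  shows "card C * card (dual_code C) \<le> CARD('k) ^ CARD('n)"
proof -
  obtain B where B: "B \<subseteq> C" "vec.independent B" "C \<subseteq> vec.span B" "card B = vec.dim C"
    using vec.basis_exists[of C] by blast
  obtain E where E: "B \<subseteq> E" "vec.independent E" "UNIV \<subseteq> vec.span E"
    using vec.maximal_independent_subset_extend[of B UNIV] B(2) by auto
  have card_E: "card E = CARD('n)" using vec.basis_card_eq_dim[OF subset_UNIV E(3,2)] vec_dim_card by metis
  have fin: "finite E" by simp
  let ?dot = "\<lambda>x y :: 'k^'n. \<Sum>i\<in>UNIV. x $ i * y $ i"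
  let ?f = "\<lambda>x. \<lambda>b\<in>E - B. ?dot x b"
  have inj: "inj_on ?f (dual_code C)"
  proof (rule inj_onI)
    fix x y assume x: "x \<in> dual_code C" and y: "y \<in> dual_code C" and eq: "?f x = ?f y"
    let ?N = "{v. ?dot (x - y) v = 0}"
    have "vec.subspace ?N"
      unfolding vec.subspace_def
      by (auto simp: distrib_left sum.distrib mult.left_commute simp flip: sum_distrib_left)
    moreover have "E \<subseteq> ?N"
    proof
      fix b assume b: "b \<in> E"
      have "?dot x b = ?dot y b"
      proof (cases "b \<in> B")
        case True thus ?thesis using x y B(1) by (auto simp: dual_code_def)
      next
        case False thus ?thesis using fun_cong[OF eq, of b] b by simp
      qed
      thus "b \<in> ?N" by (simp add: left_diff_distrib sum_subtractf)
    qed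
    ultimately have "vec.span E \<subseteq> ?N" by (simp add: vec.span_minimal)
    hence N: "?dot (x - y) v = 0" for v using E(3) by blast
    have "(x - y) $ i = 0" for i
    proof -
      have "?dot (x - y) (axis i 1) = (\<Sum>j\<in>UNIV. if j = i then (x - y) $ i else 0)"
        by (rule sum.cong) (auto simp: axis_def)
      thus ?thesis using N[of "axis i 1"] by simp
    qed
    thus "x = y" by (simp add: vec_eq_iff)
  qed
  have "card (dual_code C) \<le> card (PiE (E - B) (\<lambda>_. UNIV :: 'k set))"
  proof (rule card_inj_on_le[OF inj])
    show "?f ` dual_code C \<subseteq> PiE (E - B) (\<lambda>_. UNIV)" by (rule image_subsetI) (simp add: restrict_PiE_iff)
  qed (simp add: finite_PiE)
  hence "card (dual_code C) \<le> CARD('k) ^ (CARD('n) - card B)"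
    using card_Diff_subset[OF finite_subset[OF E(1) fin] E(1)] by (simp add: card_PiE card_E)
  moreover have "card C = CARD('k) ^ card B"
    using card_subspace[OF vec.vector_space_axioms C] B(4) by simp
  moreover have "card B \<le> CARD('n)" using card_mono[OF fin E(1)] card_E by simp
  ultimately show ?thesis
    by (metis le_add_diff_inverse mult_le_mono2 power_add)
qed

section \<open>Values and residues at rational places\<close>

context pointed_curve
begin

lemma eval_at_ops:
  assumes P: "rational_place \<iota> P" and x: "x \<in> val_ge P 0" and y: "y \<in> val_ge P 0"
  shows "eval_at \<iota> P (x + y) = eval_at \<iota> P x + eval_at \<iota> P y"
    "eval_at \<iota> P (x - y) = eval_at \<iota> P x - eval_at \<iota> P y"
    "eval_at \<iota> P (x * y) = eval_at \<iota> P x * eval_at \<iota> P y"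
    "eval_at \<iota> P x = 0 \<longleftrightarrow> x \<in> val_ge P 1"
    "eval_at \<iota> P (\<iota> c) = c"
proof -
  have Pp: "P \<in> places \<iota>" using P by (simp add: rational_place_def)
  let ?a = "eval_at \<iota> P x" and ?b = "eval_at \<iota> P y"
  note a = eval_at(1)[OF P x] and b = eval_at(1)[OF P y]
  have e1: "x + y - \<iota> (?a + ?b) = (x - \<iota> ?a) + (y - \<iota> ?b)" by (simp add: iota_add)
  thus "eval_at \<iota> P (x + y) = ?a + ?b"
    by (intro eval_at(2)[OF P val_ge_add[OF Pp x y]]) (simp only: e1 val_ge_add[OF Pp a b])
  have e2: "x - y - \<iota> (?a - ?b) = (x - \<iota> ?a) - (y - \<iota> ?b)" by (simp add: iota_diff)
  thus "eval_at \<iota> P (x - y) = ?a - ?b"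
    by (intro eval_at(2)[OF P val_ge_diff[OF Pp x y]]) (simp only: e2 val_ge_diff[OF Pp a b])
  have e: "x * y - \<iota> (?a * ?b) = (x - \<iota> ?a) * y + \<iota> ?a * (y - \<iota> ?b)" by (simp add: iota_mult algebra_simps)
  have "x * y - \<iota> (?a * ?b) \<in> val_ge P 1" unfolding e
    by (intro val_ge_add[OF Pp] val_ge_iota_mult[OF Pp b] val_ge_mult'[OF Pp a y]) simp
  thus "eval_at \<iota> P (x * y) = ?a * ?b" using eval_at(2)[OF P val_ge_mult'[OF Pp x y]] by simp
  show "?a = 0 \<longleftrightarrow> x \<in> val_ge P 1" using a eval_at(2)[OF P x, of 0] by auto
  show "eval_at \<iota> P (\<iota> c) = c" by (rule eval_at(2)[OF P]) (simp_all add: Pp)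
qed

text \<open>
  The principal part of an expansion is unique, because its terms have distinct negative orders. At
  a simple pole it consists of the value of \<open>f t\<close> divided by \<open>t\<close>.
\<close>
lemma residue_simple_pole:
  assumes P: "rational_place \<iota> P" and f: "f * dx P * local_param P \<in> val_ge P 0"
  shows "residue \<iota> P (\<omega> f) = eval_at \<iota> P (f * dx P * local_param P)"
proof -
  have Pp: "P \<in> places \<iota>" using P by (simp add: rational_place_def)
  let ?t = "local_param P" and ?u = "f * dx P"
  define c where "c = eval_at \<iota> P (?u * ?t)"
  note t = local_param[OF Pp]
  have "?u - \<iota> c / ?t = (?u * ?t - \<iota> c) * inverse ?t" using t(2) by (simp add: field_simps)
  moreover have "\<dots> \<in> val_ge P 0"
    by (rule val_ge_mult'[OF Pp eval_at(1)[OF P f, folded c_def] val_ge_self[OF Pp]]) (use t Pp in simp)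
  ultimately have reg: "?u - \<iota> c / ?t \<in> val_ge P 0" by simp
  show ?thesis
    unfolding residue_def local_coeff_eq[OF Pp] local_ring_eq c_def[symmetric]
  proof (rule the_equality)
    have "?u - (\<Sum>i\<le>0. \<iota> ((\<lambda>_. c) i) / ?t ^ Suc i) \<in> val_ge P 0" using reg by simp
    thus "\<exists>n a. c = a 0 \<and> ?u - (\<Sum>i\<le>(n::nat). \<iota> (a i) / ?t ^ Suc i) \<in> val_ge P 0"
      by (intro exI[of _ 0] exI[of _ "\<lambda>_. c"] conjI refl)
  next
    fix r assume "\<exists>n a. r = a 0 \<and> ?u - (\<Sum>i\<le>(n::nat). \<iota> (a i) / ?t ^ Suc i) \<in> val_ge P 0"
    then obtain n a where a: "r = a 0" "?u - (\<Sum>i\<le>(n::nat). \<iota> (a i) / ?t ^ Suc i) \<in> val_ge P 0" by blast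
    \<comment> \<open>the difference of two principal parts is regular and has the coefficients \<open>d\<close>\<close>
    define d where "d i = (if i = 0 then a i - c else a i)" for i :: nat
    define e where "e i = \<iota> (d i) / ?t ^ Suc i" for i
    have "(\<Sum>i\<le>n. e i) = (\<Sum>i\<le>n. \<iota> (a i) / ?t ^ Suc i) - \<iota> c / ?t"
    proof -
      have "e i = \<iota> (a i) / ?t ^ Suc i - (if i = 0 then \<iota> c / ?t else 0)" for i
        by (simp add: e_def d_def iota_diff diff_divide_distrib)
      thus ?thesis by (simp add: sum_subtractf)
    qed
    hence "(\<Sum>i\<le>n. e i) = (?u - \<iota> c / ?t) - (?u - (\<Sum>i\<le>n. \<iota> (a i) / ?t ^ Suc i))" by simp
    hence in0: "(\<Sum>i\<le>n. e i) \<in> val_ge P 0" using val_ge_diff[OF Pp reg a(2)] by simp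
    let ?I = "{i \<in> {..n}. d i \<noteq> 0}"
    have sumI: "(\<Sum>i\<in>?I. e i) = (\<Sum>i\<le>n. e i)" by (rule sum.mono_neutral_left) (auto simp: e_def)
    have ne: "e i \<noteq> 0" if "d i \<noteq> 0" for i using that t by (simp add: e_def)
    have Pe: "P (e i) = - int (Suc i)" if "d i \<noteq> 0" for i
    proof -
      have "P (e i) = P (\<iota> (d i)) - P (?t ^ Suc i)" unfolding e_def
        by (rule place_divide[OF Pp]) (use that t in simp_all)
      thus ?thesis using t Pp by (simp only: place_iota[OF Pp] place_power[OF Pp]) simp
    qed
    have "?I = {}"
    proof (rule ccontr)
      assume I: "?I \<noteq> {}"
      have inj: "inj_on (\<lambda>i. P (e i)) ?I" by (rule inj_onI) (simp add: Pe)
      have "(\<Sum>i\<in>?I. e i) \<noteq> 0 \<and> (\<exists>i\<in>?I. P (\<Sum>i\<in>?I. e i) = P (e i) \<and> (\<forall>j\<in>?I. P (e i) \<le> P (e j)))"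
        by (rule sum_distinct_places[OF Pp _ I _ inj]) (simp_all add: ne)
      then obtain i where i: "(\<Sum>i\<in>?I. e i) \<noteq> 0" "i \<in> ?I" "P (\<Sum>i\<in>?I. e i) = P (e i)" by blast
      hence "0 \<le> P (e i)" using in0 val_geD[of "\<Sum>i\<le>n. e i" P 0] unfolding sumI by simp
      thus False using Pe[of i] i(2) by simp
    qed
    hence "d 0 = 0" by auto
    thus "r = c" using a(1) by (simp add: d_def)
  qed
qed

end

section \<open>The dual of an evaluation code\<close>

locale evaluation_code = pointed_curve \<iota> Q for \<iota> :: "'k::{field,finite} \<Rightarrow> 'f::field" and Q +
  fixes P :: "'n::finite \<Rightarrow> 'f place" and G :: "'f divisor" and \<eta> :: "'f differential"
  assumes inj_P: "inj P" and rat: "rational_place \<iota> (P i)"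
    and G: "G \<in> divisors \<iota>" and G_P: "G (P i) = 0"
    and \<eta>: "\<eta> \<in> differentials \<iota>"
    and pole: "diff_val \<iota> (P i) \<eta> = - 1" and residue_1: "residue \<iota> (P i) \<eta> = 1"
begin

definition D where "D = (\<Sum>i\<in>UNIV. prime_divisor (P i))"
definition K where "K = diff_div \<iota> \<eta>"
definition A where "A = D - G + K"

lemma P [simp]: "P i \<in> places \<iota>" using rat by (simp add: rational_place_def)

lemma D_apply: "D R = (if R \<in> range P then 1 else 0)"
proof -
  have *: "(\<Sum>i\<in>I. prime_divisor (P i)) R = (\<Sum>i\<in>I. prime_divisor (P i) R)" for I
    by (induction I rule: infinite_finite_induct) auto
  show ?thesis
  proof (cases "R \<in> range P")
    case True
    then obtain j where j: "R = P j" by blast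
    have "prime_divisor (P i) R = (if i = j then 1 else 0)" for i
      using inj_P j by (auto simp: prime_divisor_apply inj_eq)
    thus ?thesis using True by (simp add: D_def *)
  next
    case False
    hence "prime_divisor (P i) R = 0" for i by (auto simp: prime_divisor_apply)
    thus ?thesis using False by (simp add: D_def *)
  qed
qed

lemma supp_D: "supp D = range P" by (auto simp: supp_def D_apply)

lemma D [simp]: "D \<in> divisors \<iota>" by (rule divisorsI[of "range P"]) (auto simp: D_apply)

lemma deg_D: "deg D = int CARD('n)"
proof -
  have "place_degree \<iota> (P i) = 1" for i using rat by (simp add: rational_place_def)
  hence "deg D = (\<Sum>R\<in>range P. 1)" unfolding div_degree_def supp_D by (intro sum.cong) (auto simp: D_apply)
  thus ?thesis using card_image[OF inj_P] by simp
qed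

text \<open>The function with \<open>\<eta> = coef dx0\<close>.\<close>
definition coef where "coef = (SOME f. \<eta> = \<omega> f)"

lemma \<eta>_eq: "\<eta> = \<omega> coef" and coef: "coef \<noteq> 0"
proof -
  show eq: "\<eta> = \<omega> coef" unfolding coef_def by (rule someI_ex) (use \<eta> differentials_eq in blast)
  show "coef \<noteq> 0"
  proof
    assume "coef = 0"
    \<comment> \<open>the type of indices is inhabited, and \<open>\<eta>\<close> has a pole at any of the places\<close>
    hence "local_coeff \<iota> (P undefined) \<eta> = 0" using local_coeff_eq[OF P] eq by simp
    thus False using pole[of undefined] place_0[OF P] by (simp add: diff_val_def)
  qed
qed

lemma \<eta>_nonzero: "\<eta> \<noteq> 0"
  using \<eta>_eq coef diff_scale_inject[OF x0(3), of coef 0] by (auto simp: diff_scale_def fun_eq_iff)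

lemma K_apply: "R \<in> places \<iota> \<Longrightarrow> K R = K0 R + R coef"
  using diff_div_eq[OF coef] \<eta>_eq by (simp add: K_def fun_div_def)

lemma K_P: "K (P i) = - 1" using pole by (simp add: K_def diff_div_def)

lemma K [simp]: "K \<in> divisors \<iota>" unfolding K_def by (rule riemann_roch[OF \<eta> \<eta>_nonzero])

lemma A [simp]: "A \<in> divisors \<iota>" using G by (simp add: A_def)

lemma A_P: "A (P i) = 0" by (simp add: A_def D_apply G_P K_P)

lemma local_coeff_\<eta>: "local_coeff \<iota> (P i) \<eta> = coef * dx (P i)"
  by (rule trans[OF arg_cong[OF \<eta>_eq, of "local_coeff \<iota> (P i)"] local_coeff_eq[OF P]])

lemma eval_residue:
  shows "coef * dx (P i) * local_param (P i) \<in> val_ge (P i) 0"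
    "eval_at \<iota> (P i) (coef * dx (P i) * local_param (P i)) = 1"
proof -
  have "P i (coef * dx (P i)) = - 1" using pole[of i] by (simp add: diff_val_def local_coeff_\<eta>)
  moreover have "coef * dx (P i) \<noteq> 0" using coef dx_nonzero[OF P] by simp
  ultimately show 1: "coef * dx (P i) * local_param (P i) \<in> val_ge (P i) 0"
    using local_param[OF P[of i]] place_mult[OF P[of i], of "coef * dx (P i)" "local_param (P i)"]
    by (simp add: val_ge_def)
  show "eval_at \<iota> (P i) (coef * dx (P i) * local_param (P i)) = 1"
    using residue_simple_pole[OF rat 1] residue_1[of i] by (simp only: \<eta>_eq[symmetric])
qed

text \<open>
  Since \<open>\<eta>\<close> has residue one, the residue of \<open>z \<eta>\<close> is the value of \<open>z\<close>. This links Tate's residue to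
  the classical one.
\<close>
lemma resP_at_pole:
  assumes z: "z \<in> val_ge (P i) 0" shows "resP (P i) (z * coef) x0 = eval_at \<iota> (P i) z"
proof -
  let ?t = "local_param (P i)" and ?w = "z * (coef * dx (P i) * local_param (P i))"
  note t = local_param[OF P[of i]]
  have "z * coef * dx (P i) = ?w / ?t" using t(2) by simp
  hence "resP (P i) (z * coef) x0 = resP (P i) (?w / ?t) ?t" unfolding resP_x0[OF P] by (rule arg_cong)
  also have "\<dots> = eval_at \<iota> (P i) ?w"
    by (rule resP_rational[OF rat t(1) val_ge_mult'[OF P z eval_residue(1)]]) simp
  also have "\<dots> = eval_at \<iota> (P i) z" unfolding eval_at_ops(3)[OF rat z eval_residue(1)] eval_residue(2) by simp
  finally show ?thesis .
qed

definition code where "code E = ag_code \<iota> P E"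

definition ev :: "'f \<Rightarrow> 'k^'n" where "ev h = (\<chi> i. eval_at \<iota> (P i) h)"

lemma code_eq: "code E = ev ` rr_space \<iota> E" by (simp add: code_def ag_code_def ev_def)

context
  fixes E assumes E: "E \<in> divisors \<iota>" and E_P: "\<And>i. E (P i) = 0"
begin

lemma rr_space_regular: "h \<in> rr_space \<iota> E \<Longrightarrow> h \<in> val_ge (P i) 0"
  unfolding rr_space_iff[OF E] using E_P[of i] P[of i] by fastforce

lemma ev_ops:
  assumes "x \<in> rr_space \<iota> E" "y \<in> rr_space \<iota> E"
  shows "ev (x + y) = ev x + ev y" "ev (x - y) = ev x - ev y" "ev (\<iota> c * x) = c *s ev x"
proof -
  note r = assms[THEN rr_space_regular]
  show "ev (x + y) = ev x + ev y" "ev (x - y) = ev x - ev y"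
    by (simp_all add: ev_def vec_eq_iff eval_at_ops[OF rat r])
  have c: "\<iota> c \<in> val_ge (P i) 0" for i by simp
  show "ev (\<iota> c * x) = c *s ev x"
    by (simp add: ev_def vec_eq_iff eval_at_ops(3)[OF rat c r(1)] eval_at_ops(5)[OF rat r])
qed

lemma code_subspace: "vec.subspace (code E)"
  unfolding code_eq
proof (rule vec.subspaceI)
  note U = rr_space_subspace[OF E]
  show "0 \<in> ev ` rr_space \<iota> E"
    using ev_ops(2)[OF k.subspace_0[OF U] k.subspace_0[OF U]] k.subspace_0[OF U] by (intro image_eqI[of _ _ 0]) simp_all
  show "x + y \<in> ev ` rr_space \<iota> E" if xy: "x \<in> ev ` rr_space \<iota> E" "y \<in> ev ` rr_space \<iota> E" for x y
  proof -
    obtain a b where ab: "x = ev a" "a \<in> rr_space \<iota> E" "y = ev b" "b \<in> rr_space \<iota> E" using xy by blast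
    show ?thesis
      by (rule image_eqI[of _ _ "a + b"]) (simp_all add: ab ev_ops k.subspace_add[OF U])
  qed
  show "c *s x \<in> ev ` rr_space \<iota> E" if x: "x \<in> ev ` rr_space \<iota> E" for c x
  proof -
    obtain a where a: "x = ev a" "a \<in> rr_space \<iota> E" using x by blast
    show ?thesis
      by (rule image_eqI[of _ _ "\<iota> c * a"])
        (use a k.subspace_scale[OF U a(2), of c] in \<open>simp_all add: ev_ops(3) const_scale_def\<close>)
  qed
qed

lemma ev_kernel: "{h \<in> rr_space \<iota> E. ev h = 0} = rr_space \<iota> (E - D)"
proof (rule Set.set_eqI)
  fix h
  have ED: "E - D \<in> divisors \<iota>" using E by simp
  show "h \<in> {h \<in> rr_space \<iota> E. ev h = 0} \<longleftrightarrow> h \<in> rr_space \<iota> (E - D)"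
  proof
    assume "h \<in> {h \<in> rr_space \<iota> E. ev h = 0}"
    hence h: "h \<in> rr_space \<iota> E" and 0: "\<And>i. eval_at \<iota> (P i) h = 0" by (auto simp: ev_def vec_eq_iff)
    show "h \<in> rr_space \<iota> (E - D)"
      unfolding rr_space_iff[OF ED]
    proof
      fix R assume R: "R \<in> places \<iota>"
      have "h \<in> val_ge (P i) 1" for i using 0 eval_at_ops(4)[OF rat rr_space_regular[OF h] rr_space_regular[OF h]] by blast
      thus "h \<in> val_ge R (- (E - D) R)"
        using h R E_P by (cases "R \<in> range P") (auto simp: D_apply rr_space_iff[OF E])
    qed
  next
    assume h: "h \<in> rr_space \<iota> (E - D)"
    have hE: "h \<in> rr_space \<iota> E"
      by (rule subsetD[OF rr_space_mono[OF ED E] h]) (simp add: le_fun_def D_apply)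
    have "h \<in> val_ge (P i) (- (E - D) (P i))" for i using h P unfolding rr_space_iff[OF ED] by blast
    hence "h \<in> val_ge (P i) 1" for i by (simp add: E_P D_apply)
    hence "ev h = 0" using eval_at_ops(4)[OF rat rr_space_regular[OF hE] rr_space_regular[OF hE]]
      by (simp add: ev_def vec_eq_iff)
    thus "h \<in> {h \<in> rr_space \<iota> E. ev h = 0}" using hE by simp
  qed
qed

lemma card_code: "q ^ rr_dim \<iota> E = card (code E) * q ^ rr_dim \<iota> (E - D)"
proof -
  have "card (rr_space \<iota> E) = card (ev ` rr_space \<iota> E) * card {h \<in> rr_space \<iota> E. ev h = 0}"
  proof (rule card_fibres(2))
    show "x - y \<in> rr_space \<iota> E" if "x \<in> rr_space \<iota> E" "y \<in> rr_space \<iota> E" for x y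
      by (rule subspace_diff[OF rr_space_subspace[OF E] that])
  qed (use E ev_ops(2) in simp_all)
  thus ?thesis unfolding ev_kernel code_eq card_rr_space[OF E] card_rr_space[OF divisor_diff[OF E D]] .
qed

end

text \<open>
  The differential \<open>f h \<eta>\<close> has poles only at the places of \<open>D\<close>, so its residues there add up to
  zero.
\<close>
lemma ev_orthogonal:
  assumes f: "f \<in> rr_space \<iota> G" and h: "h \<in> rr_space \<iota> A"
  shows "(\<Sum>i\<in>UNIV. ev f $ i * ev h $ i) = 0"
proof -
  note rf = rr_space_regular[OF G G_P f] and rh = rr_space_regular[OF A A_P h]
  have "(\<Sum>R\<in>range P. resP R (f * h * coef) x0) = 0"
  proof (rule residue_sum)
    fix R assume R: "R \<in> places \<iota>" "R \<notin> range P"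
    have "f \<in> val_ge R (- G R)" "h \<in> val_ge R (- A R)"
      using f h R(1) unfolding rr_space_iff[OF G] rr_space_iff[OF A] by blast+
    hence "f * h \<in> val_ge R (- G R + - A R)" by (rule val_ge_mult[OF R(1)])
    thus "f * h * coef \<in> val_ge R (- K0 R)"
      by (rule val_ge_mult'[OF R(1) _ val_ge_self[OF R(1)]]) (use R in \<open>simp add: A_def D_apply K_apply\<close>)
  qed auto
  also have "(\<Sum>R\<in>range P. resP R (f * h * coef) x0) = (\<Sum>i\<in>UNIV. resP (P i) (f * h * coef) x0)"
    by (rule sum.reindex_cong[OF inj_P]) simp_all
  also have "\<dots> = (\<Sum>i\<in>UNIV. ev f $ i * ev h $ i)"
  proof (rule sum.cong[OF refl])
    fix i
    have "resP (P i) (f * h * coef) x0 = eval_at \<iota> (P i) (f * h)"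
      by (rule resP_at_pole[OF val_ge_mult'[OF P rf rh]]) simp
    thus "resP (P i) (f * h * coef) x0 = ev f $ i * ev h $ i"
      by (simp add: ev_def eval_at_ops(3)[OF rat rf rh])
  qed
  finally show ?thesis .
qed

text \<open>
  By orthogonality one inclusion holds. The cardinalities agree: Riemann-Roch for \<open>G\<close> and for \<open>A\<close>,
  where \<open>A - D = K - G\<close> and \<open>K - A = G - D\<close>, makes the dimensions of the two codes add up to the
  degree of \<open>D\<close>.
\<close>
theorem dual_code_eq: "dual_code (code G) = code A"
proof (rule card_seteq[symmetric])
  show "code A \<subseteq> dual_code (code G)"
    using ev_orthogonal by (force simp: code_eq dual_code_def intro: trans[OF sum.cong[OF refl mult.commute]])
  have AD: "A - D = K - G" and KA: "K - A = G - D" by (rule ext, simp add: A_def)+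
  note rr = riemann_roch(4)[OF \<eta> \<eta>_nonzero, folded K_def] riemann_roch(2)[OF \<eta> \<eta>_nonzero, folded K_def]
  have "deg A = int CARD('n) - deg G + deg K" using G by (simp add: A_def deg_add deg_diff deg_D)
  hence "ell G + ell A = ell (G - D) + ell (A - D) + int CARD('n)"
    using rr(1)[OF G] rr(1)[OF A] rr(2) unfolding AD KA by linarith
  hence "rr_dim \<iota> G + rr_dim \<iota> A = rr_dim \<iota> (G - D) + rr_dim \<iota> (A - D) + CARD('n)" by linarith
  hence "q ^ rr_dim \<iota> G * q ^ rr_dim \<iota> A = q ^ rr_dim \<iota> (G - D) * q ^ rr_dim \<iota> (A - D) * q ^ CARD('n)"
    by (simp only: power_add[symmetric])
  hence "card (code G) * card (code A) * (q ^ rr_dim \<iota> (G - D) * q ^ rr_dim \<iota> (A - D)) =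
      q ^ CARD('n) * (q ^ rr_dim \<iota> (G - D) * q ^ rr_dim \<iota> (A - D))"
    unfolding card_code[OF G G_P] card_code[OF A A_P] by (simp only: mult_ac)
  moreover have q0: "0 < q" using q_ge_2 by simp
  ultimately have eq: "card (code G) * card (code A) = q ^ CARD('n)" by simp
  have "card (code G) * card (dual_code (code G)) \<le> card (code G) * card (code A)"
    unfolding eq using card_dual_code[OF code_subspace[OF G G_P]] by (simp only: card_k)
  moreover have "0 < card (code G)" using eq q0 by (metis mult_0 neq0_conv zero_less_power)
  ultimately show "card (dual_code (code G)) \<le> card (code A)" by simp
qed simp

end

section \<open>Clifford's inequality\<close>

text \<open>
  The translates of \<open>S\<close> by the least element of \<open>T\<close> and of \<open>T\<close> by the greatest element of \<open>S\<close> have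
  only one element in common.
\<close>
lemma card_sumset_ge:
  fixes S T :: "int set"
  assumes fin: "finite S" "finite T" and ne: "S \<noteq> {}" "T \<noteq> {}"
  shows "card S + card T \<le> card ((\<lambda>(a, b). a + b) ` (S \<times> T)) + 1"
proof -
  let ?X = "(\<lambda>a. a + Min T) ` S" and ?Y = "(\<lambda>b. Max S + b) ` T"
  have "?X \<inter> ?Y \<subseteq> {Max S + Min T}"
    using Max_ge[OF fin(1)] Min_le[OF fin(2)] by fastforce
  hence "card (?X \<inter> ?Y) \<le> 1" using card_mono[of "{Max S + Min T}" "?X \<inter> ?Y"] by simp
  moreover have "card ?X = card S" "card ?Y = card T" by (simp_all add: card_image)
  moreover have "card ?X + card ?Y = card (?X \<union> ?Y) + card (?X \<inter> ?Y)"
    by (rule card_Un_Int) (use fin in simp_all)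
  moreover have "card (?X \<union> ?Y) \<le> card ((\<lambda>(a, b). a + b) ` (S \<times> T))"
    by (rule card_mono) (use fin ne Max_in Min_in in force)+
  ultimately show ?thesis by linarith
qed

context pointed_curve
begin

text \<open>The orders at \<open>Q\<close> of the nonzero functions in \<open>L(E)\<close>.\<close>
definition vals :: "'f divisor \<Rightarrow> int set" where "vals E = Q ` (rr_space \<iota> E - {0})"

text \<open>
  Functions of different orders are independent, which bounds the number of orders by the dimension.
  Conversely a function is determined by its expansion coefficients at the orders that occur, and
  \<open>Lam\<close> provides linear coefficients.
\<close>
lemma card_vals:
  assumes E: "E \<in> divisors \<iota>"
  shows "finite (vals E)" "card (vals E) = rr_dim \<iota> E"
proof -
  note U = rr_space_subspace[OF E]
  show fin: "finite (vals E)" using E by (simp add: vals_def)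
  let ?E = "PiE (vals E) (\<lambda>_. UNIV :: 'k set)"
  have card_E: "card ?E = q ^ card (vals E)" using fin by (simp add: card_PiE card_k)
  have fin_E: "finite ?E" using fin by (simp add: finite_PiE)
  let ?f = "\<lambda>h. \<lambda>v\<in>vals E. Lam (h * x0 powi (- v - 1))"
  have "inj_on ?f (rr_space \<iota> E)"
  proof (rule inj_onI, rule ccontr)
    fix h h' assume h: "h \<in> rr_space \<iota> E" "h' \<in> rr_space \<iota> E" and eq: "?f h = ?f h'" and ne: "h \<noteq> h'"
    let ?d = "h - h'"
    have d: "?d \<in> rr_space \<iota> E" by (rule subspace_diff[OF U h])
    hence v: "Q ?d \<in> vals E" using ne by (simp add: vals_def)
    have "Lam (h * x0 powi (- Q ?d - 1)) = Lam (h' * x0 powi (- Q ?d - 1))"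
      using fun_cong[OF eq, of "Q ?d"] by (simp only: restrict_apply'[OF v])
    hence "Lam (?d * x0 powi (- Q ?d - 1)) = 0" by (simp only: left_diff_distrib linfD(4)[OF Lam_linf] diff_self)
    moreover have "Q (?d * x0 powi (- Q ?d - 1)) = - 1"
      using place_mult[OF Q _ x0_powi(2), of ?d "- Q ?d - 1"] ne by (simp only: x0_powi(1)) simp
    moreover have "?d * x0 powi (- Q ?d - 1) \<noteq> 0" using ne x0_powi(2) by (simp only: mult_eq_0_iff) simp
    ultimately show False using Lam_pole by blast
  qed
  hence "card (rr_space \<iota> E) \<le> card ?E"
  proof (rule card_inj_on_le)
    show "?f ` rr_space \<iota> E \<subseteq> ?E" by (rule image_subsetI) (simp add: restrict_PiE_iff)
  qed (rule fin_E)
  hence le: "rr_dim \<iota> E \<le> card (vals E)" by (simp add: card_E card_rr_space[OF E])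
  have "\<forall>v\<in>vals E. \<exists>e. e \<in> rr_space \<iota> E \<and> e \<noteq> 0 \<and> Q e = v" by (auto simp: vals_def)
  then obtain e where e: "\<And>v. v \<in> vals E \<Longrightarrow> e v \<in> rr_space \<iota> E \<and> e v \<noteq> 0 \<and> Q (e v) = v" by metis
  let ?g = "\<lambda>c. \<Sum>v\<in>vals E. \<iota> (c v) * e v"
  have inj: "inj_on ?g ?E"
  proof (rule inj_onI, rule ccontr)
    fix c c' assume c: "c \<in> ?E" "c' \<in> ?E" and eq: "?g c = ?g c'" and ne: "c \<noteq> c'"
    let ?I = "{v \<in> vals E. c v \<noteq> c' v}"
    have I: "?I \<noteq> {}" using c ne by (auto intro: PiE_ext)
    have Qv: "Q (\<iota> (c v - c' v) * e v) = v \<and> \<iota> (c v - c' v) * e v \<noteq> 0" if nm: "v \<in> ?I" for v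
    proof -
      have "e v \<noteq> 0" "Q (e v) = v" "c v - c' v \<noteq> 0" using e nm by auto
      thus ?thesis using place_mult[OF Q, of "\<iota> (c v - c' v)" "e v"] place_iota[OF Q] by simp
    qed
    have "(\<Sum>v\<in>?I. \<iota> (c v - c' v) * e v) \<noteq> 0"
    proof (rule sum_distinct_places[OF Q _ I, THEN conjunct1])
      show "inj_on (\<lambda>v. Q (\<iota> (c v - c' v) * e v)) ?I" by (rule inj_onI) (use Qv in force)
    qed (use fin Qv in simp_all)
    moreover have "(\<Sum>v\<in>?I. \<iota> (c v - c' v) * e v) = (\<Sum>v\<in>vals E. \<iota> (c v - c' v) * e v)"
      by (rule sum.mono_neutral_left) (use fin in auto)
    moreover have "\<dots> = 0" using eq by (simp add: iota_diff left_diff_distrib sum_subtractf)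
    ultimately show False by simp
  qed
  have "card ?E \<le> card (rr_space \<iota> E)"
  proof (rule card_inj_on_le[OF inj])
    show "?g ` ?E \<subseteq> rr_space \<iota> E"
      using e k.subspace_scale[OF U]
      by (intro image_subsetI k.subspace_sum[OF U]) (simp add: const_scale_def)
  qed (rule rr_space_finite[OF E])
  hence "card (vals E) \<le> rr_dim \<iota> E" by (simp add: card_E card_rr_space[OF E])
  thus "card (vals E) = rr_dim \<iota> E" using le by simp
qed

text \<open>
  This is the inequality of Clifford and Hopf, with orders at \<open>Q\<close> in place of divisors of sections.
\<close>
theorem ell_add_le:
  assumes E: "E \<in> divisors \<iota>" and F: "F \<in> divisors \<iota>" and pos: "0 < rr_dim \<iota> E" "0 < rr_dim \<iota> F"
  shows "rr_dim \<iota> E + rr_dim \<iota> F \<le> rr_dim \<iota> (E + F) + 1"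
proof -
  have EF: "E + F \<in> divisors \<iota>" using E F by simp
  have "vals E \<noteq> {}" "vals F \<noteq> {}" using pos card_vals[OF E] card_vals[OF F] by auto
  from card_sumset_ge[OF card_vals(1)[OF E] card_vals(1)[OF F] this]
  have "rr_dim \<iota> E + rr_dim \<iota> F \<le> card ((\<lambda>(a, b). a + b) ` (vals E \<times> vals F)) + 1"
    by (simp only: card_vals(2) E F)
  moreover have "(\<lambda>(a, b). a + b) ` (vals E \<times> vals F) \<subseteq> vals (E + F)"
  proof clarify
    fix a b assume "a \<in> vals E" "b \<in> vals F"
    then obtain e f where e: "e \<in> rr_space \<iota> E" "e \<noteq> 0" "a = Q e" and f: "f \<in> rr_space \<iota> F" "f \<noteq> 0" "b = Q f"
      by (auto simp: vals_def)
    have "e * f \<in> rr_space \<iota> (E + F)"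
      unfolding rr_space_iff[OF EF]
    proof
      fix P assume P: "P \<in> places \<iota>"
      have "e \<in> val_ge P (- E P)" "f \<in> val_ge P (- F P)"
        using e f P unfolding rr_space_iff[OF E] rr_space_iff[OF F] by blast+
      thus "e * f \<in> val_ge P (- (E + F) P)" by (rule val_ge_mult'[OF P]) simp
    qed
    thus "a + b \<in> vals (E + F)"
      unfolding vals_def using e f place_mult[OF Q, of e f] by (intro image_eqI[of _ _ "e * f"]) auto
  qed
  hence "card ((\<lambda>(a, b). a + b) ` (vals E \<times> vals F)) \<le> rr_dim \<iota> (E + F)"
    using card_mono[OF card_vals(1)[OF EF]] card_vals(2)[OF EF] by simp
  ultimately show ?thesis by linarith
qed

end

section \<open>The hull\<close>

context evaluation_code
begin

abbreviation "M \<equiv> div_meet G A"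

lemma M [simp]: "M \<in> divisors \<iota>" and join_eq: "div_join G A - D = K - M"
proof -
  show "M \<in> divisors \<iota>" unfolding div_meet_def by (rule divisor_combine[OF G A]) simp
  have A': "A R = D R - G R + K R" for R by (simp add: A_def)
  show "div_join G A - D = K - M"
    by (rule ext) (simp add: div_join_def div_meet_def A' max_def min_def)
qed

text \<open>
  Pairs \<open>(f, h)\<close> with equal values on \<open>D\<close> map onto the hull. The difference \<open>f - h\<close> maps them into
  \<open>L(K - M)\<close>, and its kernel is the intersection of \<open>L(G)\<close> and \<open>L(A)\<close>, which is \<open>L(M)\<close>.
\<close>
lemma card_hull:
  "card (code_hull (code G)) \<le> q ^ (rr_dim \<iota> M + rr_dim \<iota> (K - M))"
proof -
  let ?T = "{p \<in> rr_space \<iota> G \<times> rr_space \<iota> A. ev (fst p) = ev (snd p)}"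
  let ?\<phi> = "\<lambda>p. fst p - snd p"
  have KM: "K - M \<in> divisors \<iota>" by simp
  have fin_T: "finite ?T" using G by (intro finite_subset[of ?T "rr_space \<iota> G \<times> rr_space \<iota> A"]) auto
  have split: "card ?T = card (?\<phi> ` ?T) * card {p \<in> ?T. ?\<phi> p = 0}"
  proof (rule card_fibres(2))
    fix x y assume x: "x \<in> ?T" and y: "y \<in> ?T"
    have "fst x - fst y \<in> rr_space \<iota> G" "snd x - snd y \<in> rr_space \<iota> A"
      using x y subspace_diff[OF rr_space_subspace] G A by auto
    moreover have "ev (fst x - fst y) = ev (snd x - snd y)"
      using x y by (simp add: ev_ops(2)[OF G G_P] ev_ops(2)[OF A A_P] mem_Times_iff)
    ultimately show "x - y \<in> ?T" by (simp add: mem_Times_iff)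
  qed (simp, rule finite_imageI[OF fin_T], rule finite_subset[OF _ fin_T], blast)
  have image: "card (?\<phi> ` ?T) \<le> card (rr_space \<iota> (K - M))"
  proof (rule card_mono[OF rr_space_finite[OF KM]], rule image_subsetI)
    fix p assume p: "p \<in> ?T"
    obtain u h where uh: "p = (u, h)" by (cases p)
    have u: "u \<in> rr_space \<iota> G" and h: "h \<in> rr_space \<iota> A" and eq: "ev u = ev h" using p uh by auto
    have "u - h \<in> val_ge R (- (div_join G A - D) R)" if R: "R \<in> places \<iota>" for R
    proof (cases "R \<in> range P")
      case True
      then obtain i where i: "R = P i" by blast
      note ru = rr_space_regular[OF G G_P u, of i] and rh = rr_space_regular[OF A A_P h, of i]
      have "ev u $ i = ev h $ i" using eq by simp
      hence "eval_at \<iota> (P i) (u - h) = 0" by (simp add: ev_def eval_at_ops(2)[OF rat ru rh])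
      hence "u - h \<in> val_ge (P i) 1"
        using eval_at_ops(4)[OF rat val_ge_diff[OF P ru rh] ru] by blast
      thus ?thesis by (simp add: i div_join_def G_P A_P D_apply)
    next
      case False
      have "u \<in> val_ge R (- G R)" "h \<in> val_ge R (- A R)"
        using u h R unfolding rr_space_iff[OF G] rr_space_iff[OF A] by blast+
      hence "u \<in> val_ge R (- max (G R) (A R))" "h \<in> val_ge R (- max (G R) (A R))"
        by (auto elim!: val_ge_mono[rotated])
      hence "u - h \<in> val_ge R (- max (G R) (A R))" by (rule val_ge_diff[OF R])
      thus ?thesis using False by (simp add: div_join_def D_apply)
    qed
    hence "u - h \<in> rr_space \<iota> (K - M)" unfolding rr_space_iff[OF KM] join_eq by blast
    thus "?\<phi> p \<in> rr_space \<iota> (K - M)" using uh by simp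
  qed
  have kernel: "card {p \<in> ?T. ?\<phi> p = 0} \<le> card (rr_space \<iota> M)"
  proof (rule card_inj_on_le)
    show "inj_on fst {p \<in> ?T. ?\<phi> p = 0}" by (auto intro!: inj_onI simp: prod_eq_iff)
    show "fst ` {p \<in> ?T. ?\<phi> p = 0} \<subseteq> rr_space \<iota> M"
    proof (rule image_subsetI)
      fix p assume "p \<in> {p \<in> ?T. ?\<phi> p = 0}"
      hence "fst p \<in> rr_space \<iota> G" "fst p \<in> rr_space \<iota> A" by auto
      thus "fst p \<in> rr_space \<iota> M"
        unfolding rr_space_iff[OF M] rr_space_iff[OF G] rr_space_iff[OF A] by (auto simp: div_meet_def min_def)
    qed
  qed simp
  have T: "card ?T \<le> q ^ rr_dim \<iota> (K - M) * q ^ rr_dim \<iota> M"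
    unfolding split card_rr_space[OF KM, symmetric] card_rr_space[OF M, symmetric]
    by (rule mult_le_mono[OF image kernel])
  have "code_hull (code G) \<subseteq> (\<lambda>p. ev (fst p)) ` ?T"
  proof
    fix x assume "x \<in> code_hull (code G)"
    hence "x \<in> code G" "x \<in> code A" by (simp_all only: code_hull_def dual_code_eq Int_iff)
    then obtain u h where "x = ev u" "u \<in> rr_space \<iota> G" "x = ev h" "h \<in> rr_space \<iota> A"
      unfolding code_eq by (elim imageE)
    thus "x \<in> (\<lambda>p. ev (fst p)) ` ?T" by (intro image_eqI[of _ _ "(u, h)"]) simp_all
  qed
  hence "card (code_hull (code G)) \<le> card ?T" by (rule surj_card_le[OF fin_T])
  thus ?thesis using T by (simp add: power_add mult.commute)
qed

theorem dim_hull_le: "vec.dim (code_hull (code G)) \<le> rr_dim \<iota> M + rr_dim \<iota> (K - M)"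
proof -
  have "vec.subspace (code_hull (code G))"
    unfolding code_hull_def dual_code_eq
    by (rule vec.subspace_inter[OF code_subspace[OF G G_P] code_subspace[OF A A_P]])
  from card_subspace[OF vec.vector_space_axioms this]
  have "card (code_hull (code G)) = q ^ vec.dim (code_hull (code G))" by (simp add: card_k)
  thus ?thesis using card_hull by simp
qed

lemma deg_join: "deg (div_join G A - D) = 2 * int (genus \<iota>) - 2 - deg M"
  unfolding join_eq by (simp add: deg_diff riemann_roch(2)[OF \<eta> \<eta>_nonzero, folded K_def])

text \<open>
  If one of the spaces is zero, Riemann-Roch expresses the dimension of the other by \<open>deg M\<close>.
  Otherwise \<open>ell_add_le\<close> applies with sum \<open>K\<close>.
\<close>
theorem dim_hull_le_genus:
  assumes "0 \<le> deg M" "deg M \<le> 2 * int (genus \<iota>) - 2"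
  shows "vec.dim (code_hull (code G)) \<le> genus \<iota> + 1"
proof -
  note rr = riemann_roch(4)[OF \<eta> \<eta>_nonzero M, folded K_def]
  have "rr_dim \<iota> M + rr_dim \<iota> (K - M) \<le> genus \<iota> + 1"
  proof (cases "rr_dim \<iota> M = 0 \<or> rr_dim \<iota> (K - M) = 0")
    case True
    thus ?thesis using rr assms by linarith
  next
    case False
    have "M + (K - M) = K" by simp
    moreover have "rr_dim \<iota> K = genus \<iota>" using riemann_roch(3)[OF \<eta> \<eta>_nonzero, folded K_def] by simp
    ultimately show ?thesis using ell_add_le[OF M divisor_diff[OF K M]] False by simp
  qed
  thus ?thesis using dim_hull_le by linarith
qed

end

section \<open>The bounds for the hull\<close>

theorem corollary3p5:
  fixes \<iota> :: "'k::{field,finite} \<Rightarrow> 'f::field"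
    and P :: "'n::finite \<Rightarrow> 'f place"
    and D G K A :: "'f divisor"
    and \<eta> :: "'f differential"
    and g :: nat
    and t :: int
  assumes "curve \<iota>"
    and "genus \<iota> = g"
    and "inj P"
    and "\<forall>i. rational_place \<iota> (P i)"
    and "D = (\<Sum>i\<in>UNIV. prime_divisor (P i))"
    and "G \<in> divisors \<iota>"
    and "supp G \<inter> supp D = {}"
    and "\<eta> \<in> differentials \<iota>"
    and "\<forall>Q\<in>supp D. diff_val \<iota> Q \<eta> = -1 \<and> residue \<iota> Q \<eta> = 1"
    and "K = diff_div \<iota> \<eta>"
    and "A = D - G + K"
    and "t = div_degree \<iota> (div_join G A - D)"
  shows "t = 2 * int g - 2 - div_degree \<iota> (div_meet G A)
    \<and> vec.dim (code_hull (ag_code \<iota> P G)) \<le> rr_dim \<iota> (div_meet G A) + rr_dim \<iota> (K - div_meet G A)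
    \<and> (0 \<le> div_degree \<iota> (div_meet G A) \<and> div_degree \<iota> (div_meet G A) \<le> 2 * int g - 2
         \<longleftrightarrow> 0 \<le> t \<and> t \<le> 2 * int g - 2)
    \<and> (0 \<le> div_degree \<iota> (div_meet G A) \<and> div_degree \<iota> (div_meet G A) \<le> 2 * int g - 2
         \<longrightarrow> vec.dim (code_hull (ag_code \<iota> P G)) \<le> g + 1)"
proof -
  have supp_D: "supp D = range P"
  proof -
    have *: "(\<Sum>i\<in>I. prime_divisor (P i)) R = (\<Sum>i\<in>I. prime_divisor (P i) R)" for I R
      by (induction I rule: infinite_finite_induct) auto
    show ?thesis unfolding assms(5) supp_def * by (auto simp: prime_divisor_def sum_nonneg_eq_0_iff)
  qed
  \<comment> \<open>any of the places \<open>P i\<close> can serve as the rational place for Riemann-Roch\<close>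
  interpret H: evaluation_code \<iota> "P undefined" P G \<eta>
  proof unfold_locales
    show "G (P i) = 0" for i using assms(7) supp_D by (auto simp: supp_def)
    show "diff_val \<iota> (P i) \<eta> = - 1" "residue \<iota> (P i) \<eta> = 1" for i using assms(9) supp_D by auto
  qed (use assms(1,3,4,6,8) in \<open>simp_all add: curve_def\<close>)
  have eqs: "D = H.D" "K = H.K" "A = H.A" "ag_code \<iota> P G = H.code G"
    using assms(5,10,11) by (simp_all add: H.D_def H.K_def H.A_def H.code_def)
  have t: "t = 2 * int g - 2 - div_degree \<iota> (div_meet G H.A)"
    using H.deg_join assms(2,12) unfolding eqs(1,3) by simp
  have "vec.dim (code_hull (H.code G)) \<le> g + 1"
    if "0 \<le> div_degree \<iota> (div_meet G H.A)" "div_degree \<iota> (div_meet G H.A) \<le> 2 * int g - 2"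
    using H.dim_hull_le_genus that assms(2) by simp
  thus ?thesis using t H.dim_hull_le unfolding eqs by linarith
qed

end
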